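(* Let $(M,g)$ be a compact, oriented Riemannian manifold, $(N,h,J)$ a compact Kähler manifold with Kähler form $\omega=h(J\cdot,\cdot)$, and let $\phi:M\to N$ be a Riemannian submersion. Then $\phi$ is a critical point of the functional $E(\phi)=\frac12\int_M|\phi^*\omega|^2\,{\ast 1}$ if and only if $\phi$ is a harmonic map, equivalently if and only if the fibres of $\phi$ are minimal submanifolds of $M$; in this case $\phi$ is a harmonic morphism. Moreover, such a $\phi$ is then a critical point of the full functional $\frac12\int_M(|d\phi|^2+\alpha|\phi^*\omega|^2)\,{\ast 1}$ for every $\alpha\ge 0$.
   Context: $\ast 1$ is the volume form of $M$; the pointwise norm on $p$-forms is induced by $\langle\alpha,\beta\rangle=\frac1{p!}\sum_{i_1,\dots,i_p}\alpha(e_{i_1},\dots,e_{i_p})\beta(e_{i_1},\dots,e_{i_p})$ for a local orthonormal frame. A Riemannian submersion is a smooth map $\phi$ such that, for each $x\in M$, $d\phi_x$ maps $(\ker d\phi_x)^\perp$ isometrically onto $T_{\phi(x)}N$. A critical point of a functional is a map at which the derivative of the functional along every smooth variation vanishes. $\phi$ is harmonic if its tension field $\tau(\phi)=\mathrm{trace}\,\nabla d\phi$ vanishes, where $\nabla d\phi(X,Y)=\nabla^\phi_X d\phi(Y)-d\phi(\nabla_XY)$ with $\nabla$ the Levi-Civita connection of $M$ and $\nabla^\phi$ the pullback to $\phi^{-1}TN$ of that of $N$. A harmonic morphism is a map which pulls back locally defined harmonic functions on $N$ to harmonic functions on $M$. *)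

theory Defs
  imports "HOL-Analysis.Analysis"
begin

section \<open>Smooth functions between Euclidean spaces\<close>

abbreviation fderiv :: "('a::real_normed_vector \<Rightarrow> 'b::real_normed_vector) \<Rightarrow> 'a \<Rightarrow> 'a \<Rightarrow> 'b"
  where "fderiv f x \<equiv> frechet_derivative f (at x)"

text \<open>\<open>Ck_on k S f\<close> is only meaningful for open \<open>S\<close>.\<close>

primrec Ck_on :: "nat \<Rightarrow> 'a::euclidean_space set \<Rightarrow> ('a \<Rightarrow> 'b::euclidean_space) \<Rightarrow> bool" where
  "Ck_on 0 S f = continuous_on S f"
| "Ck_on (Suc k) S f =
     ((\<forall>x\<in>S. f differentiable (at x)) \<and> (\<forall>v. Ck_on k S (\<lambda>x. fderiv f x v)))"

definition smooth_on :: "'a::euclidean_space set \<Rightarrow> ('a \<Rightarrow> 'b::euclidean_space) \<Rightarrow> bool"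
  where "smooth_on S f \<longleftrightarrow> (\<forall>k. Ck_on k S f)"

section \<open>Smooth manifolds\<close>

text \<open>A chart is a pair of its domain and the coordinate map; the value of the coordinate map
  off the domain is irrelevant.\<close>

type_synonym ('a, 'e) chart = "'a set \<times> ('a \<Rightarrow> 'e)"

record ('a, 'e) manifold =
  mtop :: "'a topology"
  atlas :: "('a, 'e) chart set"

abbreviation points :: "('a, 'e) manifold \<Rightarrow> 'a set"
  where "points M \<equiv> topspace (mtop M)"

abbreviation cdom :: "('a, 'e) chart \<Rightarrow> 'a set" where "cdom c \<equiv> fst c"
abbreviation cmap :: "('a, 'e) chart \<Rightarrow> 'a \<Rightarrow> 'e" where "cmap c \<equiv> snd c"
abbreviation cinv :: "('a, 'e) chart \<Rightarrow> 'e \<Rightarrow> 'a" where "cinv c \<equiv> inv_into (cdom c) (cmap c)"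
abbreviation cimage :: "('a, 'e) chart \<Rightarrow> 'e set" where "cimage c \<equiv> cmap c ` cdom c"

definition is_chart :: "'a topology \<Rightarrow> ('a, 'e::euclidean_space) chart \<Rightarrow> bool" where
  "is_chart X c \<longleftrightarrow> openin X (cdom c) \<and> open (cimage c) \<and>
     homeomorphic_map (subtopology X (cdom c)) (top_of_set (cimage c)) (cmap c)"

definition transition :: "('a, 'e) chart \<Rightarrow> ('a, 'e) chart \<Rightarrow> 'e \<Rightarrow> 'e"
  where "transition c d = (\<lambda>y. cmap d (cinv c y))"

definition compatible :: "('a, 'e::euclidean_space) chart \<Rightarrow> ('a, 'e) chart \<Rightarrow> bool" where
  "compatible c d \<longleftrightarrow>
     smooth_on (cmap c ` (cdom c \<inter> cdom d)) (transition c d) \<and>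
     smooth_on (cmap d ` (cdom c \<inter> cdom d)) (transition d c)"

definition smooth_manifold :: "('a, 'e::euclidean_space) manifold \<Rightarrow> bool" where
  "smooth_manifold M \<longleftrightarrow>
     Hausdorff_space (mtop M) \<and> second_countable (mtop M) \<and>
     (\<forall>c\<in>atlas M. is_chart (mtop M) c) \<and> points M = (\<Union>c\<in>atlas M. cdom c) \<and>
     (\<forall>c\<in>atlas M. \<forall>d\<in>atlas M. compatible c d)"

definition maximal_atlas :: "('a, 'e::euclidean_space) manifold \<Rightarrow> ('a, 'e) chart set" where
  "maximal_atlas M = {c. is_chart (mtop M) c \<and> (\<forall>d\<in>atlas M. compatible c d)}"

text \<open>An orientation is given by an oriented atlas: its charts are the positive ones.\<close>

definition oriented :: "('a, real^'m) manifold \<Rightarrow> bool" where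
  "oriented M \<longleftrightarrow> (\<forall>c\<in>atlas M. \<forall>d\<in>atlas M. \<forall>p\<in>cdom c \<inter> cdom d.
     0 < det (matrix (fderiv (transition c d) (cmap c p))))"

definition smooth_map ::
    "('a, 'e::euclidean_space) manifold \<Rightarrow> ('b, 'f::euclidean_space) manifold \<Rightarrow> ('a \<Rightarrow> 'b) \<Rightarrow> bool" where
  "smooth_map M N \<phi> \<longleftrightarrow> continuous_map (mtop M) (mtop N) \<phi> \<and>
     (\<forall>c\<in>atlas M. \<forall>d\<in>atlas N.
        smooth_on (cmap c ` {q\<in>cdom c. \<phi> q \<in> cdom d}) (\<lambda>y. cmap d (\<phi> (cinv c y))))"

definition smooth_fun :: "('a, 'e::euclidean_space) manifold \<Rightarrow> 'a set \<Rightarrow> ('a \<Rightarrow> real) \<Rightarrow> bool" where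
  "smooth_fun M W f \<longleftrightarrow> (\<forall>c\<in>atlas M. smooth_on (cmap c ` (cdom c \<inter> W)) (\<lambda>y. f (cinv c y)))"

section \<open>Tangent vectors\<close>

text \<open>The tangent space at \<open>p\<close> is the model space \<open>'e\<close>: a tangent vector is identified with its
  components in the chart \<open>chart_at M p\<close>, chosen once and for all for each point.  Hence a vector
  field is a function \<open>'a \<Rightarrow> 'e\<close>, and a tensor field has the tangent space \<open>'e\<close> at each point as
  its argument type.  As \<open>chart_at M p\<close> may jump with \<open>p\<close>, differentiation always goes through the
  components in one fixed chart, given by \<open>to_chart\<close>; \<open>of_chart M c p\<close> is its inverse, so
  \<open>of_chart M c p u\<close> is the vector at \<open>p\<close> with components \<open>u\<close> in the chart \<open>c\<close>.\<close>

definition chart_at :: "('a, 'e) manifold \<Rightarrow> 'a \<Rightarrow> ('a, 'e) chart"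
  where "chart_at M p = (SOME c. c \<in> atlas M \<and> p \<in> cdom c)"

definition to_chart :: "('a, 'e::euclidean_space) manifold \<Rightarrow> ('a, 'e) chart \<Rightarrow> 'a \<Rightarrow> 'e \<Rightarrow> 'e"
  where "to_chart M c p = fderiv (transition (chart_at M p) c) (cmap (chart_at M p) p)"

definition of_chart :: "('a, 'e::euclidean_space) manifold \<Rightarrow> ('a, 'e) chart \<Rightarrow> 'a \<Rightarrow> 'e \<Rightarrow> 'e"
  where "of_chart M c p = fderiv (transition c (chart_at M p)) (cmap c p)"

definition mdiff ::
    "('a, 'e::euclidean_space) manifold \<Rightarrow> ('b, 'f::euclidean_space) manifold \<Rightarrow> ('a \<Rightarrow> 'b) \<Rightarrow> 'a \<Rightarrow> 'e \<Rightarrow> 'f"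
  where "mdiff M N \<phi> p =
     fderiv (\<lambda>y. cmap (chart_at N (\<phi> p)) (\<phi> (cinv (chart_at M p) y))) (cmap (chart_at M p) p)"

definition dfun :: "('a, 'e::euclidean_space) manifold \<Rightarrow> ('a \<Rightarrow> real) \<Rightarrow> 'a \<Rightarrow> 'e \<Rightarrow> real"
  where "dfun M f p = fderiv (\<lambda>y. f (cinv (chart_at M p) y)) (cmap (chart_at M p) p)"

definition smooth_field_on :: "('a, 'e::euclidean_space) manifold \<Rightarrow> 'a set \<Rightarrow> ('a \<Rightarrow> 'e) \<Rightarrow> bool" where
  "smooth_field_on M W X \<longleftrightarrow> (\<forall>c\<in>atlas M.
     smooth_on (cmap c ` (cdom c \<inter> W)) (\<lambda>y. to_chart M c (cinv c y) (X (cinv c y))))"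

text \<open>The local vector field near \<open>p\<close> with constant components \<open>v\<close> in \<open>chart_at M p\<close>; its value
  at \<open>p\<close> is \<open>v\<close>.\<close>

definition coord_field :: "('a, 'e::euclidean_space) manifold \<Rightarrow> 'a \<Rightarrow> 'e \<Rightarrow> 'a \<Rightarrow> 'e"
  where "coord_field M p v = (\<lambda>q. of_chart M (chart_at M p) q v)"

section \<open>Riemannian metrics, frames and norms\<close>

type_synonym ('a, 'e) bilin_field = "'a \<Rightarrow> 'e \<Rightarrow> 'e \<Rightarrow> real"

definition in_chart ::
    "('a, 'e::euclidean_space) manifold \<Rightarrow> ('a, 'e) bilin_field \<Rightarrow> ('a, 'e) chart \<Rightarrow> 'e \<Rightarrow> 'e \<Rightarrow> 'e \<Rightarrow> real"
  where "in_chart M b c y u v =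
     b (cinv c y) (of_chart M c (cinv c y) u) (of_chart M c (cinv c y) v)"

definition riemannian_metric :: "('a, 'e::euclidean_space) manifold \<Rightarrow> ('a, 'e) bilin_field \<Rightarrow> bool" where
  "riemannian_metric M g \<longleftrightarrow>
     (\<forall>p\<in>points M. bilinear (g p) \<and> (\<forall>u v. g p u v = g p v u) \<and> (\<forall>u. u \<noteq> 0 \<longrightarrow> 0 < g p u u)) \<and>
     (\<forall>c\<in>atlas M. \<forall>u v. smooth_on (cimage c) (\<lambda>y. in_chart M g c y u v))"

definition riemannian_manifold :: "('a, 'e::euclidean_space) manifold \<Rightarrow> ('a, 'e) bilin_field \<Rightarrow> bool"
  where "riemannian_manifold M g \<longleftrightarrow> smooth_manifold M \<and> riemannian_metric M g"

definition orthonormal_basis :: "('e::euclidean_space \<Rightarrow> 'e \<Rightarrow> real) \<Rightarrow> 'e set \<Rightarrow> 'e set \<Rightarrow> bool" where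
  "orthonormal_basis b S B \<longleftrightarrow> span B = S \<and> (\<forall>u\<in>B. \<forall>v\<in>B. b u v = (if u = v then 1 else 0))"

text \<open>Below, \<open>b\<close> is an inner product and the sums do not depend on the choice of the basis.\<close>

definition frame :: "('e::euclidean_space \<Rightarrow> 'e \<Rightarrow> real) \<Rightarrow> 'e set \<Rightarrow> 'e set"
  where "frame b S = (SOME B. orthonormal_basis b S B)"

definition trace_on ::
    "('e::euclidean_space \<Rightarrow> 'e \<Rightarrow> real) \<Rightarrow> 'e set \<Rightarrow> ('e \<Rightarrow> 'e \<Rightarrow> 'v::real_vector) \<Rightarrow> 'v"
  where "trace_on b S Q = (\<Sum>e\<in>frame b S. Q e e)"

definition form2_norm_sq :: "('e::euclidean_space \<Rightarrow> 'e \<Rightarrow> real) \<Rightarrow> ('e \<Rightarrow> 'e \<Rightarrow> real) \<Rightarrow> real" where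
  "form2_norm_sq b \<beta> = 1 / fact 2 * (\<Sum>u\<in>frame b UNIV. \<Sum>v\<in>frame b UNIV. \<beta> u v * \<beta> u v)"

definition diff_norm_sq ::
    "('a, 'e::euclidean_space) manifold \<Rightarrow> ('a, 'e) bilin_field \<Rightarrow>
     ('b, 'f::euclidean_space) manifold \<Rightarrow> ('b, 'f) bilin_field \<Rightarrow> ('a \<Rightarrow> 'b) \<Rightarrow> 'a \<Rightarrow> real" where
  "diff_norm_sq M g N h \<phi> p =
     trace_on (g p) UNIV (\<lambda>u v. h (\<phi> p) (mdiff M N \<phi> p u) (mdiff M N \<phi> p v))"

definition pullback_form2 ::
    "('a, 'e::euclidean_space) manifold \<Rightarrow> ('b, 'f::euclidean_space) manifold \<Rightarrow>
     ('a \<Rightarrow> 'b) \<Rightarrow> ('b, 'f) bilin_field \<Rightarrow> ('a, 'e) bilin_field" where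
  "pullback_form2 M N \<phi> \<omega> p u v = \<omega> (\<phi> p) (mdiff M N \<phi> p u) (mdiff M N \<phi> p v)"

section \<open>The volume form and integration\<close>

text \<open>An \<open>m\<close>-form is evaluated at a point on an \<open>m\<close>-tuple of tangent vectors indexed by \<open>'m\<close>.
  The charts \<open>chart_at M p\<close> are positive, so \<open>volume_form M g p\<close> is \<open>1\<close> on positive
  orthonormal frames.\<close>

definition volume_form ::
    "('a, real^'m) manifold \<Rightarrow> ('a, real^'m) bilin_field \<Rightarrow> 'a \<Rightarrow> ('m \<Rightarrow> real^'m) \<Rightarrow> real" where
  "volume_form M g p v =
     sqrt (det (\<chi> i j. g p (axis i 1) (axis j 1))) * det (\<chi> i j. v j $ i)"

definition partition_of_unity ::
    "('a, 'e::euclidean_space) manifold \<Rightarrow> ('a, 'e) chart set \<Rightarrow> (('a, 'e) chart \<Rightarrow> 'a \<Rightarrow> real) \<Rightarrow> bool" where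
  "partition_of_unity M C \<rho> \<longleftrightarrow> finite C \<and> C \<subseteq> atlas M \<and>
     (\<forall>c\<in>C. smooth_fun M (points M) (\<rho> c) \<and> (\<forall>p\<in>points M. 0 \<le> \<rho> c p) \<and>
        mtop M closure_of {p\<in>points M. \<rho> c p \<noteq> 0} \<subseteq> cdom c) \<and>
     (\<forall>p\<in>points M. (\<Sum>c\<in>C. \<rho> c p) = 1)"

text \<open>The integral of a continuous \<open>m\<close>-form on a compact oriented manifold.  It does not depend on
  the partition of unity; a finite one exists by compactness.\<close>

definition integral_form ::
    "('a, real^'m) manifold \<Rightarrow> ('a \<Rightarrow> ('m \<Rightarrow> real^'m) \<Rightarrow> real) \<Rightarrow> real" where
  "integral_form M \<eta> = (THE I. \<exists>C \<rho>. partition_of_unity M C \<rho> \<and>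
     I = (\<Sum>c\<in>C. integral (cimage c)
            (\<lambda>y. \<rho> c (cinv c y) * \<eta> (cinv c y) (\<lambda>i. of_chart M c (cinv c y) (axis i 1)))))"

definition integral_vol ::
    "('a, real^'m) manifold \<Rightarrow> ('a, real^'m) bilin_field \<Rightarrow> ('a \<Rightarrow> real) \<Rightarrow> real"
  where "integral_vol M g F = integral_form M (\<lambda>p v. F p * volume_form M g p v)"

section \<open>Levi-Civita connection and pullback connection\<close>

text \<open>The Christoffel term of the Levi-Civita connection in \<open>chart_at M p\<close>: the Koszul formula for
  coordinate vector fields, whose brackets vanish.\<close>

definition christoffel ::
    "('a, 'e::euclidean_space) manifold \<Rightarrow> ('a, 'e) bilin_field \<Rightarrow> 'a \<Rightarrow> 'e \<Rightarrow> 'e \<Rightarrow> 'e" where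
  "christoffel M g p u v = (let c = chart_at M p; x = cmap c p in
     THE z. \<forall>w. 2 * g p z w =
       fderiv (\<lambda>y. in_chart M g c y v w) x u + fderiv (\<lambda>y. in_chart M g c y u w) x v
       - fderiv (\<lambda>y. in_chart M g c y u v) x w)"

text \<open>\<open>levi_civita M g X p u\<close> is the covariant derivative of the vector field \<open>X\<close> at \<open>p\<close> in
  direction \<open>u\<close>; in \<open>pullback_connection M N h \<phi> V p u\<close>, the section \<open>V\<close> of the pullback
  of the tangent bundle of \<open>N\<close> assigns to \<open>q\<close> a tangent vector of \<open>N\<close> at \<open>\<phi> q\<close>.\<close>

definition levi_civita ::
    "('a, 'e::euclidean_space) manifold \<Rightarrow> ('a, 'e) bilin_field \<Rightarrow> ('a \<Rightarrow> 'e) \<Rightarrow> 'a \<Rightarrow> 'e \<Rightarrow> 'e" where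
  "levi_civita M g X p u = (let c = chart_at M p in
     fderiv (\<lambda>y. to_chart M c (cinv c y) (X (cinv c y))) (cmap c p) u + christoffel M g p u (X p))"

definition pullback_connection ::
    "('a, 'e::euclidean_space) manifold \<Rightarrow> ('b, 'f::euclidean_space) manifold \<Rightarrow> ('b, 'f) bilin_field \<Rightarrow>
     ('a \<Rightarrow> 'b) \<Rightarrow> ('a \<Rightarrow> 'f) \<Rightarrow> 'a \<Rightarrow> 'e \<Rightarrow> 'f" where
  "pullback_connection M N h \<phi> V p u = (let c = chart_at M p; d = chart_at N (\<phi> p) in
     fderiv (\<lambda>y. to_chart N d (\<phi> (cinv c y)) (V (cinv c y))) (cmap c p) u
     + christoffel N h (\<phi> p) (mdiff M N \<phi> p u) (V p))"

section \<open>Harmonic maps and harmonic morphisms\<close>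

text \<open>The value of \<open>\<nabla>d\<phi>(X,Y)\<close> at \<open>p\<close> depends only on \<open>u = X p\<close> and \<open>v = Y p\<close>; the definition
  takes \<open>Y = coord_field M p v\<close>.  The same applies to the Hessian \<open>X(Yf) - (\<nabla>\<^sub>X Y)f\<close>.\<close>

definition nabla_d ::
    "('a, 'e::euclidean_space) manifold \<Rightarrow> ('a, 'e) bilin_field \<Rightarrow>
     ('b, 'f::euclidean_space) manifold \<Rightarrow> ('b, 'f) bilin_field \<Rightarrow> ('a \<Rightarrow> 'b) \<Rightarrow> 'a \<Rightarrow> 'e \<Rightarrow> 'e \<Rightarrow> 'f" where
  "nabla_d M g N h \<phi> p u v = (let Y = coord_field M p v in
     pullback_connection M N h \<phi> (\<lambda>q. mdiff M N \<phi> q (Y q)) p u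
     - mdiff M N \<phi> p (levi_civita M g Y p u))"

definition tension_field ::
    "('a, 'e::euclidean_space) manifold \<Rightarrow> ('a, 'e) bilin_field \<Rightarrow>
     ('b, 'f::euclidean_space) manifold \<Rightarrow> ('b, 'f) bilin_field \<Rightarrow> ('a \<Rightarrow> 'b) \<Rightarrow> 'a \<Rightarrow> 'f" where
  "tension_field M g N h \<phi> p = trace_on (g p) UNIV (nabla_d M g N h \<phi> p)"

definition harmonic_map ::
    "('a, 'e::euclidean_space) manifold \<Rightarrow> ('a, 'e) bilin_field \<Rightarrow>
     ('b, 'f::euclidean_space) manifold \<Rightarrow> ('b, 'f) bilin_field \<Rightarrow> ('a \<Rightarrow> 'b) \<Rightarrow> bool" where
  "harmonic_map M g N h \<phi> \<longleftrightarrow> smooth_map M N \<phi> \<and> (\<forall>p\<in>points M. tension_field M g N h \<phi> p = 0)"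

definition hessian ::
    "('a, 'e::euclidean_space) manifold \<Rightarrow> ('a, 'e) bilin_field \<Rightarrow> ('a \<Rightarrow> real) \<Rightarrow> 'a \<Rightarrow> 'e \<Rightarrow> 'e \<Rightarrow> real" where
  "hessian M g f p u v = (let Y = coord_field M p v in
     dfun M (\<lambda>q. dfun M f q (Y q)) p u - dfun M f p (levi_civita M g Y p u))"

definition laplacian ::
    "('a, 'e::euclidean_space) manifold \<Rightarrow> ('a, 'e) bilin_field \<Rightarrow> ('a \<Rightarrow> real) \<Rightarrow> 'a \<Rightarrow> real" where
  "laplacian M g f p = trace_on (g p) UNIV (hessian M g f p)"

definition harmonic_fun ::
    "('a, 'e::euclidean_space) manifold \<Rightarrow> ('a, 'e) bilin_field \<Rightarrow> 'a set \<Rightarrow> ('a \<Rightarrow> real) \<Rightarrow> bool" where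
  "harmonic_fun M g W f \<longleftrightarrow> smooth_fun M W f \<and> (\<forall>p\<in>W. laplacian M g f p = 0)"

definition harmonic_morphism ::
    "('a, 'e::euclidean_space) manifold \<Rightarrow> ('a, 'e) bilin_field \<Rightarrow>
     ('b, 'f::euclidean_space) manifold \<Rightarrow> ('b, 'f) bilin_field \<Rightarrow> ('a \<Rightarrow> 'b) \<Rightarrow> bool" where
  "harmonic_morphism M g N h \<phi> \<longleftrightarrow> smooth_map M N \<phi> \<and>
     (\<forall>W f. openin (mtop N) W \<longrightarrow> harmonic_fun N h W f \<longrightarrow>
        harmonic_fun M g {p\<in>points M. \<phi> p \<in> W} (f \<circ> \<phi>))"

section \<open>Minimal submanifolds\<close>

text \<open>Embedded submanifolds, by slice charts.  The empty set is a submanifold.\<close>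

definition submanifold :: "('a, 'e::euclidean_space) manifold \<Rightarrow> 'a set \<Rightarrow> bool" where
  "submanifold M S \<longleftrightarrow> S \<subseteq> points M \<and>
     (\<exists>k. \<forall>p\<in>S. \<exists>c\<in>maximal_atlas M. p \<in> cdom c \<and>
        (\<exists>L. subspace L \<and> dim L = k \<and> cmap c ` (S \<inter> cdom c) = cimage c \<inter> L))"

definition tangent_space :: "('a, 'e::euclidean_space) manifold \<Rightarrow> 'a set \<Rightarrow> 'a \<Rightarrow> 'e set" where
  "tangent_space M S p = (let c = chart_at M p in
     {vector_derivative (\<lambda>t. cmap c (\<gamma> t)) (at 0) | \<gamma>.
        \<gamma> 0 = p \<and> (\<exists>\<epsilon>>0. \<gamma> ` {-\<epsilon><..<\<epsilon>} \<subseteq> S \<inter> cdom c \<and> smooth_on {-\<epsilon><..<\<epsilon>} (\<lambda>t. cmap c (\<gamma> t)))})"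

definition normal_part :: "('e::euclidean_space \<Rightarrow> 'e \<Rightarrow> real) \<Rightarrow> 'e set \<Rightarrow> 'e \<Rightarrow> 'e" where
  "normal_part b T w = (THE z. w - z \<in> T \<and> (\<forall>t\<in>T. b z t = 0))"

text \<open>The normal part of \<open>\<nabla>\<^sub>u V\<close> for any local vector field \<open>V\<close> that is tangent to \<open>S\<close> along \<open>S\<close>
  and extends \<open>v\<close>; it does not depend on the extension.\<close>

definition second_fundamental_form ::
    "('a, 'e::euclidean_space) manifold \<Rightarrow> ('a, 'e) bilin_field \<Rightarrow> 'a set \<Rightarrow> 'a \<Rightarrow> 'e \<Rightarrow> 'e \<Rightarrow> 'e" where
  "second_fundamental_form M g S p u v =
     (THE z. \<exists>W V. openin (mtop M) W \<and> p \<in> W \<and> smooth_field_on M W V \<and>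
        (\<forall>q\<in>S \<inter> W. V q \<in> tangent_space M S q) \<and> V p = v \<and>
        z = normal_part (g p) (tangent_space M S p) (levi_civita M g V p u))"

text \<open>Without the factor \<open>1 / dim S\<close>.\<close>

definition mean_curvature ::
    "('a, 'e::euclidean_space) manifold \<Rightarrow> ('a, 'e) bilin_field \<Rightarrow> 'a set \<Rightarrow> 'a \<Rightarrow> 'e" where
  "mean_curvature M g S p =
     trace_on (g p) (tangent_space M S p) (second_fundamental_form M g S p)"

definition minimal_submanifold ::
    "('a, 'e::euclidean_space) manifold \<Rightarrow> ('a, 'e) bilin_field \<Rightarrow> 'a set \<Rightarrow> bool" where
  "minimal_submanifold M g S \<longleftrightarrow> submanifold M S \<and> (\<forall>p\<in>S. mean_curvature M g S p = 0)"

section \<open>Riemannian submersions\<close>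

definition fibre :: "('a, 'e) manifold \<Rightarrow> ('a \<Rightarrow> 'b) \<Rightarrow> 'b \<Rightarrow> 'a set"
  where "fibre M \<phi> y = {p\<in>points M. \<phi> p = y}"

definition horizontal ::
    "('a, 'e::euclidean_space) manifold \<Rightarrow> ('a, 'e) bilin_field \<Rightarrow>
     ('b, 'f::euclidean_space) manifold \<Rightarrow> ('a \<Rightarrow> 'b) \<Rightarrow> 'a \<Rightarrow> 'e set" where
  "horizontal M g N \<phi> p = {u. \<forall>v. mdiff M N \<phi> p v = 0 \<longrightarrow> g p u v = 0}"

definition riemannian_submersion ::
    "('a, 'e::euclidean_space) manifold \<Rightarrow> ('a, 'e) bilin_field \<Rightarrow>
     ('b, 'f::euclidean_space) manifold \<Rightarrow> ('b, 'f) bilin_field \<Rightarrow> ('a \<Rightarrow> 'b) \<Rightarrow> bool" where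
  "riemannian_submersion M g N h \<phi> \<longleftrightarrow> smooth_map M N \<phi> \<and>
     (\<forall>p\<in>points M. mdiff M N \<phi> p ` horizontal M g N \<phi> p = UNIV \<and>
        (\<forall>u\<in>horizontal M g N \<phi> p. \<forall>v\<in>horizontal M g N \<phi> p.
           h (\<phi> p) (mdiff M N \<phi> p u) (mdiff M N \<phi> p v) = g p u v))"

section \<open>Kaehler manifolds\<close>

definition kaehler_form :: "('b, 'f) bilin_field \<Rightarrow> ('b \<Rightarrow> 'f \<Rightarrow> 'f) \<Rightarrow> ('b, 'f) bilin_field"
  where "kaehler_form h J p u v = h p (J p u) v"

definition endo_in_chart ::
    "('b, 'f::euclidean_space) manifold \<Rightarrow> ('b \<Rightarrow> 'f \<Rightarrow> 'f) \<Rightarrow> ('b, 'f) chart \<Rightarrow> 'f \<Rightarrow> 'f \<Rightarrow> 'f" where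
  "endo_in_chart N J c y u = to_chart N c (cinv c y) (J (cinv c y) (of_chart N c (cinv c y) u))"

definition almost_complex_structure ::
    "('b, 'f::euclidean_space) manifold \<Rightarrow> ('b \<Rightarrow> 'f \<Rightarrow> 'f) \<Rightarrow> bool" where
  "almost_complex_structure N J \<longleftrightarrow>
     (\<forall>p\<in>points N. linear (J p) \<and> (\<forall>u. J p (J p u) = - u)) \<and>
     (\<forall>c\<in>atlas N. \<forall>u. smooth_on (cimage c) (\<lambda>y. endo_in_chart N J c y u))"

text \<open>\<open>J\<close> comes from a complex manifold structure: around each point there are holomorphic
  coordinates, that is, a smooth chart in which \<open>J\<close> is a constant complex structure \<open>J0\<close> of the model
  space.  (All of these are linearly conjugate, so \<open>J0\<close> may as well depend on the point.)\<close>

definition complex_structure ::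
    "('b, 'f::euclidean_space) manifold \<Rightarrow> ('b \<Rightarrow> 'f \<Rightarrow> 'f) \<Rightarrow> bool" where
  "complex_structure N J \<longleftrightarrow> almost_complex_structure N J \<and>
     (\<forall>p\<in>points N. \<exists>c\<in>maximal_atlas N. p \<in> cdom c \<and>
        (\<exists>J0. \<forall>y\<in>cimage c. \<forall>u. endo_in_chart N J c y u = J0 u))"

text \<open>\<open>d\<omega> = 0\<close>, evaluated on coordinate vector fields.\<close>

definition closed_form2 :: "('b, 'f::euclidean_space) manifold \<Rightarrow> ('b, 'f) bilin_field \<Rightarrow> bool" where
  "closed_form2 N \<omega> \<longleftrightarrow> (\<forall>c\<in>atlas N. \<forall>x\<in>cimage c. \<forall>u v w.
     fderiv (\<lambda>y. in_chart N \<omega> c y v w) x u + fderiv (\<lambda>y. in_chart N \<omega> c y w u) x v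
     + fderiv (\<lambda>y. in_chart N \<omega> c y u v) x w = 0)"

definition kaehler_manifold ::
    "('b, 'f::euclidean_space) manifold \<Rightarrow> ('b, 'f) bilin_field \<Rightarrow> ('b \<Rightarrow> 'f \<Rightarrow> 'f) \<Rightarrow> bool" where
  "kaehler_manifold N h J \<longleftrightarrow> riemannian_manifold N h \<and> complex_structure N J \<and>
     (\<forall>p\<in>points N. \<forall>u v. h p (J p u) (J p v) = h p u v) \<and>
     closed_form2 N (kaehler_form h J)"

section \<open>Functionals and critical points\<close>

definition interval_times :: "real \<Rightarrow> ('a, 'e) manifold \<Rightarrow> (real \<times> 'a, real \<times> 'e) manifold" where
  "interval_times \<epsilon> M =
     \<lparr>mtop = prod_topology (top_of_set {-\<epsilon><..<\<epsilon>}) (mtop M),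
      atlas = (\<lambda>c. ({-\<epsilon><..<\<epsilon>} \<times> cdom c, \<lambda>(t, q). (t, cmap c q))) ` atlas M\<rparr>"

definition smooth_variation ::
    "('a, 'e::euclidean_space) manifold \<Rightarrow> ('b, 'f::euclidean_space) manifold \<Rightarrow>
     ('a \<Rightarrow> 'b) \<Rightarrow> real \<Rightarrow> (real \<Rightarrow> 'a \<Rightarrow> 'b) \<Rightarrow> bool" where
  "smooth_variation M N \<phi> \<epsilon> \<Phi> \<longleftrightarrow> 0 < \<epsilon> \<and>
     smooth_map (interval_times \<epsilon> M) N (\<lambda>(t, q). \<Phi> t q) \<and> (\<forall>q\<in>points M. \<Phi> 0 q = \<phi> q)"

definition critical_point ::
    "('a, 'e::euclidean_space) manifold \<Rightarrow> ('b, 'f::euclidean_space) manifold \<Rightarrow>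
     (('a \<Rightarrow> 'b) \<Rightarrow> real) \<Rightarrow> ('a \<Rightarrow> 'b) \<Rightarrow> bool" where
  "critical_point M N F \<phi> \<longleftrightarrow> smooth_map M N \<phi> \<and>
     (\<forall>\<epsilon> \<Phi>. smooth_variation M N \<phi> \<epsilon> \<Phi> \<longrightarrow> ((\<lambda>t. F (\<Phi> t)) has_real_derivative 0) (at 0))"

definition symplectic_energy ::
    "('a, real^'m) manifold \<Rightarrow> ('a, real^'m) bilin_field \<Rightarrow>
     ('b, 'f::euclidean_space) manifold \<Rightarrow> ('b, 'f) bilin_field \<Rightarrow> ('a \<Rightarrow> 'b) \<Rightarrow> real" where
  "symplectic_energy M g N \<omega> \<phi> =
     1/2 * integral_vol M g (\<lambda>p. form2_norm_sq (g p) (pullback_form2 M N \<phi> \<omega> p))"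

definition full_energy ::
    "real \<Rightarrow> ('a, real^'m) manifold \<Rightarrow> ('a, real^'m) bilin_field \<Rightarrow>
     ('b, 'f::euclidean_space) manifold \<Rightarrow> ('b, 'f) bilin_field \<Rightarrow> ('b, 'f) bilin_field \<Rightarrow>
     ('a \<Rightarrow> 'b) \<Rightarrow> real" where
  "full_energy \<alpha> M g N h \<omega> \<phi> =
     1/2 * integral_vol M g (\<lambda>p. diff_norm_sq M g N h \<phi> p
                                  + \<alpha> * form2_norm_sq (g p) (pullback_form2 M N \<phi> \<omega> p))"

end

(*
  At a Riemannian submersion, contracting with the Kaehler form over an orthonormal frame is the same
  as contracting with h, and |J a| = |a|; hence, to first order, the density |phi^* omega|^2 varies
  exactly as |d phi|^2 does, and both energies have the first variation of the Dirichlet energy,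
  -int h(V, tau(phi)) up to a positive factor. Bump-function variations turn this into tau(phi) = 0.
  The horizontal part of nabla d phi vanishes for a Riemannian submersion, so tau(phi) is the trace over
  the vertical spaces, which up to sign and horizontal lifting is the mean curvature of the fibres. The
  composition formula for the Hessian gives Delta(f o phi) = (Delta f) o phi + df(tau(phi)).
*)
theory Submission
  imports Defs
begin

section \<open>Smooth functions\<close>

text \<open>The divergence in the first variation comes from the adjoint of d\<phi>: for a variation
  field V, the field Z with g(Z, u) = h(V, d\<phi> u) has divergence trace h(\<nabla>V, d\<phi>) +
  h(V, \<tau>). The common derivative of the two densities is therefore 2 (div Z - h(V, \<tau>)),
  and the divergence theorem leaves the tension term. What shapes the development is that tangent
  vectors are stored in the components of \<open>chart_at\<close>, which may jump from point to
  point, and that orthonormal frames are chosen pointwise. Hence nothing is differentiated on the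
  manifold directly: each geometric object gets a coordinate expression on an open set
  (\<open>chr\<close>, \<open>covd\<close>, \<open>sff\<close>, \<open>hess\<close>) and a lemma
  identifying the two, and traces are rewritten as contractions with the inverse metric
  (\<open>trace_on_riesz\<close>), which depends smoothly on the point. Likewise
  \<open>integral_form\<close> is a definite description over all partitions of unity, so existence
  of a partition and independence of the choice precede any use of it.\<close>

lemma has_derivative_fderiv: "f differentiable (at x) \<Longrightarrow> (f has_derivative fderiv f x) (at x)"
  by (simp add: frechet_derivative_works)

lemma fderiv_eqI: "(f has_derivative f') (at x) \<Longrightarrow> fderiv f x = f'"
  using frechet_derivative_at by metis

lemma linear_fderiv: "f differentiable (at x) \<Longrightarrow> linear (fderiv f x)"
  using has_derivative_fderiv has_derivative_linear by blast

lemma fderiv_cong_open: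
  assumes "open S" "x \<in> S" "\<And>y. y \<in> S \<Longrightarrow> f y = g y"
  shows "fderiv f x = fderiv g x"
proof -
  have "(f has_derivative F) (at x) \<longleftrightarrow> (g has_derivative F) (at x)" for F
    using has_derivative_transform_within_open assms by metis
  then show ?thesis
    unfolding frechet_derivative_def by simp
qed

lemma differentiable_cong_open:
  assumes "open S" "x \<in> S" "\<And>y. y \<in> S \<Longrightarrow> f y = g y" "f differentiable (at x)"
  shows "g differentiable (at x)"
  using assms has_derivative_transform_within_open unfolding differentiable_def by metis

lemma Ck_on_cong:
  assumes "open S" "\<And>x. x \<in> S \<Longrightarrow> f x = g x" "Ck_on k S f"
  shows "Ck_on k S g"
  using assms(2,3)
proof (induction k arbitrary: f g)
  case 0
  then show ?case using continuous_on_cong[of S S f g] by simp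
next
  case (Suc k)
  have "g differentiable (at x)" if "x \<in> S" for x
    using differentiable_cong_open[OF assms(1) that, of f g] Suc.prems that by auto
  moreover have "Ck_on k S (\<lambda>x. fderiv g x v)" for v
    using Suc.IH[of "\<lambda>x. fderiv f x v" "\<lambda>x. fderiv g x v"] fderiv_cong_open[OF assms(1), of _ f g] Suc.prems
    by auto
  ultimately show ?case by simp
qed

text \<open>\<open>frechet_derivative\<close> is a choice term, so regularity proofs supply the
  derivative in an explicit form \<open>f'\<close> and trade it for the chosen one on the open set.
  Most inductions on the order of differentiability go through this rule.\<close>

lemma Ck_on_SucI:
  assumes "open S" "\<And>x. x \<in> S \<Longrightarrow> (f has_derivative f' x) (at x)" "\<And>v. Ck_on k S (\<lambda>x. f' x v)"
  shows "Ck_on (Suc k) S f"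
proof -
  have "Ck_on k S (\<lambda>x. fderiv f x v)" for v
    by (rule Ck_on_cong[OF assms(1) _ assms(3)[of v]]) (use fderiv_eqI[OF assms(2)] in auto)
  then show ?thesis using assms(2) by (auto simp: differentiable_def)
qed

lemma Ck_on_SucD: "Ck_on (Suc k) S f \<Longrightarrow> Ck_on k S f"
proof (induction k arbitrary: f)
  case 0
  then show ?case
    by (auto intro!: differentiable_imp_continuous_on simp: differentiable_on_def differentiable_at_withinI)
next
  case (Suc k)
  from Suc.prems have "Ck_on (Suc k) S (\<lambda>x. fderiv f x v)" for v by simp
  then have "Ck_on k S (\<lambda>x. fderiv f x v)" for v by (rule Suc.IH)
  with Suc.prems show ?case by simp
qed

lemma Ck_on_subset: "Ck_on k S f \<Longrightarrow> T \<subseteq> S \<Longrightarrow> Ck_on k T f"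
  by (induction k arbitrary: f) (auto intro: continuous_on_subset)

lemma Ck_on_local:
  assumes "\<And>x. x \<in> S \<Longrightarrow> \<exists>U. open U \<and> x \<in> U \<and> Ck_on k U f"
  shows "Ck_on k S f"
  using assms
proof (induction k arbitrary: f)
  case 0
  have "continuous (at x within S) f" if "x \<in> S" for x
    using 0[OF that] continuous_on_eq_continuous_at continuous_at_imp_continuous_at_within by auto blast
  then show ?case by (simp add: continuous_on_eq_continuous_within)
next
  case (Suc k)
  have "Ck_on k S (\<lambda>x. fderiv f x v)" for v
    by (rule Suc.IH) (use Suc.prems in fastforce)
  with Suc.prems show ?case by fastforce
qed

lemma Ck_on_const: "Ck_on k S (\<lambda>x. c)"
  by (induction k arbitrary: c) auto

lemma Ck_on_bounded_linear:
  assumes "bounded_linear L" "open S"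
  shows "Ck_on k S L"
proof (cases k)
  case 0
  then show ?thesis using assms by (simp add: linear_continuous_on)
next
  case (Suc j)
  show ?thesis unfolding Suc
    by (rule Ck_on_SucI[OF assms(2)], rule bounded_linear_imp_has_derivative[OF assms(1)], rule Ck_on_const)
qed

lemma Ck_on_add:
  assumes "open S" "Ck_on k S f" "Ck_on k S g"
  shows "Ck_on k S (\<lambda>x. f x + g x)"
  using assms(2,3)
proof (induction k arbitrary: f g)
  case 0
  then show ?case by (simp add: continuous_on_add)
next
  case (Suc k)
  show ?case
    by (rule Ck_on_SucI[OF assms(1), of _ "\<lambda>x v. fderiv f x v + fderiv g x v"])
      (use Suc in \<open>auto intro!: has_derivative_add has_derivative_fderiv\<close>)
qed

lemma Ck_on_bounded_bilinear:
  assumes "bounded_bilinear B" "open S" "Ck_on k S f" "Ck_on k S g"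
  shows "Ck_on k S (\<lambda>x. B (f x) (g x))"
  using assms(3,4)
proof (induction k arbitrary: f g)
  case 0
  then show ?case using bounded_bilinear.continuous_on[OF assms(1)] by simp
next
  case (Suc k)
  have *: "Ck_on k S f" "Ck_on k S g" using Suc.prems by (auto intro: Ck_on_SucD simp del: Ck_on.simps)
  show ?case
    by (rule Ck_on_SucI[OF assms(2), of _ "\<lambda>x v. B (f x) (fderiv g x v) + B (fderiv f x v) (g x)"])
      (use Suc * in \<open>auto intro!: bounded_bilinear.FDERIV[OF assms(1)] has_derivative_fderiv Ck_on_add assms(2)\<close>)
qed

lemma Ck_on_sum:
  assumes "open S" "\<And>i. i \<in> I \<Longrightarrow> Ck_on k S (f i)"
  shows "Ck_on k S (\<lambda>x. \<Sum>i\<in>I. f i x)"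
  using assms(2) by (induction I rule: infinite_finite_induct) (auto intro: Ck_on_const Ck_on_add[OF assms(1)])

lemma linear_euclidean_expand:
  fixes L :: "'a::euclidean_space \<Rightarrow> 'b::real_vector"
  assumes "linear L"
  shows "L v = (\<Sum>b\<in>Basis. (v \<bullet> b) *\<^sub>R L b)"
  by (metis (no_types, lifting) assms euclidean_representation linear_scale linear_sum sum.cong)

text \<open>The derivative of the composite evaluates \<open>fderiv g\<close> in a direction that
  moves with x, whereas \<open>Ck_on\<close> speaks of fixed directions. Expanding the moving
  direction in \<open>Basis\<close> leaves products of scalars with fixed-direction derivatives of
  \<open>g\<close> along \<open>f\<close>, to which the induction hypothesis applies.\<close>

lemma Ck_on_compose:
  assumes "open S" "open T" "Ck_on k S f" "Ck_on k T g" "f ` S \<subseteq> T"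
  shows "Ck_on k S (\<lambda>x. g (f x))"
  using assms(3-5)
proof (induction k arbitrary: f g)
  case 0
  then show ?case using continuous_on_compose2[of T g S f] by simp
next
  case (Suc k)
  have f: "Ck_on k S f" using Suc.prems(1) by (rule Ck_on_SucD)
  have "(fderiv g (f x) \<circ> fderiv f x) v = (\<Sum>b\<in>Basis. (fderiv f x v \<bullet> b) *\<^sub>R fderiv g (f x) b)" if "x \<in> S" for x v
    using linear_euclidean_expand[OF linear_fderiv, of g "f x" "fderiv f x v"] Suc.prems that by auto
  moreover have "Ck_on k S (\<lambda>x. \<Sum>b\<in>Basis. (fderiv f x v \<bullet> b) *\<^sub>R fderiv g (f x) b)" for v
    using Suc.prems f
    by (intro Ck_on_sum Ck_on_bounded_bilinear[OF bounded_bilinear_scaleR] assms Suc.IH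
        Ck_on_bounded_bilinear[OF bounded_bilinear_inner] Ck_on_const) auto
  ultimately have "Ck_on k S (\<lambda>x. (fderiv g (f x) \<circ> fderiv f x) v)" for v
    using Ck_on_cong[OF assms(1)] by (metis (no_types, lifting))
  moreover have "((\<lambda>x. g (f x)) has_derivative (fderiv g (f x) \<circ> fderiv f x)) (at x)" if "x \<in> S" for x
    unfolding comp_def[of "fderiv g (f x)"] using Suc.prems that
    by (intro has_derivative_compose[of f _ x UNIV g] has_derivative_fderiv) auto
  ultimately show ?case by (rule Ck_on_SucI[OF assms(1), rotated])
qed

section \<open>Closure properties of smooth functions\<close>

named_theorems smooth_intros

lemma smooth_on_cong: "smooth_on S f \<Longrightarrow> open S \<Longrightarrow> (\<And>x. x \<in> S \<Longrightarrow> f x = g x) \<Longrightarrow> smooth_on S g"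
  unfolding smooth_on_def using Ck_on_cong by blast

lemma smooth_on_subset: "smooth_on S f \<Longrightarrow> T \<subseteq> S \<Longrightarrow> smooth_on T f"
  unfolding smooth_on_def using Ck_on_subset by blast

lemma smooth_on_local:
  assumes "\<And>x. x \<in> S \<Longrightarrow> \<exists>U. open U \<and> x \<in> U \<and> smooth_on U f"
  shows "smooth_on S f"
  unfolding smooth_on_def by (intro allI Ck_on_local) (use assms smooth_on_def in blast)

lemma smooth_on_continuous_on: "smooth_on S f \<Longrightarrow> continuous_on S f"
  unfolding smooth_on_def using Ck_on.simps(1) by blast

lemma smooth_on_differentiable: "smooth_on S f \<Longrightarrow> x \<in> S \<Longrightarrow> f differentiable (at x)"
  unfolding smooth_on_def using Ck_on.simps(2)[of 0] by blast

lemma smooth_on_has_derivative: "smooth_on S f \<Longrightarrow> x \<in> S \<Longrightarrow> (f has_derivative fderiv f x) (at x)"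
  by (intro has_derivative_fderiv smooth_on_differentiable)

lemma smooth_on_linear_fderiv: "smooth_on S f \<Longrightarrow> x \<in> S \<Longrightarrow> linear (fderiv f x)"
  by (intro linear_fderiv smooth_on_differentiable)

lemma smooth_on_fderiv: "smooth_on S f \<Longrightarrow> smooth_on S (\<lambda>x. fderiv f x v)"
  unfolding smooth_on_def using Ck_on.simps(2) by blast

lemma smooth_on_const [smooth_intros]: "smooth_on S (\<lambda>x. c)"
  by (simp add: smooth_on_def Ck_on_const)

lemma smooth_on_bounded_linear: "bounded_linear L \<Longrightarrow> open S \<Longrightarrow> smooth_on S L"
  by (simp add: smooth_on_def Ck_on_bounded_linear)

lemma smooth_on_linear: "linear (L :: 'a::euclidean_space \<Rightarrow> 'b::euclidean_space) \<Longrightarrow> open S \<Longrightarrow> smooth_on S L"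
  by (simp add: smooth_on_bounded_linear linear_conv_bounded_linear)

lemma smooth_on_ident [smooth_intros]: "open S \<Longrightarrow> smooth_on S (\<lambda>x. x)"
  by (simp add: smooth_on_bounded_linear bounded_linear_ident)

lemma smooth_on_add [smooth_intros]:
  "open S \<Longrightarrow> smooth_on S f \<Longrightarrow> smooth_on S g \<Longrightarrow> smooth_on S (\<lambda>x. f x + g x)"
  by (simp add: smooth_on_def Ck_on_add)

lemma smooth_on_bounded_bilinear:
  "bounded_bilinear B \<Longrightarrow> open S \<Longrightarrow> smooth_on S f \<Longrightarrow> smooth_on S g \<Longrightarrow> smooth_on S (\<lambda>x. B (f x) (g x))"
  by (simp add: smooth_on_def Ck_on_bounded_bilinear)

lemmas smooth_on_scaleR [smooth_intros] = smooth_on_bounded_bilinear[OF bounded_bilinear_scaleR]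
lemmas smooth_on_inner [smooth_intros] = smooth_on_bounded_bilinear[OF bounded_bilinear_inner]
lemma smooth_on_mult [smooth_intros]:
  fixes f g :: "_ \<Rightarrow> real"
  shows "open S \<Longrightarrow> smooth_on S f \<Longrightarrow> smooth_on S g \<Longrightarrow> smooth_on S (\<lambda>x. f x * g x)"
  using smooth_on_scaleR[of S f g] by simp

lemma smooth_on_minus [smooth_intros]: "open S \<Longrightarrow> smooth_on S f \<Longrightarrow> smooth_on S (\<lambda>x. - f x)"
  using smooth_on_scaleR[of S "\<lambda>_. -1" f] by (simp add: smooth_on_const)

lemma smooth_on_diff [smooth_intros]:
  "open S \<Longrightarrow> smooth_on S f \<Longrightarrow> smooth_on S g \<Longrightarrow> smooth_on S (\<lambda>x. f x - g x)"
  using smooth_on_add[of S f "\<lambda>x. - g x"] by (simp add: smooth_on_minus)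

lemma smooth_on_sum [smooth_intros]:
  "open S \<Longrightarrow> (\<And>i. i \<in> I \<Longrightarrow> smooth_on S (f i)) \<Longrightarrow> smooth_on S (\<lambda>x. \<Sum>i\<in>I. f i x)"
  by (simp add: smooth_on_def Ck_on_sum)

lemma smooth_on_prod [smooth_intros]:
  fixes f :: "_ \<Rightarrow> _ \<Rightarrow> real"
  assumes "open S" "\<And>i. i \<in> I \<Longrightarrow> smooth_on S (f i)"
  shows "smooth_on S (\<lambda>x. \<Prod>i\<in>I. f i x)"
  using assms(2) by (induction I rule: infinite_finite_induct) (auto intro: smooth_on_const smooth_on_mult[OF assms(1)])

lemma smooth_on_compose:
  "smooth_on T g \<Longrightarrow> smooth_on S f \<Longrightarrow> open S \<Longrightarrow> open T \<Longrightarrow> (\<And>x. x \<in> S \<Longrightarrow> f x \<in> T) \<Longrightarrow> smooth_on S (\<lambda>x. g (f x))"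
  unfolding smooth_on_def using Ck_on_compose[of S T] by blast

lemma smooth_on_linear_compose:
  "linear (L :: 'a::euclidean_space \<Rightarrow> 'b::euclidean_space) \<Longrightarrow> open S \<Longrightarrow> smooth_on S f \<Longrightarrow> smooth_on S (\<lambda>x. L (f x))"
  using smooth_on_compose[OF smooth_on_linear[of L UNIV]] by auto

lemma smooth_on_euclidean_iff:
  assumes "open S"
  shows "smooth_on S f \<longleftrightarrow> (\<forall>b\<in>Basis. smooth_on S (\<lambda>x. f x \<bullet> b))"
proof
  assume "\<forall>b\<in>Basis. smooth_on S (\<lambda>x. f x \<bullet> b)"
  then have "smooth_on S (\<lambda>x. \<Sum>b\<in>Basis. (f x \<bullet> b) *\<^sub>R b)"
    by (intro smooth_on_sum smooth_on_scaleR smooth_on_const assms) auto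
  then show "smooth_on S f" by (simp add: euclidean_representation)
qed (simp add: assms smooth_on_inner smooth_on_const)

lemma smooth_on_vec_nth [smooth_intros]: "open S \<Longrightarrow> smooth_on S f \<Longrightarrow> smooth_on S (\<lambda>x. f x $ i)"
  for f :: "'a::euclidean_space \<Rightarrow> real^'n"
  using smooth_on_inner[of S f "\<lambda>_. axis i 1"] by (simp add: inner_axis smooth_on_const)

lemma smooth_on_vec [smooth_intros]:
  "open S \<Longrightarrow> (\<And>i. smooth_on S (\<lambda>x. f x i)) \<Longrightarrow> smooth_on S (\<lambda>x. (\<chi> i. f x i) :: real^'n)"
  by (subst smooth_on_euclidean_iff) (auto simp: Basis_vec_def inner_axis)

lemma smooth_on_Pair [smooth_intros]:
  assumes "open S" "smooth_on S f" "smooth_on S g"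
  shows "smooth_on S (\<lambda>x. (f x, g x))"
proof -
  have "smooth_on S (\<lambda>x. (f x, 0) + (0, g x))"
    using assms
    by (intro smooth_on_add smooth_on_linear_compose[of "\<lambda>x. (x, 0)"] smooth_on_linear_compose[of "Pair 0"])
      (auto simp: linear_iff)
  then show ?thesis by simp
qed

lemma smooth_on_fst [smooth_intros]: "open S \<Longrightarrow> smooth_on S f \<Longrightarrow> smooth_on S (\<lambda>x. fst (f x))"
  by (rule smooth_on_linear_compose) (auto simp: linear_fst)

lemma smooth_on_snd [smooth_intros]: "open S \<Longrightarrow> smooth_on S f \<Longrightarrow> smooth_on S (\<lambda>x. snd (f x))"
  by (rule smooth_on_linear_compose) (auto simp: linear_snd)

text \<open>The derivative is a polynomial in the function itself, so each order of
  differentiability yields the next. The square root below is treated in the same way, its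
  derivative being a multiple of its own reciprocal.\<close>

lemma smooth_on_inverse_real: "smooth_on (- {0}) (inverse :: real \<Rightarrow> real)"
proof -
  have "Ck_on k (- {0}) (inverse :: real \<Rightarrow> real)" for k
  proof (induction k)
    case 0
    then show ?case by (auto intro!: continuous_on_inverse)
  next
    case (Suc k)
    show ?case
    proof (rule Ck_on_SucI[of _ _ "\<lambda>x v. - (inverse x * v * inverse x)"])
      fix v :: real
      have "Ck_on k (- {0}) (\<lambda>x::real. (inverse x * inverse x) * (- v))"
        by (intro Ck_on_bounded_bilinear[OF bounded_bilinear_mult] Suc Ck_on_const) auto
      then show "Ck_on k (- {0}) (\<lambda>x. - (inverse x * v * inverse x))" by (simp add: mult_ac)
    qed (auto intro!: has_derivative_inverse')
  qed
  then show ?thesis by (simp add: smooth_on_def)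
qed

lemma smooth_on_divide [smooth_intros]:
  fixes f g :: "_ \<Rightarrow> real"
  assumes "open S" "smooth_on S f" "smooth_on S g" "\<And>x. x \<in> S \<Longrightarrow> g x \<noteq> 0"
  shows "smooth_on S (\<lambda>x. f x / g x)"
  unfolding divide_inverse using assms
  by (intro smooth_on_mult smooth_on_compose[OF smooth_on_inverse_real assms(3)]) auto

lemma smooth_on_sqrt_real: "smooth_on {0<..} sqrt"
proof -
  have "Ck_on k {0<..} sqrt" for k
  proof (induction k)
    case 0
    then show ?case by (auto intro!: continuous_intros)
  next
    case (Suc k)
    show ?case
    proof (rule Ck_on_SucI[of _ _ "\<lambda>x v. v * (inverse (sqrt x) / 2)"])
      fix v :: real
      have "Ck_on k {0<..} (\<lambda>x::real. (v/2) * inverse (sqrt x))"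
        using smooth_on_inverse_real
        by (intro Ck_on_bounded_bilinear[OF bounded_bilinear_mult] Ck_on_compose[of _ "-{0}", OF _ _ Suc] Ck_on_const)
          (auto simp: smooth_on_def)
      then show "Ck_on k {0<..} (\<lambda>x. v * (inverse (sqrt x) / 2))" by (simp add: mult_ac)
    qed (auto intro!: derivative_eq_intros simp: field_simps)
  qed
  then show ?thesis by (simp add: smooth_on_def)
qed

lemma smooth_on_sqrt [smooth_intros]:
  assumes "open S" "smooth_on S f" "\<And>x. x \<in> S \<Longrightarrow> 0 < f x"
  shows "smooth_on S (\<lambda>x. sqrt (f x))"
  by (rule smooth_on_compose[OF smooth_on_sqrt_real assms(2,1)]) (use assms in auto)

lemma smooth_on_det [smooth_intros]:
  fixes A :: "'a::euclidean_space \<Rightarrow> real^'n^'n"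
  assumes "open S" "\<And>i j. smooth_on S (\<lambda>x. A x $ i $ j)"
  shows "smooth_on S (\<lambda>x. det (A x))"
  unfolding det_def by (intro smooth_on_sum smooth_on_mult smooth_on_prod smooth_on_const assms)

lemma smooth_on_fderiv_smooth [smooth_intros]:
  assumes "open S" "smooth_on S f" "smooth_on S v"
  shows "smooth_on S (\<lambda>x. fderiv f x (v x))"
proof (rule smooth_on_cong[OF _ assms(1)])
  show "smooth_on S (\<lambda>x. \<Sum>b\<in>Basis. (v x \<bullet> b) *\<^sub>R fderiv f x b)"
    using assms by (auto intro!: smooth_intros smooth_on_fderiv)
qed (use assms linear_euclidean_expand smooth_on_linear_fderiv in metis)

lemma bilinear_expand:
  fixes b :: "'a::euclidean_space \<Rightarrow> 'b::euclidean_space \<Rightarrow> 'c::real_vector"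
  assumes "bilinear b"
  shows "b u v = (\<Sum>i\<in>Basis. \<Sum>j\<in>Basis. ((u \<bullet> i) * (v \<bullet> j)) *\<^sub>R b i j)"
proof -
  have "b u v = (\<Sum>i\<in>Basis. (u \<bullet> i) *\<^sub>R b i v)"
    using assms linear_euclidean_expand[of "\<lambda>u. b u v" u] by (simp add: bilinear_def)
  moreover have "b i v = (\<Sum>j\<in>Basis. (v \<bullet> j) *\<^sub>R b i j)" for i
    using assms linear_euclidean_expand[of "b i" v] by (simp add: bilinear_def)
  ultimately show ?thesis by (simp add: scaleR_right.sum)
qed

lemma smooth_on_bilinear_family:
  assumes "open S" "\<And>x. x \<in> S \<Longrightarrow> bilinear (b x)" "\<And>u v. smooth_on S (\<lambda>x. b x u v)"
    and "smooth_on S f" "smooth_on S g"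
  shows "smooth_on S (\<lambda>x. b x (f x) (g x))"
proof (rule smooth_on_cong[OF _ assms(1)])
  show "smooth_on S (\<lambda>x. \<Sum>i\<in>Basis. \<Sum>j\<in>Basis. ((f x \<bullet> i) * (g x \<bullet> j)) *\<^sub>R b x i j)"
    using assms by (auto intro!: smooth_intros)
  show "(\<Sum>i\<in>Basis. \<Sum>j\<in>Basis. ((f x \<bullet> i) * (g x \<bullet> j)) *\<^sub>R b x i j) = b x (f x) (g x)" if "x \<in> S" for x
    by (rule bilinear_expand[OF assms(2)[OF that], symmetric])
qed

text \<open>Expanding in the bases turns the moving form into a finite sum of products, whence a
  three-term Leibniz rule. Families of linear maps are covered as well: the first slot is then real
  and held at the constant value 1, a device that recurs below.\<close>

lemma has_derivative_bilinear_family: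
  fixes b :: "'a::euclidean_space \<Rightarrow> 'b::euclidean_space \<Rightarrow> 'c::euclidean_space \<Rightarrow> 'd::euclidean_space"
  assumes S: "open S" "x \<in> S" and b: "\<And>y. y \<in> S \<Longrightarrow> bilinear (b y)"
    and b': "\<And>u v. ((\<lambda>y. b y u v) has_derivative b' u v) (at x)"
    and f: "(f has_derivative f') (at x)" and g: "(g has_derivative g') (at x)"
  shows "((\<lambda>y. b y (f y) (g y)) has_derivative
           (\<lambda>w. b' (f x) (g x) w + b x (f' w) (g x) + b x (f x) (g' w))) (at x)"
proof -
  have 1: "(\<Sum>i\<in>Basis. \<Sum>j\<in>Basis. ((f y \<bullet> i) * (g y \<bullet> j)) *\<^sub>R b y i j) = b y (f y) (g y)" if "y \<in> S" for y
    by (rule bilinear_expand[OF b[OF that], symmetric])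
  \<comment> \<open>\<open>b'\<close> inherits bilinearity in u and v from the forms
    \<open>b y\<close>, by uniqueness of the derivative.\<close>
  have b0: "b' u v w = (\<Sum>i\<in>Basis. \<Sum>j\<in>Basis. ((u \<bullet> i) * (v \<bullet> j)) *\<^sub>R b' i j w)" for u v w
  proof -
    have "((\<lambda>y. \<Sum>i\<in>Basis. \<Sum>j\<in>Basis. ((u \<bullet> i) * (v \<bullet> j)) *\<^sub>R b y i j) has_derivative
       (\<lambda>w. \<Sum>i\<in>Basis. \<Sum>j\<in>Basis. ((u \<bullet> i) * (v \<bullet> j)) *\<^sub>R b' i j w)) (at x)"
      by (rule has_derivative_eq_rhs, (rule derivative_intros b')+) simp
    then have "((\<lambda>y. b y u v) has_derivative
       (\<lambda>w. \<Sum>i\<in>Basis. \<Sum>j\<in>Basis. ((u \<bullet> i) * (v \<bullet> j)) *\<^sub>R b' i j w)) (at x)"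
      by (rule has_derivative_transform_within_open[OF _ S]) (rule bilinear_expand[OF b, symmetric])
    from has_derivative_unique[OF b' this] show ?thesis by (rule fun_cong)
  qed
  have "((\<lambda>y. \<Sum>i\<in>Basis. \<Sum>j\<in>Basis. ((f y \<bullet> i) * (g y \<bullet> j)) *\<^sub>R b y i j) has_derivative
     (\<lambda>w. \<Sum>i\<in>Basis. \<Sum>j\<in>Basis. ((f x \<bullet> i) * (g x \<bullet> j)) *\<^sub>R b' i j w +
        ((f' w \<bullet> i) * (g x \<bullet> j)) *\<^sub>R b x i j + ((f x \<bullet> i) * (g' w \<bullet> j)) *\<^sub>R b x i j)) (at x)"
    by (rule has_derivative_eq_rhs, (rule derivative_intros b' f g)+) (simp add: fun_eq_iff algebra_simps)
  then have "((\<lambda>y. \<Sum>i\<in>Basis. \<Sum>j\<in>Basis. ((f y \<bullet> i) * (g y \<bullet> j)) *\<^sub>R b y i j) has_derivative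
     (\<lambda>w. b' (f x) (g x) w + b x (f' w) (g x) + b x (f x) (g' w))) (at x)"
    unfolding sum.distrib b0[symmetric] bilinear_expand[OF b[OF S(2)], symmetric] .
  then show ?thesis
    by (rule has_derivative_transform_within_open[OF _ S]) (use 1 in auto)
qed

section \<open>Symmetry of second derivatives\<close>

abbreviation fderiv2 :: "('a::euclidean_space \<Rightarrow> 'b::euclidean_space) \<Rightarrow> 'a \<Rightarrow> 'a \<Rightarrow> 'a \<Rightarrow> 'b"
  where "fderiv2 f x u v \<equiv> fderiv (\<lambda>y. fderiv f y v) x u"

lemma fderiv_line:
  assumes "f differentiable (at (x + s *\<^sub>R u))"
  shows "((\<lambda>s. f (x + s *\<^sub>R u)) has_derivative (\<lambda>r. r *\<^sub>R fderiv f (x + s *\<^sub>R u) u)) (at s)"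
proof -
  have 1: "((\<lambda>s. x + s *\<^sub>R u) has_derivative (\<lambda>r. r *\<^sub>R u)) (at s)"
    by (auto intro!: derivative_eq_intros)
  have "((\<lambda>s. f (x + s *\<^sub>R u)) has_derivative (\<lambda>r. fderiv f (x + s *\<^sub>R u) (r *\<^sub>R u))) (at s)"
    by (rule has_derivative_compose[OF 1 has_derivative_fderiv[OF assms]])
  then show ?thesis using linear_scale[OF linear_fderiv[OF assms]] by simp
qed

text \<open>The mean value theorem is applied in direction u to the increment in direction v, and
  then in direction v to the derivative in direction u. Exchanging u and v leaves the left-hand side
  unchanged, which is the source of the symmetry.\<close>

lemma second_difference_mvt:
  fixes f :: "'a::euclidean_space \<Rightarrow> real"
  assumes f: "smooth_on S f" and s: "0 < s" and S: "\<And>a b. 0 \<le> a \<Longrightarrow> a \<le> s \<Longrightarrow> 0 \<le> b \<Longrightarrow> b \<le> s \<Longrightarrow> x + a *\<^sub>R u + b *\<^sub>R v \<in> S"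
  obtains a b where "0 < a" "a < s" "0 < b" "b < s"
    "f (x + s *\<^sub>R u + s *\<^sub>R v) - f (x + s *\<^sub>R u) - f (x + s *\<^sub>R v) + f x = s * s * fderiv2 f (x + a *\<^sub>R u + b *\<^sub>R v) v u"
proof -
  define \<phi> where "\<phi> a = f (x + s *\<^sub>R v + a *\<^sub>R u) - f (x + a *\<^sub>R u)" for a
  have S': "x + s *\<^sub>R v + a *\<^sub>R u \<in> S" "x + a *\<^sub>R u \<in> S" if "0 \<le> a" "a \<le> s" for a
    using S[of a s] S[of a 0] that s by (auto simp: add_ac)
  have "(\<phi> has_real_derivative fderiv f (x + s *\<^sub>R v + a *\<^sub>R u) u - fderiv f (x + a *\<^sub>R u) u) (at a)" if "0 \<le> a" "a \<le> s" for a
    unfolding \<phi>_def has_field_derivative_def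
    by (rule has_derivative_eq_rhs[OF has_derivative_diff[OF fderiv_line fderiv_line]])
      (use smooth_on_differentiable[OF f S'(1)[OF that]] smooth_on_differentiable[OF f S'(2)[OF that]]
        in \<open>auto simp: fun_eq_iff algebra_simps\<close>)
  from MVT2[OF s this] obtain a where a: "0 < a" "a < s"
    "\<phi> s - \<phi> 0 = s * (fderiv f (x + s *\<^sub>R v + a *\<^sub>R u) u - fderiv f (x + a *\<^sub>R u) u)" by auto
  have "((\<lambda>b. fderiv f (x + a *\<^sub>R u + b *\<^sub>R v) u) has_real_derivative fderiv2 f (x + a *\<^sub>R u + b *\<^sub>R v) v u) (at b)"
    if "0 \<le> b" "b \<le> s" for b
    unfolding has_field_derivative_def
    using fderiv_line[of "\<lambda>y. fderiv f y u" "x + a *\<^sub>R u" b v] S[of a b] that a smooth_on_differentiable[OF smooth_on_fderiv[OF f]]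
    by (simp add: mult_commute_abs)
  from MVT2[OF s this] obtain b where b: "0 < b" "b < s"
    "fderiv f (x + a *\<^sub>R u + s *\<^sub>R v) u - fderiv f (x + a *\<^sub>R u) u = s * fderiv2 f (x + a *\<^sub>R u + b *\<^sub>R v) v u" by auto
  have e: "x + a *\<^sub>R u + s *\<^sub>R v = x + s *\<^sub>R v + a *\<^sub>R u" by (simp add: add_ac)
  have "\<phi> s - \<phi> 0 = s * (s * fderiv2 f (x + a *\<^sub>R u + b *\<^sub>R v) v u)"
    using a(3) b(3) by (simp add: e)
  with a b show ?thesis by (intro that[of a b]) (auto simp: \<phi>_def add_ac mult_ac)
qed

lemma isCont_nhds_real:
  fixes f :: "'a::metric_space \<Rightarrow> real"
  shows "isCont f x \<longleftrightarrow> (\<forall>e>0. \<forall>\<^sub>F y in nhds x. \<bar>f y - f x\<bar> < e)"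
  unfolding isCont_def tendsto_at_iff_tendsto_nhds unfolding tendsto_iff dist_real_def ..

text \<open>If the two mixed derivatives differed at x, continuity would keep them apart near x,
  while one and the same second difference over a small parallelogram represents both of them at
  nearby points.\<close>

lemma fderiv2_commute_real:
  fixes f :: "'a::euclidean_space \<Rightarrow> real"
  assumes f: "smooth_on S f" and S: "open S" "x \<in> S"
  shows "fderiv2 f x u v = fderiv2 f x v u"
proof (rule ccontr)
  assume ne: "fderiv2 f x u v \<noteq> fderiv2 f x v u"
  define e where "e = \<bar>fderiv2 f x u v - fderiv2 f x v u\<bar> / 2"
  have e: "0 < e" using ne by (simp add: e_def)
  have c: "isCont (\<lambda>y. fderiv2 f y p q) x" for p q
    using smooth_on_continuous_on[OF smooth_on_fderiv[OF smooth_on_fderiv[OF f]]] S continuous_on_eq_continuous_at by blast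
  have "\<forall>\<^sub>F y in nhds x. y \<in> S \<and> \<bar>fderiv2 f y u v - fderiv2 f x u v\<bar> < e \<and> \<bar>fderiv2 f y v u - fderiv2 f x v u\<bar> < e"
    using c[of u v] c[of v u] e S unfolding isCont_nhds_real
    by (intro eventually_conj eventually_nhds_in_open) auto
  then obtain d where d: "d > 0" and D: "\<And>y. dist y x < d \<Longrightarrow> y \<in> S \<and> \<bar>fderiv2 f y u v - fderiv2 f x u v\<bar> < e \<and> \<bar>fderiv2 f y v u - fderiv2 f x v u\<bar> < e"
    unfolding eventually_nhds_metric by auto
  \<comment> \<open>Scaled so that the parallelogram with sides s u and s v stays within d / 2 of x;
    the summand 1 covers u = v = 0.\<close>
  define K where "K = norm u + norm v + 1"
  define s where "s = d / (2 * K)"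
  have K: "K > 0" unfolding K_def using norm_ge_zero[of u] norm_ge_zero[of v] by linarith
  then have s: "0 < s" using d by (simp add: s_def)
  have near: "dist (x + a *\<^sub>R u + b *\<^sub>R v) x < d" if "0 \<le> a" "a \<le> s" "0 \<le> b" "b \<le> s" for a b
  proof -
    have "dist (x + a *\<^sub>R u + b *\<^sub>R v) x \<le> a * norm u + b * norm v"
      using norm_triangle_ineq[of "a *\<^sub>R u" "b *\<^sub>R v"] that by (simp add: dist_norm add.assoc)
    also have "\<dots> \<le> s * norm u + s * norm v" using that by (intro add_mono mult_right_mono) auto
    also have "\<dots> \<le> s * K" using s by (simp add: K_def algebra_simps)
    also have "\<dots> = d / 2"
      using K by (simp add: s_def)
    finally show ?thesis using d by simp
  qed
  obtain a b where ab: "0 < a" "a < s" "0 < b" "b < s"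
    "f (x + s *\<^sub>R u + s *\<^sub>R v) - f (x + s *\<^sub>R u) - f (x + s *\<^sub>R v) + f x = s * s * fderiv2 f (x + a *\<^sub>R u + b *\<^sub>R v) v u"
    using second_difference_mvt[OF f s, of x u v] D near by metis
  have near': "dist (x + a *\<^sub>R v + b *\<^sub>R u) x < d" if "0 \<le> a" "a \<le> s" "0 \<le> b" "b \<le> s" for a b
    using near[OF that(3,4,1,2)] by (simp add: add_ac)
  obtain a' b' where ab': "0 < a'" "a' < s" "0 < b'" "b' < s"
    "f (x + s *\<^sub>R v + s *\<^sub>R u) - f (x + s *\<^sub>R v) - f (x + s *\<^sub>R u) + f x = s * s * fderiv2 f (x + a' *\<^sub>R v + b' *\<^sub>R u) u v"
    using second_difference_mvt[OF f s, of x v u] D near' by metis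
  have e1: "x + s *\<^sub>R v + s *\<^sub>R u = x + s *\<^sub>R u + s *\<^sub>R v" by (simp add: add_ac)
  have "s * s * fderiv2 f (x + a' *\<^sub>R v + b' *\<^sub>R u) u v = s * s * fderiv2 f (x + a *\<^sub>R u + b *\<^sub>R v) v u"
    using ab(5) ab'(5) unfolding e1 by linarith
  then have "fderiv2 f (x + a' *\<^sub>R v + b' *\<^sub>R u) u v = fderiv2 f (x + a *\<^sub>R u + b *\<^sub>R v) v u" using s by simp
  then show False
    using D[OF near[of a b]] D[OF near'[of a' b']] ab ab' unfolding e_def by (auto simp: abs_if field_simps split: if_splits)
qed

lemma fderiv_inner:
  assumes "f differentiable (at x)"
  shows "fderiv (\<lambda>y. f y \<bullet> b) x u = fderiv f x u \<bullet> b"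
  using fderiv_eqI[OF has_derivative_inner_left[OF has_derivative_fderiv[OF assms]]] by metis

lemma fderiv2_commute:
  assumes f: "smooth_on S f" and S: "open S" "x \<in> S"
  shows "fderiv2 f x u v = fderiv2 f x v u"
proof (rule euclidean_eqI)
  fix b :: 'b assume "b \<in> Basis"
  have "fderiv2 f x p q \<bullet> b = fderiv2 (\<lambda>y. f y \<bullet> b) x p q" for p q
  proof -
    have "fderiv2 f x p q \<bullet> b = fderiv (\<lambda>y. fderiv f y q \<bullet> b) x p"
      using smooth_on_differentiable[OF smooth_on_fderiv[OF f] S(2)] by (simp add: fderiv_inner)
    also have "fderiv (\<lambda>y. fderiv f y q \<bullet> b) x = fderiv (\<lambda>y. fderiv (\<lambda>y. f y \<bullet> b) y q) x"
      by (rule fderiv_cong_open[OF S]) (simp add: fderiv_inner smooth_on_differentiable[OF f])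
    finally show ?thesis .
  qed
  moreover have "smooth_on S (\<lambda>y. f y \<bullet> b)" using f S by (auto intro!: smooth_intros)
  ultimately show "fderiv2 f x u v \<bullet> b = fderiv2 f x v u \<bullet> b"
    using fderiv2_commute_real S by metis
qed

section \<open>Inner products, frames and traces\<close>

definition inner_product :: "('e::euclidean_space \<Rightarrow> 'e \<Rightarrow> real) \<Rightarrow> bool" where
  "inner_product b \<longleftrightarrow> bilinear b \<and> (\<forall>u v. b u v = b v u) \<and> (\<forall>u. u \<noteq> 0 \<longrightarrow> 0 < b u u)"

lemma bilinear_linear:
  assumes "bilinear b"
  shows "linear (b u)" "linear (\<lambda>u. b u v)"
  using assms by (auto simp: bilinear_def)

lemma inner_productD:
  assumes "inner_product b"
  shows "bilinear b" "b u v = b v u" "u \<noteq> 0 \<Longrightarrow> 0 < b u u" "b u u = 0 \<longleftrightarrow> u = 0"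
  using assms unfolding inner_product_def by (auto simp: bilinear_rzero)

lemma inner_product_eqI:
  assumes "inner_product b" "\<And>w. b u w = b v w"
  shows "u = v"
proof -
  have "b (u - v) (u - v) = 0"
    using assms by (simp add: inner_productD(1) bilinear_lsub)
  then show ?thesis using inner_productD(4)[OF assms(1)] by auto
qed

context
  fixes b :: "'e::euclidean_space \<Rightarrow> 'e \<Rightarrow> real"
  assumes b: "inner_product b"
begin

interpretation bl: linear "b u" for u using bilinear_linear(1)[OF inner_productD(1)[OF b]] .
interpretation br: linear "\<lambda>u. b u v" for v using bilinear_linear(2)[OF inner_productD(1)[OF b]] .

text \<open>Gram-Schmidt by induction on the dimension: normalise one nonzero vector e and apply the
  hypothesis to the orthogonal complement of e inside S.\<close>

lemma orthonormal_basis_exists: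
  assumes "subspace S"
  shows "\<exists>B. orthonormal_basis b S B"
  using assms
proof (induction "dim S" arbitrary: S rule: less_induct)
  case less
  show ?case
  proof (cases "S = {0}")
    case True
    then show ?thesis unfolding orthonormal_basis_def by (intro exI[of _ "{}"]) auto
  next
    case False
    then obtain u where u: "u \<in> S" "u \<noteq> 0" using subspace_0[OF less.prems] by auto
    define e where "e = (1 / sqrt (b u u)) *\<^sub>R u"
    have bu: "b u u > 0" using inner_productD(3)[OF b u(2)] .
    have e: "e \<in> S" "b e e = 1"
      using subspace_scale[OF less.prems u(1)] bu by (auto simp: e_def bl.scale br.scale)
    define S' where "S' = {v\<in>S. b e v = 0}"
    have S': "subspace S'"
      using less.prems by (auto simp: S'_def subspace_def bl.add bl.scale bl.zero)
    have "e \<notin> S'" using e by (auto simp: S'_def)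
    moreover have "S' \<subseteq> S" by (auto simp: S'_def)
    ultimately have "S' \<subset> S" using e by blast
    then have "dim S' < dim S"
      using dim_psubset[of S' S] S' less.prems by (metis span_eq_iff)
    from less.hyps[OF this S'] obtain B where B: "span B = S'" "\<And>u v. u \<in> B \<Longrightarrow> v \<in> B \<Longrightarrow> b u v = (if u = v then 1 else 0)"
      by (auto simp: orthonormal_basis_def)
    have BS: "b e v = 0" "b v e = 0" if "v \<in> B" for v
    proof -
      show "b e v = 0" using that B(1) span_superset[of B] by (auto simp: S'_def)
      then show "b v e = 0" using inner_productD(2)[OF b] by metis
    qed
    have "span (insert e B) = S"
    proof
      show "span (insert e B) \<subseteq> S"
        using B(1) span_superset[of B] e by (intro span_minimal less.prems) (auto simp: S'_def)
      show "S \<subseteq> span (insert e B)"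
      proof
        fix v assume v: "v \<in> S"
        have "v - b e v *\<^sub>R e \<in> S'"
          using v e less.prems by (auto simp: S'_def bl.diff bl.scale subspace_diff subspace_scale)
        then have "v - b e v *\<^sub>R e \<in> span B" using B by simp
        then show "v \<in> span (insert e B)" using span_breakdown_eq by blast
      qed
    qed
    moreover have "e \<notin> B" using BS(1)[of e] e by auto
    ultimately show ?thesis using B(2) BS e unfolding orthonormal_basis_def by (intro exI[of _ "insert e B"]) auto
  qed
qed

lemma orthonormal_basis_frame: "subspace S \<Longrightarrow> orthonormal_basis b S (frame b S)"
  unfolding frame_def using someI_ex[OF orthonormal_basis_exists] .

text \<open>\<open>orthonormal_basis\<close> asks for span and orthonormality alone. Finiteness
  follows from linear independence, and it matters because a sum over an infinite set would be
  0.\<close>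

lemma orthonormal_basis_finite:
  assumes "orthonormal_basis b S B"
  shows "finite B"
proof -
  have "independent B"
  proof
    assume "dependent B"
    then obtain T c v where T: "finite T" "T \<subseteq> B" "(\<Sum>w\<in>T. c w *\<^sub>R w) = 0" "v \<in> T" "c v \<noteq> (0::real)"
      unfolding dependent_explicit by auto
    have "b v (\<Sum>w\<in>T. c w *\<^sub>R w) = (\<Sum>w\<in>T. if w = v then c w else 0)"
      using assms T unfolding bl.sum by (intro sum.cong) (auto simp: bl.scale orthonormal_basis_def subset_iff)
    then show False using T by (simp add: bl.zero)
  qed
  then show ?thesis by (rule independent_imp_finite)
qed

lemma orthonormal_basis_expand:
  assumes B: "orthonormal_basis b S B" and v: "v \<in> S"
  shows "v = (\<Sum>e\<in>B. b e v *\<^sub>R e)"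
proof -
  have fin: "finite B" using orthonormal_basis_finite[OF B] .
  have "v \<in> span B" using B v by (simp add: orthonormal_basis_def)
  then obtain c where c: "v = (\<Sum>w\<in>B. c w *\<^sub>R w)" using span_finite[OF fin] by auto
  have "b e v = c e" if "e \<in> B" for e
  proof -
    have "b e v = (\<Sum>w\<in>B. if w = e then c w else 0)"
      using B that unfolding c bl.sum by (intro sum.cong) (auto simp: bl.scale orthonormal_basis_def)
    then show ?thesis using that fin by simp
  qed
  then show ?thesis using c by simp
qed

text \<open>Expand one argument of Q in the other basis, exchange the sums and fold back. This makes
  the choice hidden in \<open>frame\<close> harmless.\<close>

lemma trace_on_orthonormal_basis:
  fixes Q :: "'e \<Rightarrow> 'e \<Rightarrow> 'v::real_vector"
  assumes Q: "bilinear Q" and B: "orthonormal_basis b S B" and S: "subspace S"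
  shows "trace_on b S Q = (\<Sum>e\<in>B. Q e e)"
proof -
  interpret Q1: linear "Q u" for u using bilinear_linear(1)[OF Q] .
  interpret Q2: linear "\<lambda>u. Q u v" for v using bilinear_linear(2)[OF Q] .
  let ?F = "frame b S"
  have F: "orthonormal_basis b S ?F" using orthonormal_basis_frame[OF S] .
  have inS: "e \<in> S" if "orthonormal_basis b S C" "e \<in> C" for C e
    using that span_superset[of C] by (auto simp: orthonormal_basis_def)
  have "(\<Sum>f\<in>?F. Q f f) = (\<Sum>f\<in>?F. \<Sum>e\<in>B. b e f *\<^sub>R Q e f)"
  proof (rule sum.cong)
    fix f assume "f \<in> ?F"
    then have "Q f f = Q (\<Sum>e\<in>B. b e f *\<^sub>R e) f"
      using orthonormal_basis_expand[OF B inS[OF F]] by metis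
    then show "Q f f = (\<Sum>e\<in>B. b e f *\<^sub>R Q e f)" by (simp add: Q2.sum Q2.scale)
  qed simp
  also have "\<dots> = (\<Sum>e\<in>B. \<Sum>f\<in>?F. b f e *\<^sub>R Q e f)"
    by (subst sum.swap) (simp add: inner_productD(2)[OF b])
  also have "\<dots> = (\<Sum>e\<in>B. Q e e)"
  proof (rule sum.cong)
    fix e assume "e \<in> B"
    then have "Q e e = Q e (\<Sum>f\<in>?F. b f e *\<^sub>R f)"
      using orthonormal_basis_expand[OF F inS[OF B]] by metis
    then show "(\<Sum>f\<in>?F. b f e *\<^sub>R Q e f) = Q e e" by (simp add: Q1.sum Q1.scale)
  qed simp
  finally show ?thesis by (simp add: trace_on_def)
qed

text \<open>The vector representing a functional with respect to \<open>b\<close>, given by a sum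
  over a frame so that it can be calculated with. For a coordinate functional it is a row of the
  inverse metric.\<close>

definition riesz :: "('e \<Rightarrow> real) \<Rightarrow> 'e" where
  "riesz l = (\<Sum>e\<in>frame b UNIV. l e *\<^sub>R e)"

lemma riesz_works:
  assumes "linear l"
  shows "b (riesz l) w = l w"
proof -
  interpret l: linear l by fact
  have "l w = l (\<Sum>e\<in>frame b UNIV. b e w *\<^sub>R e)"
    using orthonormal_basis_expand[OF orthonormal_basis_frame[OF subspace_UNIV]] by simp
  then show ?thesis by (simp add: riesz_def br.sum br.scale l.sum l.scale mult.commute)
qed

lemma riesz_unique:
  assumes "\<And>w. b z w = l w"
  shows "z = riesz l"
proof (rule inner_product_eqI[OF b])
  have "b z = l" using assms by auto
  then have "linear l" using bl.linear_axioms[of z] by simp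
  then show "b z w = b (riesz l) w" for w using riesz_works[of l w] assms by simp
qed

text \<open>Frames are chosen pointwise and need not vary continuously. With the fixed
  \<open>Basis\<close> and the representing vectors of the coordinate functionals, the trace becomes
  the contraction of Q with the inverse metric, in which smooth dependence on parameters is
  visible.\<close>

lemma trace_on_riesz:
  fixes Q :: "'e \<Rightarrow> 'e \<Rightarrow> 'v::real_vector"
  assumes Q: "bilinear Q"
  shows "trace_on b UNIV Q = (\<Sum>i\<in>Basis. Q (riesz (\<lambda>w. w \<bullet> i)) i)"
proof -
  interpret Q1: linear "Q u" for u using bilinear_linear(1)[OF Q] .
  interpret Q2: linear "\<lambda>u. Q u v" for v using bilinear_linear(2)[OF Q] .
  have "trace_on b UNIV Q = (\<Sum>e\<in>frame b UNIV. \<Sum>i\<in>Basis. (e \<bullet> i) *\<^sub>R Q e i)"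
    unfolding trace_on_def by (rule sum.cong[OF refl], rule linear_euclidean_expand) (simp add: Q1.linear_axioms)
  also have "\<dots> = (\<Sum>i\<in>Basis. \<Sum>e\<in>frame b UNIV. (e \<bullet> i) *\<^sub>R Q e i)" by (rule sum.swap)
  also have "\<dots> = (\<Sum>i\<in>Basis. Q (riesz (\<lambda>w. w \<bullet> i)) i)" unfolding riesz_def Q2.sum Q2.scale ..
  finally show ?thesis .
qed

end

lemma inner_product_riesz:
  assumes "inner_product b" "linear l"
  shows "b (riesz b l) w = l w" "b w (riesz b l) = l w"
  using riesz_works[OF assms] inner_productD(2)[OF assms(1)] by metis+

text \<open>The representing vector solves a linear system whose matrix is the Gram matrix of the
  form. Cramer's rule exhibits the solution as a quotient of determinants with nonvanishing
  denominator.\<close>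

lemma smooth_on_riesz:
  fixes b :: "'a::euclidean_space \<Rightarrow> real^'n \<Rightarrow> real^'n \<Rightarrow> real"
  assumes S: "open S" and b: "\<And>x. x \<in> S \<Longrightarrow> inner_product (b x)" "\<And>u v. smooth_on S (\<lambda>x. b x u v)"
    and l: "\<And>x. x \<in> S \<Longrightarrow> linear (l x)" "\<And>w. smooth_on S (\<lambda>x. l x w)"
  shows "smooth_on S (\<lambda>x. riesz (b x) (l x))"
proof -
  define A where "A x = (\<chi> j i. b x (axis i 1) (axis j 1))" for x
  define c where "c x = (\<chi> j. l x (axis j 1))" for x
  have mult: "A x *v z = (\<chi> j. b x z (axis j 1))" if "x \<in> S" for x z
  proof -
    interpret br: linear "\<lambda>u. b x u v" for v using bilinear_linear(2)[OF inner_productD(1)[OF b(1)[OF that]]] .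
    have "z = (\<Sum>i\<in>UNIV. z $ i *\<^sub>R axis i 1)"
      by (simp add: basis_expansion flip: scalar_mult_eq_scaleR)
    then have "b x z v = b x (\<Sum>i\<in>UNIV. z $ i *\<^sub>R axis i 1) v" for v by (rule arg_cong)
    then have "b x z v = (\<Sum>i\<in>UNIV. z $ i * b x (axis i 1) v)" for v by (simp only: br.sum br.scale real_scaleR_def)
    then show ?thesis by (simp add: A_def matrix_vector_mult_def vec_eq_iff mult.commute)
  qed
  have eq: "riesz (b x) (l x) = (\<chi> k. det (\<chi> i j. if j = k then c x $ i else A x $ i $ j) / det (A x))"
    and nz: "det (A x) \<noteq> 0" if x: "x \<in> S" for x
  proof -
    have "z = 0" if "A x *v z = 0" for z
    proof (rule inner_product_eqI[OF b(1)[OF x]])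
      fix w
      have z: "b x z (axis j 1) = 0" for j using that mult[OF x, of z] by (simp add: vec_eq_iff)
      have "b x z w = (\<Sum>i\<in>Basis. (w \<bullet> i) *\<^sub>R b x z i)"
        by (rule linear_euclidean_expand[OF bilinear_linear(1)[OF inner_productD(1)[OF b(1)[OF x]]]])
      also have "\<dots> = 0" using z by (intro sum.neutral) (auto simp: Basis_vec_def)
      finally show "b x z w = b x 0 w" using inner_productD(1)[OF b(1)[OF x]] by (simp add: bilinear_lzero)
    qed
    then have "invertible (A x)"
      by (simp add: invertible_left_inverse matrix_left_invertible_ker)
    then show nz: "det (A x) \<noteq> 0" by (simp add: invertible_det_nz)
    have "A x *v riesz (b x) (l x) = c x"
      using inner_product_riesz(1)[OF b(1)[OF x] l(1)[OF x]] by (simp add: mult[OF x] c_def)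
    then show "riesz (b x) (l x) = (\<chi> k. det (\<chi> i j. if j = k then c x $ i else A x $ i $ j) / det (A x))"
      using cramer[OF nz] by blast
  qed
  have "smooth_on S (\<lambda>x. (\<chi> i j. if j = k then c x $ i else A x $ i $ j) $ i $ j)" for i j k
    by (cases "j = k") (simp_all add: A_def c_def b(2) l(2))
  then have "smooth_on S (\<lambda>x. (\<chi> k. det (\<chi> i j. if j = k then c x $ i else A x $ i $ j) / det (A x)))"
    by (intro smooth_on_vec smooth_on_divide smooth_on_det S nz) (simp_all add: A_def b(2))
  then show ?thesis by (rule smooth_on_cong[OF _ S]) (simp add: eq)
qed

section \<open>Derivative of the determinant\<close>

text \<open>A permutation other than the identity moves at least two indices. After one factor has
  been differentiated, an off-diagonal entry of the identity matrix still remains in its product, so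
  the identity permutation alone contributes.\<close>

lemma has_derivative_det_at_mat1:
  fixes A :: "'a::real_normed_vector \<Rightarrow> real^'n^'n"
  assumes A': "\<And>i j. ((\<lambda>y. A y $ i $ j) has_derivative A' i j) (at x)" and A: "A x = mat 1"
  shows "((\<lambda>y. det (A y)) has_derivative (\<lambda>w. \<Sum>i\<in>UNIV. A' i i w)) (at x)"
proof -
  let ?P = "{p. p permutes (UNIV :: 'n set)}"
  have "((\<lambda>y. det (A y)) has_derivative (\<lambda>w. \<Sum>p\<in>?P. of_int (sign p) *
      (\<Sum>i\<in>UNIV. A' i (p i) w * (\<Prod>j\<in>UNIV - {i}. A x $ j $ p j)))) (at x)"
    unfolding det_def by (intro has_derivative_sum has_derivative_mult_right has_derivative_prod A')
  moreover have "(\<Sum>p\<in>?P. of_int (sign p) * (\<Sum>i\<in>UNIV. A' i (p i) w * (\<Prod>j\<in>UNIV - {i}. A x $ j $ p j)))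
      = (\<Sum>p\<in>?P. if p = id then \<Sum>i\<in>UNIV. A' i i w else 0)" for w
  proof (intro sum.cong refl)
    fix p :: "'n \<Rightarrow> 'n" assume "p \<in> ?P"
    then have p: "p permutes UNIV" by simp
    show "of_int (sign p) * (\<Sum>i\<in>UNIV. A' i (p i) w * (\<Prod>j\<in>UNIV - {i}. A x $ j $ p j))
      = (if p = id then \<Sum>i\<in>UNIV. A' i i w else 0)"
    proof (cases "p = id")
      case False
      have "\<exists>j. j \<noteq> i \<and> p j \<noteq> j" for i
      proof (rule ccontr)
        assume "\<nexists>j. j \<noteq> i \<and> p j \<noteq> j"
        then have fx: "p j = j" if "j \<noteq> i" for j using that by blast
        have "p i = i" using fx permutes_inj[OF p] by (metis injD)
        with fx have "p = id" by (intro ext) (metis id_apply)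
        then show False using False by blast
      qed
      then have z: "(\<Prod>j\<in>UNIV - {i}. A x $ j $ p j) = 0" for i
        by (intro prod_zero) (auto simp: A mat_def eq_commute[of _ "p _"])
      show ?thesis using False by (simp only: z) simp
    qed (simp add: A mat_def)
  qed
  moreover have "finite ?P" by (simp add: finite_permutations)
  ultimately show ?thesis by (simp add: permutes_id)
qed

text \<open>Jacobi's formula. Multiplication by the constant left inverse \<open>R\<close> moves the
  point of differentiation to the identity matrix, and \<open>det (A x) * det R = 1\<close> undoes
  this.\<close>

lemma has_derivative_det:
  fixes A :: "'a::real_normed_vector \<Rightarrow> real^'n^'n"
  assumes A': "\<And>i j. ((\<lambda>y. A y $ i $ j) has_derivative A' i j) (at x)" and R: "R ** A x = mat 1"
  shows "((\<lambda>y. det (A y)) has_derivative (\<lambda>w. det (A x) * (\<Sum>i\<in>UNIV. \<Sum>k\<in>UNIV. R $ i $ k * A' k i w))) (at x)"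
proof -
  have "((\<lambda>y. (R ** A y) $ i $ j) has_derivative (\<lambda>w. \<Sum>k\<in>UNIV. R $ i $ k * A' k j w)) (at x)" for i j
    by (simp add: matrix_matrix_mult_def, intro has_derivative_sum has_derivative_mult_right A')
  from has_derivative_det_at_mat1[of "\<lambda>y. R ** A y", OF this R]
  have "((\<lambda>y. det (A x) * det (R ** A y)) has_derivative (\<lambda>w. det (A x) * (\<Sum>i\<in>UNIV. \<Sum>k\<in>UNIV. R $ i $ k * A' k i w))) (at x)"
    by (rule has_derivative_mult_right)
  moreover have "det (A x) * det R = 1"
    using arg_cong[OF R, of det] by (simp add: det_mul mult.commute)
  then have "det (A x) * det (R ** A y) = det (A y)" for y
    by (simp add: det_mul flip: mult.assoc)
  ultimately show ?thesis by simp
qed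

section \<open>Christoffel symbols in a coordinate domain\<close>

definition metric_on :: "'e::euclidean_space set \<Rightarrow> ('e \<Rightarrow> 'e \<Rightarrow> 'e \<Rightarrow> real) \<Rightarrow> bool" where
  "metric_on U G \<longleftrightarrow> open U \<and> (\<forall>y\<in>U. inner_product (G y)) \<and> (\<forall>u v. smooth_on U (\<lambda>y. G y u v))"

lemma metric_onD:
  assumes "metric_on U G"
  shows "open U" "y \<in> U \<Longrightarrow> inner_product (G y)" "y \<in> U \<Longrightarrow> bilinear (G y)" "smooth_on U (\<lambda>y. G y u v)"
    "y \<in> U \<Longrightarrow> G y u v = G y v u"
  using assms inner_productD(1,2) unfolding metric_on_def by blast+

lemma fderiv_bilinear_family:
  assumes "open S" "x \<in> S" "\<And>y. y \<in> S \<Longrightarrow> bilinear (b y)" "\<And>u v. (\<lambda>y. b y u v) differentiable (at x)"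
  shows "bilinear (\<lambda>u v. fderiv (\<lambda>y. b y u v) x w)"
proof -
  note hd = has_derivative_fderiv[OF assms(4)]
  have "fderiv (\<lambda>y. b y (u + u') v) x = (\<lambda>w. fderiv (\<lambda>y. b y u v) x w + fderiv (\<lambda>y. b y u' v) x w)" for u u' v
    using fderiv_cong_open[OF assms(1,2), of "\<lambda>y. b y (u + u') v" "\<lambda>y. b y u v + b y u' v"]
      fderiv_eqI[OF has_derivative_add[OF hd hd]] by (simp add: bilinear_ladd assms(3))
  moreover have "fderiv (\<lambda>y. b y u (v + v')) x = (\<lambda>w. fderiv (\<lambda>y. b y u v) x w + fderiv (\<lambda>y. b y u v') x w)" for u v v'
    using fderiv_cong_open[OF assms(1,2), of "\<lambda>y. b y u (v + v')" "\<lambda>y. b y u v + b y u v'"]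
      fderiv_eqI[OF has_derivative_add[OF hd hd]] by (simp add: bilinear_radd assms(3))
  moreover have "fderiv (\<lambda>y. b y (r *\<^sub>R u) v) x = (\<lambda>w. r *\<^sub>R fderiv (\<lambda>y. b y u v) x w)" for r u v
    using fderiv_cong_open[OF assms(1,2), of "\<lambda>y. b y (r *\<^sub>R u) v" "\<lambda>y. r *\<^sub>R b y u v"]
      fderiv_eqI[OF has_derivative_scaleR_right[OF hd]] by (simp add: bilinear_lmul assms(3))
  moreover have "fderiv (\<lambda>y. b y u (r *\<^sub>R v)) x = (\<lambda>w. r *\<^sub>R fderiv (\<lambda>y. b y u v) x w)" for r u v
    using fderiv_cong_open[OF assms(1,2), of "\<lambda>y. b y u (r *\<^sub>R v)" "\<lambda>y. r *\<^sub>R b y u v"]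
      fderiv_eqI[OF has_derivative_scaleR_right[OF hd]] by (simp add: bilinear_rmul assms(3))
  ultimately show ?thesis by (simp add: bilinear_def linear_iff)
qed

lemma metric_on_fderiv:
  assumes "metric_on U G" "y \<in> U"
  shows "bilinear (\<lambda>u v. fderiv (\<lambda>y. G y u v) y w)" "linear (fderiv (\<lambda>y. G y u v) y)"
    "fderiv (\<lambda>y. G y u v) y w = fderiv (\<lambda>y. G y v u) y w"
    "((\<lambda>y. G y u v) has_derivative fderiv (\<lambda>y. G y u v) y) (at y)"
proof -
  note m = metric_onD[OF assms(1)]
  show "bilinear (\<lambda>u v. fderiv (\<lambda>y. G y u v) y w)"
    by (rule fderiv_bilinear_family[OF m(1) assms(2)]) (auto intro: m smooth_on_differentiable[OF m(4) assms(2)])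
  show "linear (fderiv (\<lambda>y. G y u v) y)" by (rule smooth_on_linear_fderiv[OF m(4) assms(2)])
  show "fderiv (\<lambda>y. G y u v) y w = fderiv (\<lambda>y. G y v u) y w"
    using fderiv_cong_open[OF m(1) assms(2), of "\<lambda>y. G y u v" "\<lambda>y. G y v u"] m(5) by simp
  show "((\<lambda>y. G y u v) has_derivative fderiv (\<lambda>y. G y u v) y) (at y)"
    by (rule smooth_on_has_derivative[OF m(4) assms(2)])
qed

definition koszul :: "('e::euclidean_space \<Rightarrow> 'e \<Rightarrow> 'e \<Rightarrow> real) \<Rightarrow> 'e \<Rightarrow> 'e \<Rightarrow> 'e \<Rightarrow> 'e \<Rightarrow> real" where
  "koszul G y u v w = fderiv (\<lambda>y. G y v w) y u + fderiv (\<lambda>y. G y u w) y v - fderiv (\<lambda>y. G y u v) y w"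

text \<open>The Christoffel term of a metric on a coordinate domain: the vector that
  \<open>christoffel\<close> selects by a definite description, here solved for through
  \<open>riesz\<close>. \<open>chr_eq_THE\<close> identifies the two.\<close>

definition chr :: "('e::euclidean_space \<Rightarrow> 'e \<Rightarrow> 'e \<Rightarrow> real) \<Rightarrow> 'e \<Rightarrow> 'e \<Rightarrow> 'e \<Rightarrow> 'e" where
  "chr G y u v = riesz (G y) (\<lambda>w. koszul G y u v w / 2)"

context
  fixes U :: "'e::euclidean_space set" and G y
  assumes G: "metric_on U G" and y: "y \<in> U"
begin

private lemmas fl = bilinear_linear(1)[OF metric_on_fderiv(1)[OF G y]] bilinear_linear(2)[OF metric_on_fderiv(1)[OF G y]]
  metric_on_fderiv(2)[OF G y]

lemma koszul_linear: "linear (koszul G y u v)" "linear (\<lambda>v. koszul G y u v w)" "linear (\<lambda>u. koszul G y u v w)"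
  using fl by (auto simp: koszul_def linear_iff algebra_simps)

lemma chr_koszul: "2 * G y (chr G y u v) w = koszul G y u v w"
proof -
  have "linear (\<lambda>w. koszul G y u v w / 2)"
    using koszul_linear(1)[of u v] by (auto simp: linear_iff add_divide_distrib)
  from inner_product_riesz(1)[OF metric_onD(2)[OF G y] this, of w] show ?thesis
    unfolding chr_def by linarith
qed

lemma chr_eqI:
  assumes "\<And>w. 2 * G y z w = koszul G y u v w"
  shows "chr G y u v = z"
  by (rule inner_product_eqI[OF metric_onD(2)[OF G y]]) (use assms chr_koszul[of u v] in \<open>metis mult_cancel_left zero_neq_numeral\<close>)

lemma chr_commute: "chr G y u v = chr G y v u"
  by (rule chr_eqI) (simp add: chr_koszul koszul_def metric_on_fderiv(3)[OF G y, of u v])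

lemma bilinear_chr: "bilinear (chr G y)"
proof -
  have b: "bilinear (G y)" by (rule metric_onD(3)[OF G y])
  have "linear (chr G y u)" for u
    using koszul_linear(2)[of u]
    by (intro linearI; intro chr_eqI) (simp_all add: linear_iff bilinear_ladd[OF b] bilinear_lmul[OF b] distrib_left chr_koszul)
  moreover have "(\<lambda>u. chr G y u v) = chr G y v" for v by (intro ext chr_commute)
  ultimately show ?thesis by (simp add: bilinear_def)
qed

text \<open>In the sum of the Koszul expressions for (u, v, w) and (u, w, v), the derivatives in the
  directions v and w cancel.\<close>

lemma metric_compatible: "fderiv (\<lambda>y. G y v w) y u = G y (chr G y u v) w + G y v (chr G y u w)"
proof -
  have "2 * G y (chr G y u v) w + 2 * G y (chr G y u w) v = 2 * fderiv (\<lambda>y. G y v w) y u"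
    unfolding chr_koszul koszul_def
    using metric_on_fderiv(3)[OF G y, of v w] metric_on_fderiv(3)[OF G y, of u w] metric_on_fderiv(3)[OF G y, of u v] by simp
  then show ?thesis using metric_onD(5)[OF G y, of "chr G y u w" v] by simp
qed

lemma chr_eq_THE: "(THE z. \<forall>w. 2 * G y z w = koszul G y u v w) = chr G y u v"
  using chr_koszul chr_eqI by (intro the_equality) (auto simp: chr_koszul)

end

text \<open>Covariant derivative of a field \<open>a\<close> along \<open>f\<close>. One definition
  serves three purposes: \<open>f\<close> the identity gives the Levi-Civita connection,
  \<open>f\<close> a coordinate expression of \<phi> gives the pullback connection, and
  \<open>f\<close> a curve gives the covariant derivative in time.\<close>

definition covd :: "('f::euclidean_space \<Rightarrow> 'f \<Rightarrow> 'f \<Rightarrow> real) \<Rightarrow> ('e::real_normed_vector \<Rightarrow> 'f) \<Rightarrow> ('e \<Rightarrow> 'f) \<Rightarrow> 'e \<Rightarrow> 'e \<Rightarrow> 'f" where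
  "covd H f a y u = fderiv a y u + chr H (f y) (fderiv f y u) (a y)"

lemma covd_metric:
  fixes H :: "'f::euclidean_space \<Rightarrow> 'f \<Rightarrow> 'f \<Rightarrow> real" and f :: "'e::euclidean_space \<Rightarrow> 'f"
  assumes H: "metric_on W H" and U: "open U" "y \<in> U" "f ` U \<subseteq> W"
    and d: "f differentiable (at y)" "a differentiable (at y)" "c differentiable (at y)"
  shows "((\<lambda>y. H (f y) (a y) (c y)) has_derivative
      (\<lambda>u. H (f y) (covd H f a y u) (c y) + H (f y) (a y) (covd H f c y u))) (at y)"
proof -
  have fy: "f y \<in> W" using U by auto
  have b: "bilinear (H (f y))" by (rule metric_onD(3)[OF H fy])
  have 1: "((\<lambda>y. H (f y) u v) has_derivative (\<lambda>w. fderiv (\<lambda>z. H z u v) (f y) (fderiv f y w))) (at y)" for u v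
    by (rule has_derivative_compose[OF has_derivative_fderiv[OF d(1)] metric_on_fderiv(4)[OF H fy]])
  have 2: "bilinear (H (f z))" if "z \<in> U" for z using metric_onD(3)[OF H, of "f z"] U(3) that by auto
  show ?thesis
    by (rule has_derivative_eq_rhs[OF has_derivative_bilinear_family[OF U(1,2) 2 1 has_derivative_fderiv[OF d(2)] has_derivative_fderiv[OF d(3)]]])
      (auto simp: covd_def metric_compatible[OF H fy] bilinear_ladd[OF b] bilinear_radd[OF b])
qed

lemmas fderiv_covd_metric = fderiv_eqI[OF covd_metric, THEN fun_cong]

text \<open>Uniqueness of the symmetric metric connection in disguise. The bilinear map S, the
  covariant derivative of \<open>fderiv T\<close> along T, is symmetric and compatible with G', so
  it satisfies the Koszul formula of the pulled-back metric G; surjectivity of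
  \<open>fderiv T y\<close> then identifies S with the image of the Christoffel term of G.\<close>

lemma chr_transform:
  assumes G: "metric_on U G" and G': "metric_on U' G'" and y: "y \<in> U"
    and T: "smooth_on U T" "T ` U \<subseteq> U'" "surj (fderiv T y)"
    and eq: "\<And>y u v. y \<in> U \<Longrightarrow> G y u v = G' (T y) (fderiv T y u) (fderiv T y v)"
  shows "fderiv T y (chr G y u v) = fderiv2 T y u v + chr G' (T y) (fderiv T y u) (fderiv T y v)"
proof -
  define S where "S u v = covd G' T (\<lambda>y. fderiv T y v) y u" for u v
  have U: "open U" by (rule metric_onD(1)[OF G])
  have Ty: "T y \<in> U'" using T(2) y by auto
  note b = metric_onD(3)[OF G' Ty] and sy = metric_onD(5)[OF G' Ty]
  note d = smooth_on_differentiable[OF T(1) y] smooth_on_differentiable[OF smooth_on_fderiv[OF T(1)] y]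
  have S_eq: "S u v = fderiv2 T y u v + chr G' (T y) (fderiv T y u) (fderiv T y v)" for u v
    by (simp add: S_def covd_def)
  have S_sym: "S u v = S v u" for u v
    using fderiv2_commute[OF T(1) U y, of u v] chr_commute[OF G' Ty] by (simp add: S_eq)
  have "fderiv (\<lambda>y. G y v w) y u = fderiv (\<lambda>y. G' (T y) (fderiv T y v) (fderiv T y w)) y u" for u v w
    by (rule fun_cong[OF fderiv_cong_open[OF U y]]) (rule eq)
  then have der: "fderiv (\<lambda>y. G y v w) y u = G' (T y) (S u v) (fderiv T y w) + G' (T y) (fderiv T y v) (S u w)" for u v w
    using fderiv_covd_metric[OF G' U y T(2) d(1) d(2) d(2)] by (simp add: S_def)
  have "2 * G y (chr G y u v) w = 2 * G' (T y) (S u v) (fderiv T y w)" for w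
    unfolding chr_koszul[OF G y] koszul_def der
    using S_sym[of u v] S_sym[of w u] S_sym[of w v] sy[of "fderiv T y v" "S u w"] sy[of "fderiv T y u" "S v w"] by simp
  then have "G' (T y) (fderiv T y (chr G y u v)) (fderiv T y w) = G' (T y) (S u v) (fderiv T y w)" for w
    using eq[OF y] by simp
  then have "fderiv T y (chr G y u v) = S u v"
    using T(3) by (intro inner_product_eqI[OF metric_onD(2)[OF G' Ty]]) (metis surjD)
  then show ?thesis by (simp add: S_eq)
qed

section \<open>Divergence\<close>

definition metric_det :: "(real^'n \<Rightarrow> real^'n \<Rightarrow> real) \<Rightarrow> real" where
  "metric_det b = det (\<chi> i j. b (axis i 1) (axis j 1))"

lemma trace_on_matrix:
  fixes b :: "real^'n \<Rightarrow> real^'n \<Rightarrow> real"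
  assumes "inner_product b" "bilinear Q"
  shows "trace_on b UNIV Q = (\<Sum>i\<in>UNIV. Q (riesz b (\<lambda>w. w $ i)) (axis i 1))"
proof -
  have "(\<Sum>u\<in>Basis. Q (riesz b (\<lambda>w. w \<bullet> u)) u) = (\<Sum>i\<in>UNIV. Q (riesz b (\<lambda>w. w \<bullet> axis i 1)) (axis i (1::real)))"
    by (intro sum.reindex_bij_betw[symmetric]) (auto simp: bij_betw_def inj_on_def axis_eq_axis Basis_vec_def)
  then show ?thesis using trace_on_riesz[OF assms] by (simp add: inner_axis)
qed

lemma linear_vec_nth: "linear (\<lambda>w. (w :: real^'n) $ i)"
  by (simp add: linear_iff)

text \<open>The representing vectors of the coordinate functionals are the rows of the inverse Gram
  matrix. This supplies the left inverse in Jacobi's formula.\<close>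

lemma matrix_inverse_riesz:
  fixes b :: "real^'n \<Rightarrow> real^'n \<Rightarrow> real"
  assumes "inner_product b"
  shows "(\<chi> i j. riesz b (\<lambda>w. w $ i) $ j) ** (\<chi> i j. b (axis i 1) (axis j 1)) = mat 1"
proof -
  have "(\<Sum>k\<in>UNIV. riesz b (\<lambda>w. w $ i) $ k * b (axis k 1) (axis j 1)) = (if i = j then 1 else 0)" for i j
  proof -
    interpret br: linear "\<lambda>u. b u v" for v using bilinear_linear(2)[OF inner_productD(1)[OF assms]] .
    let ?z = "riesz b (\<lambda>w. w $ i)"
    have "?z = (\<Sum>k\<in>UNIV. ?z $ k *\<^sub>R axis k 1)" by (simp add: basis_expansion flip: scalar_mult_eq_scaleR)
    then have "b ?z (axis j 1) = b (\<Sum>k\<in>UNIV. ?z $ k *\<^sub>R axis k 1) (axis j 1)" by (rule arg_cong)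
    then have "b ?z (axis j 1) = (\<Sum>k\<in>UNIV. ?z $ k * b (axis k 1) (axis j 1))"
      by (simp only: br.sum br.scale real_scaleR_def)
    then show ?thesis
      using inner_product_riesz(1)[OF assms linear_vec_nth, of i "axis j 1"] by (simp add: axis_def)
  qed
  then show ?thesis by (simp add: matrix_matrix_mult_def mat_def vec_eq_iff)
qed

lemma metric_det_nz: "inner_product b \<Longrightarrow> metric_det b \<noteq> 0"
  using matrix_inverse_riesz[of b] invertible_det_nz invertible_left_inverse unfolding metric_det_def by metis

lemma has_derivative_metric_det:
  fixes G :: "real^'n \<Rightarrow> real^'n \<Rightarrow> real^'n \<Rightarrow> real"
  assumes G: "metric_on U G" and y: "y \<in> U"
  shows "((\<lambda>y. metric_det (G y)) has_derivative
     (\<lambda>w. metric_det (G y) * trace_on (G y) UNIV (\<lambda>u v. fderiv (\<lambda>y. G y u v) y w))) (at y)"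
proof -
  let ?r = "\<lambda>i. riesz (G y) (\<lambda>w. w $ i)"
  note ip = metric_onD(2)[OF G y]
  have "trace_on (G y) UNIV (\<lambda>u v. fderiv (\<lambda>y. G y u v) y w)
      = (\<Sum>i\<in>UNIV. \<Sum>k\<in>UNIV. ?r i $ k * fderiv (\<lambda>y. G y (axis k 1) (axis i 1)) y w)" for w
  proof -
    interpret br: linear "\<lambda>u. fderiv (\<lambda>y. G y u v) y w" for v
      using bilinear_linear(2)[OF metric_on_fderiv(1)[OF G y]] .
    have e: "?r i = (\<Sum>k\<in>UNIV. ?r i $ k *\<^sub>R axis k 1)" for i by (simp add: basis_expansion flip: scalar_mult_eq_scaleR)
    have "fderiv (\<lambda>y'. G y' (?r i) v) y w = fderiv (\<lambda>y'. G y' (\<Sum>k\<in>UNIV. ?r i $ k *\<^sub>R axis k 1) v) y w" for i v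
      by (rule arg_cong[where f="\<lambda>z. fderiv (\<lambda>y. G y z v) y w", OF e])
    then have "fderiv (\<lambda>y'. G y' (?r i) v) y w = (\<Sum>k\<in>UNIV. ?r i $ k * fderiv (\<lambda>y. G y (axis k 1) v) y w)" for i v
      by (simp only: br.sum br.scale real_scaleR_def)
    then show ?thesis using trace_on_matrix[OF ip metric_on_fderiv(1)[OF G y]] by simp
  qed
  then show ?thesis
    using has_derivative_det[of "\<lambda>y. \<chi> i j. G y (axis i 1) (axis j 1)" "\<lambda>i j. fderiv (\<lambda>y. G y (axis i 1) (axis j 1)) y" y,
        OF _ matrix_inverse_riesz[OF ip]] metric_on_fderiv(4)[OF G y]
    by (simp add: metric_det_def)
qed

text \<open>The segment from \<open>b\<close> to the Euclidean inner product consists of inner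
  products, on which the Gram determinant never vanishes. Its value at the Euclidean end is 1, so it
  cannot have changed sign.\<close>

lemma metric_det_pos:
  assumes "inner_product b"
  shows "0 < metric_det (b :: real^'n \<Rightarrow> real^'n \<Rightarrow> real)"
proof (rule ccontr)
  assume neg: "\<not> 0 < metric_det b"
  define f where "f t u v = (1 - t) * b u v + t * (u \<bullet> v)" for t :: real and u v :: "real^'n"
  have b: "bilinear b" by (rule inner_productD(1)[OF assms])
  have ip: "inner_product (f t)" if t: "0 \<le> t" "t \<le> 1" for t
    unfolding inner_product_def
  proof (intro conjI allI impI)
    show "bilinear (f t)"
      by (auto simp: bilinear_def linear_iff f_def bilinear_ladd[OF b] bilinear_radd[OF b] bilinear_lmul[OF b] bilinear_rmul[OF b]
          inner_add_left inner_add_right algebra_simps)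
    show "f t u v = f t v u" for u v using inner_productD(2)[OF assms, of u v] by (simp add: f_def inner_commute)
    fix u :: "real^'n" assume "u \<noteq> 0"
    then have "0 < b u u" "0 < u \<bullet> u" using inner_productD(3)[OF assms] by auto
    then show "0 < f t u u" using t by (cases "t = 0") (auto simp: f_def intro!: add_nonneg_pos mult_nonneg_nonneg)
  qed
  have "metric_det (f 1) = 1"
    using det_I[where 'n='n and 'a=real] by (simp add: metric_det_def f_def inner_axis_axis mat_def inner_real_def cong: if_cong)
  moreover have "metric_det (f 0) \<le> 0" using neg by (simp add: f_def[abs_def])
  moreover have "continuous_on {0..1} (\<lambda>t. metric_det (f t))"
    unfolding metric_det_def f_def det_def by (auto intro!: continuous_intros)
  ultimately obtain t where "0 \<le> t" "t \<le> 1" "metric_det (f t) = 0"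
    using IVT'[of "\<lambda>t. metric_det (f t)" 0 0 1] by auto
  then show False using metric_det_nz[OF ip] by auto
qed

lemma smooth_on_sqrt_metric_det:
  assumes "metric_on U G"
  shows "smooth_on U (\<lambda>y. sqrt (metric_det (G y)))"
  using metric_onD(1,4)[OF assms] metric_det_pos[OF metric_onD(2)[OF assms]] unfolding metric_det_def
  by (intro smooth_on_sqrt smooth_on_det) auto

text \<open>Differentiating the density contributes half the metric trace of the derivative of G in
  direction Z. The same quantity is the trace of the Christoffel term w \<mapsto>
  \<open>chr G y w (Z y)\<close>, by metric compatibility.\<close>

lemma divergence_formula:
  fixes G :: "real^'n \<Rightarrow> real^'n \<Rightarrow> real^'n \<Rightarrow> real"
  assumes G: "metric_on U G" and y: "y \<in> U" and Z: "Z differentiable (at y)"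
  shows "(\<Sum>i\<in>UNIV. fderiv (\<lambda>y. sqrt (metric_det (G y)) * Z y $ i) y (axis i 1))
     = sqrt (metric_det (G y)) * (\<Sum>i\<in>UNIV. covd G (\<lambda>y. y) Z y (axis i 1) $ i)"
proof -
  note ip = metric_onD(2)[OF G y] and sy = metric_onD(5)[OF G y]
  let ?s = "sqrt (metric_det (G y))" and ?z = "Z y"
  let ?dG = "\<lambda>w u v. fderiv (\<lambda>y. G y u v) y w"
  have pos: "0 < metric_det (G y)" by (rule metric_det_pos[OF ip])
  have hd: "((\<lambda>y. sqrt (metric_det (G y)) * Z y $ i) has_derivative
      (\<lambda>w. ?s * fderiv Z y w $ i + ?s * (trace_on (G y) UNIV (?dG w) / 2) * ?z $ i)) (at y)" for i
  proof -
    have 1: "((\<lambda>y. sqrt (metric_det (G y))) has_derivative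
       (\<lambda>w. (metric_det (G y) * trace_on (G y) UNIV (?dG w)) * (inverse ?s / 2))) (at y)"
      by (rule has_derivative_eq_rhs[OF has_derivative_compose[OF has_derivative_metric_det[OF G y]
              DERIV_real_sqrt[OF pos, unfolded has_field_derivative_def]]]) (simp add: mult.commute)
    have "s * s * t * (inverse s / 2) = s * (t / 2)" if "0 < s" for s t :: real
      using that by simp
    from this[of ?s] have 2: "metric_det (G y) * t * (inverse ?s / 2) = ?s * (t / 2)" for t
      using pos by simp
    have 3: "((\<lambda>y. Z y $ i) has_derivative (\<lambda>w. fderiv Z y w $ i)) (at y)"
      using bounded_linear.has_derivative[OF bounded_linear_vec_nth has_derivative_fderiv[OF Z]] .
    show ?thesis using has_derivative_mult[OF 1 3] unfolding 2 by simp
  qed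
  have "fderiv (\<lambda>y. sqrt (metric_det (G y)) * Z y $ i) y w
     = ?s * fderiv Z y w $ i + ?s * (trace_on (G y) UNIV (?dG w) / 2) * ?z $ i" for i w
    by (simp only: fderiv_eqI[OF hd])
  then have 1: "(\<Sum>i\<in>UNIV. fderiv (\<lambda>y. sqrt (metric_det (G y)) * Z y $ i) y (axis i 1))
     = ?s * (\<Sum>i\<in>UNIV. fderiv Z y (axis i 1) $ i) + ?s * (\<Sum>i\<in>UNIV. ?z $ i * (trace_on (G y) UNIV (?dG (axis i 1)) / 2))"
    by (simp add: sum.distrib sum_distrib_left mult_ac)
  have "linear (\<lambda>w. trace_on (G y) UNIV (?dG w))"
    using linear_compose_sum[of "frame (G y) UNIV" "\<lambda>e w. ?dG w e e"] metric_on_fderiv(2)[OF G y]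
    by (auto simp: trace_on_def)
  then interpret t: linear "\<lambda>w. trace_on (G y) UNIV (?dG w)" .
  have "?z = (\<Sum>i\<in>UNIV. ?z $ i *\<^sub>R axis i 1)" by (simp add: basis_expansion flip: scalar_mult_eq_scaleR)
  then have "trace_on (G y) UNIV (?dG ?z) = trace_on (G y) UNIV (?dG (\<Sum>i\<in>UNIV. ?z $ i *\<^sub>R axis i 1))" by (rule arg_cong)
  then have 2: "trace_on (G y) UNIV (?dG ?z) = (\<Sum>i\<in>UNIV. ?z $ i * trace_on (G y) UNIV (?dG (axis i 1)))"
    by (simp only: t.sum t.scale real_scaleR_def)
  let ?Q = "\<lambda>u v. G y u (chr G y v ?z)"
  have Q: "bilinear ?Q"
    using bilinear_linear[OF metric_onD(3)[OF G y]] linear_compose[OF bilinear_linear(2)[OF bilinear_chr[OF G y]] bilinear_linear(1)[OF metric_onD(3)[OF G y]]]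
    by (auto simp: bilinear_def comp_def)
  have "trace_on (G y) UNIV ?Q = (\<Sum>i\<in>UNIV. chr G y (axis i 1) ?z $ i)"
    using inner_product_riesz(1)[OF ip linear_vec_nth] by (simp add: trace_on_matrix[OF ip Q])
  \<comment> \<open>On the diagonal, compatibility in direction Z gives twice the term in question,
    once the symmetry of the Christoffel term has exchanged e and Z.\<close>
  moreover have "?Q e e = ?dG ?z e e / 2" for e
    using metric_compatible[OF G y, of e e ?z] chr_commute[OF G y, of e ?z] sy[of e] by simp
  ultimately have "(\<Sum>i\<in>UNIV. chr G y (axis i 1) ?z $ i) = trace_on (G y) UNIV (?dG ?z) / 2"
    by (simp add: trace_on_def sum_divide_distrib)
  then show ?thesis
    unfolding 1 by (simp add: covd_def sum.distrib 2 sum_divide_distrib distrib_left)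
qed

section \<open>The second fundamental form of a map in coordinates\<close>

text \<open>The coordinate expression of \<nabla>d\<phi> for a map between two coordinate domains;
  \<open>nabla_d_eq_sff\<close> provides the link.\<close>

definition sff :: "('e::euclidean_space \<Rightarrow> 'e \<Rightarrow> 'e \<Rightarrow> real) \<Rightarrow> ('f::euclidean_space \<Rightarrow> 'f \<Rightarrow> 'f \<Rightarrow> real) \<Rightarrow>
    ('e \<Rightarrow> 'f) \<Rightarrow> 'e \<Rightarrow> 'e \<Rightarrow> 'e \<Rightarrow> 'f" where
  "sff G H \<phi> y u v = fderiv2 \<phi> y u v + chr H (\<phi> y) (fderiv \<phi> y u) (fderiv \<phi> y v) - fderiv \<phi> y (chr G y u v)"

lemma has_derivative_fderiv_apply:
  assumes f: "smooth_on S f" and S: "open S" "x \<in> S" and z: "z differentiable (at x)"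
  shows "((\<lambda>y. fderiv f y (z y)) has_derivative (\<lambda>u. fderiv2 f x u (z x) + fderiv f x (fderiv z x u))) (at x)"
proof -
  have "bilinear (\<lambda>(r::real) v. r *\<^sub>R fderiv f y v)" if "y \<in> S" for y
    using smooth_on_linear_fderiv[OF f that] by (auto simp: bilinear_def linear_iff algebra_simps)
  moreover have "((\<lambda>y. r *\<^sub>R fderiv f y v) has_derivative (\<lambda>u. r *\<^sub>R fderiv2 f x u v)) (at x)" for r :: real and v
    by (intro has_derivative_scaleR_right smooth_on_has_derivative[OF smooth_on_fderiv[OF f] S(2)])
  ultimately have "((\<lambda>y. 1 *\<^sub>R fderiv f y (z y)) has_derivative (\<lambda>u. 1 *\<^sub>R fderiv2 f x u (z x) + 0 *\<^sub>R fderiv f x (z x) + 1 *\<^sub>R fderiv f x (fderiv z x u))) (at x)"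
    by (rule has_derivative_bilinear_family[OF S, where f="\<lambda>_. 1" and f'="\<lambda>_. 0", OF _ _ has_derivative_const has_derivative_fderiv[OF z]])
  then show ?thesis by simp
qed

lemma bilinear_fderiv2:
  assumes "smooth_on S f" "open S" "x \<in> S"
  shows "bilinear (fderiv2 f x)"
proof -
  have 1: "linear (\<lambda>u. fderiv2 f x u v)" for v by (rule smooth_on_linear_fderiv[OF smooth_on_fderiv[OF assms(1)] assms(3)])
  have "fderiv2 f x u = (\<lambda>v. fderiv2 f x v u)" for u by (intro ext fderiv2_commute[OF assms])
  then have "linear (fderiv2 f x u)" for u using 1[of u] by simp
  with 1 show ?thesis by (simp add: bilinear_def)
qed

context
  fixes U :: "'e::euclidean_space set" and G and W :: "'f::euclidean_space set" and H and \<phi> and y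
  assumes G: "metric_on U G" and H: "metric_on W H" and \<phi>: "smooth_on U \<phi>" "\<phi> ` U \<subseteq> W" and y: "y \<in> U"
begin

private lemma U: "open U" by (rule metric_onD(1)[OF G])
private lemma \<phi>y: "\<phi> y \<in> W" using \<phi> y by auto
private lemmas bH = metric_onD(3)[OF H \<phi>y] and sH = metric_onD(5)[OF H \<phi>y]
private lemmas lin = smooth_on_linear_fderiv[OF \<phi>(1) y]
private lemmas dif = smooth_on_differentiable[OF \<phi>(1) y]

lemma sff_commute: "sff G H \<phi> y u v = sff G H \<phi> y v u"
  by (simp add: sff_def fderiv2_commute[OF \<phi>(1) U y, of u] chr_commute[OF H \<phi>y, of "fderiv \<phi> y u"] chr_commute[OF G y, of u])

lemma bilinear_sff: "bilinear (sff G H \<phi> y)"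
proof -
  have "linear (sff G H \<phi> y u)" for u
    unfolding sff_def[abs_def]
    using bilinear_linear(1)[OF bilinear_fderiv2[OF \<phi>(1) U y]]
      linear_compose[OF lin bilinear_linear(1)[OF bilinear_chr[OF H \<phi>y]]]
      linear_compose[OF bilinear_linear(1)[OF bilinear_chr[OF G y]] lin]
    by (intro linear_compose_sub linear_compose_add) (auto simp: comp_def)
  moreover have "(\<lambda>u. sff G H \<phi> y u v) = sff G H \<phi> y v" for v by (intro ext sff_commute)
  ultimately show ?thesis by (simp add: bilinear_def)
qed

text \<open>Differentiate the adjointness relation with u held constant in coordinates. Both sides
  produce a term with \<open>chr G y w u\<close>, and these two agree by the relation itself,
  leaving the second fundamental form.\<close>

lemma covd_adjoint:
  assumes Z: "Z differentiable (at y)" and V: "V differentiable (at y)"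
    and eq: "\<And>y u. y \<in> U \<Longrightarrow> G y (Z y) u = H (\<phi> y) (V y) (fderiv \<phi> y u)"
  shows "G y (covd G (\<lambda>y. y) Z y w) u = H (\<phi> y) (covd H \<phi> V y w) (fderiv \<phi> y u) + H (\<phi> y) (V y) (sff G H \<phi> y w u)"
proof -
  have "fderiv (\<lambda>y. G y (Z y) u) y w = fderiv (\<lambda>y. H (\<phi> y) (V y) (fderiv \<phi> y u)) y w"
    by (rule fun_cong[OF fderiv_cong_open[OF U y]]) (rule eq)
  moreover have "fderiv (\<lambda>y. G y (Z y) u) y w = G y (covd G (\<lambda>y. y) Z y w) u + G y (Z y) (covd G (\<lambda>y. y) (\<lambda>_. u) y w)"
    by (rule fderiv_covd_metric[OF G U y, of "\<lambda>y. y"]) (auto simp: Z)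
  moreover have "fderiv (\<lambda>y. H (\<phi> y) (V y) (fderiv \<phi> y u)) y w
      = H (\<phi> y) (covd H \<phi> V y w) (fderiv \<phi> y u) + H (\<phi> y) (V y) (covd H \<phi> (\<lambda>y. fderiv \<phi> y u) y w)"
    by (rule fderiv_covd_metric[OF H U y \<phi>(2) dif V smooth_on_differentiable[OF smooth_on_fderiv[OF \<phi>(1)] y]])
  moreover have "covd G (\<lambda>y. y) (\<lambda>_. u) y w = chr G y w u" by (simp add: covd_def)
  moreover have "covd H \<phi> (\<lambda>y. fderiv \<phi> y u) y w = sff G H \<phi> y w u + fderiv \<phi> y (chr G y w u)"
    by (simp add: covd_def sff_def)
  ultimately show ?thesis using eq[OF y] by (simp add: bilinear_radd[OF bH])
qed

end

lemma trace_of_linear: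
  fixes b :: "real^'n \<Rightarrow> real^'n \<Rightarrow> real"
  assumes b: "inner_product b" and L: "linear L"
  shows "(\<Sum>i\<in>UNIV. L (axis i 1) $ i) = trace_on b UNIV (\<lambda>u v. b (L u) v)"
proof -
  note bl = inner_productD(1)[OF b]
  have "bilinear (\<lambda>u v. b u (L v))"
    using bilinear_linear[OF bl] linear_compose[OF L bilinear_linear(1)[OF bl]] by (auto simp: bilinear_def comp_def)
  from trace_on_matrix[OF b this] show ?thesis
    using inner_product_riesz(1)[OF b linear_vec_nth] by (simp add: trace_on_def inner_productD(2)[OF b, of "L _"])
qed

lemma linear_covd:
  assumes "metric_on W H" "f y \<in> W" "a differentiable (at y)" "f differentiable (at y)"
  shows "linear (covd H f a y)"
  using linear_fderiv[OF assms(3)] linear_compose[OF linear_fderiv[OF assms(4)] bilinear_linear(2)[OF bilinear_chr[OF assms(1,2)]]]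
  unfolding covd_def[abs_def] by (intro linear_compose_add) (auto simp: comp_def)

text \<open>The traced form of \<open>covd_adjoint\<close>. It is the point at which the tension
  field enters the first variation: the trace of h(\<nabla>V, d\<phi>) is a divergence up to h(V,
  \<tau>).\<close>

lemma divergence_adjoint:
  fixes G :: "real^'m \<Rightarrow> real^'m \<Rightarrow> real^'m \<Rightarrow> real"
  assumes G: "metric_on U G" and H: "metric_on W H" and \<phi>: "smooth_on U \<phi>" "\<phi> ` U \<subseteq> W" and y: "y \<in> U"
    and Z: "Z differentiable (at y)" and V: "V differentiable (at y)"
    and eq: "\<And>y u. y \<in> U \<Longrightarrow> G y (Z y) u = H (\<phi> y) (V y) (fderiv \<phi> y u)"
  shows "(\<Sum>i\<in>UNIV. covd G (\<lambda>y. y) Z y (axis i 1) $ i)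
    = trace_on (G y) UNIV (\<lambda>u v. H (\<phi> y) (covd H \<phi> V y u) (fderiv \<phi> y v)) + H (\<phi> y) (V y) (trace_on (G y) UNIV (sff G H \<phi> y))"
proof -
  have "\<phi> y \<in> W" using \<phi> y by auto
  then interpret l: linear "H (\<phi> y) (V y)" using bilinear_linear(1)[OF metric_onD(3)[OF H]] by blast
  have "linear (covd G (\<lambda>y. y) Z y)" by (rule linear_covd[OF G]) (auto simp: y Z)
  from trace_of_linear[OF metric_onD(2)[OF G y] this] show ?thesis
    by (simp add: covd_adjoint[OF G H \<phi> y Z V eq] trace_on_def sum.distrib l.sum)
qed

section \<open>Riemannian submersions in coordinates\<close>

definition rsub_at :: "('e::euclidean_space \<Rightarrow> 'e \<Rightarrow> real) \<Rightarrow> ('f::euclidean_space \<Rightarrow> 'f \<Rightarrow> real) \<Rightarrow> ('e \<Rightarrow> 'f) \<Rightarrow> bool" where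
  "rsub_at g h A \<longleftrightarrow> linear A \<and> inner_product g \<and> inner_product h \<and> A ` {u. \<forall>v. A v = 0 \<longrightarrow> g u v = 0} = UNIV \<and>
     (\<forall>u v. (\<forall>w. A w = 0 \<longrightarrow> g u w = 0) \<longrightarrow> (\<forall>w. A w = 0 \<longrightarrow> g v w = 0) \<longrightarrow> h (A u) (A v) = g u v)"

text \<open>The adjoint of \<open>A\<close> with respect to the two inner products. For a Riemannian
  submersion \<open>A\<close> composed with its adjoint is the identity, so the adjoint is the
  horizontal lift.\<close>

definition lift :: "('e::euclidean_space \<Rightarrow> 'e \<Rightarrow> real) \<Rightarrow> ('f::euclidean_space \<Rightarrow> 'f \<Rightarrow> real) \<Rightarrow> ('e \<Rightarrow> 'f) \<Rightarrow> 'f \<Rightarrow> 'e" where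
  "lift g h A w = riesz g (\<lambda>u. h w (A u))"

context
  fixes g h A
  assumes r: "rsub_at g h A"
begin

private lemma A: "linear A" and ipg: "inner_product g" and iph: "inner_product h"
  and surj: "\<exists>u. z = A u \<and> (\<forall>v. A v = 0 \<longrightarrow> g u v = 0)"
  and iso: "(\<And>w. A w = 0 \<Longrightarrow> g u w = 0) \<Longrightarrow> (\<And>w. A w = 0 \<Longrightarrow> g v w = 0) \<Longrightarrow> h (A u) (A v) = g u v"
proof -
  have "z \<in> A ` {u. \<forall>v. A v = 0 \<longrightarrow> g u v = 0}" using r unfolding rsub_at_def by simp
  then show "\<exists>u. z = A u \<and> (\<forall>v. A v = 0 \<longrightarrow> g u v = 0)" by blast
qed (use r in \<open>simp_all add: rsub_at_def\<close>)

lemma lift_works: "g (lift g h A w) u = h w (A u)"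
  unfolding lift_def using linear_compose[OF A bilinear_linear(1)[OF inner_productD(1)[OF iph]], of w]
  by (intro inner_product_riesz ipg) (simp add: comp_def)

lemma lift_works': "g u (lift g h A w) = h w (A u)"
  by (simp only: inner_productD(2)[OF ipg, of u] lift_works)

text \<open>The adjoint takes values orthogonal to the kernel, so the isometry condition applies to
  it; testing against the image of an arbitrary horizontal vector identifies
  \<open>A (lift g h A w)\<close>.\<close>

lemma lift_section: "A (lift g h A w) = w"
proof (rule inner_product_eqI[OF iph])
  fix z
  obtain u where u: "z = A u" "\<And>v. A v = 0 \<Longrightarrow> g u v = 0" using surj by blast
  have "g (lift g h A w) v = 0" if "A v = 0" for v
    using that by (simp add: lift_works bilinear_rzero inner_productD(1)[OF iph])
  then show "h (A (lift g h A w)) z = h w z"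
    using iso[of "lift g h A w" u] u lift_works by simp
qed

lemma lift_inner: "g (lift g h A w) (lift g h A z) = h w z"
  by (simp add: lift_works lift_section)

text \<open>A vector differs from the lift of its image by a kernel vector, which gives the span.
  Lifts are orthogonal to the kernel because the product of a lift with u depends on
  \<open>A u\<close> alone.\<close>

lemma lift_basis:
  assumes B: "orthonormal_basis g {u. A u = 0} B" and F: "orthonormal_basis h UNIV F"
  shows "orthonormal_basis g UNIV (B \<union> lift g h A ` F)" "B \<inter> lift g h A ` F = {}" "inj_on (lift g h A) F"
proof -
  interpret A: linear A by (rule A)
  note ip = ipg iph
  have BA: "A e = 0" if "e \<in> B" for e using B that span_superset[of B] by (auto simp: orthonormal_basis_def)
  have h0: "h f 0 = 0" "h 0 f = 0" for f using ip(2) by (auto simp: bilinear_rzero bilinear_lzero inner_productD(1))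
  show inj: "inj_on (lift g h A) F" by (metis inj_onI lift_section)
  show "B \<inter> lift g h A ` F = {}"
  proof (rule ccontr)
    assume "B \<inter> lift g h A ` F \<noteq> {}"
    then obtain f where f: "f \<in> F" "lift g h A f \<in> B" by auto
    then have "f = 0" using BA[OF f(2)] lift_section[of f] by simp
    moreover have "h f f = 1" using f(1) F by (simp add: orthonormal_basis_def)
    ultimately show False using h0(1)[of 0] by simp
  qed
  have 1: "g e (lift g h A f) = 0" "g (lift g h A f) e = 0" if "e \<in> B" for e f
    using BA[OF that] h0 by (simp_all add: lift_works lift_works')
  have "u \<in> span (B \<union> lift g h A ` F)" for u
  proof -
    let ?s = "\<Sum>f\<in>F. h f (A u) *\<^sub>R lift g h A f"
    have "A ?s = (\<Sum>f\<in>F. h f (A u) *\<^sub>R f)" by (simp add: A.sum A.scale lift_section)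
    also have "\<dots> = A u" using orthonormal_basis_expand[OF ip(2) F, of "A u"] by simp
    finally have "u - ?s \<in> span B" using B by (auto simp: orthonormal_basis_def A.diff)
    moreover have "?s \<in> span (lift g h A ` F)" by (intro span_sum span_scale span_base) auto
    ultimately have "(u - ?s) + ?s \<in> span (B \<union> lift g h A ` F)"
      by (intro span_add) (meson Un_upper1 Un_upper2 span_mono subsetD)+
    then show ?thesis by simp
  qed
  moreover have "g (lift g h A f) (lift g h A f') = (if lift g h A f = lift g h A f' then 1 else 0)" if "f \<in> F" "f' \<in> F" for f f'
    using F that inj by (auto simp: lift_inner orthonormal_basis_def inj_on_def)
  ultimately show "orthonormal_basis g UNIV (B \<union> lift g h A ` F)"
    using B 1 BA lift_section unfolding orthonormal_basis_def by auto
qed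

lemma subspace_kernel: "subspace {u. A u = 0}"
  by (rule linear_subspace_kernel[OF A])

lemma trace_on_split:
  fixes Q :: "_ \<Rightarrow> _ \<Rightarrow> 'v::real_vector"
  assumes "bilinear Q"
  shows "trace_on g UNIV Q = trace_on g {u. A u = 0} Q + (\<Sum>f\<in>frame h UNIV. Q (lift g h A f) (lift g h A f))"
proof -
  note ip = ipg iph
  let ?B = "frame g {u. A u = 0}" and ?F = "frame h UNIV"
  have B: "orthonormal_basis g {u. A u = 0} ?B" and F: "orthonormal_basis h UNIV ?F"
    by (rule orthonormal_basis_frame[OF ipg subspace_kernel] orthonormal_basis_frame[OF iph subspace_UNIV])+
  note l = lift_basis[OF B F]
  have "trace_on g UNIV Q = (\<Sum>e\<in>?B \<union> lift g h A ` ?F. Q e e)"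
    by (rule trace_on_orthonormal_basis[OF ip(1) assms l(1) subspace_UNIV])
  also have "\<dots> = (\<Sum>e\<in>?B. Q e e) + (\<Sum>e\<in>lift g h A ` ?F. Q e e)"
    using orthonormal_basis_finite[OF ip(1) l(1)] l(2) by (intro sum.union_disjoint) auto
  finally show ?thesis by (simp add: sum.reindex[OF l(3)] trace_on_def)
qed

text \<open>Computed in the adapted frame: vertical vectors contribute nothing, and over the lifted
  frame the sum is Parseval's identity for h. So any frame of the source can be contracted away
  through \<open>A\<close>.\<close>

lemma frame_sum_submersion:
  "(\<Sum>u\<in>frame g UNIV. h x (A u) * h z (A u)) = h x z"
proof -
  note ip = ipg iph
  note bl = bilinear_linear(1)[OF inner_productD(1)[OF ip(2)]]
  have "bilinear (\<lambda>u v. h x (A u) * h z (A v))"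
    using linear_compose[OF A bl] by (auto simp: bilinear_def linear_iff algebra_simps)
  from trace_on_split[OF this] have "(\<Sum>u\<in>frame g UNIV. h x (A u) * h z (A u)) =
      (\<Sum>u\<in>frame g {u. A u = 0}. h x (A u) * h z (A u)) + (\<Sum>f\<in>frame h UNIV. h x f * h z f)"
    by (simp add: trace_on_def lift_section)
  moreover have "(\<Sum>u\<in>frame g {u. A u = 0}. h x (A u) * h z (A u)) = 0"
  proof (rule sum.neutral, rule ballI)
    fix u assume "u \<in> frame g {u. A u = 0}"
    then have "A u = 0"
      using orthonormal_basis_frame[OF ip(1) subspace_kernel] span_superset[of "frame g {u. A u = 0}"] by (auto simp: orthonormal_basis_def)
    then show "h x (A u) * h z (A u) = 0" by (simp add: bilinear_rzero inner_productD(1)[OF ip(2)])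
  qed
  moreover have "h x z = h x (\<Sum>f\<in>frame h UNIV. h f z *\<^sub>R f)"
    using orthonormal_basis_expand[OF ip(2) orthonormal_basis_frame[OF ip(2) subspace_UNIV], of z] by simp
  moreover have "\<dots> = (\<Sum>f\<in>frame h UNIV. h x f * h z f)"
    by (simp add: linear_sum[OF bl] linear_scale[OF bl] inner_productD(2)[OF ip(2), of z] mult.commute)
  ultimately show ?thesis by simp
qed

end

lemma smooth_on_lift:
  fixes G :: "real^'m \<Rightarrow> real^'m \<Rightarrow> real^'m \<Rightarrow> real" and H :: "real^'n \<Rightarrow> real^'n \<Rightarrow> real^'n \<Rightarrow> real"
  assumes G: "metric_on U G" and H: "metric_on W H" and \<phi>: "smooth_on U \<phi>" "\<phi> ` U \<subseteq> W" and V: "smooth_on U V"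
  shows "smooth_on U (\<lambda>y. lift (G y) (H (\<phi> y)) (fderiv \<phi> y) (V y))"
  unfolding lift_def
proof (rule smooth_on_riesz[OF metric_onD(1)[OF G] metric_onD(2,4)[OF G]])
  have \<phi>y: "\<phi> y \<in> W" if "y \<in> U" for y using that \<phi> by auto
  show "linear (\<lambda>u. H (\<phi> y) (V y) (fderiv \<phi> y u))" if "y \<in> U" for y
    using linear_compose[OF smooth_on_linear_fderiv[OF \<phi>(1) that] bilinear_linear(1)[OF metric_onD(3)[OF H \<phi>y[OF that]]]]
    by (simp add: comp_def)
  show "smooth_on U (\<lambda>y. H (\<phi> y) (V y) (fderiv \<phi> y u))" for u
    by (rule smooth_on_bilinear_family[OF metric_onD(1)[OF G] metric_onD(3)[OF H \<phi>y]
          smooth_on_compose[OF metric_onD(4)[OF H] \<phi>(1) metric_onD(1)[OF G] metric_onD(1)[OF H] \<phi>y] V smooth_on_fderiv[OF \<phi>(1)]])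
qed auto

text \<open>For the lifts \<open>Z w\<close>, \<open>Z z\<close> of constant fields, \<open>H (\<nabla>d\<phi>(x, Z w)) z\<close> is skew in \<open>w\<close> and \<open>z\<close>; on horizontal
  vectors it is also symmetric in \<open>x\<close> and \<open>Z w\<close>, and a trilinear form with both symmetries vanishes.\<close>

lemma sff_lift_eq_0:
  fixes G :: "real^'m \<Rightarrow> real^'m \<Rightarrow> real^'m \<Rightarrow> real" and H :: "real^'n \<Rightarrow> real^'n \<Rightarrow> real^'n \<Rightarrow> real"
  assumes G: "metric_on U G" and H: "metric_on W H" and \<phi>: "smooth_on U \<phi>" "\<phi> ` U \<subseteq> W" and y: "y \<in> U"
    and r: "\<And>y. y \<in> U \<Longrightarrow> rsub_at (G y) (H (\<phi> y)) (fderiv \<phi> y)"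
  shows "sff G H \<phi> y (lift (G y) (H (\<phi> y)) (fderiv \<phi> y) a) (lift (G y) (H (\<phi> y)) (fderiv \<phi> y) b) = 0"
proof -
  define Z where "Z w y = lift (G y) (H (\<phi> y)) (fderiv \<phi> y) w" for w y
  define S where "S = sff G H \<phi> y"
  have \<phi>y: "\<phi> y \<in> W" using \<phi> y by auto
  have U: "open U" by (rule metric_onD(1)[OF G])
  note bH = metric_onD(3)[OF H \<phi>y] and sH = metric_onD(5)[OF H \<phi>y]
  have Z: "Z w differentiable (at y)" for w
    using smooth_on_lift[OF G H \<phi> smooth_on_const, of w] y unfolding Z_def by (rule smooth_on_differentiable)
  have S: "S u v = S v u" for u v unfolding S_def by (rule sff_commute[OF G H \<phi> y])
  have adj: "G y (covd G (\<lambda>y. y) (Z w) y x) u = H (\<phi> y) (chr H (\<phi> y) (fderiv \<phi> y x) w) (fderiv \<phi> y u) + H (\<phi> y) w (S x u)" for w x u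
    using covd_adjoint[OF G H \<phi> y Z, of "\<lambda>_. w" w x u] lift_works[OF r] by (simp add: Z_def S_def covd_def)
  \<comment> \<open>The covariant derivative of the identity d\<phi>(Z w) = w, whose right-hand side
    is constant in coordinates.\<close>
  have sec: "S x (Z w y) + fderiv \<phi> y (covd G (\<lambda>y. y) (Z w) y x) = chr H (\<phi> y) (fderiv \<phi> y x) w" for w x
  proof -
    have "fderiv (\<lambda>y. fderiv \<phi> y (Z w y)) y = fderiv (\<lambda>_. w) y"
      by (rule fderiv_cong_open[OF U y]) (simp add: Z_def lift_section[OF r])
    then have "fderiv2 \<phi> y x (Z w y) + fderiv \<phi> y (fderiv (Z w) y x) = 0"
      using fderiv_eqI[OF has_derivative_fderiv_apply[OF \<phi>(1) U y Z]] by (simp add: fun_eq_iff)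
    then show ?thesis
      by (simp add: S_def sff_def covd_def linear_add[OF smooth_on_linear_fderiv[OF \<phi>(1) y]] Z_def lift_section[OF r[OF y]] algebra_simps)
  qed
  \<comment> \<open>Pair \<open>sec\<close> with z, move d\<phi> across by adjointness and evaluate
    the result by \<open>adj\<close>: the Christoffel terms of H cancel.\<close>
  have anti: "H (\<phi> y) (S x (Z w y)) z + H (\<phi> y) (S x (Z z y)) w = 0" for x w z
  proof -
    have "H (\<phi> y) (S x (Z w y)) z + H (\<phi> y) (fderiv \<phi> y (covd G (\<lambda>y. y) (Z w) y x)) z = H (\<phi> y) (chr H (\<phi> y) (fderiv \<phi> y x) w) z"
      using sec[of x w] by (metis bilinear_ladd[OF bH])
    moreover have "H (\<phi> y) (fderiv \<phi> y (covd G (\<lambda>y. y) (Z w) y x)) z = G y (covd G (\<lambda>y. y) (Z w) y x) (Z z y)"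
      by (simp add: Z_def lift_works'[OF r[OF y]] sH)
    moreover have "fderiv \<phi> y (Z z y) = z" by (simp add: Z_def lift_section[OF r[OF y]])
    ultimately show ?thesis using adj[of w x "Z z y"] sH[of w] by simp
  qed
  \<comment> \<open>With T(a, b, z) for the left-hand side, alternate the two symmetries: T(a, b, z)
    = - T(a, z, b) = - T(z, a, b) = T(z, b, a) = T(b, z, a) = - T(b, a, z) = - T(a, b, z).\<close>
  have "H (\<phi> y) (S (Z a y) (Z b y)) z = H (\<phi> y) 0 z" for z
    using anti[of "Z a y" b z] anti[of "Z z y" a b] anti[of "Z b y" z a]
      S[of "Z a y" "Z b y"] S[of "Z z y" "Z b y"] S[of "Z z y" "Z a y"] bilinear_lzero[OF bH] by simp
  then show ?thesis using inner_product_eqI[OF metric_onD(2)[OF H \<phi>y]] by (simp add: S_def Z_def)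
qed

lemma trace_sff_submersion:
  fixes G :: "real^'m \<Rightarrow> real^'m \<Rightarrow> real^'m \<Rightarrow> real" and H :: "real^'n \<Rightarrow> real^'n \<Rightarrow> real^'n \<Rightarrow> real"
  assumes G: "metric_on U G" and H: "metric_on W H" and \<phi>: "smooth_on U \<phi>" "\<phi> ` U \<subseteq> W" and y: "y \<in> U"
    and r: "\<And>y. y \<in> U \<Longrightarrow> rsub_at (G y) (H (\<phi> y)) (fderiv \<phi> y)"
  shows "trace_on (G y) UNIV (sff G H \<phi> y) = trace_on (G y) {u. fderiv \<phi> y u = 0} (sff G H \<phi> y)"
  using trace_on_split[OF r[OF y] bilinear_sff[OF G H \<phi> y]] sff_lift_eq_0[OF G H \<phi> y r] by simp

section \<open>Pointwise first variation\<close>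

lemma DERIV_eventually_cong:
  "(f has_real_derivative D) (at x) \<Longrightarrow> \<forall>\<^sub>F t in nhds x. g t = f t \<Longrightarrow> (g has_real_derivative D) (at x)"
  by (subst DERIV_cong_ev[OF refl _ refl])

lemma has_derivative_imp_has_real_derivative:
  fixes f :: "real \<Rightarrow> real"
  assumes "(f has_derivative D) (at x)"
  shows "(f has_real_derivative D 1) (at x)"
proof (rule has_derivative_imp_has_field_derivative[OF assms])
  show "s * D 1 = D s" for s using linear_scale[OF has_derivative_linear[OF assms], of s 1] by simp
qed

lemma fderiv_Pair_right:
  assumes "\<Phi> differentiable (at (t, y))"
  shows "fderiv (\<lambda>z. \<Phi> (t, z)) y u = fderiv \<Phi> (t, y) (0, u)"
proof -
  have "((\<lambda>z. (t, z)) has_derivative (\<lambda>u. (0, u))) (at y)" by (auto intro!: derivative_eq_intros)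
  from fderiv_eqI[OF has_derivative_compose[OF this has_derivative_fderiv[OF assms]]] show ?thesis by simp
qed

lemma fderiv_Pair_left:
  fixes t :: real
  assumes "\<Phi> differentiable (at (t, y))"
  shows "((\<lambda>t. \<Phi> (t, y)) has_derivative (\<lambda>s. s *\<^sub>R fderiv \<Phi> (t, y) (1, 0))) (at t)"
proof -
  have 1: "((\<lambda>t. (t, y)) has_derivative (\<lambda>s. (s, 0))) (at t)" by (auto intro!: derivative_eq_intros)
  have "fderiv \<Phi> (t, y) (s, 0) = s *\<^sub>R fderiv \<Phi> (t, y) (1, 0)" for s
    using linear_scale[OF linear_fderiv[OF assms], of s "(1, 0)"] by simp
  then have "(\<lambda>s. fderiv \<Phi> (t, y) (s, 0)) = (\<lambda>s. s *\<^sub>R fderiv \<Phi> (t, y) (1, 0))" by (rule ext)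
  then show ?thesis using has_derivative_compose[OF 1 has_derivative_fderiv[OF assms]] by (simp only:)
qed

context
  fixes \<Phi> :: "real \<times> 'e::euclidean_space \<Rightarrow> 'f::euclidean_space" and S y W H
  assumes \<Phi>: "smooth_on S \<Phi>" "open S" "(0, y) \<in> S" "\<Phi> ` S \<subseteq> W" and H: "metric_on W H"
begin

private lemma pre: "\<exists>T. open T \<and> 0 \<in> T \<and> (\<forall>t\<in>T. (t, y) \<in> S)"
proof -
  have "open ((\<lambda>t. (t, y)) -` S)" by (intro open_vimage \<Phi>(2)) (auto intro!: continuous_intros)
  then show ?thesis using \<Phi>(3) by (intro exI[of _ "(\<lambda>t. (t, y)) -` S"]) auto
qed

text \<open>Absence of torsion: second derivatives of \<Phi> commute and the Christoffel term is
  symmetric, so the time derivative of d\<Phi>(u) is the derivative of the variation field in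
  direction u.\<close>

lemma covd_time:
  "covd H (\<lambda>t. \<Phi> (t, y)) (\<lambda>t. fderiv \<Phi> (t, y) (0, u)) 0 1 = covd H (\<lambda>y. \<Phi> (0, y)) (\<lambda>y. fderiv \<Phi> (0, y) (1, 0)) y u"
proof -
  have W: "\<Phi> (0, y) \<in> W" using \<Phi> by auto
  note d = smooth_on_differentiable[OF \<Phi>(1,3)] and d2 = smooth_on_differentiable[OF smooth_on_fderiv[OF \<Phi>(1)] \<Phi>(3)]
  show ?thesis
    unfolding covd_def fderiv_Pair_right[OF d] fderiv_Pair_right[OF d2] fderiv_eqI[OF fderiv_Pair_left[OF d]]
      fderiv_eqI[OF fderiv_Pair_left[OF d2]]
    by (simp add: chr_commute[OF H W, of "fderiv \<Phi> (0, y) (1, 0)"] fderiv2_commute[OF \<Phi>(1,2,3), of "(1, 0)"])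
qed

lemma has_derivative_inner_time:
  assumes "a differentiable (at 0)" "c differentiable (at 0)"
  shows "((\<lambda>t. H (\<Phi> (t, y)) (a t) (c t)) has_real_derivative
     H (\<Phi> (0, y)) (covd H (\<lambda>t. \<Phi> (t, y)) a 0 1) (c 0) + H (\<Phi> (0, y)) (a 0) (covd H (\<lambda>t. \<Phi> (t, y)) c 0 1)) (at 0)"
proof -
  obtain T where T: "open T" "0 \<in> T" "\<And>t. t \<in> T \<Longrightarrow> (t, y) \<in> S" using pre by auto
  have "(\<lambda>t. \<Phi> (t, y)) differentiable (at 0)"
    using fderiv_Pair_left[OF smooth_on_differentiable[OF \<Phi>(1,3)]] by (auto simp: differentiable_def)
  moreover have "(\<lambda>t. \<Phi> (t, y)) ` T \<subseteq> W" using T \<Phi>(4) by auto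
  ultimately have "((\<lambda>t. H (\<Phi> (t, y)) (a t) (c t)) has_derivative
      (\<lambda>s. H (\<Phi> (0, y)) (covd H (\<lambda>t. \<Phi> (t, y)) a 0 s) (c 0) + H (\<Phi> (0, y)) (a 0) (covd H (\<lambda>t. \<Phi> (t, y)) c 0 s))) (at 0)"
    by (intro covd_metric[OF H T(1,2)] assms)
  then show ?thesis by (rule has_derivative_imp_has_real_derivative)
qed

private lemma da: "(\<lambda>t. fderiv \<Phi> (t, y) (0, u)) differentiable (at 0)"
  using fderiv_Pair_left[OF smooth_on_differentiable[OF smooth_on_fderiv[OF \<Phi>(1)] \<Phi>(3)]] by (auto simp: differentiable_def)

private lemma ev: "\<forall>\<^sub>F t in nhds 0. fderiv (\<lambda>z. \<Phi> (t, z)) y = (\<lambda>u. fderiv \<Phi> (t, y) (0, u)) \<and> (t, y) \<in> S"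
proof -
  obtain T where T: "open T" "0 \<in> T" "\<And>t. t \<in> T \<Longrightarrow> (t, y) \<in> S" using pre by auto
  show ?thesis
    by (rule eventually_mono[OF eventually_nhds_in_open[OF T(1,2)]])
      (auto simp: T(3) fderiv_Pair_right[OF smooth_on_differentiable[OF \<Phi>(1) T(3)]])
qed

text \<open>The frame belongs to the metric at a fixed point and does not move with t. Only the
  vectors d\<Phi>(e) vary, and \<open>covd_time\<close> turns their time derivatives into
  derivatives of the variation field.\<close>

lemma dirichlet_density_derivative:
  "((\<lambda>t. trace_on g UNIV (\<lambda>u v. H (\<Phi> (t, y)) (fderiv (\<lambda>z. \<Phi> (t, z)) y u) (fderiv (\<lambda>z. \<Phi> (t, z)) y v))) has_real_derivative
    2 * trace_on g UNIV (\<lambda>u v. H (\<Phi> (0, y)) (covd H (\<lambda>y. \<Phi> (0, y)) (\<lambda>y. fderiv \<Phi> (0, y) (1, 0)) y u)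
       (fderiv (\<lambda>z. \<Phi> (0, z)) y v))) (at 0)" (is "(?F has_real_derivative ?D) (at 0)")
proof -
  have W: "\<Phi> (0, y) \<in> W" using \<Phi> by auto
  have "((\<lambda>t. \<Sum>e\<in>frame g UNIV. H (\<Phi> (t, y)) (fderiv \<Phi> (t, y) (0, e)) (fderiv \<Phi> (t, y) (0, e))) has_real_derivative
      (\<Sum>e\<in>frame g UNIV. H (\<Phi> (0, y)) (covd H (\<lambda>t. \<Phi> (t, y)) (\<lambda>t. fderiv \<Phi> (t, y) (0, e)) 0 1) (fderiv \<Phi> (0, y) (0, e))
        + H (\<Phi> (0, y)) (fderiv \<Phi> (0, y) (0, e)) (covd H (\<lambda>t. \<Phi> (t, y)) (\<lambda>t. fderiv \<Phi> (t, y) (0, e)) 0 1))) (at 0)"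
    by (rule DERIV_sum, rule has_derivative_inner_time[OF da da])
  then have "((\<lambda>t. \<Sum>e\<in>frame g UNIV. H (\<Phi> (t, y)) (fderiv \<Phi> (t, y) (0, e)) (fderiv \<Phi> (t, y) (0, e))) has_real_derivative ?D) (at 0)"
    unfolding covd_time fderiv_Pair_right[OF smooth_on_differentiable[OF \<Phi>(1,3)]]
    by (rule DERIV_cong) (simp add: trace_on_def sum_distrib_left metric_onD(5)[OF H W, of "fderiv \<Phi> (0, y) (0, _)"])
  moreover have "\<forall>\<^sub>F t in nhds 0. ?F t = (\<Sum>e\<in>frame g UNIV. H (\<Phi> (t, y)) (fderiv \<Phi> (t, y) (0, e)) (fderiv \<Phi> (t, y) (0, e)))"
    using ev by (rule eventually_mono) (simp add: trace_on_def)
  ultimately show ?thesis by (rule DERIV_eventually_cong)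
qed

text \<open>Along a Riemannian submersion, contracting with \<open>\<Omega> = H (J \<cdot>, \<cdot>)\<close> over a frame is the same as
  contracting with \<open>H\<close>, and \<open>|J a|\<^sup>2 = |a|\<^sup>2\<close> for every curve \<open>a\<close> of vectors. Hence the derivative of
  \<open>J\<close> does not contribute, and the density has the same derivative as the Dirichlet density.\<close>

lemma symplectic_density_derivative:
  assumes r: "rsub_at g (H (\<Phi> (0, y))) (fderiv (\<lambda>z. \<Phi> (0, z)) y)"
    and J: "\<And>z. z \<in> W \<Longrightarrow> linear (J z)" "\<And>z u. z \<in> W \<Longrightarrow> J z (J z u) = - u" "\<And>u. smooth_on W (\<lambda>z. J z u)"
      "\<And>z u v. z \<in> W \<Longrightarrow> H z (J z u) (J z v) = H z u v"
  shows "((\<lambda>t. form2_norm_sq g (\<lambda>u v. H (\<Phi> (t, y)) (J (\<Phi> (t, y)) (fderiv (\<lambda>z. \<Phi> (t, z)) y u)) (fderiv (\<lambda>z. \<Phi> (t, z)) y v))) has_real_derivative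
    2 * trace_on g UNIV (\<lambda>u v. H (\<Phi> (0, y)) (covd H (\<lambda>y. \<Phi> (0, y)) (\<lambda>y. fderiv \<Phi> (0, y) (1, 0)) y u)
       (fderiv (\<lambda>z. \<Phi> (0, z)) y v))) (at 0)" (is "(?F has_real_derivative ?D) (at 0)")
proof -
  obtain T where T: "open T" "0 \<in> T" "\<And>t. t \<in> T \<Longrightarrow> (t, y) \<in> S" using pre by auto
  have W: "\<Phi> (0, y) \<in> W" using \<Phi> by auto
  define a where "a u t = fderiv \<Phi> (t, y) (0, u)" for u t
  define j where "j u t = J (\<Phi> (t, y)) (a u t)" for u t
  define D where "D b = covd H (\<lambda>t. \<Phi> (t, y)) b 0 1" for b
  let ?H = "H (\<Phi> (0, y))" and ?B = "frame g UNIV"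
  note sH = metric_onD(5)[OF H W] and bH = metric_onD(3)[OF H W]
  have a: "a u differentiable (at 0)" for u using da[of u] by (simp add: a_def[abs_def])
  have a0: "fderiv (\<lambda>z. \<Phi> (0, z)) y u = a u 0" for u
    by (simp add: a_def fderiv_Pair_right[OF smooth_on_differentiable[OF \<Phi>(1,3)]])
  have j: "j u differentiable (at 0)" for u
  proof -
    have c: "(\<lambda>t. \<Phi> (t, y)) differentiable (at 0)"
      using fderiv_Pair_left[OF smooth_on_differentiable[OF \<Phi>(1,3)]] by (auto simp: differentiable_def)
    have "bilinear (\<lambda>(r::real) v. r *\<^sub>R J (\<Phi> (t, y)) v)" if "t \<in> T" for t
      using J(1)[of "\<Phi> (t, y)"] \<Phi>(4) T(3)[OF that] by (auto simp: bilinear_def linear_iff algebra_simps image_subset_iff)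
    moreover have "((\<lambda>t. r *\<^sub>R J (\<Phi> (t, y)) v) has_derivative (\<lambda>s. r *\<^sub>R fderiv (\<lambda>z. J z v) (\<Phi> (0, y)) (fderiv (\<lambda>t. \<Phi> (t, y)) 0 s))) (at 0)" for r :: real and v
      by (intro has_derivative_scaleR_right has_derivative_compose[OF has_derivative_fderiv[OF c] smooth_on_has_derivative[OF J(3) W]])
    ultimately have "((\<lambda>t. 1 *\<^sub>R J (\<Phi> (t, y)) (a u t)) has_derivative
       (\<lambda>s. 1 *\<^sub>R fderiv (\<lambda>z. J z (a u 0)) (\<Phi> (0, y)) (fderiv (\<lambda>t. \<Phi> (t, y)) 0 s) + 0 *\<^sub>R J (\<Phi> (0, y)) (a u 0)
          + 1 *\<^sub>R J (\<Phi> (0, y)) (fderiv (a u) 0 s))) (at 0)"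
      by (rule has_derivative_bilinear_family[OF T(1,2), where f="\<lambda>_. 1" and f'="\<lambda>_. 0", OF _ _ has_derivative_const has_derivative_fderiv[OF a]])
    then show ?thesis by (auto simp: differentiable_def j_def[abs_def])
  qed
  have jj: "?H (j u 0) (D (j u)) = ?H (a u 0) (D (a u))" for u
  proof -
    have 1: "((\<lambda>t. H (\<Phi> (t, y)) (j u t) (j u t)) has_real_derivative ?H (D (j u)) (j u 0) + ?H (j u 0) (D (j u))) (at 0)"
      unfolding D_def by (rule has_derivative_inner_time[OF j j])
    have 2: "((\<lambda>t. H (\<Phi> (t, y)) (a u t) (a u t)) has_real_derivative ?H (D (a u)) (a u 0) + ?H (a u 0) (D (a u))) (at 0)"
      unfolding D_def by (rule has_derivative_inner_time[OF a a])
    have "\<forall>\<^sub>F t in nhds 0. H (\<Phi> (t, y)) (j u t) (j u t) = H (\<Phi> (t, y)) (a u t) (a u t)"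
      using ev by (rule eventually_mono) (use J(4) \<Phi>(4) in \<open>auto simp: j_def image_subset_iff\<close>)
    then have "?H (D (j u)) (j u 0) + ?H (j u 0) (D (j u)) = ?H (D (a u)) (a u 0) + ?H (a u 0) (D (a u))"
      by (rule DERIV_unique[OF 1 DERIV_eventually_cong[OF 2]])
    then show ?thesis by (simp add: sH[of "D _"])
  qed
  have skew: "?H (j u 0) v = - ?H (a u 0) (J (\<Phi> (0, y)) v)" for u v
    using J(4)[OF W, of "j u 0" v] J(2)[OF W] by (simp add: j_def bilinear_lneg[OF bH])
  have sumj: "(\<Sum>v\<in>?B. ?H (j u 0) (a v 0) * ?H x (a v 0)) = ?H (j u 0) x" for u x
    using frame_sum_submersion[OF r, of "j u 0" x] by (simp add: a0)
  \<comment> \<open>Here the summed index carries J. Skewness moves J onto the two fixed vectors,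
    where it is an isometry, and the frame sum can then be contracted.\<close>
  have suma: "(\<Sum>u\<in>?B. ?H (j u 0) (a v 0) * ?H (j u 0) x) = ?H (a v 0) x" for v x
  proof -
    have "?H (j u 0) (a v 0) = - ?H (j v 0) (a u 0)" for u
      by (simp only: skew[of u "a v 0"]) (simp only: j_def sH[of "a u 0"])
    moreover have "?H (j u 0) x = - ?H (J (\<Phi> (0, y)) x) (a u 0)" for u
      by (simp only: skew[of u x] sH[of "a u 0"])
    moreover have "?H (j v 0) (J (\<Phi> (0, y)) x) = ?H (a v 0) x" by (simp only: j_def J(4)[OF W])
    ultimately show ?thesis
      using frame_sum_submersion[OF r, of "j v 0" "J (\<Phi> (0, y)) x"] by (simp add: a0)
  qed
  have "((\<lambda>t. 1 / 2 * (\<Sum>u\<in>?B. \<Sum>v\<in>?B. H (\<Phi> (t, y)) (j u t) (a v t) * H (\<Phi> (t, y)) (j u t) (a v t))) has_real_derivative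
     1 / 2 * (\<Sum>u\<in>?B. \<Sum>v\<in>?B. (?H (D (j u)) (a v 0) + ?H (j u 0) (D (a v))) * ?H (j u 0) (a v 0)
       + (?H (D (j u)) (a v 0) + ?H (j u 0) (D (a v))) * ?H (j u 0) (a v 0))) (at 0)"
    unfolding D_def by (rule DERIV_cmult, rule DERIV_sum, rule DERIV_sum, rule DERIV_mult; rule has_derivative_inner_time[OF j a])
  moreover have "1 / 2 * (\<Sum>u\<in>?B. \<Sum>v\<in>?B. (?H (D (j u)) (a v 0) + ?H (j u 0) (D (a v))) * ?H (j u 0) (a v 0)
       + (?H (D (j u)) (a v 0) + ?H (j u 0) (D (a v))) * ?H (j u 0) (a v 0)) = ?D"
  proof -
    have "(\<Sum>u\<in>?B. \<Sum>v\<in>?B. ?H (j u 0) (a v 0) * ?H (D (j u)) (a v 0)) = (\<Sum>u\<in>?B. ?H (a u 0) (D (a u)))"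
      by (simp add: sumj jj)
    moreover have "(\<Sum>u\<in>?B. \<Sum>v\<in>?B. ?H (j u 0) (a v 0) * ?H (j u 0) (D (a v))) = (\<Sum>v\<in>?B. ?H (a v 0) (D (a v)))"
      by (subst sum.swap) (simp add: suma)
    moreover have "?D = 2 * (\<Sum>u\<in>?B. ?H (a u 0) (D (a u)))"
      by (simp add: trace_on_def a0 D_def a_def[abs_def] covd_time sH[of "covd _ _ _ _ _"])
    ultimately show ?thesis by (simp add: algebra_simps sum.distrib flip: sum_distrib_left)
  qed
  moreover have "\<forall>\<^sub>F t in nhds 0. ?F t = 1 / 2 * (\<Sum>u\<in>?B. \<Sum>v\<in>?B. H (\<Phi> (t, y)) (j u t) (a v t) * H (\<Phi> (t, y)) (j u t) (a v t))"
    using ev by (rule eventually_mono) (simp add: form2_norm_sq_def a_def j_def fact_2)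
  ultimately show ?thesis by (simp only: DERIV_eventually_cong)
qed

end

section \<open>Charts\<close>

lemma is_chart_inj_on:
  assumes "is_chart X c"
  shows "inj_on (cmap c) (cdom c)"
proof -
  have "inj_on (cmap c) (topspace (subtopology X (cdom c)))"
    using assms homeomorphic_imp_injective_map by (simp only: is_chart_def) blast
  moreover have "cdom c \<subseteq> topspace X" using assms by (simp add: is_chart_def openin_subset)
  ultimately show ?thesis by (simp add: Int_absorb1)
qed

lemma cinv_cmap: "is_chart X c \<Longrightarrow> p \<in> cdom c \<Longrightarrow> cinv c (cmap c p) = p"
  by (simp add: is_chart_inj_on inv_into_f_f)

lemma cmap_cinv: "y \<in> cimage c \<Longrightarrow> cmap c (cinv c y) = y"
  by (rule f_inv_into_f)

lemma cinv_in: "y \<in> cimage c \<Longrightarrow> cinv c y \<in> cdom c"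
  by (rule inv_into_into)

lemma open_cimage: "is_chart X c \<Longrightarrow> open (cimage c)"
  by (simp add: is_chart_def)

lemma openin_cdom: "is_chart X c \<Longrightarrow> openin X (cdom c)"
  by (simp add: is_chart_def)

lemma open_chart_image:
  assumes c: "is_chart X c" and W: "openin X W"
  shows "open (cmap c ` (cdom c \<inter> W))"
proof -
  have "openin (subtopology X (cdom c)) (cdom c \<inter> W)"
    using W by (simp add: openin_subtopology_Int2)
  moreover have "open_map (subtopology X (cdom c)) (top_of_set (cimage c)) (cmap c)"
    using c homeomorphic_imp_open_map is_chart_def by blast
  ultimately have "openin (top_of_set (cimage c)) (cmap c ` (cdom c \<inter> W))"
    by (simp add: open_map_def)
  then show ?thesis using open_cimage[OF c] openin_open_eq by blast
qed

lemma openin_chart_vimage: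
  assumes c: "is_chart X c" and V: "open V"
  shows "openin X {p \<in> cdom c. cmap c p \<in> V}"
proof -
  have "continuous_map (subtopology X (cdom c)) (top_of_set (cimage c)) (cmap c)"
    using c homeomorphic_imp_continuous_map is_chart_def by blast
  moreover have "openin (top_of_set (cimage c)) (cimage c \<inter> V)" using V by (simp add: openin_open_Int)
  ultimately have "openin (subtopology X (cdom c)) {p \<in> topspace (subtopology X (cdom c)). cmap c p \<in> cimage c \<inter> V}"
    by (rule openin_continuous_map_preimage)
  moreover have "{p \<in> topspace (subtopology X (cdom c)). cmap c p \<in> cimage c \<inter> V} = {p \<in> cdom c. cmap c p \<in> V}"
    using openin_subset[OF openin_cdom[OF c]] by auto
  ultimately show ?thesis using openin_trans_full[OF _ openin_cdom[OF c]] by simp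
qed

lemma chart_image_eq: "is_chart X c \<Longrightarrow> cmap c ` (cdom c \<inter> W) = {y \<in> cimage c. cinv c y \<in> W}"
  by (auto simp: cinv_cmap)

section \<open>Change of charts\<close>

abbreviation overlap :: "('a, 'e) chart \<Rightarrow> ('a, 'e) chart \<Rightarrow> 'e set"
  where "overlap c d \<equiv> cmap c ` (cdom c \<inter> cdom d)"

lemma open_overlap: "is_chart X c \<Longrightarrow> is_chart X d \<Longrightarrow> open (overlap c d)"
  using open_chart_image openin_cdom by blast

lemma transition_cmap: "is_chart X c \<Longrightarrow> p \<in> cdom c \<Longrightarrow> transition c d (cmap c p) = cmap d p"
  by (simp add: transition_def cinv_cmap)

text \<open>The cocycle rule for Jacobians. Since \<open>to_chart\<close> and
  \<open>of_chart\<close> are Jacobians of transitions from and to \<open>chart_at\<close>, the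
  rules for changing components below are instances of it.\<close>

lemma fderiv_transition_trans:
  assumes c: "is_chart X c" and d: "is_chart X d" and e: "is_chart X e"
    and sm: "smooth_on (overlap c d) (transition c d)" "smooth_on (overlap d e) (transition d e)"
    and p: "p \<in> cdom c" "p \<in> cdom d" "p \<in> cdom e"
  shows "fderiv (transition d e) (cmap d p) (fderiv (transition c d) (cmap c p) u) = fderiv (transition c e) (cmap c p) u"
proof -
  have T: "(transition c d has_derivative fderiv (transition c d) (cmap c p)) (at (cmap c p))"
    using smooth_on_has_derivative[OF sm(1)] p by blast
  have "(transition d e has_derivative fderiv (transition d e) (cmap d p)) (at (transition c d (cmap c p)))"
    using smooth_on_has_derivative[OF sm(2), of "cmap d p"] p by (simp add: transition_cmap[OF c])
  from has_derivative_compose[OF T this]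
  have 1: "fderiv (\<lambda>y. transition d e (transition c d y)) (cmap c p) = (\<lambda>u. fderiv (transition d e) (cmap d p) (fderiv (transition c d) (cmap c p) u))"
    by (rule fderiv_eqI)
  have "fderiv (\<lambda>y. transition d e (transition c d y)) (cmap c p) = fderiv (transition c e) (cmap c p)"
    by (rule fderiv_cong_open[OF open_chart_image[OF c openin_Int[OF openin_cdom[OF d] openin_cdom[OF e]]]])
      (use p in \<open>auto simp: transition_cmap[OF c] transition_cmap[OF d]\<close>)
  then show ?thesis by (simp add: 1 fun_eq_iff)
qed

lemma fderiv_transition_self:
  assumes c: "is_chart X c" and p: "p \<in> cdom c"
  shows "fderiv (transition c c) (cmap c p) u = u"
proof -
  have "fderiv (transition c c) (cmap c p) = fderiv (\<lambda>y. y) (cmap c p)"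
    by (rule fderiv_cong_open[OF open_cimage[OF c]]) (use p in \<open>auto simp: transition_cmap[OF c]\<close>)
  then show ?thesis by simp
qed

context
  fixes M :: "('a, 'e::euclidean_space) manifold"
  assumes M: "smooth_manifold M"
begin

lemma atlas_is_chart: "c \<in> atlas M \<Longrightarrow> is_chart (mtop M) c"
  using M by (simp add: smooth_manifold_def)

lemma atlas_compatible: "c \<in> atlas M \<Longrightarrow> d \<in> atlas M \<Longrightarrow> compatible c d"
  using M by (simp add: smooth_manifold_def)

lemma cdom_subset_points: "c \<in> atlas M \<Longrightarrow> cdom c \<subseteq> points M"
  using M by (auto simp: smooth_manifold_def)

lemma chart_at:
  assumes "p \<in> points M"
  shows "chart_at M p \<in> atlas M" "p \<in> cdom (chart_at M p)"
proof -
  have "\<exists>c. c \<in> atlas M \<and> p \<in> cdom c" using M assms by (auto simp: smooth_manifold_def)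
  from someI_ex[OF this] show "chart_at M p \<in> atlas M" "p \<in> cdom (chart_at M p)"
    unfolding chart_at_def by blast+
qed

lemma chart_at_cdom:
  assumes "c \<in> atlas M" "p \<in> cdom c"
  shows "chart_at M p \<in> atlas M" "p \<in> cdom (chart_at M p)" "is_chart (mtop M) (chart_at M p)"
  using chart_at cdom_subset_points assms atlas_is_chart by blast+

lemma smooth_transition: "c \<in> atlas M \<Longrightarrow> d \<in> atlas M \<Longrightarrow> smooth_on (overlap c d) (transition c d)"
  using atlas_compatible unfolding compatible_def by blast

lemma to_chart_of_chart:
  assumes "c \<in> atlas M" "d \<in> atlas M" "p \<in> cdom c" "p \<in> cdom d"
  shows "to_chart M d p (of_chart M c p u) = fderiv (transition c d) (cmap c p) u"
  unfolding to_chart_def of_chart_def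
  by (rule fderiv_transition_trans[OF atlas_is_chart chart_at_cdom(3) atlas_is_chart smooth_transition smooth_transition])
    (use assms chart_at_cdom in auto)

lemma of_chart_fderiv_transition:
  assumes "c \<in> atlas M" "d \<in> atlas M" "p \<in> cdom c" "p \<in> cdom d"
  shows "of_chart M d p (fderiv (transition c d) (cmap c p) u) = of_chart M c p u"
  unfolding of_chart_def
  by (rule fderiv_transition_trans[OF atlas_is_chart atlas_is_chart chart_at_cdom(3) smooth_transition smooth_transition])
    (use assms chart_at_cdom in auto)

lemma to_chart_trans:
  assumes "c \<in> atlas M" "d \<in> atlas M" "p \<in> cdom c" "p \<in> cdom d"
  shows "fderiv (transition c d) (cmap c p) (to_chart M c p u) = to_chart M d p u"
  unfolding to_chart_def
  by (rule fderiv_transition_trans[OF chart_at_cdom(3) atlas_is_chart atlas_is_chart smooth_transition smooth_transition])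
    (use assms chart_at_cdom in auto)

lemma to_chart_inverse [simp]: "c \<in> atlas M \<Longrightarrow> p \<in> cdom c \<Longrightarrow> to_chart M c p (of_chart M c p u) = u"
  by (simp add: to_chart_of_chart fderiv_transition_self[OF atlas_is_chart])

lemma of_chart_inverse [simp]:
  assumes "c \<in> atlas M" "p \<in> cdom c"
  shows "of_chart M c p (to_chart M c p u) = u"
proof -
  have "of_chart M c p (to_chart M c p u) = fderiv (transition (chart_at M p) (chart_at M p)) (cmap (chart_at M p) p) u"
    unfolding to_chart_def of_chart_def
    by (rule fderiv_transition_trans[OF chart_at_cdom(3) atlas_is_chart chart_at_cdom(3) smooth_transition smooth_transition])
      (use assms chart_at_cdom in auto)
  then show ?thesis using fderiv_transition_self[OF chart_at_cdom(3)[OF assms] chart_at_cdom(2)[OF assms]] by simp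
qed

lemma of_chart_chart_at [simp]: "p \<in> points M \<Longrightarrow> of_chart M (chart_at M p) p u = u"
  unfolding of_chart_def by (rule fderiv_transition_self[OF atlas_is_chart[OF chart_at(1)] chart_at(2)])

lemma to_chart_chart_at [simp]: "p \<in> points M \<Longrightarrow> to_chart M (chart_at M p) p u = u"
  unfolding to_chart_def by (rule fderiv_transition_self[OF atlas_is_chart[OF chart_at(1)] chart_at(2)])

lemma linear_of_chart:
  assumes "c \<in> atlas M" "p \<in> cdom c"
  shows "linear (of_chart M c p)"
  unfolding of_chart_def
  by (rule smooth_on_linear_fderiv[OF smooth_transition]) (use assms chart_at_cdom in auto)

lemma linear_to_chart:
  assumes "c \<in> atlas M" "p \<in> cdom c"
  shows "linear (to_chart M c p)"
  unfolding to_chart_def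
  by (rule smooth_on_linear_fderiv[OF smooth_transition]) (use assms chart_at_cdom in auto)

lemma bij_of_chart:
  assumes "c \<in> atlas M" "p \<in> cdom c"
  shows "bij (of_chart M c p)"
  using assms by (intro bij_betwI[of _ _ _ "to_chart M c p"]) auto

lemma cinv_points: "c \<in> atlas M \<Longrightarrow> y \<in> cimage c \<Longrightarrow> cinv c y \<in> points M"
  by (rule subsetD[OF cdom_subset_points cinv_in])

lemma in_chart_cmap:
  assumes "c \<in> atlas M" "p \<in> cdom c"
  shows "in_chart M b c (cmap c p) u v = b p (of_chart M c p u) (of_chart M c p v)"
  by (simp add: in_chart_def cinv_cmap[OF atlas_is_chart[OF assms(1)] assms(2)])

lemma in_chart_chart_at:
  assumes "p \<in> points M"
  shows "in_chart M b (chart_at M p) (cmap (chart_at M p) p) = b p"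
  by (intro ext) (simp add: in_chart_cmap chart_at assms)

lemma in_chart_transition:
  assumes "c \<in> atlas M" "d \<in> atlas M" "y \<in> overlap c d"
  shows "in_chart M b c y u v = in_chart M b d (transition c d y) (fderiv (transition c d) y u) (fderiv (transition c d) y v)"
  using assms by (auto simp: in_chart_cmap of_chart_fderiv_transition transition_cmap[OF atlas_is_chart])

lemma metric_on_in_chart:
  assumes g: "riemannian_metric M g" and c: "c \<in> atlas M"
  shows "metric_on (cimage c) (in_chart M g c)"
  unfolding metric_on_def
proof (intro conjI ballI allI)
  show "open (cimage c)" by (rule open_cimage[OF atlas_is_chart[OF c]])
  show "smooth_on (cimage c) (\<lambda>y. in_chart M g c y u v)" for u v using g c by (simp add: riemannian_metric_def)
  fix y assume "y \<in> cimage c"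
  then obtain p where p: "p \<in> cdom c" "y = cmap c p" by auto
  then have gp: "bilinear (g p)" "g p u v = g p v u" "u \<noteq> 0 \<Longrightarrow> 0 < g p u u" for u v
    using g cdom_subset_points[OF c] by (auto simp: riemannian_metric_def)
  interpret L: linear "of_chart M c p" by (rule linear_of_chart[OF c p(1)])
  have e: "in_chart M g c y = (\<lambda>u v. g p (of_chart M c p u) (of_chart M c p v))"
    by (intro ext) (simp add: p(2) in_chart_cmap[OF c p(1)])
  have "of_chart M c p u \<noteq> 0" if "u \<noteq> 0" for u
    using to_chart_inverse[OF c p(1), of u] linear_0[OF linear_to_chart[OF c p(1)]] that by auto
  then show "inner_product (in_chart M g c y)"
    using gp by (auto simp: inner_product_def e bilinear_def linear_iff L.add L.scale)
qed

lemma inner_product_metric: "riemannian_metric M g \<Longrightarrow> p \<in> points M \<Longrightarrow> inner_product (g p)"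
  by (simp add: riemannian_metric_def inner_product_def)

lemma christoffel_eq:
  assumes g: "riemannian_metric M g" and p: "p \<in> points M"
  shows "christoffel M g p u v = chr (in_chart M g (chart_at M p)) (cmap (chart_at M p) p) u v"
proof -
  let ?c = "chart_at M p"
  have "chr (in_chart M g ?c) (cmap ?c p) u v = (THE z. \<forall>w. 2 * in_chart M g ?c (cmap ?c p) z w = koszul (in_chart M g ?c) (cmap ?c p) u v w)"
    by (rule chr_eq_THE[OF metric_on_in_chart[OF g], symmetric]) (use chart_at[OF p] in auto)
  then show ?thesis by (simp add: christoffel_def Let_def koszul_def in_chart_chart_at[OF p])
qed

end

section \<open>Traces under linear isomorphisms\<close>

lemma trace_on_iso:
  fixes L :: "'e::euclidean_space \<Rightarrow> 'e" and Q :: "'e \<Rightarrow> 'e \<Rightarrow> 'v::real_vector"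
  assumes b: "inner_product b" and b': "inner_product b'" and L: "linear L" "bij L" and Q: "bilinear Q"
    and eq: "\<And>u v. b' u v = b (L u) (L v)"
  shows "trace_on b UNIV Q = trace_on b' UNIV (\<lambda>u v. Q (L u) (L v))"
proof -
  let ?F = "frame b' UNIV"
  have F: "orthonormal_basis b' UNIV ?F" by (rule orthonormal_basis_frame[OF b' subspace_UNIV])
  have inj: "inj L" using L(2) by (rule bij_is_inj)
  have "orthonormal_basis b UNIV (L ` ?F)"
    unfolding orthonormal_basis_def
  proof (intro conjI ballI)
    show "span (L ` ?F) = UNIV"
      using F L linear_span_image[OF L(1)] by (simp add: orthonormal_basis_def bij_is_surj)
    fix u v assume "u \<in> L ` ?F" "v \<in> L ` ?F"
    then show "b u v = (if u = v then 1 else 0)"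
      using F inj by (auto simp: orthonormal_basis_def eq inj_eq)
  qed
  from trace_on_orthonormal_basis[OF b Q this subspace_UNIV] show ?thesis
    using inj by (simp add: trace_on_def sum.reindex inj_on_subset)
qed

text \<open>Seen as a trace of traces, the norm inherits independence of the basis and smoothness
  from the single trace, one slot at a time.\<close>

lemma form2_norm_sq_trace:
  assumes "bilinear \<beta>"
  shows "form2_norm_sq b \<beta> = 1/2 * trace_on b UNIV (\<lambda>u u'. trace_on b UNIV (\<lambda>v v'. \<beta> u v * \<beta> u' v'))"
  by (simp add: form2_norm_sq_def trace_on_def fact_2)

lemma bilinear_trace_inner:
  fixes \<beta> :: "'e::euclidean_space \<Rightarrow> 'e \<Rightarrow> real"
  assumes "bilinear \<beta>"
  shows "bilinear (\<lambda>u u'. trace_on b UNIV (\<lambda>v v'. \<beta> u v * \<beta> u' v'))" "bilinear (\<lambda>v v'. \<beta> u v * \<beta> u' v')"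
  using assms by (auto simp: bilinear_def linear_iff trace_on_def algebra_simps sum.distrib sum_distrib_left)

lemma form2_norm_sq_iso:
  fixes L :: "'e::euclidean_space \<Rightarrow> 'e"
  assumes b: "inner_product b" and b': "inner_product b'" and L: "linear L" "bij L" and \<beta>: "bilinear \<beta>"
    and eq: "\<And>u v. b' u v = b (L u) (L v)"
  shows "form2_norm_sq b \<beta> = form2_norm_sq b' (\<lambda>u v. \<beta> (L u) (L v))"
proof -
  have "trace_on b UNIV (\<lambda>v v'. \<beta> u v * \<beta> u' v') = trace_on b' UNIV (\<lambda>v v'. \<beta> u (L v) * \<beta> u' (L v'))" for u u'
    by (rule trace_on_iso[OF b b' L bilinear_trace_inner(2)[OF \<beta>] eq])
  moreover have "form2_norm_sq b \<beta> = 1/2 * trace_on b' UNIV (\<lambda>u u'. trace_on b UNIV (\<lambda>v v'. \<beta> (L u) v * \<beta> (L u') v'))"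
    unfolding form2_norm_sq_trace[OF \<beta>] by (simp add: trace_on_iso[OF b b' L bilinear_trace_inner(1)[OF \<beta>] eq])
  moreover have "bilinear (\<lambda>u v. \<beta> (L u) (L v))"
    using \<beta> L(1) by (auto simp: bilinear_def linear_iff)
  ultimately show ?thesis by (simp add: form2_norm_sq_trace)
qed

section \<open>Change of variables\<close>

text \<open>The library's change of variables theorem needs a well-ordered index type. Any finite index type is
  in bijection with the following well-ordered copy of itself.\<close>

typedef 'a wo = "UNIV :: 'a set" ..

lemma bij_Abs_wo: "bij (Abs_wo :: 'a \<Rightarrow> 'a wo)"
  by (metis Abs_wo_inverse Rep_wo_inverse UNIV_I bij_betw_byWitness subset_UNIV)

lemma Rep_Abs_wo [simp]: "Rep_wo (Abs_wo x) = x"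
  by (simp add: Abs_wo_inverse)

instantiation wo :: (finite) "{finite, wellorder}"
begin

definition less_eq_wo :: "'a wo \<Rightarrow> 'a wo \<Rightarrow> bool" where
  "x \<le> y \<longleftrightarrow> to_nat (Rep_wo x) \<le> to_nat (Rep_wo y)"

definition less_wo :: "'a wo \<Rightarrow> 'a wo \<Rightarrow> bool" where
  "x < y \<longleftrightarrow> to_nat (Rep_wo x) < to_nat (Rep_wo y)"

instance
proof
  have "range (Abs_wo :: 'a \<Rightarrow> 'a wo) = UNIV" by (rule bij_is_surj[OF bij_Abs_wo])
  moreover have "finite (range (Abs_wo :: 'a \<Rightarrow> 'a wo))" by simp
  ultimately show "finite (UNIV :: 'a wo set)" by (simp only:)
  fix P and a :: "'a wo"
  assume P: "\<And>x :: 'a wo. (\<And>y. y < x \<Longrightarrow> P y) \<Longrightarrow> P x"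
  show "P a"
    by (induction "to_nat (Rep_wo a)" arbitrary: a rule: less_induct) (use P less_wo_def in blast)
qed (auto simp: less_eq_wo_def less_wo_def Rep_wo_inject)

end

text \<open>Rows and columns are renamed by the same bijection, which conjugates the permutations in
  the Leibniz sum and preserves their signs.\<close>

lemma det_reindex_wo:
  fixes A :: "real^'n^'n"
  shows "det (\<chi> i j. A $ Rep_wo i $ Rep_wo j :: real^'n wo^'n wo) = det A"
proof -
  let ?m = "map_permutation UNIV (Abs_wo :: 'n \<Rightarrow> 'n wo)"
  have inj: "inj (Abs_wo :: 'n \<Rightarrow> 'n wo)" and surj: "range (Abs_wo :: 'n \<Rightarrow> 'n wo) = UNIV"
    using bij_Abs_wo bij_is_inj bij_is_surj by auto
  have m: "?m q (Abs_wo i) = Abs_wo (q i)" if "q permutes UNIV" for q i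
    using map_permutation_apply[OF inj, of i q] by simp
  have bij: "bij_betw ?m {q. q permutes UNIV} {p. p permutes UNIV}"
  proof -
    have "?m q = (\<lambda>x. if x \<in> UNIV then Abs_wo (q (inv_into UNIV Abs_wo x)) else x)" for q
      by (auto simp: map_permutation_def restrict_id_def surj)
    then have "?m = (\<lambda>q x. if x \<in> UNIV then Abs_wo (q (inv_into UNIV Abs_wo x)) else x)" by (rule ext)
    then show ?thesis using bij_betw_permutations[of Abs_wo "UNIV :: 'n set" UNIV] bij_Abs_wo by simp
  qed
  have "det (\<chi> i j. A $ Rep_wo i $ Rep_wo j :: real^'n wo^'n wo)
      = (\<Sum>p | p permutes UNIV. of_int (sign p) * (\<Prod>i\<in>UNIV. A $ Rep_wo i $ Rep_wo (p i)))"
    by (simp add: det_def)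
  also have "\<dots> = (\<Sum>q | q permutes UNIV. of_int (sign (?m q)) * (\<Prod>i\<in>UNIV. A $ Rep_wo i $ Rep_wo (?m q i)))"
    by (rule sum.reindex_bij_betw[OF bij, symmetric])
  also have "\<dots> = (\<Sum>q | q permutes UNIV. of_int (sign q) * (\<Prod>i\<in>UNIV. A $ i $ q i))"
  proof (rule sum.cong[OF refl])
    fix q :: "'n \<Rightarrow> 'n" assume "q \<in> {q. q permutes UNIV}"
    then have q: "q permutes UNIV" by simp
    have "(\<Prod>i\<in>UNIV. A $ Rep_wo i $ Rep_wo (?m q i)) = (\<Prod>i\<in>UNIV. A $ Rep_wo (Abs_wo i) $ Rep_wo (?m q (Abs_wo i)))"
      by (rule prod.reindex_bij_betw[OF bij_Abs_wo, symmetric])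
    then show "of_int (sign (?m q)) * (\<Prod>i\<in>UNIV. A $ Rep_wo i $ Rep_wo (?m q i)) = of_int (sign q) * (\<Prod>i\<in>UNIV. A $ i $ q i)"
      by (simp add: sign_map_permutation[OF inj q] m[OF q])
  qed
  finally show ?thesis by (simp add: det_def)
qed

text \<open>Functions are kept total and vanish outside some ball, so that integrals over
  \<open>UNIV\<close> exist and can be added, translated and reindexed without tracking
  domains.\<close>

definition compact_supported :: "('a::euclidean_space \<Rightarrow> real) \<Rightarrow> bool" where
  "compact_supported F \<longleftrightarrow> continuous_on UNIV F \<and> (\<exists>R. \<forall>x. R < norm x \<longrightarrow> F x = 0)"

lemma compact_supported_cbox:
  assumes "compact_supported F"
  obtains a b where "\<And>x. x \<notin> cbox a b \<Longrightarrow> F x = 0"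
proof -
  obtain R where R: "\<And>x. R < norm x \<Longrightarrow> F x = 0" using assms by (auto simp: compact_supported_def)
  obtain a where "cball (0 :: 'a) R \<subseteq> cbox (-a) a" using bounded_subset_cbox_symmetric[OF bounded_cball] by blast
  then show ?thesis using R by (intro that[of "-a" a]) (auto simp: subset_iff not_le[symmetric])
qed

lemma compact_supported_integrable:
  assumes "compact_supported F"
  shows "F absolutely_integrable_on UNIV" "F integrable_on UNIV"
proof -
  obtain a b where ab: "\<And>x. x \<notin> cbox a b \<Longrightarrow> F x = 0" by (rule compact_supported_cbox[OF assms]) blast
  then have "(\<lambda>x. if x \<in> cbox a b then F x else 0) = F" by auto
  moreover have "F absolutely_integrable_on cbox a b"
    using assms by (intro absolutely_integrable_continuous) (auto simp: compact_supported_def intro: continuous_on_subset)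
  ultimately show 1: "F absolutely_integrable_on UNIV"
    using absolutely_integrable_restrict_UNIV[of "cbox a b" F] by simp
  show "F integrable_on UNIV" using set_lebesgue_integral_eq_integral(1)[OF 1] .
qed

text \<open>The open sets S and - K cover the space, and on their overlap both formulas give
  0.\<close>

lemma compact_supportedI:
  assumes S: "open S" and K: "compact K" "K \<subseteq> S" and f: "continuous_on S f" "\<And>x. x \<in> S - K \<Longrightarrow> f x = 0"
  shows "compact_supported (\<lambda>x. if x \<in> S then f x else 0)"
  unfolding compact_supported_def
proof
  have "continuous_on (S \<union> - K) (\<lambda>x. if x \<in> S then f x else 0)"
  proof (rule continuous_on_open_Un[OF S])
    show "open (- K)" using K compact_imp_closed by blast
    show "continuous_on S (\<lambda>x. if x \<in> S then f x else 0)" using f(1) by (simp cong: continuous_on_cong)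
    have "continuous_on (- K) (\<lambda>x. 0 :: real)" by simp
    then show "continuous_on (- K) (\<lambda>x. if x \<in> S then f x else 0)"
      by (rule continuous_on_eq) (use f(2) in auto)
  qed
  moreover have "S \<union> - K = UNIV" using K by auto
  ultimately show "continuous_on UNIV (\<lambda>x. if x \<in> S then f x else 0)" by simp
  obtain R where "\<And>x. x \<in> K \<Longrightarrow> norm x \<le> R" using compact_imp_bounded[OF K(1)] by (auto simp: bounded_iff)
  then show "\<exists>R. \<forall>x. R < norm x \<longrightarrow> (if x \<in> S then f x else 0) = 0"
    using f(2) by (intro exI[of _ R]) (metis DiffI not_le)
qed

text \<open>Renaming coordinates takes boxes to boxes of the same volume, so
  \<open>has_integral_twiddle\<close> applies with factor 1. A box outside which F vanishes mediates
  between the whole space and bounded domains.\<close>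

lemma integral_reindex_wo:
  fixes F :: "real^'n \<Rightarrow> real"
  assumes F: "compact_supported F"
  shows "integral UNIV (\<lambda>x :: real^'n wo. F (\<chi> i. x $ Abs_wo i)) = integral UNIV F"
proof -
  let ?Q = "\<lambda>x :: real^'n wo. \<chi> i. x $ Abs_wo i" and ?P = "\<lambda>x :: real^'n. \<chi> i. x $ Rep_wo i"
  obtain a b where ab: "\<And>x. x \<notin> cbox a b \<Longrightarrow> F x = 0" by (rule compact_supported_cbox[OF F]) blast
  have PQ [simp]: "?P (?Q x) = x" "?Q (?P z) = z" for x z by (simp_all add: Rep_wo_inverse)
  have Q: "?Q ` cbox u v = cbox (?Q u) (?Q v)" for u v
  proof
    show "cbox (?Q u) (?Q v) \<subseteq> ?Q ` cbox u v"
    proof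
      fix z assume "z \<in> cbox (?Q u) (?Q v)"
      then have "u $ Abs_wo i \<le> z $ i" "z $ i \<le> v $ Abs_wo i" for i by (auto simp: mem_box_cart)
      then have "?P z \<in> cbox u v" by (simp add: mem_box_cart) (metis Rep_wo_inverse)
      then show "z \<in> ?Q ` cbox u v" by (rule image_eqI[of _ _ "?P z", rotated]) (simp add: vec_eq_iff)
    qed
  qed (auto simp: mem_box_cart)
  have P: "?P ` cbox u v = cbox (?P u) (?P v)" for u v
  proof
    show "cbox (?P u) (?P v) \<subseteq> ?P ` cbox u v"
    proof
      fix z assume "z \<in> cbox (?P u) (?P v)"
      then have "u $ Rep_wo i \<le> z $ i" "z $ i \<le> v $ Rep_wo i" for i by (auto simp: mem_box_cart)
      then have "?Q z \<in> cbox u v" by (simp add: mem_box_cart) (metis Rep_Abs_wo)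
      then show "z \<in> ?P ` cbox u v" by (rule image_eqI[of _ _ "?Q z", rotated]) (simp add: Rep_wo_inverse)
    qed
  qed (auto simp: mem_box_cart)
  have "measure lborel (?Q ` cbox u v) = 1 * measure lborel (cbox u v)" for u v
  proof (cases "cbox u v = {}")
    case False
    then have "cbox (?Q u) (?Q v) \<noteq> {}" using Q by (metis image_is_empty)
    then have "measure lborel (cbox (?Q u) (?Q v)) = (\<Prod>i\<in>UNIV. v $ Abs_wo i - u $ Abs_wo i)"
      by (simp add: content_cbox_cart)
    also have "\<dots> = (\<Prod>i\<in>UNIV. v $ i - u $ i)" by (rule prod.reindex_bij_betw[OF bij_Abs_wo])
    finally show ?thesis using False by (simp add: Q content_cbox_cart)
  qed simp
  moreover have "isCont ?Q x" for x
    by (intro linear_continuous_at) (simp add: linear_iff vec_eq_iff flip: linear_conv_bounded_linear)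
  moreover have "(F has_integral integral (cbox a b) F) (cbox a b)"
    using compact_supported_integrable(2)[OF F] integrable_on_subcbox by (intro integrable_integral) blast
  ultimately have "((\<lambda>x. F (?Q x)) has_integral (1 / 1) *\<^sub>R integral (cbox a b) F) (?P ` cbox a b)"
    using P Q PQ by (intro has_integral_twiddle[of 1]) auto
  then have 1: "integral (?P ` cbox a b) (\<lambda>x. F (?Q x)) = integral (cbox a b) F" by (simp add: integral_unique)
  have "x \<in> ?P ` cbox a b" if "F (?Q x) \<noteq> 0" for x
    using ab[of "?Q x"] that by (intro image_eqI[of _ _ "?Q x"]) (auto simp: Rep_wo_inverse)
  then have "(\<lambda>x. if x \<in> ?P ` cbox a b then F (?Q x) else 0) = (\<lambda>x. F (?Q x))"
    by (intro ext) (metis (no_types, lifting))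
  then have "integral (?P ` cbox a b) (\<lambda>x. F (?Q x)) = integral UNIV (\<lambda>x. F (?Q x))"
    using integral_restrict_UNIV[of "?P ` cbox a b" "\<lambda>x. F (?Q x)"] by simp
  moreover have "(\<lambda>x. if x \<in> cbox a b then F x else 0) = F" using ab by auto
  then have "integral (cbox a b) F = integral UNIV F"
    using integral_restrict_UNIV[of "cbox a b" F] by simp
  ultimately show ?thesis using 1 by simp
qed

lemma integral_change_of_variables_wo:
  fixes F :: "real^'n::{finite,wellorder} \<Rightarrow> real"
  assumes S: "open S" and T: "\<And>x. x \<in> S \<Longrightarrow> (T has_derivative T' x) (at x)" "inj_on T S"
    and F: "compact_supported F" "\<And>x. x \<notin> T ` S \<Longrightarrow> F x = 0"
  shows "integral UNIV F = integral S (\<lambda>x. \<bar>det (matrix (T' x))\<bar> * F (T x))"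
proof -
  have e: "(\<lambda>x. if x \<in> T ` S then F x else 0) = F" using F(2) by auto
  \<comment> \<open>The change of variables theorem is stated for vector-valued integrands; the
    values are embedded in \<open>real^1\<close> and read off again as components.\<close>
  define f where "f x = (vec (F x) :: real^1)" for x
  have F': "F absolutely_integrable_on (T ` S)"
    using compact_supported_integrable(1)[OF F(1)] absolutely_integrable_restrict_UNIV[of "T ` S" F] e by simp
  have fi: "f absolutely_integrable_on (T ` S)"
    by (subst absolutely_integrable_componentwise_iff) (use F' in \<open>simp add: Basis_vec_def inner_axis f_def\<close>)
  have cv: "(\<lambda>x. \<bar>det (matrix (T' x))\<bar> *\<^sub>R f (T x)) absolutely_integrable_on S \<and>
           integral S (\<lambda>x. \<bar>det (matrix (T' x))\<bar> *\<^sub>R f (T x)) = integral (T ` S) f"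
    using has_absolute_integral_change_of_variables[of S T T' f "integral (T ` S) f"] S T fi
    by (auto intro: has_derivative_at_withinI)
  have comp: "integral A g $ 1 = integral A (\<lambda>x. g x $ 1)" if "g absolutely_integrable_on A" for g :: "(real, 'n) vec \<Rightarrow> real^1" and A
    using integral_component_eq_cart[OF set_lebesgue_integral_eq_integral(1)[OF that], of 1] by simp
  have "integral UNIV F = integral (T ` S) F" using integral_restrict_UNIV[of "T ` S" F] e by simp
  also have "\<dots> = integral (T ` S) f $ 1" by (simp add: comp[OF fi] f_def)
  also have "\<dots> = integral S (\<lambda>x. \<bar>det (matrix (T' x))\<bar> *\<^sub>R f (T x)) $ 1" using cv by simp
  also have "\<dots> = integral S (\<lambda>x. \<bar>det (matrix (T' x))\<bar> * F (T x))" using comp[OF conjunct1[OF cv]] by (simp add: f_def)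
  finally show ?thesis .
qed

text \<open>Conjugate T with the renaming of coordinates and apply the well-ordered version.
  Assumption \<open>FT\<close> allows the integral on the right to be renamed back.\<close>

lemma integral_change_of_variables_finite:
  fixes F :: "real^'n \<Rightarrow> real"
  assumes S: "open S" and T: "\<And>x. x \<in> S \<Longrightarrow> (T has_derivative T' x) (at x)" "inj_on T S"
    and F: "compact_supported F" "\<And>x. x \<notin> T ` S \<Longrightarrow> F x = 0"
    and FT: "compact_supported (\<lambda>x. if x \<in> S then \<bar>det (matrix (T' x))\<bar> * F (T x) else 0)"
  shows "integral UNIV F = integral S (\<lambda>x. \<bar>det (matrix (T' x))\<bar> * F (T x))"
proof -
  let ?Q = "\<lambda>x :: real^'n wo. \<chi> i. x $ Abs_wo i" and ?P = "\<lambda>x :: real^'n. \<chi> i. x $ Rep_wo i"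
  have PQ [simp]: "?P (?Q x) = x" "?Q (?P z) = z" for x z by (simp_all add: Rep_wo_inverse)
  have Q: "bounded_linear ?Q" and P: "bounded_linear ?P"
    by (simp_all add: linear_iff vec_eq_iff flip: linear_conv_bounded_linear)
  define S' where "S' = ?Q -` S"
  define T1 where "T1 x = ?P (T (?Q x))" for x
  define T1' where "T1' x = (\<lambda>u. ?P (T' (?Q x) (?Q u)))" for x
  have cQ: "compact_supported (\<lambda>x. H (?Q x))" if H: "compact_supported H" for H
  proof -
    obtain R where R: "\<forall>x. R < norm x \<longrightarrow> H x = 0" using H unfolding compact_supported_def by blast
    obtain B where B: "B > 0" "\<And>x. norm (?P x) \<le> norm x * B" using bounded_linear.pos_bounded[OF P] by blast
    have "H (?Q x) = 0" if "B * R < norm x" for x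
    proof -
      have "B * R < B * norm (?Q x)" using B(2)[of "?Q x"] that unfolding PQ by (simp add: mult.commute)
      then show ?thesis using R B(1) by simp
    qed
    moreover have "continuous_on UNIV (\<lambda>x. H (?Q x))"
      using H linear_continuous_on[OF Q] by (auto simp: compact_supported_def intro!: continuous_on_compose2[of UNIV H])
    ultimately show ?thesis unfolding compact_supported_def by blast
  qed
  have "open S'" unfolding S'_def by (intro open_vimage S linear_continuous_on Q)
  moreover have "(T1 has_derivative T1' x) (at x)" if "x \<in> S'" for x
  proof -
    have "((\<lambda>x. T (?Q x)) has_derivative (\<lambda>u. T' (?Q x) (?Q u))) (at x)"
      using that T(1) by (intro has_derivative_compose[OF bounded_linear_imp_has_derivative[OF Q]]) (auto simp: S'_def)
    from has_derivative_compose[OF this bounded_linear_imp_has_derivative[OF P]] show ?thesis by (simp add: T1_def[abs_def] T1'_def)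
  qed
  moreover have "inj_on T1 S'"
    using T(2) unfolding inj_on_def T1_def S'_def by (metis PQ vimageD)
  moreover have "F (?Q x) = 0" if "x \<notin> T1 ` S'" for x
  proof (rule F(2), rule notI)
    assume "?Q x \<in> T ` S"
    then obtain z where z: "z \<in> S" "?Q x = T z" by auto
    then have "x = T1 (?P z)" "?P z \<in> S'" by (simp_all add: T1_def S'_def Rep_wo_inverse flip: z(2))
    then show False using that by blast
  qed
  ultimately have "integral UNIV (\<lambda>x. F (?Q x)) = integral S' (\<lambda>x. \<bar>det (matrix (T1' x))\<bar> * F (?Q (T1 x)))"
    by (intro integral_change_of_variables_wo cQ F(1))
  moreover have "det (matrix (T1' x)) = det (matrix (T' (?Q x)))" for x
  proof -
    have "?Q (axis j 1) = axis (Rep_wo j) 1" for j by (auto simp: axis_def vec_eq_iff Rep_wo_inverse)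
    then have "matrix (T1' x) = (\<chi> i j. matrix (T' (?Q x)) $ Rep_wo i $ Rep_wo j)"
      by (simp add: matrix_def T1'_def)
    then show ?thesis by (simp add: det_reindex_wo)
  qed
  moreover have "?Q (T1 x) = T (?Q x)" for x by (simp add: T1_def)
  ultimately have "integral UNIV F = integral S' (\<lambda>x. \<bar>det (matrix (T' (?Q x)))\<bar> * F (T (?Q x)))"
    using integral_reindex_wo[OF F(1)] by simp
  also have "\<dots> = integral UNIV (\<lambda>x. if ?Q x \<in> S then \<bar>det (matrix (T' (?Q x)))\<bar> * F (T (?Q x)) else 0)"
    by (subst integral_restrict_UNIV[of S', symmetric]) (simp add: S'_def)
  also have "\<dots> = integral UNIV (\<lambda>x. if x \<in> S then \<bar>det (matrix (T' x))\<bar> * F (T x) else 0)"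
    by (rule integral_reindex_wo[OF FT])
  finally show ?thesis using integral_restrict_UNIV[of S] by simp
qed

section \<open>Bump functions\<close>

text \<open>A family rather than the single function exp(-1/t): differentiation produces powers of
  1/t, and the family is closed under it up to linear combinations, so that one induction gives
  smoothness of all members.\<close>

definition flat :: "nat \<Rightarrow> real \<Rightarrow> real" where
  "flat n t = (if 0 < t then (1 / t) ^ n * exp (- (1 / t)) else 0)"

lemma flat_nonneg: "0 \<le> flat n t"
  by (simp add: flat_def)

text \<open>With m = n + 2 and x = 1/t, raising x/m \<le> exp(x/m) to the m-th power bounds x^m
  exp(-x) by m^m. The two surplus powers of x become the factor t^2, enough for the difference
  quotient at 0 to vanish in the limit.\<close>

lemma flat_le: "flat n t \<le> real (n + 2) ^ (n + 2) * t\<^sup>2"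
proof (cases "0 < t")
  case True
  define m x where "m = n + 2" and "x = 1 / t"
  have x: "0 < x" and m: "0 < real m" using True by (auto simp: x_def m_def)
  have "x / m \<le> exp (x / m)" using exp_ge_add_one_self[of "x / m"] by linarith
  then have "(x / m) ^ m \<le> exp (x / m) ^ m" using x m by (intro power_mono) auto
  also have "exp (x / m) ^ m = exp x" using m by (simp flip: exp_of_nat_mult)
  finally have "x ^ m \<le> real m ^ m * exp x" using m by (simp add: power_divide field_simps)
  then have "x ^ m * exp (- x) \<le> real m ^ m" by (simp add: exp_minus field_simps)
  then have "x ^ m * exp (- x) * t\<^sup>2 \<le> real m ^ m * t\<^sup>2" by (rule mult_right_mono) simp
  then have "x ^ m * t\<^sup>2 * exp (- x) \<le> real m ^ m * t\<^sup>2" by (simp only: mult_ac)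
  moreover have "x ^ m * t\<^sup>2 = x ^ n" using True by (simp add: m_def x_def power_add power_divide power2_eq_square)
  moreover have "flat n t = x ^ n * exp (- x)" using True by (simp add: flat_def x_def)
  ultimately have "flat n t \<le> real m ^ m * t\<^sup>2" by (simp only:)
  then show ?thesis by (simp only: m_def)
qed (simp add: flat_def)

lemma DERIV_flat: "(flat n has_real_derivative flat (n + 2) t - n * flat (n + 1) t) (at t)"
proof -
  consider "t < 0" | "t = 0" | "0 < t" by linarith
  then show ?thesis
  proof cases
    case 1
    have "((\<lambda>_. 0) has_real_derivative 0) (at t)" by simp
    moreover have "\<forall>\<^sub>F s in nhds t. flat n s = 0"
      using eventually_nhds_in_open[of "{..<0}" t] 1 by (auto simp: flat_def elim!: eventually_mono)
    ultimately show ?thesis using 1 DERIV_eventually_cong[of "\<lambda>_. 0"] by (simp add: flat_def)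
  next
    case 2
    define C where "C = real (n + 2) ^ (n + 2)"
    have "((\<lambda>h. flat n h / h) \<longlongrightarrow> 0) (at 0)"
    proof (rule Lim_null_comparison[where g = "\<lambda>h. C * \<bar>h\<bar>"])
      show "\<forall>\<^sub>F h in at 0. norm (flat n h / h) \<le> C * \<bar>h\<bar>"
      proof (rule always_eventually, rule allI)
        fix h
        show "norm (flat n h / h) \<le> C * \<bar>h\<bar>"
        proof (cases "0 < h")
          case True
          then have "flat n h / h \<le> C * h" "0 \<le> flat n h / h"
            using flat_le[of n h] flat_nonneg[of n h] by (simp_all add: C_def divide_le_eq power2_eq_square mult_ac)
          then show ?thesis using True by simp
        next
          case False
          have "0 \<le> C * \<bar>h\<bar>" by (simp add: C_def)
          then show ?thesis using False by (simp add: flat_def)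
        qed
      qed
      show "((\<lambda>h. C * \<bar>h\<bar>) \<longlongrightarrow> 0) (at 0)" by (auto intro!: tendsto_eq_intros)
    qed
    then show ?thesis using 2 by (simp add: DERIV_def flat_def)
  next
    case 3
    define x where "x = 1 / t"
    have h: "((\<lambda>s. 1 / s) has_real_derivative - (x * x)) (at t)"
      using 3 by (auto intro!: derivative_eq_intros simp: x_def power2_eq_square)
    have "((\<lambda>s. (1 / s) ^ n * exp (- (1 / s))) has_real_derivative
        n * (- (x * x) * (1 / t) ^ (n - Suc 0)) * exp (- (1 / t)) + (exp (- (1 / t)) * - (- (x * x))) * (1 / t) ^ n) (at t)"
      by (intro DERIV_mult DERIV_power DERIV_fun_exp DERIV_minus h)
    moreover have "n * (- (x * x) * x ^ (n - Suc 0)) * exp (- x) + (exp (- x) * - (- (x * x))) * x ^ n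
        = x ^ (n + 2) * exp (- x) - n * (x ^ (n + 1) * exp (- x))"
      by (cases n) (simp_all add: algebra_simps)
    ultimately have "((\<lambda>s. (1 / s) ^ n * exp (- (1 / s))) has_real_derivative
        (1 / t) ^ (n + 2) * exp (- (1 / t)) - n * ((1 / t) ^ (n + 1) * exp (- (1 / t)))) (at t)"
      by (simp only: x_def)
    moreover have "\<forall>\<^sub>F s in nhds t. flat n s = (1 / s) ^ n * exp (- (1 / s))"
      using eventually_nhds_in_open[of "{0<..}" t] 3 by (auto simp: flat_def elim!: eventually_mono)
    ultimately show ?thesis using 3 DERIV_eventually_cong by (simp add: flat_def)
  qed
qed

lemma smooth_on_flat: "smooth_on UNIV (flat n)"
proof -
  have "Ck_on k UNIV (flat n)" for k
  proof (induction k arbitrary: n)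
    case 0
    have "isCont (flat n) t" for t using DERIV_flat DERIV_isCont by blast
    then show ?case by (simp add: continuous_at_imp_continuous_on)
  next
    case (Suc k)
    show ?case
    proof (rule Ck_on_SucI[where f' = "\<lambda>t v. v * (flat (n + 2) t + (- n) * flat (n + 1) t)"])
      show "(flat n has_derivative (\<lambda>v. v * (flat (n + 2) t + (- n) * flat (n + 1) t))) (at t)" for t
        using DERIV_flat[of n t] by (simp add: has_field_derivative_def mult.commute[of _ "_ - _"] mult_commute_abs)
      show "Ck_on k UNIV (\<lambda>t. v * (flat (n + 2) t + (- n) * flat (n + 1) t))" for v
        by (intro Ck_on_bounded_bilinear[OF bounded_bilinear_mult] Ck_on_add Ck_on_const Suc open_UNIV)
    qed simp
  qed
  then show ?thesis by (simp add: smooth_on_def)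
qed

lemma bump_exists:
  fixes a :: "'a::euclidean_space"
  assumes "0 < r"
  shows "\<exists>\<psi> :: 'a \<Rightarrow> real. smooth_on UNIV \<psi> \<and> (\<forall>x. 0 \<le> \<psi> x) \<and> 0 < \<psi> a \<and> (\<forall>x. x \<notin> cball a r \<longrightarrow> \<psi> x = 0)"
proof (intro exI conjI allI impI)
  let ?\<psi> = "\<lambda>x. flat 0 (r\<^sup>2 - (x - a) \<bullet> (x - a))"
  show "smooth_on UNIV ?\<psi>"
    by (intro smooth_on_compose[OF smooth_on_flat] smooth_intros) auto
  show "0 \<le> ?\<psi> x" for x by (rule flat_nonneg)
  show "0 < ?\<psi> a" using assms by (simp add: flat_def)
  show "?\<psi> x = 0" if "x \<notin> cball a r" for x
  proof -
    have "r < norm (x - a)" using that by (simp add: dist_norm norm_minus_commute)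
    then have "r\<^sup>2 < (norm (x - a))\<^sup>2" using assms by (intro power_strict_mono) auto
    then show ?thesis by (simp add: flat_def dot_square_norm)
  qed
qed

section \<open>Smooth functions on a manifold\<close>

lemma continuous_map_cinv:
  assumes "is_chart X c"
  shows "continuous_map (top_of_set (cimage c)) X (cinv c)"
proof -
  obtain i where i: "homeomorphic_maps (subtopology X (cdom c)) (top_of_set (cimage c)) (cmap c) i"
    using assms homeomorphic_map_maps unfolding is_chart_def by blast
  have ts: "topspace (subtopology X (cdom c)) = cdom c" using openin_subset[OF openin_cdom[OF assms]] by auto
  have "i y = cinv c y" if "y \<in> cimage c" for y
    using i that ts cinv_cmap[OF assms] by (auto simp: homeomorphic_maps_def)
  moreover have "continuous_map (top_of_set (cimage c)) X i"
    using i continuous_map_into_fulltopology unfolding homeomorphic_maps_def by blast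
  ultimately show ?thesis using continuous_map_eq[of "top_of_set (cimage c)" X i "cinv c"] by simp
qed

lemma continuous_map_cmap: "is_chart X c \<Longrightarrow> continuous_map (subtopology X (cdom c)) euclidean (cmap c)"
  using homeomorphic_imp_continuous_map continuous_map_into_fulltopology unfolding is_chart_def by blast

lemma compact_chart_image:
  assumes "is_chart X c" "compactin X K" "K \<subseteq> cdom c"
  shows "compact (cmap c ` K)"
proof -
  have "compactin (subtopology X (cdom c)) K" using assms by (simp add: compactin_subtopology)
  from image_compactin[OF this continuous_map_cmap[OF assms(1)]] show ?thesis by (simp add: compactin_euclidean_iff)
qed

definition extend_zero :: "('a, 'e) chart \<Rightarrow> ('e \<Rightarrow> 'v::zero) \<Rightarrow> 'a \<Rightarrow> 'v" where
  "extend_zero c f q = (if q \<in> cdom c then f (cmap c q) else 0)"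

lemma bchoice2:
  assumes "\<forall>x\<in>S. \<exists>y z. Q x y z"
  shows "\<exists>f g. \<forall>x\<in>S. Q x (f x) (g x)"
proof -
  from bchoice[OF assms] obtain f where "\<forall>x\<in>S. \<exists>z. Q x (f x) z" ..
  from bchoice[OF this] obtain g where "\<forall>x\<in>S. Q x (f x) (g x)" ..
  then show ?thesis by blast
qed

context
  fixes M :: "('a, 'e::euclidean_space) manifold"
  assumes M: "smooth_manifold M"
begin

lemma smooth_fun_localI:
  assumes W: "openin (mtop M) W" and "\<And>p. p \<in> W \<Longrightarrow> \<exists>U. openin (mtop M) U \<and> p \<in> U \<and> smooth_fun M U f"
  shows "smooth_fun M W f"
  unfolding smooth_fun_def
proof (intro ballI smooth_on_local)
  fix c y assume c: "c \<in> atlas M" and "y \<in> cmap c ` (cdom c \<inter> W)"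
  then obtain p where p: "p \<in> cdom c" "p \<in> W" "y = cmap c p" by auto
  obtain U where U: "openin (mtop M) U" "p \<in> U" "smooth_fun M U f" using assms(2)[OF p(2)] by blast
  show "\<exists>V. open V \<and> y \<in> V \<and> smooth_on V (\<lambda>y. f (cinv c y))"
    using U p c open_chart_image[OF atlas_is_chart[OF M c] U(1)] by (intro exI[of _ "cmap c ` (cdom c \<inter> U)"]) (auto simp: smooth_fun_def)
qed

lemma smooth_fun_one_chart:
  assumes W: "openin (mtop M) W" and c: "c \<in> atlas M" "W \<subseteq> cdom c"
    and f: "smooth_on (cmap c ` W) (\<lambda>y. f (cinv c y))"
  shows "smooth_fun M W f"
  unfolding smooth_fun_def
proof
  fix d assume d: "d \<in> atlas M"
  have o: "open (cmap d ` (cdom d \<inter> W))" by (rule open_chart_image[OF atlas_is_chart[OF M d] W])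
  have "open (cmap c ` (cdom c \<inter> W))" by (rule open_chart_image[OF atlas_is_chart[OF M c(1)] W])
  moreover have "cdom c \<inter> W = W" using c by auto
  ultimately have oW: "open (cmap c ` W)" by simp
  have sub: "cmap d ` (cdom d \<inter> W) \<subseteq> overlap d c" using c by auto
  have tr: "transition d c y = cmap c (cinv d y)" for y by (simp add: transition_def)
  show "smooth_on (cmap d ` (cdom d \<inter> W)) (\<lambda>y. f (cinv d y))"
  proof (rule smooth_on_cong[OF smooth_on_compose[OF f smooth_on_subset[OF smooth_transition[OF M d c(1)] sub] o oW] o])
    show "transition d c y \<in> cmap c ` W" if "y \<in> cmap d ` (cdom d \<inter> W)" for y
      using that by (auto simp: transition_cmap[OF atlas_is_chart[OF M d]])
    show "f (cinv c (transition d c y)) = f (cinv d y)" if "y \<in> cmap d ` (cdom d \<inter> W)" for y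
      using that c(2) by (auto simp: tr cinv_cmap[OF atlas_is_chart[OF M d]] subset_iff cinv_cmap[OF atlas_is_chart[OF M c(1)]])
  qed
qed

lemma smooth_funD: "smooth_fun M W f \<Longrightarrow> c \<in> atlas M \<Longrightarrow> smooth_on (cmap c ` (cdom c \<inter> W)) (\<lambda>y. f (cinv c y))"
  by (simp add: smooth_fun_def)

lemma smooth_fun_cong:
  assumes f: "smooth_fun M W f" and W: "openin (mtop M) W" and eq: "\<And>p. p \<in> W \<Longrightarrow> f p = g p"
  shows "smooth_fun M W g"
  unfolding smooth_fun_def
proof
  fix c assume c: "c \<in> atlas M"
  show "smooth_on (cmap c ` (cdom c \<inter> W)) (\<lambda>y. g (cinv c y))"
  proof (rule smooth_on_cong[OF smooth_funD[OF f c] open_chart_image[OF atlas_is_chart[OF M c] W]])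
    fix y assume "y \<in> cmap c ` (cdom c \<inter> W)"
    then have "cinv c y \<in> W" unfolding chart_image_eq[OF atlas_is_chart[OF M c]] by simp
    then show "f (cinv c y) = g (cinv c y)" by (rule eq)
  qed
qed

text \<open>The chart domain and the complement of the closed set K cover the manifold; on the first
  the function is f in coordinates, on the second it is 0.\<close>

lemma smooth_fun_extend_zero:
  fixes f :: "'e \<Rightarrow> real"
  assumes c: "c \<in> atlas M" and K: "closedin (mtop M) K" "K \<subseteq> cdom c"
    and f: "smooth_on (cimage c) f" "\<And>p. p \<in> cdom c - K \<Longrightarrow> f (cmap c p) = 0"
  shows "smooth_fun M (points M) (extend_zero c f)"
proof (rule smooth_fun_localI)
  fix p assume p: "p \<in> points M"
  show "\<exists>U. openin (mtop M) U \<and> p \<in> U \<and> smooth_fun M U (extend_zero c f)"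
  proof (cases "p \<in> cdom c")
    case True
    have "smooth_on (cimage c) (\<lambda>y. extend_zero c f (cinv c y))"
      by (rule smooth_on_cong[OF f(1) open_cimage[OF atlas_is_chart[OF M c]]]) (auto simp: extend_zero_def cinv_cmap[OF atlas_is_chart[OF M c]])
    then show ?thesis using True smooth_fun_one_chart[OF openin_cdom[OF atlas_is_chart[OF M c]] c] openin_cdom[OF atlas_is_chart[OF M c]] by auto
  next
    case False
    have o: "openin (mtop M) (points M - K)" using K(1) by (simp add: openin_diff)
    have "smooth_fun M (points M - K) (\<lambda>_. 0)" by (simp add: smooth_fun_def smooth_on_const)
    then have "smooth_fun M (points M - K) (extend_zero c f)"
      by (rule smooth_fun_cong[OF _ o]) (use f(2) in \<open>auto simp: extend_zero_def\<close>)
    then show ?thesis using o p K(2) False by auto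
  qed
qed simp

lemma open_chart_points: "c \<in> atlas M \<Longrightarrow> open (cmap c ` (cdom c \<inter> points M))"
  using open_chart_image[OF atlas_is_chart[OF M]] by auto

lemma smooth_fun_binop:
  assumes f: "smooth_fun M W f" and g: "smooth_fun M W g" and W: "openin (mtop M) W"
  shows "smooth_fun M W (\<lambda>p. f p + g p)" "smooth_fun M W (\<lambda>p. f p * g p)"
    "(\<And>p. p \<in> W \<Longrightarrow> g p \<noteq> 0) \<Longrightarrow> smooth_fun M W (\<lambda>p. f p / g p)"
proof -
  show "smooth_fun M W (\<lambda>p. f p + g p)" "smooth_fun M W (\<lambda>p. f p * g p)"
    unfolding smooth_fun_def
    by (intro ballI smooth_intros open_chart_image[OF atlas_is_chart[OF M] W] smooth_funD[OF f] smooth_funD[OF g]; assumption)+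
  show "smooth_fun M W (\<lambda>p. f p / g p)" if nz: "\<And>p. p \<in> W \<Longrightarrow> g p \<noteq> 0"
    unfolding smooth_fun_def
  proof (intro ballI)
    fix c assume c: "c \<in> atlas M"
    have "g (cinv c y) \<noteq> 0" if "y \<in> cmap c ` (cdom c \<inter> W)" for y
      using that unfolding chart_image_eq[OF atlas_is_chart[OF M c]] by (intro nz) simp
    then show "smooth_on (cmap c ` (cdom c \<inter> W)) (\<lambda>y. f (cinv c y) / g (cinv c y))"
      by (rule smooth_on_divide[OF open_chart_image[OF atlas_is_chart[OF M c] W] smooth_funD[OF f c] smooth_funD[OF g c]])
  qed
qed

lemma smooth_fun_const: "smooth_fun M W (\<lambda>p. k)"
  by (simp add: smooth_fun_def smooth_on_const)

lemma smooth_fun_sum: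
  assumes "\<And>i. i \<in> I \<Longrightarrow> smooth_fun M W (f i)" "openin (mtop M) W"
  shows "smooth_fun M W (\<lambda>p. \<Sum>i\<in>I. f i p)"
  using assms(1) by (induction I rule: infinite_finite_induct) (auto intro: smooth_fun_const smooth_fun_binop(1)[OF _ _ assms(2)])

lemma continuous_map_chartsI:
  assumes f: "\<And>c. c \<in> atlas M \<Longrightarrow> continuous_on (cimage c) (\<lambda>y. f (cinv c y))"
  shows "continuous_map (mtop M) euclidean f"
  unfolding continuous_map_def
proof (intro conjI allI impI)
  fix V :: "'b set" assume V: "openin euclidean V"
  show "openin (mtop M) {p \<in> points M. f p \<in> V}"
  proof (subst openin_subopen, intro ballI)
    fix p assume p: "p \<in> {p \<in> points M. f p \<in> V}"
    let ?c = "chart_at M p"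
    have c: "?c \<in> atlas M" "p \<in> cdom ?c" using chart_at[OF M] p by auto
    let ?V = "cimage ?c \<inter> (\<lambda>y. f (cinv ?c y)) -` V"
    have "open ?V" using f[OF c(1)] V open_cimage[OF atlas_is_chart[OF M c(1)]] by (intro continuous_open_preimage) auto
    from openin_chart_vimage[OF atlas_is_chart[OF M c(1)] this]
    have "openin (mtop M) {q \<in> cdom ?c. f q \<in> V}"
      by (simp add: cinv_cmap[OF atlas_is_chart[OF M c(1)]] cong: conj_cong)
    then show "\<exists>T. openin (mtop M) T \<and> p \<in> T \<and> T \<subseteq> {p \<in> points M. f p \<in> V}"
      using c p cdom_subset_points[OF M c(1)] by (intro exI[of _ "{q \<in> cdom ?c. f q \<in> V}"]) auto
  qed
qed simp

lemma smooth_fun_continuous: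
  assumes "smooth_fun M (points M) f"
  shows "c \<in> atlas M \<Longrightarrow> continuous_on (cimage c) (\<lambda>y. f (cinv c y))"
  using assms cdom_subset_points[OF M] unfolding smooth_fun_def by (metis Int_absorb2 smooth_on_continuous_on)

text \<open>The Hausdorff property enters here: a compact set of coordinates has compact image,
  which is therefore closed in the whole manifold. The supports of bump functions arise in this
  way.\<close>

lemma closedin_chart_compact:
  assumes c: "c \<in> atlas M" and K: "compact K" "K \<subseteq> cimage c"
  shows "closedin (mtop M) (cinv c ` K)" "cinv c ` K \<subseteq> cdom c"
proof -
  have "compactin (top_of_set (cimage c)) K" using K by (simp add: compactin_subtopology)
  from image_compactin[OF this continuous_map_cinv[OF atlas_is_chart[OF M c]]]
  show "closedin (mtop M) (cinv c ` K)" using M compactin_imp_closedin unfolding smooth_manifold_def by blast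
  show "cinv c ` K \<subseteq> cdom c" using K(2) cinv_in[of _ c] by blast
qed

lemma manifold_bump:
  assumes c: "c \<in> atlas M" and W: "openin (mtop M) W" and p: "p \<in> W" "p \<in> cdom c"
  shows "\<exists>\<psi> K. smooth_fun M (points M) \<psi> \<and> (\<forall>q. 0 \<le> \<psi> q) \<and> 0 < \<psi> p \<and> closedin (mtop M) K \<and> K \<subseteq> W \<inter> cdom c \<and> (\<forall>q. q \<notin> K \<longrightarrow> \<psi> q = 0)"
proof -
  have "open (cmap c ` (cdom c \<inter> W))" by (rule open_chart_image[OF atlas_is_chart[OF M c] W])
  moreover have "cmap c p \<in> cmap c ` (cdom c \<inter> W)" using p by auto
  ultimately obtain r where r: "0 < r" "cball (cmap c p) r \<subseteq> cmap c ` (cdom c \<inter> W)" using open_contains_cball by blast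
  then have sub: "cball (cmap c p) r \<subseteq> cimage c" by auto
  obtain f :: "'e \<Rightarrow> real" where "smooth_on UNIV f \<and> (\<forall>x. 0 \<le> f x) \<and> 0 < f (cmap c p) \<and> (\<forall>x. x \<notin> cball (cmap c p) r \<longrightarrow> f x = 0)"
    using bump_exists[OF r(1), of "cmap c p"] ..
  then have f: "smooth_on UNIV f" "\<And>x. 0 \<le> f x" "0 < f (cmap c p)" "\<And>x. x \<notin> cball (cmap c p) r \<Longrightarrow> f x = 0"
    by simp_all
  define K where "K = cinv c ` cball (cmap c p) r"
  note K = closedin_chart_compact[OF c compact_cball sub, folded K_def]
  have 0: "f (cmap c q) = 0" if "q \<in> cdom c - K" for q
  proof (rule f(4), rule notI)
    assume "cmap c q \<in> cball (cmap c p) r"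
    then have "cinv c (cmap c q) \<in> K" by (auto simp only: K_def)
    then show False using that cinv_cmap[OF atlas_is_chart[OF M c]] by auto
  qed
  show ?thesis
  proof (intro exI conjI allI impI)
    show "smooth_fun M (points M) (extend_zero c f)"
      by (rule smooth_fun_extend_zero[OF c K smooth_on_subset[OF f(1)] 0]) auto
    show "K \<subseteq> W \<inter> cdom c"
    proof
      fix x assume "x \<in> K"
      then obtain y where y: "y \<in> cball (cmap c p) r" "x = cinv c y" unfolding K_def by blast
      then obtain q where q: "q \<in> cdom c" "q \<in> W" "y = cmap c q" using r(2) by blast
      then show "x \<in> W \<inter> cdom c" using y(2) cinv_cmap[OF atlas_is_chart[OF M c]] by simp
    qed
    show "0 \<le> extend_zero c f q" for q using f(2) by (simp add: extend_zero_def)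
    show "0 < extend_zero c f p" using f(3) p by (simp add: extend_zero_def)
    show "extend_zero c f q = 0" if "q \<notin> K" for q using 0 that by (simp add: extend_zero_def)
  qed (rule K)
qed

lemma partition_of_unity_exists:
  assumes "compact_space (mtop M)"
  shows "\<exists>C \<rho>. partition_of_unity M C \<rho>"
proof -
  define Q where "Q p \<psi> K \<longleftrightarrow> smooth_fun M (points M) \<psi> \<and> (\<forall>q. 0 \<le> \<psi> q) \<and> 0 < \<psi> p \<and>
    closedin (mtop M) K \<and> K \<subseteq> cdom (chart_at M p) \<and> (\<forall>q. q \<notin> K \<longrightarrow> \<psi> q = 0)" for p \<psi> K
  have "\<exists>\<psi> K. Q p \<psi> K" if "p \<in> points M" for p
    unfolding Q_def
    using manifold_bump[OF chart_at(1)[OF M that] openin_topspace that chart_at(2)[OF M that]] by (simp only: le_inf_iff) blast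
  then have "\<forall>p\<in>points M. \<exists>\<psi> K. Q p \<psi> K" by blast
  from bchoice2[OF this] obtain \<psi> K where "\<forall>p\<in>points M. Q p (\<psi> p) (K p)" by blast
  then have \<psi>: "\<And>p. p \<in> points M \<Longrightarrow> smooth_fun M (points M) (\<psi> p)" "\<And>p q. p \<in> points M \<Longrightarrow> 0 \<le> \<psi> p q" "\<And>p. p \<in> points M \<Longrightarrow> 0 < \<psi> p p"
    and K: "\<And>p. p \<in> points M \<Longrightarrow> closedin (mtop M) (K p)" "\<And>p. p \<in> points M \<Longrightarrow> K p \<subseteq> cdom (chart_at M p)" "\<And>p q. p \<in> points M \<Longrightarrow> q \<notin> K p \<Longrightarrow> \<psi> p q = 0"
    unfolding Q_def by simp_all
  define U where "U p = {q \<in> points M. 0 < \<psi> p q}" for p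
  have U: "openin (mtop M) (U p)" if "p \<in> points M" for p
  proof -
    have "continuous_map (mtop M) euclidean (\<psi> p)"
      using continuous_map_chartsI smooth_fun_continuous[OF \<psi>(1)[OF that]] by blast
    from openin_continuous_map_preimage[OF this, of "{0<..}"] show ?thesis by (simp add: U_def)
  qed
  have "(\<forall>V\<in>U ` points M. openin (mtop M) V) \<and> points M \<subseteq> \<Union>(U ` points M)"
    using U \<psi>(3) by (force simp: U_def)
  from assms[unfolded compact_space_alt, THEN spec, THEN mp, OF this]
  obtain F where F: "finite F" "F \<subseteq> U ` points M" "points M \<subseteq> \<Union>F" by blast
  obtain P where "P \<subseteq> points M" "finite P" "F = U ` P" using finite_subset_image[OF F(1,2)] by blast
  then have P: "finite P" "P \<subseteq> points M" "points M \<subseteq> \<Union>(U ` P)" using F(3) by auto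
  define s where "s q = (\<Sum>p\<in>P. \<psi> p q)" for q
  have s: "0 < s q" if "q \<in> points M" for q
  proof -
    obtain p where "p \<in> P" "0 < \<psi> p q" using P(3) \<open>q \<in> points M\<close> by (auto simp: U_def)
    then show ?thesis unfolding s_def using P \<psi>(2) by (intro sum_pos2[of P p]) auto
  qed
  have s_smooth: "smooth_fun M (points M) s"
    unfolding s_def using P(2) \<psi>(1) by (intro smooth_fun_sum) auto
  define C where "C = chart_at M ` P"
  \<comment> \<open>The bumps are indexed by points but a partition of unity is indexed by charts;
    the bumps of points with the same chart are added before normalisation.\<close>
  define \<rho> where "\<rho> c q = (\<Sum>p\<in>{p\<in>P. chart_at M p = c}. \<psi> p q) / s q" for c q
  have "partition_of_unity M C \<rho>"
    unfolding partition_of_unity_def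
  proof (intro conjI ballI)
    show "finite C" using P by (simp add: C_def)
    show "C \<subseteq> atlas M" using P chart_at[OF M] by (auto simp: C_def)
    fix q assume q: "q \<in> points M"
    have "(\<Sum>c\<in>C. \<rho> c q) = (\<Sum>c\<in>C. \<Sum>p\<in>{p\<in>P. chart_at M p = c}. \<psi> p q) / s q"
      by (simp add: \<rho>_def sum_divide_distrib)
    also have "(\<Sum>c\<in>C. \<Sum>p\<in>{p\<in>P. chart_at M p = c}. \<psi> p q) = s q"
      unfolding C_def s_def by (rule sum.image_gen[OF P(1), symmetric])
    finally show "(\<Sum>c\<in>C. \<rho> c q) = 1" using s[OF q] by simp
  next
    fix c assume c: "c \<in> C"
    show "smooth_fun M (points M) (\<rho> c)"
      unfolding \<rho>_def using P(2) \<psi>(1) by (intro smooth_fun_binop(3) smooth_fun_sum s_smooth) (auto dest!: s)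
    show "0 \<le> \<rho> c q" if "q \<in> points M" for q
      unfolding \<rho>_def using s[OF that] \<psi>(2) P(2) by (intro divide_nonneg_pos sum_nonneg) auto
    have "closedin (mtop M) (\<Union>(K ` {p\<in>P. chart_at M p = c}))"
      using P K(1) by (intro closedin_Union) auto
    moreover have "{q \<in> points M. \<rho> c q \<noteq> 0} \<subseteq> \<Union>(K ` {p\<in>P. chart_at M p = c})"
    proof
      fix q assume "q \<in> {q \<in> points M. \<rho> c q \<noteq> 0}"
      then have "(\<Sum>p\<in>{p\<in>P. chart_at M p = c}. \<psi> p q) \<noteq> 0" by (auto simp: \<rho>_def)
      then obtain p where "p \<in> P" "chart_at M p = c" "\<psi> p q \<noteq> 0" by (metis (mono_tags, lifting) mem_Collect_eq sum.neutral)
      then show "q \<in> \<Union>(K ` {p\<in>P. chart_at M p = c})" using K(3) P(2) by blast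
    qed
    ultimately have "mtop M closure_of {q \<in> points M. \<rho> c q \<noteq> 0} \<subseteq> \<Union>(K ` {p\<in>P. chart_at M p = c})"
      by (rule closure_of_minimal[rotated])
    also have "\<dots> \<subseteq> cdom c" using K(2) P(2) by auto
    finally show "mtop M closure_of {q \<in> points M. \<rho> c q \<noteq> 0} \<subseteq> cdom c" .
  qed
  then show ?thesis by blast
qed

end

section \<open>Integration on a compact oriented Riemannian manifold\<close>

lemma metric_det_pullback:
  fixes b :: "real^'n \<Rightarrow> real^'n \<Rightarrow> real" and L :: "real^'n \<Rightarrow> real^'n"
  assumes b: "bilinear b" and L: "linear L"
  shows "metric_det (\<lambda>u v. b (L u) (L v)) = (det (matrix L))\<^sup>2 * metric_det b"
proof -
  interpret b1: linear "b u" for u using bilinear_linear(1)[OF b] .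
  interpret b2: linear "\<lambda>u. b u v" for v using bilinear_linear(2)[OF b] .
  let ?m = "matrix L" and ?G = "\<chi> i j. b (axis i 1) (axis j 1)"
  have Le: "L (axis i 1) = (\<Sum>k\<in>UNIV. ?m $ k $ i *\<^sub>R axis k 1)" for i
    using basis_expansion[of "L (axis i 1)"] by (simp add: matrix_def scalar_mult_eq_scaleR)
  have "b (L (axis i 1)) (L (axis j 1)) = (\<Sum>k\<in>UNIV. ?m $ k $ i * (\<Sum>l\<in>UNIV. b (axis k 1) (axis l 1) * ?m $ l $ j))" for i j
  proof -
    have "b (L (axis i 1)) (L (axis j 1)) = (\<Sum>l\<in>UNIV. ?m $ l $ j * (\<Sum>k\<in>UNIV. ?m $ k $ i * b (axis k 1) (axis l 1)))"
      unfolding Le b2.sum b2.scale b1.sum b1.scale by simp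
    also have "\<dots> = (\<Sum>l\<in>UNIV. \<Sum>k\<in>UNIV. ?m $ k $ i * (b (axis k 1) (axis l 1) * ?m $ l $ j))"
      by (simp add: sum_distrib_left mult_ac)
    also have "\<dots> = (\<Sum>k\<in>UNIV. \<Sum>l\<in>UNIV. ?m $ k $ i * (b (axis k 1) (axis l 1) * ?m $ l $ j))"
      by (rule sum.swap)
    finally show ?thesis by (simp add: sum_distrib_left)
  qed
  then have "(\<chi> i j. b (L (axis i 1)) (L (axis j 1))) = transpose ?m ** (?G ** ?m)"
    by (simp add: vec_eq_iff matrix_matrix_mult_def transpose_def)
  then show ?thesis by (simp add: metric_det_def det_mul det_transpose power2_eq_square)
qed

definition dens :: "('a, real^'m) manifold \<Rightarrow> ('a, real^'m) bilin_field \<Rightarrow> ('a, real^'m) chart \<Rightarrow> real^'m \<Rightarrow> real" where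
  "dens M g c y = sqrt (metric_det (in_chart M g c y))"

text \<open>The contribution of a single chart. It represents the integral over the manifold when
  the support of f lies in the chart domain.\<close>

definition cint :: "('a, real^'m) manifold \<Rightarrow> ('a, real^'m) bilin_field \<Rightarrow> ('a, real^'m) chart \<Rightarrow> ('a \<Rightarrow> real) \<Rightarrow> real" where
  "cint M g c f = integral (cimage c) (\<lambda>y. f (cinv c y) * dens M g c y)"

definition chart_continuous :: "('a, 'e::euclidean_space) manifold \<Rightarrow> ('a \<Rightarrow> real) \<Rightarrow> bool" where
  "chart_continuous M f \<longleftrightarrow> (\<forall>c\<in>atlas M. continuous_on (cimage c) (\<lambda>y. f (cinv c y)))"

text \<open>Phrased by a closed witness set instead of the closure of the nonvanishing locus:
  witnesses can be intersected for products and united for sums.\<close>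

definition supported_in :: "('a, 'e) manifold \<Rightarrow> 'a set \<Rightarrow> ('a \<Rightarrow> real) \<Rightarrow> bool" where
  "supported_in M W f \<longleftrightarrow> (\<exists>K. closedin (mtop M) K \<and> K \<subseteq> W \<and> (\<forall>p\<in>points M - K. f p = 0))"

lemma chart_continuous_ops:
  assumes "chart_continuous M f" "chart_continuous M h"
  shows "chart_continuous M (\<lambda>p. f p + h p)" "chart_continuous M (\<lambda>p. f p * h p)" "chart_continuous M (\<lambda>p. f p - h p)"
  using assms unfolding chart_continuous_def by (auto intro!: continuous_intros)

lemma chart_continuous_const: "chart_continuous M (\<lambda>p. k)"
  by (simp add: chart_continuous_def)

lemma smooth_fun_chart_continuous:
  "smooth_manifold M \<Longrightarrow> smooth_fun M (points M) f \<Longrightarrow> chart_continuous M f"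
  using smooth_fun_continuous unfolding chart_continuous_def by blast

lemma supported_in_mult: "supported_in M W f \<Longrightarrow> supported_in M W (\<lambda>p. f p * h p)"
  unfolding supported_in_def by auto

lemma supported_in_mult': "supported_in M W f \<Longrightarrow> supported_in M W (\<lambda>p. h p * f p)"
  unfolding supported_in_def by auto

lemma supported_in_Int:
  assumes "supported_in M W f" "supported_in M W' h"
  shows "supported_in M (W \<inter> W') (\<lambda>p. f p * h p)"
proof -
  obtain K K' where K: "closedin (mtop M) K" "K \<subseteq> W" "\<forall>p\<in>points M - K. f p = 0"
    and K': "closedin (mtop M) K'" "K' \<subseteq> W'" "\<forall>p\<in>points M - K'. h p = 0"
    using assms unfolding supported_in_def by blast
  then show ?thesis unfolding supported_in_def
    by (intro exI[of _ "K \<inter> K'"]) (auto simp: closedin_Int)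
qed

lemma supported_in_mono: "supported_in M W f \<Longrightarrow> W \<subseteq> W' \<Longrightarrow> supported_in M W' f"
  unfolding supported_in_def by blast

lemma partition_of_unityD:
  assumes "partition_of_unity M C \<rho>"
  shows "finite C" "c \<in> C \<Longrightarrow> c \<in> atlas M" "c \<in> C \<Longrightarrow> smooth_fun M (points M) (\<rho> c)"
    "c \<in> C \<Longrightarrow> p \<in> points M \<Longrightarrow> 0 \<le> \<rho> c p" "c \<in> C \<Longrightarrow> supported_in M (cdom c) (\<rho> c)"
    "p \<in> points M \<Longrightarrow> (\<Sum>c\<in>C. \<rho> c p) = 1"
proof -
  note a = assms[unfolded partition_of_unity_def]
  show "supported_in M (cdom c) (\<rho> c)" if "c \<in> C"
    unfolding supported_in_def
  proof (intro exI[of _ "mtop M closure_of {p \<in> points M. \<rho> c p \<noteq> 0}"] conjI ballI)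
    show "mtop M closure_of {p \<in> points M. \<rho> c p \<noteq> 0} \<subseteq> cdom c" using a that by blast
    fix p assume "p \<in> points M - mtop M closure_of {p \<in> points M. \<rho> c p \<noteq> 0}"
    then show "\<rho> c p = 0"
      using closure_of_subset[of "{p \<in> points M. \<rho> c p \<noteq> 0}" "mtop M"] by auto
  qed simp
qed (use assms in \<open>auto simp: partition_of_unity_def\<close>)

section \<open>Chart integrals, their invariance, and the integral over the manifold\<close>

locale compact_oriented_riemannian =
  fixes M :: "('a, real^'m) manifold" and g :: "('a, real^'m) bilin_field"
  assumes M: "smooth_manifold M" and g: "riemannian_metric M g" and K: "compact_space (mtop M)" and O: "oriented M"
begin

lemmas ch = atlas_is_chart[OF M]

lemma dens_smooth: "c \<in> atlas M \<Longrightarrow> smooth_on (cimage c) (dens M g c)"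
  unfolding dens_def[abs_def] by (rule smooth_on_sqrt_metric_det[OF metric_on_in_chart[OF M g]])

lemma dens_pos: "c \<in> atlas M \<Longrightarrow> y \<in> cimage c \<Longrightarrow> 0 < dens M g c y"
  unfolding dens_def using metric_det_pos[OF metric_onD(2)[OF metric_on_in_chart[OF M g]]] by simp

text \<open>The Gram determinant scales with the square of the Jacobian determinant, and the
  orientation fixes the sign of the latter, so the square root cancels against the determinant in
  \<open>volume_form\<close>.\<close>

lemma dens_cmap:
  assumes c: "c \<in> atlas M" "p \<in> cdom c"
  shows "volume_form M g p (\<lambda>i. of_chart M c p (axis i 1)) = dens M g c (cmap c p)"
proof -
  let ?L = "of_chart M c p"
  have p: "p \<in> points M" using cdom_subset_points[OF M c(1)] c(2) by auto
  have "in_chart M g c (cmap c p) = (\<lambda>u v. g p (?L u) (?L v))"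
    by (intro ext) (rule in_chart_cmap[OF M c])
  then have "metric_det (in_chart M g c (cmap c p)) = (det (matrix ?L))\<^sup>2 * metric_det (g p)"
    using metric_det_pullback[OF inner_productD(1)[OF inner_product_metric[OF M g p]] linear_of_chart[OF M c]] by simp
  moreover have "0 < det (matrix ?L)"
    using O c chart_at[OF M p] unfolding oriented_def of_chart_def by blast
  moreover have "volume_form M g p (\<lambda>i. ?L (axis i 1)) = sqrt (metric_det (g p)) * det (matrix ?L)"
    by (simp add: volume_form_def metric_det_def matrix_def)
  ultimately show ?thesis by (simp add: dens_def real_sqrt_mult mult.commute)
qed

lemma dens_transition:
  assumes c: "c \<in> atlas M" and d: "d \<in> atlas M" and y: "y \<in> overlap c d"
  shows "\<bar>det (matrix (fderiv (transition c d) y))\<bar> * dens M g d (transition c d y) = dens M g c y"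
proof -
  let ?L = "fderiv (transition c d) y"
  have ty: "transition c d y \<in> cimage d" using y by (auto simp: transition_cmap[OF ch[OF c]])
  have "in_chart M g c y = (\<lambda>u v. in_chart M g d (transition c d y) (?L u) (?L v))"
    by (intro ext) (rule in_chart_transition[OF M c d y])
  then have "metric_det (in_chart M g c y) = (det (matrix ?L))\<^sup>2 * metric_det (in_chart M g d (transition c d y))"
    using metric_det_pullback[OF metric_onD(3)[OF metric_on_in_chart[OF M g d] ty] smooth_on_linear_fderiv[OF smooth_transition[OF M c d] y]] by simp
  then show ?thesis by (simp add: dens_def real_sqrt_mult)
qed

lemma cint_compact_supported:
  assumes c: "c \<in> atlas M" and f: "chart_continuous M f" "supported_in M (cdom c) f"
  shows "compact_supported (\<lambda>y. if y \<in> cimage c then f (cinv c y) * dens M g c y else 0)"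
proof -
  obtain S where S: "closedin (mtop M) S" "S \<subseteq> cdom c" "\<forall>p\<in>points M - S. f p = 0"
    using f(2) unfolding supported_in_def by blast
  have "compactin (mtop M) S" using closedin_compact_space[OF K S(1)] .
  from compact_chart_image[OF ch[OF c] this S(2)] have 1: "compact (cmap c ` S)" .
  show ?thesis
  proof (rule compact_supportedI[OF open_cimage[OF ch[OF c]] 1])
    show "cmap c ` S \<subseteq> cimage c" using S(2) by auto
    show "continuous_on (cimage c) (\<lambda>y. f (cinv c y) * dens M g c y)"
      using f(1) c smooth_on_continuous_on[OF dens_smooth[OF c]] by (auto simp: chart_continuous_def intro!: continuous_on_mult)
    fix y assume y: "y \<in> cimage c - cmap c ` S"
    have "cinv c y \<notin> S"
    proof
      assume "cinv c y \<in> S"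
      then have "cmap c (cinv c y) \<in> cmap c ` S" by (rule imageI)
      then show False using y cmap_cinv[of y c] by simp
    qed
    then have "f (cinv c y) = 0" using S(3) cinv_points[OF M c, of y] y by auto
    then show "f (cinv c y) * dens M g c y = 0" by simp
  qed
qed

lemma cint_eq_UNIV: "cint M g c f = integral UNIV (\<lambda>y. if y \<in> cimage c then f (cinv c y) * dens M g c y else 0)"
  unfolding cint_def by (rule integral_restrict_UNIV[symmetric])

lemma cint_add:
  assumes c: "c \<in> atlas M" and f: "chart_continuous M f" "supported_in M (cdom c) f" and h: "chart_continuous M h" "supported_in M (cdom c) h"
  shows "cint M g c (\<lambda>p. f p + h p) = cint M g c f + cint M g c h"
proof -
  have "cint M g c (\<lambda>p. f p + h p) = integral UNIV (\<lambda>y. (if y \<in> cimage c then f (cinv c y) * dens M g c y else 0)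
      + (if y \<in> cimage c then h (cinv c y) * dens M g c y else 0))"
    unfolding cint_eq_UNIV by (rule integral_cong) (simp add: distrib_right)
  also have "\<dots> = cint M g c f + cint M g c h"
    unfolding cint_eq_UNIV
    by (rule integral_add) (rule compact_supported_integrable(2)[OF cint_compact_supported[OF c]], fact, fact)+
  finally show ?thesis .
qed

lemma cint_0: "cint M g c (\<lambda>p. 0) = 0"
  by (simp add: cint_def)

lemma cint_cong: "c \<in> atlas M \<Longrightarrow> (\<And>p. p \<in> points M \<Longrightarrow> f p = h p) \<Longrightarrow> cint M g c f = cint M g c h"
  unfolding cint_def using cinv_points[OF M] by (intro integral_cong) simp

lemma cint_cmult: "cint M g c (\<lambda>p. k * f p) = k * cint M g c f"
  unfolding cint_def by (simp add: mult.assoc)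

lemma cint_sum:
  assumes c: "c \<in> atlas M" and f: "\<And>i. i \<in> I \<Longrightarrow> chart_continuous M (f i)" "\<And>i. i \<in> I \<Longrightarrow> supported_in M (cdom c) (f i)"
  shows "cint M g c (\<lambda>p. \<Sum>i\<in>I. f i p) = (\<Sum>i\<in>I. cint M g c (f i))
    \<and> chart_continuous M (\<lambda>p. \<Sum>i\<in>I. f i p) \<and> supported_in M (cdom c) (\<lambda>p. \<Sum>i\<in>I. f i p)"
  using f
proof (induction I rule: infinite_finite_induct)
  case (insert i I)
  have "supported_in M (cdom c) (\<lambda>p. f i p + (\<Sum>i\<in>I. f i p))"
  proof -
    obtain A where A: "closedin (mtop M) A" "A \<subseteq> cdom c" "\<forall>p\<in>points M - A. f i p = 0"
      using insert.prems(2)[of i] unfolding supported_in_def by blast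
    obtain B where B: "closedin (mtop M) B" "B \<subseteq> cdom c" "\<forall>p\<in>points M - B. (\<Sum>i\<in>I. f i p) = 0"
      using insert unfolding supported_in_def by blast
    show ?thesis unfolding supported_in_def using A B by (intro exI[of _ "A \<union> B"]) (auto simp: closedin_Un)
  qed
  then show ?case using insert cint_add[OF c, of "f i" "\<lambda>p. \<Sum>i\<in>I. f i p"]
    by (simp add: chart_continuous_ops(1))
qed (auto simp: cint_0 chart_continuous_const supported_in_def intro!: exI[of _ "{}"])

text \<open>Both integrands are extended by zero to the whole space. The support condition places
  everything that contributes in the overlap, where the transition map is injective and
  \<open>dens_transition\<close> absorbs its Jacobian.\<close>

lemma cint_change:
  assumes c: "c \<in> atlas M" and d: "d \<in> atlas M" and f: "chart_continuous M f" "supported_in M (cdom c \<inter> cdom d) f"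
  shows "cint M g c f = cint M g d f"
proof -
  let ?T = "transition c d" and ?S = "overlap c d"
  let ?F = "\<lambda>y. if y \<in> cimage d then f (cinv d y) * dens M g d y else 0"
  let ?G = "\<lambda>y. if y \<in> cimage c then f (cinv c y) * dens M g c y else 0"
  obtain A where A: "closedin (mtop M) A" "A \<subseteq> cdom c \<inter> cdom d" "\<forall>p\<in>points M - A. f p = 0"
    using f(2) unfolding supported_in_def by blast
  have cF: "compact_supported ?F" and cG: "compact_supported ?G"
    using cint_compact_supported[OF _ f(1) supported_in_mono[OF f(2)]] c d by auto
  have TS: "?T ` ?S = overlap d c"
    unfolding image_image by (rule image_cong) (auto simp: transition_cmap[OF ch[OF c]])
  have 1: "\<bar>det (matrix (fderiv ?T x))\<bar> * ?F (?T x) = f (cinv c x) * dens M g c x" if x: "x \<in> ?S" for x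
  proof -
    obtain p where p: "p \<in> cdom c" "p \<in> cdom d" "x = cmap c p" using x by auto
    then have "?F (?T x) = f p * dens M g d (?T x)"
      by (simp add: transition_cmap[OF ch[OF c]] cinv_cmap[OF ch[OF d]])
    then show ?thesis using dens_transition[OF c d x] by (simp add: p(3) cinv_cmap[OF ch[OF c] p(1)] mult_ac)
  qed
  have 2: "(if x \<in> ?S then \<bar>det (matrix (fderiv ?T x))\<bar> * ?F (?T x) else 0) = ?G x" for x
  proof (cases "x \<in> ?S")
    case True
    then have "x \<in> cimage c" by auto
    then show ?thesis using 1[OF True] True by simp
  next
    case False
    have "f (cinv c x) = 0" if "x \<in> cimage c"
    proof -
      have "cinv c x \<notin> cdom d"
      proof
        assume "cinv c x \<in> cdom d"
        then have "cmap c (cinv c x) \<in> ?S" using cinv_in[OF that] by blast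
        then show False using False cmap_cinv[OF that] by simp
      qed
      then show ?thesis using A cinv_points[OF M c that] by auto
    qed
    then show ?thesis using False by simp
  qed
  have "integral UNIV ?F = integral ?S (\<lambda>x. \<bar>det (matrix (fderiv ?T x))\<bar> * ?F (?T x))"
  proof (rule integral_change_of_variables_finite)
    show "open ?S" by (rule open_overlap[OF ch[OF c] ch[OF d]])
    show "(?T has_derivative fderiv ?T x) (at x)" if "x \<in> ?S" for x
      by (rule smooth_on_has_derivative[OF smooth_transition[OF M c d] that])
    show "inj_on ?T ?S"
      using is_chart_inj_on[OF ch[OF d]] transition_cmap[OF ch[OF c]] by (auto simp: inj_on_def)
    show "compact_supported ?F" by (rule cF)
    show "compact_supported (\<lambda>x. if x \<in> ?S then \<bar>det (matrix (fderiv ?T x))\<bar> * ?F (?T x) else 0)"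
      unfolding 2 by (rule cG)
    fix y assume y: "y \<notin> ?T ` ?S"
    have "f (cinv d y) = 0" if "y \<in> cimage d"
    proof -
      have "cinv d y \<notin> cdom c"
      proof
        assume "cinv d y \<in> cdom c"
        then have "cmap d (cinv d y) \<in> overlap d c" using cinv_in[OF that] by blast
        then show False using y cmap_cinv[OF that] TS by simp
      qed
      then show ?thesis using A cinv_points[OF M d that] by auto
    qed
    then show "?F y = 0" by simp
  qed
  also have "\<dots> = integral UNIV ?G"
    by (subst integral_restrict_UNIV[of ?S, symmetric]) (simp only: 2)
  finally show ?thesis by (simp add: cint_eq_UNIV)
qed

lemma pou_sum_cint:
  assumes \<rho>: "partition_of_unity M C \<rho>" and c: "c \<in> atlas M" and f: "chart_continuous M f" "supported_in M (cdom c) f"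
  shows "(\<Sum>d\<in>C. cint M g d (\<lambda>p. \<rho> d p * f p)) = cint M g c f"
proof -
  note p = partition_of_unityD[OF \<rho>]
  have 1: "chart_continuous M (\<lambda>p. \<rho> d p * f p)" if "d \<in> C" for d
    using chart_continuous_ops(2)[OF smooth_fun_chart_continuous[OF M p(3)[OF that]] f(1)] .
  have "(\<Sum>d\<in>C. cint M g d (\<lambda>p. \<rho> d p * f p)) = (\<Sum>d\<in>C. cint M g c (\<lambda>p. \<rho> d p * f p))"
    using p(2,5) 1 f(2) by (intro sum.cong refl cint_change c) (auto intro: supported_in_Int)
  also have "\<dots> = cint M g c (\<lambda>p. \<Sum>d\<in>C. \<rho> d p * f p)"
    using cint_sum[OF c, of C "\<lambda>d p. \<rho> d p * f p"] 1 supported_in_mult'[OF f(2)] by simp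
  also have "\<dots> = cint M g c f"
    using p(6) by (intro cint_cong c) (simp flip: sum_distrib_right)
  finally show ?thesis .
qed

text \<open>Two partitions of unity are compared through the products of their members: each product
  is supported in the intersection of two chart domains, where \<open>cint_change\<close> applies.
  This makes the definite description in \<open>integral_form\<close> denote.\<close>

lemma integral_vol_pou:
  assumes \<rho>: "partition_of_unity M C \<rho>" and f: "chart_continuous M f"
  shows "integral_vol M g f = (\<Sum>c\<in>C. cint M g c (\<lambda>p. \<rho> c p * f p))"
proof -
  have int: "integral (cimage c) (\<lambda>y. \<rho> c (cinv c y) * (f (cinv c y) * volume_form M g (cinv c y) (\<lambda>i. of_chart M c (cinv c y) (axis i 1))))
      = cint M g c (\<lambda>p. \<rho> c p * f p)" if "c \<in> atlas M" for c and \<rho> :: "_ \<Rightarrow> _ \<Rightarrow> real"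
    unfolding cint_def
  proof (rule integral_cong)
    fix y assume "y \<in> cimage c"
    then have "volume_form M g (cinv c y) (\<lambda>i. of_chart M c (cinv c y) (axis i 1)) = dens M g c y"
      using dens_cmap[OF that cinv_in, of y] cmap_cinv[of y c] by simp
    then show "\<rho> c (cinv c y) * (f (cinv c y) * volume_form M g (cinv c y) (\<lambda>i. of_chart M c (cinv c y) (axis i 1)))
        = \<rho> c (cinv c y) * f (cinv c y) * dens M g c y" by simp
  qed
  have eq: "(\<Sum>c\<in>D. integral (cimage c) (\<lambda>y. \<sigma> c (cinv c y) * (f (cinv c y) * volume_form M g (cinv c y) (\<lambda>i. of_chart M c (cinv c y) (axis i 1)))))
      = (\<Sum>c\<in>C. cint M g c (\<lambda>p. \<rho> c p * f p))" if \<sigma>: "partition_of_unity M D \<sigma>" for D \<sigma>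
  proof -
    note p = partition_of_unityD[OF \<rho>] and q = partition_of_unityD[OF \<sigma>]
    have c1: "chart_continuous M (\<lambda>p. \<rho> c p * f p)" if "c \<in> C" for c
      using chart_continuous_ops(2)[OF smooth_fun_chart_continuous[OF M p(3)[OF that]] f(1)] .
    have c2: "chart_continuous M (\<lambda>p. \<sigma> d p * f p)" if "d \<in> D" for d
      using chart_continuous_ops(2)[OF smooth_fun_chart_continuous[OF M q(3)[OF that]] f(1)] .
    have "(\<Sum>d\<in>D. cint M g d (\<lambda>p. \<sigma> d p * f p)) = (\<Sum>d\<in>D. \<Sum>c\<in>C. cint M g c (\<lambda>p. \<rho> c p * (\<sigma> d p * f p)))"
      using pou_sum_cint[OF \<rho> q(2) c2 supported_in_mult[OF q(5)]] by simp
    also have "\<dots> = (\<Sum>c\<in>C. \<Sum>d\<in>D. cint M g c (\<lambda>p. \<rho> c p * (\<sigma> d p * f p)))" by (rule sum.swap)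
    also have "\<dots> = (\<Sum>c\<in>C. \<Sum>d\<in>D. cint M g d (\<lambda>p. \<sigma> d p * (\<rho> c p * f p)))"
    proof (intro sum.cong refl)
      fix c d assume c: "c \<in> C" and d: "d \<in> D"
      have e: "(\<lambda>p. \<rho> c p * (\<sigma> d p * f p)) = (\<lambda>p. \<sigma> d p * (\<rho> c p * f p))" by (simp add: mult_ac)
      show "cint M g c (\<lambda>p. \<rho> c p * (\<sigma> d p * f p)) = cint M g d (\<lambda>p. \<sigma> d p * (\<rho> c p * f p))"
        unfolding e
      proof (rule cint_change[OF p(2)[OF c] q(2)[OF d]])
        show "chart_continuous M (\<lambda>p. \<sigma> d p * (\<rho> c p * f p))"
          using chart_continuous_ops(2)[OF smooth_fun_chart_continuous[OF M q(3)[OF d]] c1[OF c]] .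
        have "supported_in M (cdom d \<inter> cdom c) (\<lambda>p. \<sigma> d p * (\<rho> c p * f p))"
          by (rule supported_in_Int[OF q(5)[OF d] supported_in_mult[OF p(5)[OF c]]])
        then show "supported_in M (cdom c \<inter> cdom d) (\<lambda>p. \<sigma> d p * (\<rho> c p * f p))" by (simp add: Int_commute)
      qed
    qed
    also have "\<dots> = (\<Sum>c\<in>C. cint M g c (\<lambda>p. \<rho> c p * f p))"
      using pou_sum_cint[OF \<sigma> p(2) c1 supported_in_mult[OF p(5)]] by simp
    finally show ?thesis using int q(2) by simp
  qed
  show ?thesis
    unfolding integral_vol_def integral_form_def
  proof (rule the_equality)
    show "\<exists>C' \<rho>'. partition_of_unity M C' \<rho>' \<and> (\<Sum>c\<in>C. cint M g c (\<lambda>p. \<rho> c p * f p)) =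
        (\<Sum>c\<in>C'. integral (cimage c) (\<lambda>y. \<rho>' c (cinv c y) *
           (f (cinv c y) * volume_form M g (cinv c y) (\<lambda>i. of_chart M c (cinv c y) (axis i 1)))))"
      by (intro exI[of _ C] exI[of _ \<rho>] conjI \<rho> eq[OF \<rho>, symmetric])
  qed (elim exE conjE, simp only: eq)
qed

lemma pou: obtains C \<rho> where "partition_of_unity M C \<rho>"
  using partition_of_unity_exists[OF M K] by blast

lemma integral_vol_supported:
  assumes "c \<in> atlas M" "chart_continuous M f" "supported_in M (cdom c) f"
  shows "integral_vol M g f = cint M g c f"
proof -
  obtain C \<rho> where \<rho>: "partition_of_unity M C \<rho>" using pou by blast
  show ?thesis using integral_vol_pou[OF \<rho> assms(2)] pou_sum_cint[OF \<rho> assms] by simp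
qed

section \<open>Linearity, positivity and bounds of the integral\<close>

lemma integral_vol_add:
  assumes f: "chart_continuous M f" and h: "chart_continuous M h"
  shows "integral_vol M g (\<lambda>p. f p + h p) = integral_vol M g f + integral_vol M g h"
proof -
  obtain C \<rho> where \<rho>: "partition_of_unity M C \<rho>" using pou by blast
  note p = partition_of_unityD[OF \<rho>]
  have 1: "cint M g c (\<lambda>p. \<rho> c p * (f p + h p)) = cint M g c (\<lambda>p. \<rho> c p * f p) + cint M g c (\<lambda>p. \<rho> c p * h p)" if c: "c \<in> C" for c
    unfolding distrib_left
    by (rule cint_add[OF p(2)[OF c]]) (intro chart_continuous_ops(2) smooth_fun_chart_continuous[OF M p(3)[OF c]] f h supported_in_mult p(5)[OF c])+
  show ?thesis
    unfolding integral_vol_pou[OF \<rho> f] integral_vol_pou[OF \<rho> h] integral_vol_pou[OF \<rho> chart_continuous_ops(1)[OF f h]]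
    by (simp add: 1 sum.distrib)
qed

lemma integral_vol_cmult:
  assumes f: "chart_continuous M f"
  shows "integral_vol M g (\<lambda>p. k * f p) = k * integral_vol M g f"
proof -
  obtain C \<rho> where \<rho>: "partition_of_unity M C \<rho>" using pou by blast
  show ?thesis
    unfolding integral_vol_pou[OF \<rho> f] integral_vol_pou[OF \<rho> chart_continuous_ops(2)[OF chart_continuous_const f]]
    by (simp add: sum_distrib_left mult.left_commute[of _ k] cint_cmult)
qed

lemma integral_vol_cong:
  assumes f: "chart_continuous M f" and eq: "\<And>p. p \<in> points M \<Longrightarrow> f p = h p"
  shows "integral_vol M g f = integral_vol M g h"
proof -
  obtain C \<rho> where \<rho>: "partition_of_unity M C \<rho>" using pou by blast
  have h: "chart_continuous M h"
    unfolding chart_continuous_def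
  proof
    fix c assume c: "c \<in> atlas M"
    have "continuous_on (cimage c) (\<lambda>y. f (cinv c y))" using f c by (simp add: chart_continuous_def)
    then show "continuous_on (cimage c) (\<lambda>y. h (cinv c y))"
      by (rule continuous_on_eq) (use eq cinv_points[OF M c] in auto)
  qed
  show ?thesis
    unfolding integral_vol_pou[OF \<rho> f] integral_vol_pou[OF \<rho> h]
    by (intro sum.cong refl cint_cong partition_of_unityD(2)[OF \<rho>]) (simp_all add: eq)
qed

lemma cint_nonneg:
  assumes c: "c \<in> atlas M" and f: "chart_continuous M f" "supported_in M (cdom c) f" "\<And>p. p \<in> points M \<Longrightarrow> 0 \<le> f p"
  shows "0 \<le> cint M g c f"
  unfolding cint_eq_UNIV
proof (rule integral_nonneg[OF compact_supported_integrable(2)[OF cint_compact_supported[OF c f(1,2)]]])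
  show "0 \<le> (if y \<in> cimage c then f (cinv c y) * dens M g c y else 0)" for y
  proof (cases "y \<in> cimage c")
    case True
    then show ?thesis using f(3)[OF cinv_points[OF M c True]] dens_pos[OF c True] by simp
  qed simp
qed

lemma compact_supported_integral_pos:
  fixes F :: "real^'m \<Rightarrow> real"
  assumes F: "compact_supported F" and nn: "\<And>x. 0 \<le> F x" and x: "0 < F x"
  shows "0 < integral UNIV F"
proof -
  have cF: "continuous_on S F" for S using F continuous_on_subset unfolding compact_supported_def by blast
  have "0 \<le> integral UNIV F" using nn by (intro integral_nonneg compact_supported_integrable[OF F]) auto
  moreover have "integral UNIV F \<noteq> 0"
  proof
    assume 0: "integral UNIV F = 0"
    let ?a = "x - One" and ?b = "x + One"
    have "integral (cbox ?a ?b) F \<le> integral UNIV F"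
      using nn by (intro integral_subset_le integrable_continuous cF compact_supported_integrable[OF F]) auto
    moreover have "0 \<le> integral (cbox ?a ?b) F" using nn by (intro integral_nonneg integrable_continuous cF) auto
    ultimately have "integral (cbox ?a ?b) F = 0" using 0 by simp
    moreover have "x \<in> box ?a ?b" by (auto simp: mem_box inner_diff_left inner_add_left)
    ultimately have "F x = 0"
      using integral_cbox_eq_0_iff[of ?a ?b F] cF nn box_subset_cbox[of ?a ?b] by auto
    then show False using \<open>0 < F x\<close> by simp
  qed
  ultimately show ?thesis by simp
qed

lemma integral_vol_nonneg:
  assumes f: "chart_continuous M f" "\<And>p. p \<in> points M \<Longrightarrow> 0 \<le> f p"
  shows "0 \<le> integral_vol M g f"
proof -
  obtain C \<rho> where \<rho>: "partition_of_unity M C \<rho>" using pou by blast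
  note p = partition_of_unityD[OF \<rho>]
  show ?thesis
    unfolding integral_vol_pou[OF \<rho> f(1)]
  proof (rule sum_nonneg)
    fix c assume c: "c \<in> C"
    show "0 \<le> cint M g c (\<lambda>q. \<rho> c q * f q)"
      by (rule cint_nonneg[OF p(2)[OF c]])
        (intro chart_continuous_ops(2) smooth_fun_chart_continuous[OF M p(3)[OF c]] f supported_in_mult p(5)[OF c]
          mult_nonneg_nonneg p(4)[OF c]; assumption)+
  qed
qed

lemma integral_vol_pos:
  assumes f: "chart_continuous M f" "\<And>p. p \<in> points M \<Longrightarrow> 0 \<le> f p" and q: "q \<in> points M" "0 < f q"
  shows "0 < integral_vol M g f"
proof -
  obtain C \<rho> where \<rho>: "partition_of_unity M C \<rho>" using pou by blast
  note p = partition_of_unityD[OF \<rho>]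
  have "\<exists>c\<in>C. \<rho> c q \<noteq> 0" using p(6)[OF q(1)] by (metis sum.neutral zero_neq_one)
  then obtain c where c: "c \<in> C" "0 < \<rho> c q" using p(4)[OF _ q(1)] by (metis order_le_less)
  have sc: "chart_continuous M (\<lambda>p. \<rho> d p * f p)" "supported_in M (cdom d) (\<lambda>p. \<rho> d p * f p)" if "d \<in> C" for d
    by (intro chart_continuous_ops(2) smooth_fun_chart_continuous[OF M p(3)[OF that]] f supported_in_mult p(5)[OF that])+
  obtain A where A: "A \<subseteq> cdom c" "\<forall>p\<in>points M - A. \<rho> c p = 0"
    using p(5)[OF c(1)] unfolding supported_in_def by blast
  have "q \<in> A" using A(2) c(2) q(1) by (cases "q \<in> A") auto
  then have qc: "q \<in> cdom c" using A(1) by blast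
  let ?F = "\<lambda>y. if y \<in> cimage c then (\<rho> c (cinv c y) * f (cinv c y)) * dens M g c y else 0"
  have "0 < integral UNIV ?F"
  proof (rule compact_supported_integral_pos)
    show "compact_supported ?F" by (rule cint_compact_supported[OF p(2)[OF c(1)] sc[OF c(1)]])
    show "0 \<le> ?F y" for y
    proof (cases "y \<in> cimage c")
      case True
      note y = cinv_points[OF M p(2)[OF c(1)] True]
      show ?thesis using p(4)[OF c(1) y] f(2)[OF y] dens_pos[OF p(2)[OF c(1)] True] True by simp
    qed simp
    show "0 < ?F (cmap c q)"
      using c q qc dens_pos[OF p(2)[OF c(1)], of "cmap c q"] by (simp add: cinv_cmap[OF ch[OF p(2)[OF c(1)]]])
  qed
  then have "0 < cint M g c (\<lambda>p. \<rho> c p * f p)" by (simp add: cint_eq_UNIV)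
  moreover have "0 \<le> cint M g d (\<lambda>p. \<rho> d p * f p)" if "d \<in> C" for d
    by (rule cint_nonneg[OF p(2)[OF that] sc[OF that]]) (use p(4) f(2) that in auto)
  ultimately show ?thesis
    unfolding integral_vol_pou[OF \<rho> f(1)] using c(1) p(1) by (intro sum_pos2) auto
qed

lemma integral_vol_bound:
  assumes f: "chart_continuous M f" and B: "\<And>p. p \<in> points M \<Longrightarrow> \<bar>f p\<bar> \<le> B"
  shows "\<bar>integral_vol M g f\<bar> \<le> B * integral_vol M g (\<lambda>p. 1)"
proof -
  have c: "chart_continuous M (\<lambda>p. k * f p)" "chart_continuous M (\<lambda>p. B * 1)" for k
    using chart_continuous_ops(2)[OF chart_continuous_const f] chart_continuous_const by auto
  \<comment> \<open>The parameter k stands for 1 and -1, so that both inequalities hidden in the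
    absolute value are proved at once.\<close>
  have "0 \<le> integral_vol M g (\<lambda>p. B * 1 + k * f p)" if "\<bar>k\<bar> = 1" for k
  proof (rule integral_vol_nonneg[OF chart_continuous_ops(1)[OF c(2) c(1)]])
    fix p assume "p \<in> points M"
    then have "\<bar>k * f p\<bar> \<le> B" using B that by (simp add: abs_mult)
    then show "0 \<le> B * 1 + k * f p" by linarith
  qed
  then have "0 \<le> B * integral_vol M g (\<lambda>p. 1) + k * integral_vol M g f" if "\<bar>k\<bar> = 1" for k
    using that integral_vol_add[OF c(2) c(1)] integral_vol_cmult[OF f] integral_vol_cmult[OF chart_continuous_const, of B 1] by simp
  from this[of 1] this[of "-1"] show ?thesis by simp
qed

end

section \<open>The divergence theorem\<close>

lemma compact_supported_translate:
  assumes "compact_supported F"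
  shows "compact_supported (\<lambda>x. F (a + x))" "integral UNIV (\<lambda>x. F (a + x)) = integral UNIV F"
proof -
  obtain R where R: "\<And>x. R < norm x \<Longrightarrow> F x = 0" using assms unfolding compact_supported_def by blast
  have "F (a + x) = 0" if "R + norm a < norm x" for x
    using norm_triangle_ineq2[of x "- a"] that by (intro R) (simp add: add.commute)
  moreover have "continuous_on UNIV (\<lambda>x. F (a + x))"
    using assms unfolding compact_supported_def by (auto intro!: continuous_on_compose2[of UNIV F] continuous_intros)
  ultimately show 1: "compact_supported (\<lambda>x. F (a + x))" unfolding compact_supported_def by blast
  have ex: "\<exists>u v. \<forall>x. x \<notin> cbox u v \<longrightarrow> F x = 0" using compact_supported_cbox[OF assms] by metis
  then obtain u v where uv: "\<And>x. x \<notin> cbox u v \<Longrightarrow> F x = 0" by blast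
  have r: "integral UNIV H = integral (cbox u' v') H" if "\<And>x. x \<notin> cbox u' v' \<Longrightarrow> H x = 0" for u' v' and H :: "'a \<Rightarrow> real"
  proof -
    have "(\<lambda>x. if x \<in> cbox u' v' then H x else 0) = H" using that by auto
    then show ?thesis using integral_restrict_UNIV[of "cbox u' v'" H] by simp
  qed
  have "integral (cbox (u - a) (v - a)) (F \<circ> (+) a) = integral (cbox u v) F"
    using integral_shift_cbox_plus[of "u - a" "v - a" F a] by simp
  moreover have "integral UNIV (\<lambda>x. F (a + x)) = integral (cbox (u - a) (v - a)) (\<lambda>x. F (a + x))"
    by (rule r, rule uv) (auto simp: mem_box inner_diff_left inner_add_left algebra_simps)
  ultimately show "integral UNIV (\<lambda>x. F (a + x)) = integral UNIV F"
    using r[OF uv] by (simp add: comp_def)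
qed

lemma compact_supported_fderiv:
  fixes f :: "'a::euclidean_space \<Rightarrow> real"
  assumes f: "smooth_on UNIV f" and R: "\<And>x. R < norm x \<Longrightarrow> f x = 0"
  shows "R < norm x \<Longrightarrow> fderiv f x v = 0" "compact_supported (\<lambda>x. fderiv f x v)"
proof -
  show 0: "fderiv f x v = 0" if "R < norm x" for x
  proof -
    have "open {x :: 'a. R < norm x}" by (intro open_Collect_less continuous_intros)
    then have "fderiv f x = fderiv (\<lambda>_. 0) x" by (rule fderiv_cong_open) (use that R in auto)
    then show ?thesis by simp
  qed
  show "compact_supported (\<lambda>x. fderiv f x v)"
    unfolding compact_supported_def using 0 smooth_on_continuous_on[OF smooth_on_fderiv[OF f]] by blast
qed

text \<open>By translation invariance every difference quotient of f has integral 0. The quotients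
  converge to the derivative uniformly with supports in one fixed box, so the integral of the
  derivative is smaller than any multiple of the volume of that box.\<close>

lemma integral_fderiv_eq_0:
  fixes f :: "'a::euclidean_space \<Rightarrow> real"
  assumes f: "smooth_on UNIV f" and R: "\<And>x. R < norm x \<Longrightarrow> f x = 0"
  shows "integral UNIV (\<lambda>x. fderiv f x v) = 0"
proof -
  let ?F = "\<lambda>x. fderiv f x v"
  note cF = compact_supported_fderiv[OF f R]
  have cf: "compact_supported f"
    unfolding compact_supported_def using R smooth_on_continuous_on[OF f] by blast
  obtain a where a: "cball (0 :: 'a) (R + norm v) \<subseteq> cbox (-a) a"
    using bounded_subset_cbox_symmetric[OF bounded_cball] by blast
  let ?V = "measure lborel (cbox (-a) a)"
  have "\<bar>integral UNIV ?F\<bar> \<le> e * ?V" if e: "0 < e" for e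
  proof -
    have "uniformly_continuous_on (cball 0 (R + 2 * norm v)) ?F"
      using cF(2) by (intro compact_uniformly_continuous) (auto simp: compact_supported_def intro: continuous_on_subset)
    then obtain d where d: "0 < d" "\<And>x x'. x \<in> cball 0 (R + 2 * norm v) \<Longrightarrow> x' \<in> cball 0 (R + 2 * norm v) \<Longrightarrow> dist x' x < d \<Longrightarrow> dist (?F x') (?F x) < e"
      using e unfolding uniformly_continuous_on_def by metis
    define n where "n = norm v + 1"
    \<comment> \<open>The bound s \<le> 1 keeps the translates inside a fixed ball, and the other
      entry gives s * norm v < d, the range of the uniform continuity estimate.\<close>
    define s where "s = min 1 (d / (2 * n))"
    have nv: "0 < n" using norm_ge_zero[of v] unfolding n_def by linarith
    have s: "0 < s" "s \<le> 1" using d(1) nv by (auto simp: s_def)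
    have "s * n \<le> d / 2"
    proof -
      have "s * n \<le> d / (2 * n) * n" using nv by (intro mult_right_mono) (auto simp: s_def)
      then show ?thesis using nv by simp
    qed
    then have sv: "s * norm v < d" using s d(1) by (simp add: n_def distrib_left)
    define h where "h x = (f (s *\<^sub>R v + x) - f x) * (1 / s) - ?F x" for x
    have far: "h x = 0" if "R + norm v < norm x" for x
    proof -
      have "s * norm v \<le> norm v" using s by (simp add: mult_left_le_one_le)
      then have "R < norm (s *\<^sub>R v + x)" using norm_triangle_ineq2[of x "- (s *\<^sub>R v)"] that s by (simp add: add.commute)
      moreover have "R < norm x" using that norm_ge_zero[of v] by linarith
      ultimately show ?thesis using R cF(1) by (simp add: h_def)
    qed
    have bound: "\<bar>h x\<bar> \<le> e" for x
    proof (cases "R + norm v < norm x")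
      case False
      have "((\<lambda>r. f (x + r *\<^sub>R v)) has_real_derivative ?F (x + r *\<^sub>R v)) (at r)" for r
        using fderiv_line[OF smooth_on_differentiable[OF f]] by (simp add: has_field_derivative_def mult_commute_abs)
      from MVT2[OF s(1) this] obtain z where z: "0 < z" "z < s" "f (x + s *\<^sub>R v) - f x = s * ?F (x + z *\<^sub>R v)" by auto
      have zv: "norm (z *\<^sub>R v) \<le> s * norm v" using z by (simp add: mult_right_mono)
      have "s * norm v \<le> norm v" using s by (simp add: mult_left_le_one_le)
      then have "norm (x + z *\<^sub>R v) \<le> R + 2 * norm v" using norm_triangle_ineq[of x "z *\<^sub>R v"] zv False by linarith
      moreover have "norm x \<le> R + 2 * norm v" using False norm_ge_zero[of v] by linarith
      moreover have "dist (x + z *\<^sub>R v) x < d" using zv sv by (simp add: dist_norm)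
      ultimately have "dist (?F (x + z *\<^sub>R v)) (?F x) < e" by (intro d(2)) auto
      moreover have "h x = ?F (x + z *\<^sub>R v) - ?F x" using z(3) s by (simp add: h_def add.commute)
      ultimately show ?thesis by (simp add: dist_real_def)
    qed (use far e in simp)
    note 1 = compact_supported_integrable(2)[OF compact_supported_translate(1)[OF cf]] compact_supported_integrable(2)[OF cf]
      compact_supported_integrable(2)[OF cF(2)]
    have "integral UNIV h = (integral UNIV (\<lambda>x. f (s *\<^sub>R v + x)) - integral UNIV f) * (1 / s) - integral UNIV ?F"
    proof -
      have "integral UNIV h = integral UNIV (\<lambda>x. (f (s *\<^sub>R v + x) - f x) * (1 / s)) - integral UNIV ?F"
        unfolding h_def by (rule integral_diff[OF integrable_on_mult_left[OF integrable_diff[OF 1(1,2)]] 1(3)])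
      also have "integral UNIV (\<lambda>x. (f (s *\<^sub>R v + x) - f x) * (1 / s)) = integral UNIV (\<lambda>x. f (s *\<^sub>R v + x) - f x) * (1 / s)"
        by (rule integral_mult_left)
      also have "integral UNIV (\<lambda>x. f (s *\<^sub>R v + x) - f x) = integral UNIV (\<lambda>x. f (s *\<^sub>R v + x)) - integral UNIV f"
        by (rule integral_diff[OF 1(1,2)])
      finally show ?thesis .
    qed
    then have "integral UNIV h = - integral UNIV ?F" using compact_supported_translate(2)[OF cf] by simp
    moreover have "integral UNIV h = integral (cbox (-a) a) h"
    proof -
      have "(\<lambda>x. if x \<in> cbox (-a) a then h x else 0) = h"
      proof
        fix x show "(if x \<in> cbox (-a) a then h x else 0) = h x"
          using far[of x] a by (cases "R + norm v < norm x") (auto simp: subset_iff)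
      qed
      then show ?thesis using integral_restrict_UNIV[of "cbox (-a) a" h] by simp
    qed
    moreover have "norm (integral (cbox (-a) a) h) \<le> e * ?V"
    proof (rule integrable_bound)
      show "h integrable_on cbox (-a) a"
        unfolding h_def
        by (rule integrable_on_subcbox[OF integrable_diff[OF integrable_on_mult_left[OF integrable_diff[OF 1(1,2)]] 1(3)] subset_UNIV])
    qed (use e bound in auto)
    ultimately show ?thesis by simp
  qed
  note bd = this
  have "\<bar>integral UNIV ?F\<bar> \<le> 0 + e" if e: "0 < e" for e
  proof -
    have V: "0 \<le> ?V" by (rule measure_nonneg)
    then have "0 < ?V + 1" by linarith
    then have "\<bar>integral UNIV ?F\<bar> \<le> e / (?V + 1) * ?V" by (intro bd divide_pos_pos e)
    also have "e / (x + 1) * x \<le> e" if "0 \<le> x" for x :: real using that e by (simp add: field_simps)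
    then have "e / (?V + 1) * ?V \<le> e" using V .
    finally show ?thesis by simp
  qed
  then have "\<bar>integral UNIV ?F\<bar> \<le> 0" by (rule field_le_epsilon)
  then show ?thesis by simp
qed

lemma metric_on_subset: "metric_on U G \<Longrightarrow> open V \<Longrightarrow> V \<subseteq> U \<Longrightarrow> metric_on V G"
  unfolding metric_on_def using smooth_on_subset by blast

section \<open>Covariant derivative and divergence in an arbitrary chart\<close>

definition field_in_chart :: "('a, 'e::euclidean_space) manifold \<Rightarrow> ('a \<Rightarrow> 'e) \<Rightarrow> ('a, 'e) chart \<Rightarrow> 'e \<Rightarrow> 'e" where
  "field_in_chart M Z c y = to_chart M c (cinv c y) (Z (cinv c y))"

definition divergence :: "('a, real^'m) manifold \<Rightarrow> ('a, real^'m) bilin_field \<Rightarrow> ('a \<Rightarrow> real^'m) \<Rightarrow> 'a \<Rightarrow> real" where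
  "divergence M g Z p = (\<Sum>i\<in>UNIV. levi_civita M g Z p (axis i 1) $ i)"

text \<open>Conjugate endomorphisms have equal traces. Hence \<open>divergence\<close>, defined in
  the components of \<open>chart_at\<close>, may be computed in any chart around the point.\<close>

lemma trace_conjugate:
  fixes A A' L L' :: "real^'n \<Rightarrow> real^'n"
  assumes L: "linear L" "linear L'" "\<And>u. L' (L u) = u" and A: "linear A" "linear A'" and eq: "\<And>u. L (A u) = A' (L u)"
  shows "(\<Sum>i\<in>UNIV. A (axis i 1) $ i) = (\<Sum>i\<in>UNIV. A' (axis i 1) $ i)"
proof -
  have tr: "(\<Sum>i\<in>UNIV. B (axis i 1) $ i) = trace (matrix B)" for B :: "real^'n \<Rightarrow> real^'n"
    by (simp add: trace_def matrix_def)
  have "A = L' \<circ> (A' \<circ> L)" by (rule ext) (simp only: comp_def L(3) flip: eq)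
  then have "matrix A = matrix L' ** (matrix A' ** matrix L)"
    using L A by (simp add: matrix_compose linear_compose)
  then have "trace (matrix A) = trace ((matrix A' ** matrix L) ** matrix L')" by (simp only: trace_mul_sym[of "matrix L'"])
  moreover have "matrix L' ** matrix L = mat 1"
    using L(3) by (simp add: matrix_compose[OF L(1,2), symmetric] comp_def matrix_id_mat_1[unfolded id_def])
  then have "matrix L ** matrix L' = mat 1" by (rule iffD1[OF matrix_left_right_inverse])
  then have "(matrix A' ** matrix L) ** matrix L' = matrix A'" by (simp flip: matrix_mul_assoc)
  ultimately show ?thesis by (simp add: tr)
qed

context
  fixes M :: "('a, 'e::euclidean_space) manifold" and g
  assumes M: "smooth_manifold M" and g: "riemannian_metric M g"
begin

text \<open>Differentiating the transformation law of the components of Z produces a second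
  derivative of the transition map. The transformation law of the Christoffel term contains the same
  expression with the opposite effect, and the two cancel in the covariant derivative.\<close>

lemma levi_civita_in_chart:
  assumes W: "openin (mtop M) W" and Z: "smooth_field_on M W Z" and p: "p \<in> W" and c: "c \<in> atlas M" "p \<in> cdom c"
  shows "to_chart M c p (levi_civita M g Z p u)
    = covd (in_chart M g c) (\<lambda>y. y) (field_in_chart M Z c) (cmap c p) (to_chart M c p u)"
proof -
  let ?b = "chart_at M p"
  let ?T = "transition ?b c" and ?x = "cmap ?b p" and ?Zb = "field_in_chart M Z ?b" and ?Zc = "field_in_chart M Z c"
  let ?U = "cmap ?b ` (cdom ?b \<inter> (cdom c \<inter> W))"
  have pM: "p \<in> points M" using cdom_subset_points[OF M c(1)] c(2) by auto
  note b = chart_at[OF M pM]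
  have U: "open ?U" by (rule open_chart_image[OF atlas_is_chart[OF M b(1)] openin_Int[OF openin_cdom[OF atlas_is_chart[OF M c(1)]] W]])
  have x: "?x \<in> ?U" using b c p by auto
  have T: "smooth_on ?U ?T" by (rule smooth_on_subset[OF smooth_transition[OF M b(1) c(1)]]) auto
  have Tx: "?T ?x = cmap c p" by (rule transition_cmap[OF atlas_is_chart[OF M b(1)] b(2)])
  have sb: "smooth_on (cmap ?b ` (cdom ?b \<inter> W)) ?Zb" and sc: "smooth_on (cmap c ` (cdom c \<inter> W)) ?Zc"
    using Z b c unfolding smooth_field_on_def field_in_chart_def[abs_def] by auto
  have db: "?Zb differentiable (at ?x)" and dc: "?Zc differentiable (at (?T ?x))"
    using smooth_on_differentiable[OF sb, of ?x] smooth_on_differentiable[OF sc, of "?T ?x"] b c p by (auto simp: Tx)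
  have D: "fderiv ?T ?x = to_chart M c p" by (simp add: to_chart_def[abs_def])
  have DZ: "fderiv ?T y (?Zb y) = ?Zc (?T y)" if "y \<in> ?U" for y
    using that by (auto simp: field_in_chart_def transition_cmap[OF atlas_is_chart[OF M b(1)]] cinv_cmap[OF atlas_is_chart[OF M b(1)]] cinv_cmap[OF atlas_is_chart[OF M c(1)]]
        to_chart_trans[OF M b(1) c(1)])
  have "((\<lambda>y. fderiv ?T y (?Zb y)) has_derivative (\<lambda>u. fderiv2 ?T ?x u (?Zb ?x) + fderiv ?T ?x (fderiv ?Zb ?x u))) (at ?x)"
    by (rule has_derivative_fderiv_apply[OF T U x db])
  then have d1: "((\<lambda>y. ?Zc (?T y)) has_derivative (\<lambda>u. fderiv2 ?T ?x u (?Zb ?x) + fderiv ?T ?x (fderiv ?Zb ?x u))) (at ?x)"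
    by (rule has_derivative_transform_within_open[OF _ U x]) (rule DZ)
  have d2: "((\<lambda>y. ?Zc (?T y)) has_derivative (\<lambda>u. fderiv ?Zc (?T ?x) (fderiv ?T ?x u))) (at ?x)"
    by (rule has_derivative_compose[OF smooth_on_has_derivative[OF T x] has_derivative_fderiv[OF dc]])
  have 1: "fderiv ?Zc (?T ?x) (fderiv ?T ?x u) = fderiv2 ?T ?x u (?Zb ?x) + fderiv ?T ?x (fderiv ?Zb ?x u)" for u
    using has_derivative_unique[OF d2 d1] by (rule fun_cong)
  have 2: "fderiv ?T ?x (chr (in_chart M g ?b) ?x u v) = fderiv2 ?T ?x u v + chr (in_chart M g c) (?T ?x) (fderiv ?T ?x u) (fderiv ?T ?x v)" for u v
  proof (rule chr_transform[OF metric_on_subset[OF metric_on_in_chart[OF M g b(1)] U] metric_on_in_chart[OF M g c(1)] x T])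
    show "?U \<subseteq> cimage ?b" by auto
    show "?T ` ?U \<subseteq> cimage c" by (auto simp: transition_cmap[OF atlas_is_chart[OF M b(1)]])
    show "surj (fderiv ?T ?x)" unfolding D by (rule surjI[of _ "of_chart M c p"]) (rule to_chart_inverse[OF M c])
    show "in_chart M g ?b y u v = in_chart M g c (?T y) (fderiv ?T y u) (fderiv ?T y v)" if "y \<in> ?U" for y u v
      by (rule in_chart_transition[OF M b(1) c(1)]) (use that in auto)
  qed
  have Zx: "?Zb ?x = Z p" using b by (simp add: field_in_chart_def cinv_cmap[OF atlas_is_chart[OF M b(1)]] to_chart_chart_at[OF M pM])
  have "levi_civita M g Z p u = fderiv ?Zb ?x u + christoffel M g p u (Z p)"
    by (simp add: levi_civita_def Let_def field_in_chart_def[abs_def])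
  then have "levi_civita M g Z p u = fderiv ?Zb ?x u + chr (in_chart M g ?b) ?x u (?Zb ?x)"
    by (simp only: christoffel_eq[OF M g pM] Zx)
  then have "fderiv ?T ?x (levi_civita M g Z p u) = fderiv ?Zc (?T ?x) (fderiv ?T ?x u) + chr (in_chart M g c) (?T ?x) (fderiv ?T ?x u) (fderiv ?T ?x (?Zb ?x))"
    by (simp add: linear_add[OF smooth_on_linear_fderiv[OF T x]] 1 2)
  then show ?thesis using DZ[OF x] by (simp add: covd_def Tx D)
qed

lemma linear_levi_civita:
  assumes W: "openin (mtop M) W" and Z: "smooth_field_on M W Z" and p: "p \<in> W"
  shows "linear (levi_civita M g Z p)"
proof -
  let ?b = "chart_at M p"
  have pM: "p \<in> points M" using openin_subset[OF W] p by auto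
  note b = chart_at[OF M pM]
  have "smooth_on (cmap ?b ` (cdom ?b \<inter> W)) (field_in_chart M Z ?b)"
    using Z b unfolding smooth_field_on_def field_in_chart_def[abs_def] by auto
  then have "field_in_chart M Z ?b differentiable (at (cmap ?b p))" using b p by (intro smooth_on_differentiable) auto
  then have "linear (covd (in_chart M g ?b) (\<lambda>y. y) (field_in_chart M Z ?b) (cmap ?b p))"
    using b by (intro linear_covd[OF metric_on_in_chart[OF M g b(1)]]) auto
  moreover have "levi_civita M g Z p = covd (in_chart M g ?b) (\<lambda>y. y) (field_in_chart M Z ?b) (cmap ?b p)"
    using levi_civita_in_chart[OF W Z p b] by (auto simp: to_chart_chart_at[OF M pM])
  ultimately show ?thesis by simp
qed

end

context compact_oriented_riemannian
begin

lemma dens_divergence: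
  assumes Z: "smooth_field_on M (points M) Z" and c: "c \<in> atlas M" and y: "y \<in> cimage c"
  shows "divergence M g Z (cinv c y) * dens M g c y = (\<Sum>i\<in>UNIV. fderiv (\<lambda>y. dens M g c y * field_in_chart M Z c y $ i) y (axis i 1))"
proof -
  let ?p = "cinv c y" and ?G = "in_chart M g c" and ?Z = "field_in_chart M Z c"
  have p: "?p \<in> points M" "?p \<in> cdom c" using cinv_points[OF M c y] cinv_in[OF y] by auto
  have yp: "cmap c ?p = y" by (rule cmap_cinv[OF y])
  have "smooth_on (cmap c ` (cdom c \<inter> points M)) ?Z"
    using Z c unfolding smooth_field_on_def field_in_chart_def[abs_def] by auto
  then have d: "?Z differentiable (at y)"
    using p yp by (intro smooth_on_differentiable) (auto intro: image_eqI[of _ _ ?p])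
  have "divergence M g Z ?p = (\<Sum>i\<in>UNIV. covd ?G (\<lambda>y. y) ?Z y (axis i 1) $ i)"
    unfolding divergence_def
  proof (rule trace_conjugate[OF linear_to_chart[OF M c p(2)] linear_of_chart[OF M c p(2)]])
    show "of_chart M c ?p (to_chart M c ?p u) = u" for u by (rule of_chart_inverse[OF M c p(2)])
    show "linear (levi_civita M g Z ?p)" by (rule linear_levi_civita[OF M g openin_topspace Z p(1)])
    show "linear (covd ?G (\<lambda>y. y) ?Z y)"
      by (rule linear_covd[OF metric_on_in_chart[OF M g c]]) (use y d in auto)
    show "to_chart M c ?p (levi_civita M g Z ?p u) = covd ?G (\<lambda>y. y) ?Z y (to_chart M c ?p u)" for u
      using levi_civita_in_chart[OF M g openin_topspace Z p(1) c p(2)] unfolding yp .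
  qed
  then show ?thesis
    using divergence_formula[OF metric_on_in_chart[OF M g c] y d] by (simp add: dens_def[abs_def] mult.commute)
qed

lemma field_in_chart_smooth:
  assumes "smooth_field_on M (points M) Z" "c \<in> atlas M"
  shows "smooth_on (cimage c) (field_in_chart M Z c)"
proof -
  have e: "cdom c \<inter> points M = cdom c" using cdom_subset_points[OF M assms(2)] by auto
  have "smooth_on (cmap c ` (cdom c \<inter> points M)) (field_in_chart M Z c)"
    using assms unfolding smooth_field_on_def field_in_chart_def[abs_def] by blast
  then show ?thesis by (simp only: e)
qed

lemma smooth_fun_divergence:
  assumes Z: "smooth_field_on M (points M) Z"
  shows "smooth_fun M (points M) (divergence M g Z)"
  unfolding smooth_fun_def
proof
  fix c assume c: "c \<in> atlas M"
  have e: "cdom c \<inter> points M = cdom c" using cdom_subset_points[OF M c] by auto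
  note o = open_cimage[OF ch[OF c]]
  let ?S = "\<lambda>y. \<Sum>i\<in>UNIV. fderiv (\<lambda>y. dens M g c y * field_in_chart M Z c y $ i) y (axis i 1)"
  have nz: "dens M g c y \<noteq> 0" if "y \<in> cimage c" for y using dens_pos[OF c that] by simp
  have "smooth_on (cimage c) (\<lambda>y. ?S y / dens M g c y)"
    by (intro smooth_on_divide[OF o _ dens_smooth[OF c] nz] smooth_on_sum[OF o] smooth_on_fderiv smooth_on_mult[OF o dens_smooth[OF c]]
        smooth_on_vec_nth[OF o field_in_chart_smooth[OF Z c]])
  then show "smooth_on (cmap c ` (cdom c \<inter> points M)) (\<lambda>y. divergence M g Z (cinv c y))"
    unfolding e
  proof (rule smooth_on_cong[OF _ o])
    show "?S y / dens M g c y = divergence M g Z (cinv c y)" if "y \<in> cimage c" for y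
      using nz[OF that] by (simp only: dens_divergence[OF Z c that, symmetric]) simp
  qed
qed

lemma integral_divergence_supported:
  assumes Z: "smooth_field_on M (points M) Z" and c: "c \<in> atlas M"
    and A: "closedin (mtop M) A" "A \<subseteq> cdom c" "\<And>p. p \<in> points M - A \<Longrightarrow> Z p = 0"
  shows "integral_vol M g (divergence M g Z) = 0"
proof -
  have cc: "chart_continuous M (divergence M g Z)"
    by (rule smooth_fun_chart_continuous[OF M smooth_fun_divergence[OF Z]])
  have "supported_in M (cdom c) (divergence M g Z)"
    unfolding supported_in_def
  proof (intro exI[of _ A] conjI ballI A)
    fix p assume p: "p \<in> points M - A"
    let ?b = "chart_at M p"
    note b = chart_at[OF M, of p]
    have o: "openin (mtop M) (points M - A)" using A(1) by (simp add: openin_diff)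
    have "fderiv (field_in_chart M Z ?b) (cmap ?b p) = fderiv (\<lambda>_. 0) (cmap ?b p)"
    proof (rule fderiv_cong_open[OF open_chart_image[OF ch o]])
      show "field_in_chart M Z ?b y = 0" if "y \<in> cmap ?b ` (cdom ?b \<inter> (points M - A))" for y
        using that A(3) b p linear_0[OF linear_to_chart[OF M b(1)]] by (auto simp: field_in_chart_def cinv_cmap[OF ch])
    qed (use b p in auto)
    then have "levi_civita M g Z p u = christoffel M g p u 0" for u
      using A(3)[OF p] by (simp add: levi_civita_def Let_def field_in_chart_def[abs_def])
    also have "christoffel M g p u 0 = 0" for u
      using bilinear_rzero[OF bilinear_chr[OF metric_on_in_chart[OF M g b(1)]]] b p by (simp add: christoffel_eq[OF M g])
    finally show "divergence M g Z p = 0" by (simp add: divergence_def)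
  qed
  then have "integral_vol M g (divergence M g Z) = cint M g c (divergence M g Z)"
    by (rule integral_vol_supported[OF c cc])
  also have "\<dots> = 0"
  proof -
    \<comment> \<open>Density times component, extended by zero. It is smooth on the whole space
      because Z vanishes off a set with compact image in the chart, so its partial derivatives
      integrate to 0.\<close>
    define f where "f i y = (if y \<in> cimage c then dens M g c y * field_in_chart M Z c y $ i else 0)" for i y
    have cK: "compact (cmap c ` A)" using compact_chart_image[OF ch[OF c] closedin_compact_space[OF K A(1)] A(2)] .
    note o = open_cimage[OF ch[OF c]]
    have zero: "field_in_chart M Z c y = 0" if "y \<in> cimage c - cmap c ` A" for y
    proof -
      have "cinv c y \<notin> A"
      proof
        assume "cinv c y \<in> A"
        then have "cmap c (cinv c y) \<in> cmap c ` A" by (rule imageI)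
        then show False using that cmap_cinv[of y c] by simp
      qed
      then have "Z (cinv c y) = 0" using A(3) cinv_points[OF M c, of y] that by auto
      then show ?thesis using that linear_0[OF linear_to_chart[OF M c cinv_in]] by (simp add: field_in_chart_def)
    qed
    have sm: "smooth_on UNIV (f i)" for i
    proof (rule smooth_on_local)
      fix y
      have s1: "smooth_on (cimage c) (f i)"
        by (rule smooth_on_cong[OF smooth_on_mult[OF o dens_smooth[OF c] smooth_on_vec_nth[OF o field_in_chart_smooth[OF Z c], of i]] o])
          (simp add: f_def)
      have o2: "open (- (cmap c ` A))" using cK compact_imp_closed by blast
      have s2: "smooth_on (- (cmap c ` A)) (f i)"
        by (rule smooth_on_cong[OF smooth_on_const[of _ 0] o2]) (use zero in \<open>auto simp: f_def\<close>)
      show "\<exists>U. open U \<and> y \<in> U \<and> smooth_on U (f i)"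
      proof (cases "y \<in> cimage c")
        case True then show ?thesis using s1 o by blast
      next
        case False
        then have "y \<notin> cmap c ` A" using A(2) by blast
        then show ?thesis using s2 o2 by blast
      qed
    qed
    obtain R where R: "\<And>y. y \<in> cmap c ` A \<Longrightarrow> norm y \<le> R" using compact_imp_bounded[OF cK] by (auto simp: bounded_iff)
    have f0: "f i y = 0" if "R < norm y" for i y
      using R[of y] zero[of y] that by (cases "y \<in> cmap c ` A") (auto simp: f_def)
    have "cint M g c (divergence M g Z) = integral UNIV (\<lambda>y. \<Sum>i\<in>UNIV. fderiv (f i) y (axis i 1))"
      unfolding cint_eq_UNIV
    proof (rule integral_cong)
      fix y
      show "(if y \<in> cimage c then divergence M g Z (cinv c y) * dens M g c y else 0) = (\<Sum>i\<in>UNIV. fderiv (f i) y (axis i 1))"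
      proof (cases "y \<in> cimage c")
        case True
        have "fderiv (f i) y = fderiv (\<lambda>y. dens M g c y * field_in_chart M Z c y $ i) y" for i
          by (rule fderiv_cong_open[OF o True]) (simp add: f_def)
        then show ?thesis using True dens_divergence[OF Z c True] by simp
      next
        case False
        have o2: "open (- (cmap c ` A))" using cK compact_imp_closed by blast
        have "y \<in> - (cmap c ` A)" using A(2) False by blast
        then have "fderiv (f i) y = fderiv (\<lambda>_. 0) y" for i
          by (rule fderiv_cong_open[OF o2]) (use zero in \<open>auto simp: f_def\<close>)
        then show ?thesis using False by simp
      qed
    qed
    also have "\<dots> = (\<Sum>i\<in>UNIV. integral UNIV (\<lambda>y. fderiv (f i) y (axis i 1)))"
      by (rule integral_sum) (auto intro!: compact_supported_integrable(2) compact_supported_fderiv(2)[OF sm f0])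
    also have "\<dots> = 0" using integral_fderiv_eq_0[OF sm f0] by simp
    finally show ?thesis .
  qed
  finally show ?thesis .
qed

lemma integral_vol_sum:
  assumes "finite I" "\<And>i. i \<in> I \<Longrightarrow> chart_continuous M (f i)"
  shows "integral_vol M g (\<lambda>p. \<Sum>i\<in>I. f i p) = (\<Sum>i\<in>I. integral_vol M g (f i)) \<and> chart_continuous M (\<lambda>p. \<Sum>i\<in>I. f i p)"
  using assms
proof (induction I)
  case empty
  show ?case using integral_vol_cmult[OF chart_continuous_const, of 0 0] by (simp add: chart_continuous_const)
next
  case (insert i I)
  then show ?case by (simp add: integral_vol_add chart_continuous_ops(1))
qed

theorem divergence_theorem:
  assumes Z: "smooth_field_on M (points M) Z"
  shows "integral_vol M g (divergence M g Z) = 0"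
proof -
  obtain C \<rho> where \<rho>: "partition_of_unity M C \<rho>" using pou by blast
  note p = partition_of_unityD[OF \<rho>]
  define Y where "Y c p = \<rho> c p *\<^sub>R Z p" for c p
  have Yc: "field_in_chart M (Y c) b y = \<rho> c (cinv b y) *\<^sub>R field_in_chart M Z b y" if "b \<in> atlas M" "y \<in> cimage b" for b c y
    using linear_scale[OF linear_to_chart[OF M that(1) cinv_in[OF that(2)]]] by (simp add: field_in_chart_def Y_def)
  have dom: "cdom b \<inter> points M = cdom b" if "b \<in> atlas M" for b using cdom_subset_points[OF M that] by auto
  have Ys: "smooth_field_on M (points M) (Y c)" if "c \<in> C" for c
    unfolding smooth_field_on_def
  proof
    fix b assume b: "b \<in> atlas M"
    note o = open_cimage[OF ch[OF b]]
    have "smooth_on (cimage b) (\<lambda>y. \<rho> c (cinv b y))"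
      using smooth_funD[OF M p(3)[OF that] b] by (simp only: dom[OF b])
    from smooth_on_scaleR[OF o this field_in_chart_smooth[OF Z b]]
    have "smooth_on (cimage b) (field_in_chart M (Y c) b)" by (rule smooth_on_cong[OF _ o]) (simp add: Yc[OF b])
    then show "smooth_on (cmap b ` (cdom b \<inter> points M)) (\<lambda>y. to_chart M b (cinv b y) (Y c (cinv b y)))"
      unfolding dom[OF b] field_in_chart_def[abs_def] .
  qed
  have "integral_vol M g (divergence M g (Y c)) = 0" if c: "c \<in> C" for c
  proof -
    obtain A where "closedin (mtop M) A" "A \<subseteq> cdom c" "\<forall>p\<in>points M - A. \<rho> c p = 0"
      using p(5)[OF c] unfolding supported_in_def by blast
    then show ?thesis by (intro integral_divergence_supported[OF Ys[OF c] p(2)[OF c]]) (auto simp: Y_def)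
  qed
  moreover have cY: "chart_continuous M (divergence M g (Y c))" if "c \<in> C" for c
    by (rule smooth_fun_chart_continuous[OF M smooth_fun_divergence[OF Ys[OF that]]])
  \<comment> \<open>Additivity is read off the coordinate formula \<open>dens_divergence\<close>,
    where the field enters linearly under the derivative; the pieces sum to Z because the partition
    functions sum to 1.\<close>
  moreover have "(\<Sum>c\<in>C. divergence M g (Y c) q) = divergence M g Z q" if q: "q \<in> points M" for q
  proof -
    let ?b = "chart_at M q" and ?x = "cmap (chart_at M q) q"
    note b = chart_at[OF M q]
    note o = open_cimage[OF ch[OF b(1)]]
    have x: "?x \<in> cimage ?b" "cinv ?b ?x = q" using b cinv_cmap[OF ch[OF b(1)] b(2)] by auto
    have d: "(\<lambda>y. dens M g ?b y * field_in_chart M (Y c) ?b y $ i) differentiable (at ?x)" if "c \<in> C" for c i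
      by (rule smooth_on_differentiable[OF smooth_on_mult[OF o dens_smooth[OF b(1)] smooth_on_vec_nth[OF o field_in_chart_smooth[OF Ys[OF that] b(1)]]] x(1)])
    have "fderiv (\<lambda>y. dens M g ?b y * field_in_chart M Z ?b y $ i) ?x = (\<lambda>u. \<Sum>c\<in>C. fderiv (\<lambda>y. dens M g ?b y * field_in_chart M (Y c) ?b y $ i) ?x u)" for i
    proof -
      have "fderiv (\<lambda>y. dens M g ?b y * field_in_chart M Z ?b y $ i) ?x = fderiv (\<lambda>y. \<Sum>c\<in>C. dens M g ?b y * field_in_chart M (Y c) ?b y $ i) ?x"
      proof (rule fderiv_cong_open[OF o x(1)])
        fix y assume y: "y \<in> cimage ?b"
        have "(\<Sum>c\<in>C. dens M g ?b y * field_in_chart M (Y c) ?b y $ i) = dens M g ?b y * ((\<Sum>c\<in>C. \<rho> c (cinv ?b y)) * field_in_chart M Z ?b y $ i)"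
          by (simp add: Yc[OF b(1) y] sum_distrib_left sum_distrib_right)
        then show "dens M g ?b y * field_in_chart M Z ?b y $ i = (\<Sum>c\<in>C. dens M g ?b y * field_in_chart M (Y c) ?b y $ i)"
          using p(6)[OF cinv_points[OF M b(1) y]] by simp
      qed
      also have "\<dots> = (\<lambda>u. \<Sum>c\<in>C. fderiv (\<lambda>y. dens M g ?b y * field_in_chart M (Y c) ?b y $ i) ?x u)"
        by (rule fderiv_eqI) (intro has_derivative_sum has_derivative_fderiv d)
      finally show ?thesis .
    qed
    then have "divergence M g Z q * dens M g ?b ?x = (\<Sum>c\<in>C. divergence M g (Y c) q * dens M g ?b ?x)"
      using dens_divergence[OF Z b(1) x(1)] dens_divergence[OF Ys b(1) x(1)] unfolding x(2) by (simp add: sum.swap[of _ UNIV C])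
    then show ?thesis using dens_pos[OF b(1) x(1)] by (simp flip: sum_distrib_right)
  qed
  ultimately show ?thesis
    using integral_vol_sum[OF p(1) cY] integral_vol_cong[of "\<lambda>q. \<Sum>c\<in>C. divergence M g (Y c) q" "divergence M g Z"] by simp
qed

section \<open>Differentiation under the integral\<close>

definition smooth_family :: "real \<Rightarrow> (real \<Rightarrow> 'a \<Rightarrow> real) \<Rightarrow> bool" where
  "smooth_family \<epsilon> f \<longleftrightarrow> (\<forall>c\<in>atlas M. smooth_on ({-\<epsilon><..<\<epsilon>} \<times> cimage c) (\<lambda>(t, y). f t (cinv c y)))"

lemma open_strip: "c \<in> atlas M \<Longrightarrow> open ({-\<epsilon><..<\<epsilon>} \<times> cimage c)" for \<epsilon> :: real
  by (intro open_Times open_greaterThanLessThan open_cimage[OF ch])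

lemma smooth_family_continuous:
  assumes f: "smooth_family \<epsilon> f" and t: "\<bar>t\<bar> < \<epsilon>"
  shows "chart_continuous M (f t)"
  unfolding chart_continuous_def
proof
  fix c assume c: "c \<in> atlas M"
  have "continuous_on ({-\<epsilon><..<\<epsilon>} \<times> cimage c) (\<lambda>(t, y). f t (cinv c y))"
    using f c smooth_on_continuous_on unfolding smooth_family_def by blast
  then have "continuous_on (cimage c) (\<lambda>y. (\<lambda>(t, y). f t (cinv c y)) (t, y))"
    by (rule continuous_on_compose2) (use t in \<open>auto intro!: continuous_intros\<close>)
  then show "continuous_on (cimage c) (\<lambda>y. f t (cinv c y))" by simp
qed

text \<open>By continuity the second time derivative is bounded by \<open>B\<close> on a product
  neighbourhood of (0, p). Two applications of the mean value inequality give a quadratic remainder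
  with the same constant for all nearby points.\<close>

lemma smooth_family_local_taylor:
  assumes f: "smooth_family \<epsilon> f" and \<epsilon>: "0 < \<epsilon>" and p: "p \<in> points M"
    and f': "\<And>p. p \<in> points M \<Longrightarrow> ((\<lambda>t. f t p) has_real_derivative f' p) (at 0)"
  shows "\<exists>W B \<delta>. openin (mtop M) W \<and> p \<in> W \<and> 0 < \<delta> \<and> (\<forall>q\<in>W. \<forall>t. \<bar>t\<bar> < \<delta> \<longrightarrow> \<bar>f t q - f 0 q - t * f' q\<bar> \<le> B * t\<^sup>2)"
proof -
  let ?c = "chart_at M p" and ?x = "cmap (chart_at M p) p"
  note c = chart_at[OF M p]
  define h where "h = (\<lambda>(t, y). f t (cinv ?c y))"
  let ?S = "{-\<epsilon><..<\<epsilon>} \<times> cimage ?c"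
  have h: "smooth_on ?S h" using f c(1) unfolding smooth_family_def h_def by blast
  have S: "open ?S" "(0, ?x) \<in> ?S" using open_strip[OF c(1)] c(2) \<epsilon> by auto
  define h1 where "h1 z = fderiv h z (1, 0)" for z
  define h2 where "h2 z = fderiv h1 z (1, 0)" for z
  have h1: "smooth_on ?S h1" unfolding h1_def[abs_def] by (rule smooth_on_fderiv[OF h])
  have h2: "continuous_on ?S h2" unfolding h2_def[abs_def] by (rule smooth_on_continuous_on[OF smooth_on_fderiv[OF h1]])
  have dh: "((\<lambda>t. h (t, y)) has_real_derivative h1 (t, y)) (at t)" "((\<lambda>t. h1 (t, y)) has_real_derivative h2 (t, y)) (at t)" if "(t, y) \<in> ?S" for t y
    using has_derivative_imp_has_real_derivative[OF fderiv_Pair_left[OF smooth_on_differentiable[OF h that]]]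
      has_derivative_imp_has_real_derivative[OF fderiv_Pair_left[OF smooth_on_differentiable[OF h1 that]]]
    by (simp_all add: h1_def h2_def)
  define B where "B = \<bar>h2 (0, ?x)\<bar> + 1"
  have "isCont h2 (0, ?x)" using h2 S continuous_on_eq_continuous_at by blast
  then have "\<forall>\<^sub>F z in nhds (0, ?x). z \<in> ?S \<and> \<bar>h2 z - h2 (0, ?x)\<bar> < 1"
    using eventually_nhds_in_open[OF S] unfolding isCont_nhds_real by (intro eventually_conj) auto
  then obtain V where V: "open V" "(0, ?x) \<in> V" "\<And>z. z \<in> V \<Longrightarrow> z \<in> ?S \<and> \<bar>h2 z - h2 (0, ?x)\<bar> < 1"
    unfolding eventually_nhds by blast
  obtain A D where AD': "open A" "open D" "(0, ?x) \<in> A \<times> D" "A \<times> D \<subseteq> V" by (rule open_prod_elim[OF V(1,2)])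
  then have AD: "open A" "open D" "0 \<in> A" "?x \<in> D" "A \<times> D \<subseteq> V" by simp_all
  obtain \<delta> where \<delta>: "0 < \<delta>" "ball 0 \<delta> \<subseteq> A" using AD(1,3) open_contains_ball by blast
  have inV: "(t, y) \<in> ?S" "\<bar>h2 (t, y)\<bar> \<le> B" if "\<bar>t\<bar> < \<delta>" "y \<in> D" for t y
  proof -
    have "(t, y) \<in> V" using AD(5) \<delta>(2) that by (auto simp: subset_iff dist_real_def)
    then show "(t, y) \<in> ?S" "\<bar>h2 (t, y)\<bar> \<le> B" using V(3)[of "(t, y)"] by (auto simp: B_def)
  qed
  have tay: "\<bar>h (t, y) - h (0, y) - t * h1 (0, y)\<bar> \<le> B * t\<^sup>2" if t: "\<bar>t\<bar> < \<delta>" and y: "y \<in> D" for t y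
  proof -
    have B1: "\<bar>h1 (s, y) - h1 (0, y)\<bar> \<le> B * \<bar>s\<bar>" if "\<bar>s\<bar> < \<delta>" for s
    proof -
      have "norm (h1 (s, y) - h1 (0, y)) \<le> B * norm (s - 0)"
      proof (rule field_differentiable_bound[of "ball 0 \<delta>" "\<lambda>t. h1 (t, y)" "\<lambda>t. h2 (t, y)"])
        fix r :: real assume r: "r \<in> ball 0 \<delta>"
        then have r': "\<bar>r\<bar> < \<delta>" by (simp add: dist_real_def)
        show "((\<lambda>t. h1 (t, y)) has_field_derivative h2 (r, y)) (at r within ball 0 \<delta>)"
          by (rule has_field_derivative_at_within[OF dh(2)[OF inV(1)[OF r' y]]])
        show "norm (h2 (r, y)) \<le> B" using inV(2)[OF r' y] by simp
      qed (use that \<delta> in \<open>auto simp: dist_real_def\<close>)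
      then show ?thesis by simp
    qed
    have "norm ((h (t, y) - t * h1 (0, y)) - (h (0, y) - 0 * h1 (0, y))) \<le> (B * \<bar>t\<bar>) * norm (t - 0)"
    proof (rule field_differentiable_bound[of "cball 0 \<bar>t\<bar>" "\<lambda>s. h (s, y) - s * h1 (0, y)" "\<lambda>s. h1 (s, y) - h1 (0, y)"])
      fix s :: real assume s: "s \<in> cball 0 \<bar>t\<bar>"
      then have s': "\<bar>s\<bar> < \<delta>" "\<bar>s\<bar> \<le> \<bar>t\<bar>" using t by (simp_all add: dist_real_def)
      note DERIV_diff[OF dh(1)[OF inV(1)[OF s'(1) y]] DERIV_cmult_right[OF DERIV_ident, of "h1 (0, y)"]]
      then have "((\<lambda>s. h (s, y) - s * h1 (0, y)) has_real_derivative h1 (s, y) - h1 (0, y)) (at s)"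
        by (simp only: mult_1)
      then show "((\<lambda>s. h (s, y) - s * h1 (0, y)) has_field_derivative h1 (s, y) - h1 (0, y)) (at s within cball 0 \<bar>t\<bar>)"
        by (rule has_field_derivative_at_within)
      have "B * \<bar>s\<bar> \<le> B * \<bar>t\<bar>" using s'(2) by (intro mult_left_mono) (auto simp: B_def)
      then show "norm (h1 (s, y) - h1 (0, y)) \<le> B * \<bar>t\<bar>" using B1[OF s'(1)] by simp
    qed (auto simp: dist_real_def)
    then show ?thesis by (simp add: power2_eq_square mult.assoc abs_mult_self_eq algebra_simps)
  qed
  define W where "W = {q \<in> cdom ?c. cmap ?c q \<in> D}"
  have "\<bar>f t q - f 0 q - t * f' q\<bar> \<le> B * t\<^sup>2" if q: "q \<in> W" and t: "\<bar>t\<bar> < \<delta>" for q t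
  proof -
    let ?y = "cmap ?c q"
    have y: "?y \<in> D" "cinv ?c ?y = q" "q \<in> points M"
      using q cinv_cmap[OF ch[OF c(1)]] cdom_subset_points[OF M c(1)] by (auto simp: W_def)
    have 1: "((\<lambda>t. h (t, ?y)) has_real_derivative h1 (0, ?y)) (at 0)" by (rule dh(1)[OF inV(1)]) (use y \<delta> in auto)
    have "((\<lambda>t. h (t, ?y)) has_real_derivative f' q) (at 0)" using f'[OF y(3)] by (simp add: h_def y(2))
    from DERIV_unique[OF 1 this] have "h1 (0, ?y) = f' q" .
    then show ?thesis using tay[OF t y(1)] by (simp add: h_def y(2))
  qed
  moreover have "openin (mtop M) W" unfolding W_def by (rule openin_chart_vimage[OF ch[OF c(1)] AD(2)])
  moreover have "p \<in> W" using c AD by (simp add: W_def)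
  ultimately show ?thesis using \<delta>(1) by blast
qed

lemma smooth_family_derivative_continuous:
  assumes f: "smooth_family \<epsilon> f" and \<epsilon>: "0 < \<epsilon>"
    and f': "\<And>p. p \<in> points M \<Longrightarrow> ((\<lambda>t. f t p) has_real_derivative f' p) (at 0)"
  shows "chart_continuous M f'"
  unfolding chart_continuous_def
proof
  fix c assume c: "c \<in> atlas M"
  define h where "h = (\<lambda>(t, y). f t (cinv c y))"
  have h: "smooth_on ({-\<epsilon><..<\<epsilon>} \<times> cimage c) h" using f c unfolding smooth_family_def h_def by blast
  have "continuous_on (cimage c) (\<lambda>y. fderiv h (0, y) (1, 0))"
    by (rule continuous_on_compose2[OF smooth_on_continuous_on[OF smooth_on_fderiv[OF h]]])
      (use \<epsilon> in \<open>auto intro!: continuous_intros\<close>)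
  then show "continuous_on (cimage c) (\<lambda>y. f' (cinv c y))"
  proof (rule continuous_on_eq)
    fix y assume y: "y \<in> cimage c"
    have 1: "((\<lambda>t. h (t, y)) has_real_derivative fderiv h (0, y) (1, 0)) (at 0)"
      using has_derivative_imp_has_real_derivative[OF fderiv_Pair_left[OF smooth_on_differentiable[OF h]], of 0 y] y \<epsilon> by simp
    have "((\<lambda>t. h (t, y)) has_real_derivative f' (cinv c y)) (at 0)"
      using f'[OF cinv_points[OF M c y]] by (simp add: h_def)
    from DERIV_unique[OF 1 this] show "fderiv h (0, y) (1, 0) = f' (cinv c y)" .
  qed
qed

text \<open>Compactness makes the local Taylor estimates uniform over the manifold. The remainder of
  the integral is then at most a constant times t^2, which disappears after division by t.\<close>

theorem has_derivative_integral_vol: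
  assumes f: "smooth_family \<epsilon> f" and \<epsilon>: "0 < \<epsilon>"
    and f': "\<And>p. p \<in> points M \<Longrightarrow> ((\<lambda>t. f t p) has_real_derivative f' p) (at 0)"
  shows "((\<lambda>t. integral_vol M g (f t)) has_real_derivative integral_vol M g f') (at 0)"
proof -
  define P where "P W B \<delta> \<longleftrightarrow> (\<forall>q\<in>W. \<forall>t. \<bar>t\<bar> < \<delta> \<longrightarrow> \<bar>f t q - f 0 q - t * f' q\<bar> \<le> B * t\<^sup>2)" for W and B \<delta> :: real
  define \<U> where "\<U> = {W. openin (mtop M) W \<and> (\<exists>B \<delta>. 0 < \<delta> \<and> P W B \<delta>)}"
  have "\<exists>W\<in>\<U>. p \<in> W" if p: "p \<in> points M" for p
  proof -
    obtain W B \<delta> where "openin (mtop M) W" "p \<in> W" "0 < \<delta>" "P W B \<delta>"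
      using smooth_family_local_taylor[OF f \<epsilon> p f'] unfolding P_def by blast
    then show ?thesis unfolding \<U>_def by blast
  qed
  then have "points M \<subseteq> \<Union>\<U>" by (intro subsetI) (simp only: Union_iff)
  moreover have "\<forall>W\<in>\<U>. openin (mtop M) W" by (simp add: \<U>_def)
  ultimately have "(\<forall>W\<in>\<U>. openin (mtop M) W) \<and> points M \<subseteq> \<Union>\<U>" by (simp only: simp_thms)
  from K[unfolded compact_space_alt, THEN spec, THEN mp, OF this]
  obtain \<F> where \<F>: "finite \<F>" "\<F> \<subseteq> \<U>" "points M \<subseteq> \<Union>\<F>" by blast
  have "\<exists>B \<delta>. 0 < \<delta> \<and> P (\<Union>\<F>) B \<delta>"
    using \<F>(1,2)
  proof (induction \<F>)
    case empty
    show ?case by (intro exI[of _ 1]) (simp add: P_def)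
  next
    case (insert W \<F>)
    obtain B \<delta> where 1: "0 < \<delta>" "P (\<Union>\<F>) B \<delta>" using insert by auto
    obtain B' \<delta>' where 2: "0 < \<delta>'" "P W B' \<delta>'" using insert.prems by (auto simp: \<U>_def)
    have "P (\<Union>(insert W \<F>)) (max B B') (min \<delta> \<delta>')"
      unfolding P_def
    proof (intro ballI allI impI)
      fix q t assume q: "q \<in> \<Union>(insert W \<F>)" and t: "\<bar>t\<bar> < min \<delta> \<delta>'"
      have "\<bar>f t q - f 0 q - t * f' q\<bar> \<le> B * t\<^sup>2 \<or> \<bar>f t q - f 0 q - t * f' q\<bar> \<le> B' * t\<^sup>2"
        using q t 1(2) 2(2) unfolding P_def by auto
      moreover have "B * t\<^sup>2 \<le> max B B' * t\<^sup>2" "B' * t\<^sup>2 \<le> max B B' * t\<^sup>2" by (simp_all add: mult_right_mono)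
      ultimately show "\<bar>f t q - f 0 q - t * f' q\<bar> \<le> max B B' * t\<^sup>2" by linarith
    qed
    then show ?case using 1(1) 2(1) by (intro exI[of _ "max B B'"] exI[of _ "min \<delta> \<delta>'"]) simp
  qed
  then obtain B \<delta> where B: "0 < \<delta>" "P (points M) B \<delta>" using \<F>(3) unfolding P_def by blast
  let ?I = "\<lambda>t. integral_vol M g (f t)" and ?V = "integral_vol M g (\<lambda>p. 1)"
  note cf' = smooth_family_derivative_continuous[OF f \<epsilon> f']
  have est: "\<bar>?I t - ?I 0 - t * integral_vol M g f'\<bar> \<le> B * t\<^sup>2 * ?V" if t: "\<bar>t\<bar> < min \<epsilon> \<delta>" for t
  proof -
    have c: "chart_continuous M (f t)" "chart_continuous M (\<lambda>p. (-1) * f 0 p)" "chart_continuous M (\<lambda>p. (-t) * f' p)"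
      using t \<epsilon> by (intro smooth_family_continuous[OF f] chart_continuous_ops(2) chart_continuous_const cf'; simp)+
    have c0: "chart_continuous M (f 0)" using \<epsilon> by (intro smooth_family_continuous[OF f]) simp
    have "integral_vol M g (\<lambda>p. f t p + (-1) * f 0 p + (-t) * f' p) = ?I t + (-1) * ?I 0 + (-t) * integral_vol M g f'"
      using integral_vol_add[OF chart_continuous_ops(1)[OF c(1,2)] c(3)] integral_vol_add[OF c(1,2)] integral_vol_cmult[OF c0, of "-1"] integral_vol_cmult[OF cf', of "-t"] by simp
    moreover have "\<bar>integral_vol M g (\<lambda>p. f t p + (-1) * f 0 p + (-t) * f' p)\<bar> \<le> B * t\<^sup>2 * ?V"
      by (rule integral_vol_bound[OF chart_continuous_ops(1)[OF chart_continuous_ops(1)[OF c(1,2)] c(3)]])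
        (use B(2) t in \<open>auto simp: P_def\<close>)
    ultimately show ?thesis by simp
  qed
  have "((\<lambda>t. (?I t - ?I 0) / t - integral_vol M g f') \<longlongrightarrow> 0) (at 0)"
  proof (rule Lim_null_comparison[where g = "\<lambda>t. \<bar>B * ?V\<bar> * \<bar>t\<bar>"])
    have "\<forall>\<^sub>F t in at 0. \<bar>t\<bar> < min \<epsilon> \<delta> \<and> t \<noteq> 0"
      using \<epsilon> B(1) by (auto simp: eventually_at dist_real_def intro!: exI[of _ "min \<epsilon> \<delta>"])
    then show "\<forall>\<^sub>F t in at 0. norm ((?I t - ?I 0) / t - integral_vol M g f') \<le> \<bar>B * ?V\<bar> * \<bar>t\<bar>"
    proof (rule eventually_mono)
      fix t assume t: "\<bar>t\<bar> < min \<epsilon> \<delta> \<and> t \<noteq> 0"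
      have "\<bar>(?I t - ?I 0) / t - integral_vol M g f'\<bar> = \<bar>?I t - ?I 0 - t * integral_vol M g f'\<bar> / \<bar>t\<bar>"
        using t by (simp add: field_simps flip: abs_divide)
      also have "\<dots> \<le> (B * t\<^sup>2 * ?V) / \<bar>t\<bar>" using est t by (intro divide_right_mono) auto
      also have "\<dots> = (B * ?V) * \<bar>t\<bar>" using t by (simp add: power2_eq_square field_simps abs_mult_self_eq flip: abs_mult)
      also have "\<dots> \<le> \<bar>B * ?V\<bar> * \<bar>t\<bar>" by (intro mult_right_mono) auto
      finally show "norm ((?I t - ?I 0) / t - integral_vol M g f') \<le> \<bar>B * ?V\<bar> * \<bar>t\<bar>" by simp
    qed
    show "((\<lambda>t. \<bar>B * ?V\<bar> * \<bar>t\<bar>) \<longlongrightarrow> 0) (at 0)" by (auto intro!: tendsto_eq_intros)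
  qed
  then have "((\<lambda>t. (?I t - ?I 0) / t) \<longlongrightarrow> integral_vol M g f') (at 0)" by (simp add: LIM_zero_iff)
  then show ?thesis by (simp add: DERIV_def)
qed

end

section \<open>Smooth maps in charts\<close>

definition lrep :: "('a, 'e) chart \<Rightarrow> ('b, 'f) chart \<Rightarrow> ('a \<Rightarrow> 'b) \<Rightarrow> 'e \<Rightarrow> 'f" where
  "lrep c d \<phi> y = cmap d (\<phi> (cinv c y))"

definition ldom :: "('a, 'e) chart \<Rightarrow> ('b, 'f) chart \<Rightarrow> ('a \<Rightarrow> 'b) \<Rightarrow> 'e set" where
  "ldom c d \<phi> = cmap c ` {q \<in> cdom c. \<phi> q \<in> cdom d}"

lemma levi_civita_coord_field:
  assumes M: "smooth_manifold M" and g: "riemannian_metric M g" and p: "p \<in> points M"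
  shows "levi_civita M g (coord_field M p v) p u = chr (in_chart M g (chart_at M p)) (cmap (chart_at M p) p) u v"
proof -
  let ?c = "chart_at M p"
  note c = chart_at[OF M p]
  have "fderiv (\<lambda>y. to_chart M ?c (cinv ?c y) (coord_field M p v (cinv ?c y))) (cmap ?c p) = fderiv (\<lambda>_. v) (cmap ?c p)"
    by (rule fderiv_cong_open[OF open_cimage[OF atlas_is_chart[OF M c(1)]]])
      (use c in \<open>auto simp: coord_field_def cinv_cmap[OF atlas_is_chart[OF M]] to_chart_inverse[OF M]\<close>)
  then show ?thesis
    by (simp add: levi_civita_def Let_def christoffel_eq[OF M g p] coord_field_def of_chart_chart_at[OF M p])
qed

lemma to_chart_in_chart:
  assumes "smooth_manifold M" "c \<in> atlas M" "p \<in> cdom c"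
  shows "in_chart M b c (cmap c p) (to_chart M c p u) (to_chart M c p v) = b p u v"
  using assms by (simp add: in_chart_cmap)

lemma endo_in_chart_to_chart:
  assumes "smooth_manifold M" "c \<in> atlas M" "p \<in> cdom c"
  shows "endo_in_chart M J c (cmap c p) (to_chart M c p u) = to_chart M c p (J p u)"
  using assms by (simp add: endo_in_chart_def cinv_cmap[OF atlas_is_chart])

context
  fixes M :: "('a, 'e::euclidean_space) manifold" and N :: "('b, 'f::euclidean_space) manifold"
  assumes M: "smooth_manifold M" and N: "smooth_manifold N"
begin

lemma ldom_cimage: "ldom c d \<phi> \<subseteq> cimage c"
  by (auto simp: ldom_def)

lemma ldomD:
  assumes "c \<in> atlas M" "y \<in> ldom c d \<phi>"
  shows "y \<in> cimage c" "cinv c y \<in> cdom c" "\<phi> (cinv c y) \<in> cdom d" "cmap c (cinv c y) = y"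
  using assms by (auto simp: ldom_def cinv_cmap[OF atlas_is_chart[OF M]])

lemma ldomI: "p \<in> cdom c \<Longrightarrow> \<phi> p \<in> cdom d \<Longrightarrow> cmap c p \<in> ldom c d \<phi>"
  by (auto simp: ldom_def)

lemma lrep_cmap: "c \<in> atlas M \<Longrightarrow> p \<in> cdom c \<Longrightarrow> lrep c d \<phi> (cmap c p) = cmap d (\<phi> p)"
  by (simp add: lrep_def cinv_cmap[OF atlas_is_chart[OF M]])

lemma lrep_image: "c \<in> atlas M \<Longrightarrow> lrep c d \<phi> ` ldom c d \<phi> \<subseteq> cimage d"
  by (auto simp: ldom_def lrep_cmap)

context
  fixes \<phi>
  assumes \<phi>: "smooth_map M N \<phi>"
begin

lemma smooth_map_points: "p \<in> points M \<Longrightarrow> \<phi> p \<in> points N"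
  using \<phi> continuous_map_funspace unfolding smooth_map_def by blast

lemma openin_preimage:
  assumes "openin (mtop N) W"
  shows "openin (mtop M) {p \<in> points M. \<phi> p \<in> W}"
  using \<phi> assms openin_continuous_map_preimage unfolding smooth_map_def by blast

lemma ldom_eq: "c \<in> atlas M \<Longrightarrow> ldom c d \<phi> = cmap c ` (cdom c \<inter> {p \<in> points M. \<phi> p \<in> cdom d})"
  using cdom_subset_points[OF M, of c] unfolding ldom_def by (intro arg_cong[where f = "image (cmap c)"]) auto

lemma open_ldom: "c \<in> atlas M \<Longrightarrow> d \<in> atlas N \<Longrightarrow> open (ldom c d \<phi>)"
  unfolding ldom_eq by (rule open_chart_image[OF atlas_is_chart[OF M] openin_preimage[OF openin_cdom[OF atlas_is_chart[OF N]]]])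

lemma smooth_lrep: "c \<in> atlas M \<Longrightarrow> d \<in> atlas N \<Longrightarrow> smooth_on (ldom c d \<phi>) (lrep c d \<phi>)"
  using \<phi> unfolding smooth_map_def lrep_def[abs_def] ldom_def by blast

lemma fderiv_lrep_domain:
  assumes c: "b \<in> atlas M" "c \<in> atlas M" "d \<in> atlas N" and p: "p \<in> cdom b" "p \<in> cdom c" "\<phi> p \<in> cdom d"
  shows "fderiv (lrep c d \<phi>) (cmap c p) (fderiv (transition b c) (cmap b p) u) = fderiv (lrep b d \<phi>) (cmap b p) u"
proof -
  let ?T = "transition b c" and ?x = "cmap b p"
  let ?U = "cmap b ` (cdom b \<inter> (cdom c \<inter> {q \<in> points M. \<phi> q \<in> cdom d}))"
  have U: "open ?U"
    by (intro open_chart_image[OF atlas_is_chart[OF M c(1)]] openin_Int openin_cdom[OF atlas_is_chart[OF M c(2)]] openin_preimage openin_cdom[OF atlas_is_chart[OF N c(3)]])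
  have x: "?x \<in> ?U" using p cdom_subset_points[OF M c(1)] by auto
  have Tx: "?T ?x = cmap c p" by (rule transition_cmap[OF atlas_is_chart[OF M c(1)] p(1)])
  have T: "(?T has_derivative fderiv ?T ?x) (at ?x)"
    by (rule smooth_on_has_derivative[OF smooth_transition[OF M c(1,2)]]) (use p in auto)
  have L: "(lrep c d \<phi> has_derivative fderiv (lrep c d \<phi>) (cmap c p)) (at (?T ?x))"
    unfolding Tx by (rule smooth_on_has_derivative[OF smooth_lrep[OF c(2,3)] ldomI]) (use p in auto)
  have "fderiv (lrep b d \<phi>) ?x = fderiv (\<lambda>y. lrep c d \<phi> (?T y)) ?x"
    by (rule fderiv_cong_open[OF U x]) (auto simp: transition_cmap[OF atlas_is_chart[OF M c(1)]] lrep_cmap[OF c(1)] lrep_cmap[OF c(2)])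
  then show ?thesis using fderiv_eqI[OF has_derivative_compose[OF T L]] by simp
qed

lemma fderiv_lrep_codomain:
  assumes c: "c \<in> atlas M" "e \<in> atlas N" "d \<in> atlas N" and p: "p \<in> cdom c" "\<phi> p \<in> cdom e" "\<phi> p \<in> cdom d"
  shows "fderiv (transition e d) (cmap e (\<phi> p)) (fderiv (lrep c e \<phi>) (cmap c p) u) = fderiv (lrep c d \<phi>) (cmap c p) u"
proof -
  let ?T = "transition e d" and ?x = "cmap c p"
  let ?U = "cmap c ` (cdom c \<inter> {q \<in> points M. \<phi> q \<in> cdom e \<inter> cdom d})"
  have U: "open ?U"
    by (intro open_chart_image[OF atlas_is_chart[OF M c(1)]] openin_preimage openin_Int openin_cdom[OF atlas_is_chart[OF N c(2)]] openin_cdom[OF atlas_is_chart[OF N c(3)]])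
  have x: "?x \<in> ?U" using p cdom_subset_points[OF M c(1)] by auto
  have L: "(lrep c e \<phi> has_derivative fderiv (lrep c e \<phi>) ?x) (at ?x)"
    by (rule smooth_on_has_derivative[OF smooth_lrep[OF c(1,2)] ldomI]) (use p in auto)
  have T: "(?T has_derivative fderiv ?T (cmap e (\<phi> p))) (at (lrep c e \<phi> ?x))"
    unfolding lrep_cmap[OF c(1) p(1)] by (rule smooth_on_has_derivative[OF smooth_transition[OF N c(2,3)]]) (use p in auto)
  have "fderiv (lrep c d \<phi>) ?x = fderiv (\<lambda>y. ?T (lrep c e \<phi> y)) ?x"
    by (rule fderiv_cong_open[OF U x]) (auto simp: lrep_cmap[OF c(1)] transition_cmap[OF atlas_is_chart[OF N c(2)]])
  then show ?thesis using fderiv_eqI[OF has_derivative_compose[OF L T]] by simp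
qed

lemma mdiff_eq: "mdiff M N \<phi> p = fderiv (lrep (chart_at M p) (chart_at N (\<phi> p)) \<phi>) (cmap (chart_at M p) p)"
  by (simp add: mdiff_def lrep_def[abs_def])

text \<open>\<open>mdiff\<close> is computed in the charts attached to p and \<phi> p. One chain
  rule on each side carries it to arbitrary charts.\<close>

lemma to_chart_mdiff:
  assumes c: "c \<in> atlas M" "d \<in> atlas N" and p: "p \<in> cdom c" "\<phi> p \<in> cdom d"
  shows "to_chart N d (\<phi> p) (mdiff M N \<phi> p u) = fderiv (lrep c d \<phi>) (cmap c p) (to_chart M c p u)"
proof -
  have pM: "p \<in> points M" using cdom_subset_points[OF M c(1)] p by auto
  note b = chart_at[OF M pM] and e = chart_at[OF N smooth_map_points[OF pM]]
  have "to_chart N d (\<phi> p) (mdiff M N \<phi> p u) = fderiv (lrep (chart_at M p) d \<phi>) (cmap (chart_at M p) p) u"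
    unfolding to_chart_def mdiff_eq by (rule fderiv_lrep_codomain[OF b(1) e(1) c(2) b(2) e(2) p(2)])
  also have "\<dots> = fderiv (lrep c d \<phi>) (cmap c p) (to_chart M c p u)"
    unfolding to_chart_def by (rule fderiv_lrep_domain[OF b(1) c b(2) p, symmetric])
  finally show ?thesis .
qed

lemma to_chart_mdiff_of_chart:
  assumes c: "c \<in> atlas M" "d \<in> atlas N" and p: "p \<in> cdom c" "\<phi> p \<in> cdom d"
  shows "to_chart N d (\<phi> p) (mdiff M N \<phi> p (of_chart M c p u)) = fderiv (lrep c d \<phi>) (cmap c p) u"
  by (simp add: to_chart_mdiff[OF assms] to_chart_inverse[OF M c(1) p(1)])

lemma linear_mdiff: "p \<in> points M \<Longrightarrow> linear (mdiff M N \<phi> p)"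
  unfolding mdiff_eq
  by (rule smooth_on_linear_fderiv[OF smooth_lrep ldomI]) (use chart_at[OF M] chart_at[OF N smooth_map_points] in auto)

lemma pullback_in_chart:
  assumes c: "c \<in> atlas M" "d \<in> atlas N" and p: "p \<in> cdom c" "\<phi> p \<in> cdom d"
  shows "h (\<phi> p) (mdiff M N \<phi> p (of_chart M c p u)) (mdiff M N \<phi> p (of_chart M c p v))
    = in_chart N h d (cmap d (\<phi> p)) (fderiv (lrep c d \<phi>) (cmap c p) u) (fderiv (lrep c d \<phi>) (cmap c p) v)"
  by (simp add: to_chart_in_chart[OF N c(2) p(2)] flip: to_chart_mdiff_of_chart[OF c p])

lemma bilinear_pullback:
  assumes p: "p \<in> points M" and b: "bilinear (\<omega> (\<phi> p))"
  shows "bilinear (pullback_form2 M N \<phi> \<omega> p)"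
  using linear_compose[OF linear_mdiff[OF p] bilinear_linear(1)[OF b]] linear_compose[OF linear_mdiff[OF p] bilinear_linear(2)[OF b]]
  unfolding pullback_form2_def[abs_def] bilinear_def comp_def by blast

lemma diff_norm_sq_in_chart:
  assumes g: "riemannian_metric M g" and h: "riemannian_metric N h"
    and c: "c \<in> atlas M" "d \<in> atlas N" and p: "p \<in> cdom c" "\<phi> p \<in> cdom d"
  shows "diff_norm_sq M g N h \<phi> p = trace_on (in_chart M g c (cmap c p)) UNIV
    (\<lambda>u v. in_chart N h d (lrep c d \<phi> (cmap c p)) (fderiv (lrep c d \<phi>) (cmap c p) u) (fderiv (lrep c d \<phi>) (cmap c p) v))"
proof -
  have pM: "p \<in> points M" using cdom_subset_points[OF M c(1)] p by auto
  have "bilinear (h (\<phi> p))" using h smooth_map_points[OF pM] by (simp add: riemannian_metric_def)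
  from bilinear_pullback[where \<omega> = h, OF pM this] have b: "bilinear (\<lambda>u v. h (\<phi> p) (mdiff M N \<phi> p u) (mdiff M N \<phi> p v))"
    by (simp add: pullback_form2_def[abs_def])
  have "diff_norm_sq M g N h \<phi> p = trace_on (in_chart M g c (cmap c p)) UNIV
      (\<lambda>u v. h (\<phi> p) (mdiff M N \<phi> p (of_chart M c p u)) (mdiff M N \<phi> p (of_chart M c p v)))"
    unfolding diff_norm_sq_def
    by (rule trace_on_iso[OF inner_product_metric[OF M g pM] metric_onD(2)[OF metric_on_in_chart[OF M g c(1)]]
          linear_of_chart[OF M c(1) p(1)] bij_of_chart[OF M c(1) p(1)] b in_chart_cmap[OF M c(1) p(1)]]) (use p in auto)
  then show ?thesis by (simp add: pullback_in_chart[OF c p] lrep_cmap[OF c(1) p(1)])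
qed

lemma symplectic_density_in_chart:
  assumes g: "riemannian_metric M g" and h: "riemannian_metric N h" and J: "\<And>q. q \<in> points N \<Longrightarrow> linear (J q)"
    and c: "c \<in> atlas M" "d \<in> atlas N" and p: "p \<in> cdom c" "\<phi> p \<in> cdom d"
  shows "form2_norm_sq (g p) (pullback_form2 M N \<phi> (kaehler_form h J) p) = form2_norm_sq (in_chart M g c (cmap c p))
    (\<lambda>u v. in_chart N h d (lrep c d \<phi> (cmap c p)) (endo_in_chart N J d (lrep c d \<phi> (cmap c p)) (fderiv (lrep c d \<phi>) (cmap c p) u))
       (fderiv (lrep c d \<phi>) (cmap c p) v))"
proof -
  have pM: "p \<in> points M" using cdom_subset_points[OF M c(1)] p by auto
  note q = smooth_map_points[OF pM]
  have "bilinear (h (\<phi> p))" using h q by (simp add: riemannian_metric_def)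
  then have "bilinear (kaehler_form h J (\<phi> p))"
    using linear_compose[OF J[OF q] bilinear_linear(2)] unfolding kaehler_form_def[abs_def] bilinear_def comp_def by blast
  note b = bilinear_pullback[where \<omega> = "kaehler_form h J", OF pM this]
  have "form2_norm_sq (g p) (pullback_form2 M N \<phi> (kaehler_form h J) p) = form2_norm_sq (in_chart M g c (cmap c p))
      (\<lambda>u v. pullback_form2 M N \<phi> (kaehler_form h J) p (of_chart M c p u) (of_chart M c p v))"
    by (rule form2_norm_sq_iso[OF inner_product_metric[OF M g pM] metric_onD(2)[OF metric_on_in_chart[OF M g c(1)]]
          linear_of_chart[OF M c(1) p(1)] bij_of_chart[OF M c(1) p(1)] b in_chart_cmap[OF M c(1) p(1)]]) (use p in auto)
  moreover have "pullback_form2 M N \<phi> (kaehler_form h J) p (of_chart M c p u) (of_chart M c p v)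
      = in_chart N h d (lrep c d \<phi> (cmap c p)) (endo_in_chart N J d (lrep c d \<phi> (cmap c p)) (fderiv (lrep c d \<phi>) (cmap c p) u))
       (fderiv (lrep c d \<phi>) (cmap c p) v)" for u v
    by (simp add: pullback_form2_def kaehler_form_def lrep_cmap[OF c(1) p(1)] endo_in_chart_to_chart[OF N c(2) p(2)]
        to_chart_in_chart[OF N c(2) p(2)] flip: to_chart_mdiff_of_chart[OF c p])
  ultimately show ?thesis by simp
qed

text \<open>The coordinate field in \<open>nabla_d\<close> has constant components in the chart
  attached to p. Its covariant derivative is therefore a pure Christoffel term, and d\<phi> applied
  to it is a directional derivative of the coordinate expression of \<phi>.\<close>

lemma nabla_d_eq_sff:
  assumes g: "riemannian_metric M g" and h: "riemannian_metric N h" and p: "p \<in> points M"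
  shows "nabla_d M g N h \<phi> p = sff (in_chart M g (chart_at M p)) (in_chart N h (chart_at N (\<phi> p)))
     (lrep (chart_at M p) (chart_at N (\<phi> p)) \<phi>) (cmap (chart_at M p) p)"
proof (intro ext)
  fix u v
  let ?c = "chart_at M p" and ?d = "chart_at N (\<phi> p)"
  let ?x = "cmap ?c p" and ?f = "lrep ?c ?d \<phi>"
  note c = chart_at[OF M p] and q = smooth_map_points[OF p] and d = chart_at[OF N smooth_map_points[OF p]]
  have fx: "?f ?x = cmap ?d (\<phi> p)" by (rule lrep_cmap[OF c])
  have xl: "?x \<in> ldom ?c ?d \<phi>" using c(2) d(2) by (rule ldomI)
  have mp: "mdiff M N \<phi> p = fderiv ?f ?x" by (rule mdiff_eq)
  have Y: "coord_field M p v p = v" by (simp add: coord_field_def of_chart_chart_at[OF M p])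
  have "fderiv (\<lambda>y. to_chart N ?d (\<phi> (cinv ?c y)) (mdiff M N \<phi> (cinv ?c y) (coord_field M p v (cinv ?c y)))) ?x = fderiv (\<lambda>y. fderiv ?f y v) ?x"
  proof (rule fderiv_cong_open[OF open_ldom[OF c(1) d(1)] xl])
    fix y assume y: "y \<in> ldom ?c ?d \<phi>"
    note l = ldomD[OF c(1) y]
    show "to_chart N ?d (\<phi> (cinv ?c y)) (mdiff M N \<phi> (cinv ?c y) (coord_field M p v (cinv ?c y))) = fderiv ?f y v"
      using to_chart_mdiff_of_chart[OF c(1) d(1) l(2,3), of v] by (simp add: coord_field_def l(4))
  qed
  then have "pullback_connection M N h \<phi> (\<lambda>q. mdiff M N \<phi> q (coord_field M p v q)) p u
      = fderiv2 ?f ?x u v + christoffel N h (\<phi> p) (mdiff M N \<phi> p u) (mdiff M N \<phi> p v)"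
    unfolding pullback_connection_def Let_def by (simp only: Y)
  then have 1: "pullback_connection M N h \<phi> (\<lambda>q. mdiff M N \<phi> q (coord_field M p v q)) p u
      = fderiv2 ?f ?x u v + chr (in_chart N h ?d) (?f ?x) (fderiv ?f ?x u) (fderiv ?f ?x v)"
    by (simp only: christoffel_eq[OF N h q] mp fx)
  have 2: "levi_civita M g (coord_field M p v) p u = chr (in_chart M g ?c) ?x u v"
    by (rule levi_civita_coord_field[OF M g p])
  show "nabla_d M g N h \<phi> p u v = sff (in_chart M g ?c) (in_chart N h ?d) ?f ?x u v"
    by (simp only: nabla_d_def Let_def 1 2 sff_def mp)
qed

end

end

lemma rsub_at_iso:
  assumes r: "rsub_at g h A" and L: "linear L" "bij L" and K: "linear K" "bij K"
    and g': "inner_product g'" "\<And>u v. g' u v = g (L u) (L v)" and h': "inner_product h'" "\<And>u v. h' u v = h (K u) (K v)"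
    and A': "linear A'" "\<And>u. K (A' u) = A (L u)"
  shows "rsub_at g' h' A'"
proof -
  have K0: "K w = 0 \<longleftrightarrow> w = 0" for w using linear_injective_0[OF K(1)] bij_is_inj[OF K(2)] linear_0[OF K(1)] by blast
  have ker: "A' v = 0 \<longleftrightarrow> A (L v) = 0" for v using K0[of "A' v"] by (simp add: A'(2))
  have hor: "(\<forall>v. A' v = 0 \<longrightarrow> g' u v = 0) \<longleftrightarrow> (\<forall>v. A v = 0 \<longrightarrow> g (L u) v = 0)" for u
    unfolding ker g'(2) using bij_is_surj[OF L(2)] by (metis surjD)
  have "w \<in> A' ` {u. \<forall>v. A' v = 0 \<longrightarrow> g' u v = 0}" for w
  proof -
    have "K w \<in> A ` {u. \<forall>v. A v = 0 \<longrightarrow> g u v = 0}" using r unfolding rsub_at_def by simp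
    then obtain x where x: "K w = A x" "\<forall>v. A v = 0 \<longrightarrow> g x v = 0" by blast
    obtain u where u: "x = L u" using bij_is_surj[OF L(2)] by (metis surjD)
    have "A' u = w" using x(1) bij_is_inj[OF K(2)] by (simp add: u inj_eq flip: A'(2))
    then show ?thesis using x(2) hor[of u] u by blast
  qed
  moreover have "h' (A' u) (A' v) = g' u v" if "\<forall>w. A' w = 0 \<longrightarrow> g' u w = 0" "\<forall>w. A' w = 0 \<longrightarrow> g' v w = 0" for u v
    using that r unfolding hor by (simp add: h'(2) g'(2) A'(2) rsub_at_def)
  ultimately show ?thesis unfolding rsub_at_def using A'(1) g'(1) h'(1) by blast
qed

lemma rsub_at_mdiff:
  assumes M: "smooth_manifold M" and N: "smooth_manifold N" and g: "riemannian_metric M g" and h: "riemannian_metric N h"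
    and \<phi>: "riemannian_submersion M g N h \<phi>" and p: "p \<in> points M"
  shows "rsub_at (g p) (h (\<phi> p)) (mdiff M N \<phi> p)"
proof -
  have s: "smooth_map M N \<phi>" using \<phi> by (simp add: riemannian_submersion_def)
  show ?thesis
    using \<phi> p linear_mdiff[OF M N s p] inner_product_metric[OF M g p] inner_product_metric[OF N h smooth_map_points[OF M N s p]]
    by (auto simp: rsub_at_def riemannian_submersion_def horizontal_def)
qed

lemma rsub_at_lrep:
  assumes M: "smooth_manifold M" and N: "smooth_manifold N" and g: "riemannian_metric M g" and h: "riemannian_metric N h"
    and \<phi>: "riemannian_submersion M g N h \<phi>" and c: "c \<in> atlas M" "d \<in> atlas N" and y: "y \<in> ldom c d \<phi>"
  shows "rsub_at (in_chart M g c y) (in_chart N h d (lrep c d \<phi> y)) (fderiv (lrep c d \<phi>) y)"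
proof -
  let ?p = "cinv c y"
  have s: "smooth_map M N \<phi>" using \<phi> by (simp add: riemannian_submersion_def)
  note l = ldomD[OF M N c(1) y]
  have p: "?p \<in> points M" using cdom_subset_points[OF M c(1)] l(2) by auto
  have fy: "lrep c d \<phi> y = cmap d (\<phi> ?p)" by (simp add: lrep_def)
  show ?thesis
  proof (rule rsub_at_iso[OF rsub_at_mdiff[OF M N g h \<phi> p] linear_of_chart[OF M c(1) l(2)] bij_of_chart[OF M c(1) l(2)]
        linear_of_chart[OF N c(2) l(3)] bij_of_chart[OF N c(2) l(3)]])
    show "inner_product (in_chart M g c y)" by (rule metric_onD(2)[OF metric_on_in_chart[OF M g c(1)] l(1)])
    show "inner_product (in_chart N h d (lrep c d \<phi> y))"
      by (rule metric_onD(2)[OF metric_on_in_chart[OF N h c(2)]]) (use l fy in auto)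
    show "linear (fderiv (lrep c d \<phi>) y)" by (rule smooth_on_linear_fderiv[OF smooth_lrep[OF M N s c] y])
    show "in_chart M g c y u v = g ?p (of_chart M c ?p u) (of_chart M c ?p v)" for u v by (simp add: in_chart_def)
    show "in_chart N h d (lrep c d \<phi> y) u v = h (\<phi> ?p) (of_chart N d (\<phi> ?p) u) (of_chart N d (\<phi> ?p) v)" for u v
      unfolding fy by (rule in_chart_cmap[OF N c(2) l(3)])
    show "of_chart N d (\<phi> ?p) (fderiv (lrep c d \<phi>) y u) = mdiff M N \<phi> ?p (of_chart M c ?p u)" for u
      using arg_cong[OF to_chart_mdiff_of_chart[OF M N s c l(2,3), of u], of "of_chart N d (\<phi> ?p)"]
      unfolding of_chart_inverse[OF N c(2) l(3)] l(4) by (rule sym)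
  qed
qed

section \<open>Variations in charts\<close>

definition vrep :: "('a, 'e) chart \<Rightarrow> ('b, 'f) chart \<Rightarrow> (real \<Rightarrow> 'a \<Rightarrow> 'b) \<Rightarrow> real \<times> 'e \<Rightarrow> 'f" where
  "vrep c d \<Phi> = (\<lambda>(t, y). cmap d (\<Phi> t (cinv c y)))"

definition vdom :: "real \<Rightarrow> ('a, 'e) chart \<Rightarrow> ('b, 'f) chart \<Rightarrow> (real \<Rightarrow> 'a \<Rightarrow> 'b) \<Rightarrow> (real \<times> 'e) set" where
  "vdom \<epsilon> c d \<Phi> = {(t, y). t \<in> {-\<epsilon><..<\<epsilon>} \<and> y \<in> cimage c \<and> \<Phi> t (cinv c y) \<in> cdom d}"

abbreviation pchart :: "real \<Rightarrow> ('a, 'e) chart \<Rightarrow> (real \<times> 'a, real \<times> 'e) chart" where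
  "pchart \<epsilon> c \<equiv> ({-\<epsilon><..<\<epsilon>} \<times> cdom c, \<lambda>(t, q). (t, cmap c q))"

lemma cinv_pchart:
  assumes "is_chart X c" "t \<in> {-\<epsilon><..<\<epsilon>}" "y \<in> cimage c"
  shows "cinv (pchart \<epsilon> c) (t, y) = (t, cinv c y)"
proof -
  have inj: "inj_on (\<lambda>(t, q). (t, cmap c q)) ({-\<epsilon><..<\<epsilon>} \<times> cdom c)"
    using is_chart_inj_on[OF assms(1)] by (auto simp: inj_on_def)
  have "(t, cinv c y) \<in> {-\<epsilon><..<\<epsilon>} \<times> cdom c" using assms(2) cinv_in[OF assms(3)] by simp
  from inv_into_f_f[OF inj this] show ?thesis by (simp add: cmap_cinv[OF assms(3)])
qed

lemma vdom_eq:
  assumes "is_chart X c"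
  shows "cmap (pchart \<epsilon> c) ` {z \<in> cdom (pchart \<epsilon> c). (\<lambda>(t, q). \<Phi> t q) z \<in> cdom d} = vdom \<epsilon> c d \<Phi>"
proof (intro equalityI subsetI)
  fix z assume "z \<in> vdom \<epsilon> c d \<Phi>"
  then obtain t y where z: "z = (t, y)" "t \<in> {-\<epsilon><..<\<epsilon>}" "y \<in> cimage c" "\<Phi> t (cinv c y) \<in> cdom d" by (auto simp: vdom_def)
  have "z = cmap (pchart \<epsilon> c) (t, cinv c y)" by (simp add: z(1) cmap_cinv[OF z(3)])
  moreover have "(t, cinv c y) \<in> {z \<in> cdom (pchart \<epsilon> c). (\<lambda>(t, q). \<Phi> t q) z \<in> cdom d}" using z cinv_in[OF z(3)] by simp
  ultimately show "z \<in> cmap (pchart \<epsilon> c) ` {z \<in> cdom (pchart \<epsilon> c). (\<lambda>(t, q). \<Phi> t q) z \<in> cdom d}" by (rule image_eqI)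
qed (use assms in \<open>auto simp: vdom_def cinv_cmap\<close>)

lemma smooth_on_linear_family:
  assumes S: "open S" and L: "\<And>x. x \<in> S \<Longrightarrow> linear (L x)" "\<And>u. smooth_on S (\<lambda>x. L x u)" and a: "smooth_on S a"
  shows "smooth_on S (\<lambda>x. L x (a x))"
proof (rule smooth_on_cong[OF _ S])
  show "smooth_on S (\<lambda>x. \<Sum>b\<in>Basis. (a x \<bullet> b) *\<^sub>R L x b)"
    by (intro smooth_on_sum smooth_on_scaleR smooth_on_inner S a smooth_on_const L(2))
  show "(\<Sum>b\<in>Basis. (a x \<bullet> b) *\<^sub>R L x b) = L x (a x)" if "x \<in> S" for x
    using linear_euclidean_expand[OF L(1)[OF that], of "a x"] by simp
qed

context
  fixes M :: "('a, 'e::euclidean_space) manifold" and N :: "('b, 'f::euclidean_space) manifold"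
  assumes M: "smooth_manifold M" and N: "smooth_manifold N"
begin

text \<open>Stated from continuity of the variation, so that it is available in the proof of
  \<open>smooth_variation_iff\<close> and for bump variations before their smoothness is
  known.\<close>

lemma open_vdom_continuous:
  assumes cont: "continuous_map (prod_topology (top_of_set {-\<epsilon><..<\<epsilon>}) (mtop M)) (mtop N) (\<lambda>(t, q). \<Phi> t q)"
    and c: "c \<in> atlas M" and d: "d \<in> atlas N"
  shows "open (vdom \<epsilon> c d \<Phi>)"
proof -
  have "continuous_map (top_of_set ({-\<epsilon><..<\<epsilon>} \<times> cimage c)) (prod_topology (top_of_set {-\<epsilon><..<\<epsilon>}) (mtop M)) (\<lambda>z. (fst z, cinv c (snd z)))"
    unfolding continuous_map_paired
  proof
    show "continuous_map (top_of_set ({-\<epsilon><..<\<epsilon>} \<times> cimage c)) (top_of_set {-\<epsilon><..<\<epsilon>}) fst"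
      by (auto simp: continuous_map_in_subtopology intro!: continuous_intros)
    have "continuous_map (top_of_set ({-\<epsilon><..<\<epsilon>} \<times> cimage c)) (top_of_set (cimage c)) snd"
      by (auto simp: continuous_map_in_subtopology intro!: continuous_intros)
    from continuous_map_compose[OF this continuous_map_cinv[OF atlas_is_chart[OF M c]]]
    show "continuous_map (top_of_set ({-\<epsilon><..<\<epsilon>} \<times> cimage c)) (mtop M) (\<lambda>z. cinv c (snd z))" by (simp add: comp_def)
  qed
  from continuous_map_compose[OF this cont]
  have "continuous_map (top_of_set ({-\<epsilon><..<\<epsilon>} \<times> cimage c)) (mtop N) (\<lambda>z. \<Phi> (fst z) (cinv c (snd z)))" by (simp add: comp_def)
  from openin_continuous_map_preimage[OF this openin_cdom[OF atlas_is_chart[OF N d]]]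
  have "openin (top_of_set ({-\<epsilon><..<\<epsilon>} \<times> cimage c)) {z \<in> {-\<epsilon><..<\<epsilon>} \<times> cimage c. \<Phi> (fst z) (cinv c (snd z)) \<in> cdom d}" by simp
  moreover have "open ({-\<epsilon><..<\<epsilon>} \<times> cimage c)" by (intro open_Times open_greaterThanLessThan open_cimage[OF atlas_is_chart[OF M c]])
  moreover have "{z \<in> {-\<epsilon><..<\<epsilon>} \<times> cimage c. \<Phi> (fst z) (cinv c (snd z)) \<in> cdom d} = vdom \<epsilon> c d \<Phi>" by (auto simp: vdom_def)
  ultimately show ?thesis using openin_open_eq by metis
qed

text \<open>The charts of \<open>interval_times\<close> are inverted by \<open>inv_into\<close> on a
  product, which agrees with the expected map on the chart image. The characterisation removes these
  inverses once and for all; openness of \<open>vdom\<close> is what permits the replacement under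
  \<open>smooth_on\<close>.\<close>

lemma smooth_variation_iff:
  "smooth_variation M N \<phi> \<epsilon> \<Phi> \<longleftrightarrow> 0 < \<epsilon> \<and> (\<forall>q\<in>points M. \<Phi> 0 q = \<phi> q) \<and>
    continuous_map (prod_topology (top_of_set {-\<epsilon><..<\<epsilon>}) (mtop M)) (mtop N) (\<lambda>(t, q). \<Phi> t q) \<and>
    (\<forall>c\<in>atlas M. \<forall>d\<in>atlas N. smooth_on (vdom \<epsilon> c d \<Phi>) (vrep c d \<Phi>))"
  (is "_ \<longleftrightarrow> _ \<and> _ \<and> ?cont \<and> _")
proof -
  have sm: "smooth_on (cmap (pchart \<epsilon> c) ` {z \<in> cdom (pchart \<epsilon> c). (\<lambda>(t, q). \<Phi> t q) z \<in> cdom d})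
       (\<lambda>z. cmap d ((\<lambda>(t, q). \<Phi> t q) (cinv (pchart \<epsilon> c) z))) \<longleftrightarrow> smooth_on (vdom \<epsilon> c d \<Phi>) (vrep c d \<Phi>)"
    if c: "c \<in> atlas M" and d: "d \<in> atlas N" and cont: ?cont for c d
  proof -
    have e: "cmap d ((\<lambda>(t, q). \<Phi> t q) (cinv (pchart \<epsilon> c) z)) = vrep c d \<Phi> z" if "z \<in> vdom \<epsilon> c d \<Phi>" for z
    proof -
      obtain t y where z: "z = (t, y)" by (cases z)
      have ty: "t \<in> {-\<epsilon><..<\<epsilon>}" "y \<in> cimage c" using that unfolding z vdom_def by blast+
      show ?thesis unfolding z cinv_pchart[OF atlas_is_chart[OF M c] ty] by (simp add: vrep_def)
    qed
    have o: "open (vdom \<epsilon> c d \<Phi>)" by (rule open_vdom_continuous[OF cont c d])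
    show ?thesis unfolding vdom_eq[OF atlas_is_chart[OF M c]]
    proof
      show "smooth_on (vdom \<epsilon> c d \<Phi>) (\<lambda>z. cmap d ((\<lambda>(t, q). \<Phi> t q) (cinv (pchart \<epsilon> c) z))) \<Longrightarrow> smooth_on (vdom \<epsilon> c d \<Phi>) (vrep c d \<Phi>)"
        by (erule smooth_on_cong[OF _ o]) (rule e)
      show "smooth_on (vdom \<epsilon> c d \<Phi>) (vrep c d \<Phi>) \<Longrightarrow> smooth_on (vdom \<epsilon> c d \<Phi>) (\<lambda>z. cmap d ((\<lambda>(t, q). \<Phi> t q) (cinv (pchart \<epsilon> c) z)))"
        by (erule smooth_on_cong[OF _ o]) (rule e[symmetric])
    qed
  qed
  have "smooth_map (interval_times \<epsilon> M) N (\<lambda>(t, q). \<Phi> t q) \<longleftrightarrow> ?cont \<and> (\<forall>c\<in>atlas M. \<forall>d\<in>atlas N.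
      smooth_on (cmap (pchart \<epsilon> c) ` {z \<in> cdom (pchart \<epsilon> c). (\<lambda>(t, q). \<Phi> t q) z \<in> cdom d})
       (\<lambda>z. cmap d ((\<lambda>(t, q). \<Phi> t q) (cinv (pchart \<epsilon> c) z))))"
    unfolding smooth_map_def interval_times_def by simp
  then have "smooth_map (interval_times \<epsilon> M) N (\<lambda>(t, q). \<Phi> t q) \<longleftrightarrow> ?cont \<and> (\<forall>c\<in>atlas M. \<forall>d\<in>atlas N. smooth_on (vdom \<epsilon> c d \<Phi>) (vrep c d \<Phi>))"
    using sm by (simp only: cong: conj_cong ball_cong)
  then show ?thesis unfolding smooth_variation_def by blast
qed

context
  fixes \<phi> \<epsilon> \<Phi>
  assumes \<Phi>: "smooth_variation M N \<phi> \<epsilon> \<Phi>"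
begin

lemma variation_eps: "0 < \<epsilon>"
  using \<Phi> by (simp add: smooth_variation_def)

lemma variation_0: "q \<in> points M \<Longrightarrow> \<Phi> 0 q = \<phi> q"
  using \<Phi> by (simp add: smooth_variation_def)

lemma variation_continuous: "continuous_map (prod_topology (top_of_set {-\<epsilon><..<\<epsilon>}) (mtop M)) (mtop N) (\<lambda>(t, q). \<Phi> t q)"
  using \<Phi> unfolding smooth_variation_iff by blast

lemma smooth_vrep: "c \<in> atlas M \<Longrightarrow> d \<in> atlas N \<Longrightarrow> smooth_on (vdom \<epsilon> c d \<Phi>) (vrep c d \<Phi>)"
  using \<Phi> unfolding smooth_variation_iff by blast

lemma open_vdom: "c \<in> atlas M \<Longrightarrow> d \<in> atlas N \<Longrightarrow> open (vdom \<epsilon> c d \<Phi>)"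
  by (rule open_vdom_continuous[OF variation_continuous])

lemma smooth_map_slice:
  assumes t: "\<bar>t\<bar> < \<epsilon>"
  shows "smooth_map M N (\<Phi> t)"
proof -
  have t': "t \<in> {-\<epsilon><..<\<epsilon>}" using t by auto
  have "continuous_map (mtop M) (prod_topology (top_of_set {-\<epsilon><..<\<epsilon>}) (mtop M)) (\<lambda>q. (t, q))"
    unfolding continuous_map_paired using t' by simp
  from continuous_map_compose[OF this variation_continuous]
  have 1: "continuous_map (mtop M) (mtop N) (\<Phi> t)" by (simp add: comp_def)
  have "smooth_on (cmap c ` {q \<in> cdom c. \<Phi> t q \<in> cdom d}) (\<lambda>y. cmap d (\<Phi> t (cinv c y)))" if c: "c \<in> atlas M" and d: "d \<in> atlas N" for c d
  proof -
    have "cmap c ` {q \<in> cdom c. \<Phi> t q \<in> cdom d} = (\<lambda>y. (t, y)) -` vdom \<epsilon> c d \<Phi>"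
    proof (intro equalityI subsetI)
      fix y assume "y \<in> (\<lambda>y. (t, y)) -` vdom \<epsilon> c d \<Phi>"
      then have y: "y \<in> cimage c" "\<Phi> t (cinv c y) \<in> cdom d" by (auto simp: vdom_def)
      have "cinv c y \<in> {q \<in> cdom c. \<Phi> t q \<in> cdom d}" using cinv_in[OF y(1)] y(2) by simp
      then show "y \<in> cmap c ` {q \<in> cdom c. \<Phi> t q \<in> cdom d}" by (rule image_eqI[where f="cmap c", rotated]) (simp add: cmap_cinv[OF y(1)])
    qed (use t' in \<open>auto simp: vdom_def cinv_cmap[OF atlas_is_chart[OF M c]]\<close>)
    moreover have "open ((\<lambda>y. (t, y)) -` vdom \<epsilon> c d \<Phi>)" by (intro open_vimage open_vdom c d) (auto intro!: continuous_intros)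
    moreover have "smooth_on ((\<lambda>y. (t, y)) -` vdom \<epsilon> c d \<Phi>) (\<lambda>y. vrep c d \<Phi> (t, y))"
      by (rule smooth_on_compose[OF smooth_vrep[OF c d] _ calculation(2) open_vdom[OF c d]])
        (auto intro!: smooth_intros calculation(2))
    ultimately show ?thesis by (simp add: vrep_def)
  qed
  with 1 show ?thesis unfolding smooth_map_def by blast
qed

lemma vrep_lrep: "(\<lambda>z. vrep c d \<Phi> (t, z)) = lrep c d (\<Phi> t)"
  by (simp add: vrep_def lrep_def[abs_def])

lemma vdomD:
  assumes "(t, y) \<in> vdom \<epsilon> c d \<Phi>"
  shows "\<bar>t\<bar> < \<epsilon>" "y \<in> cimage c" "cinv c y \<in> cdom c" "\<Phi> t (cinv c y) \<in> cdom d"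
proof -
  have 1: "t \<in> {-\<epsilon><..<\<epsilon>}" "y \<in> cimage c" "\<Phi> t (cinv c y) \<in> cdom d" using assms unfolding vdom_def by blast+
  show "\<bar>t\<bar> < \<epsilon>" using 1(1) by auto
  show "y \<in> cimage c" "\<Phi> t (cinv c y) \<in> cdom d" by (fact 1)+
  show "cinv c y \<in> cdom c" by (rule cinv_in[OF 1(2)])
qed

lemma vrep_image: "vrep c d \<Phi> ` vdom \<epsilon> c d \<Phi> \<subseteq> cimage d"
  by (auto simp: vrep_def vdom_def)

lemma vdom_0: "c \<in> atlas M \<Longrightarrow> q \<in> cdom c \<Longrightarrow> \<phi> q \<in> cdom d \<Longrightarrow> (0, cmap c q) \<in> vdom \<epsilon> c d \<Phi>"
  using variation_eps variation_0 cdom_subset_points[OF M, of c] by (auto simp: vdom_def cinv_cmap[OF atlas_is_chart[OF M]])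

lemma fderiv_vrep_lrep:
  assumes "c \<in> atlas M" "d \<in> atlas N" "(t, y) \<in> vdom \<epsilon> c d \<Phi>"
  shows "fderiv (lrep c d (\<Phi> t)) y u = fderiv (vrep c d \<Phi>) (t, y) (0, u)"
  unfolding vrep_lrep[symmetric] by (rule fderiv_Pair_right[OF smooth_on_differentiable[OF smooth_vrep[OF assms(1,2)] assms(3)]])

lemma lrep_0: "c \<in> atlas M \<Longrightarrow> y \<in> cimage c \<Longrightarrow> vrep c d \<Phi> (0, y) = lrep c d \<phi> y"
  using variation_0 cinv_points[OF M, of c y] by (simp add: vrep_def lrep_def)

text \<open>The velocity at t = 0, in the components of the chart attached to \<phi> q. The curve
  may leave that chart at later times; for the derivative its germ at 0 suffices.\<close>

definition vfield :: "'a \<Rightarrow> 'f" where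
  "vfield q = fderiv (\<lambda>t. cmap (chart_at N (\<phi> q)) (\<Phi> t q)) 0 1"

lemma vfield_curve:
  assumes c: "c \<in> atlas M" and d: "d \<in> atlas N" and q: "q \<in> cdom c" "\<phi> q \<in> cdom d"
  shows "((\<lambda>t. cmap d (\<Phi> t q)) has_derivative (\<lambda>s. s *\<^sub>R fderiv (vrep c d \<Phi>) (0, cmap c q) (1, 0))) (at 0)"
  using fderiv_Pair_left[OF smooth_on_differentiable[OF smooth_vrep[OF c d] vdom_0[OF c q]]]
  by (simp add: vrep_def cinv_cmap[OF atlas_is_chart[OF M c] q(1)])

lemma eventually_variation_in:
  assumes d: "d \<in> atlas N" and q: "q \<in> points M" "\<phi> q \<in> cdom d"
  shows "\<exists>T. open T \<and> 0 \<in> T \<and> (\<forall>t\<in>T. \<Phi> t q \<in> cdom d)"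
proof -
  let ?c = "chart_at M q"
  note c = chart_at[OF M q(1)]
  let ?T = "(\<lambda>t. (t, cmap ?c q)) -` vdom \<epsilon> ?c d \<Phi>"
  have "open ?T" by (intro open_vimage open_vdom c d) (auto intro!: continuous_intros)
  moreover have "0 \<in> ?T" using vdom_0[OF c q(2)] by simp
  moreover have "\<Phi> t q \<in> cdom d" if "t \<in> ?T" for t using that by (simp add: vdom_def cinv_cmap[OF atlas_is_chart[OF M c(1)] c(2)])
  ultimately show ?thesis by blast
qed

lemma to_chart_vfield:
  assumes c: "c \<in> atlas M" and d: "d \<in> atlas N" and q: "q \<in> cdom c" "\<phi> q \<in> cdom d" and \<phi>: "\<phi> q \<in> points N"
  shows "to_chart N d (\<phi> q) (vfield q) = fderiv (vrep c d \<Phi>) (0, cmap c q) (1, 0)"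
proof -
  let ?e = "chart_at N (\<phi> q)"
  note e = chart_at[OF N \<phi>]
  have qM: "q \<in> points M" using cdom_subset_points[OF M c] q by auto
  obtain T where T: "open T" "0 \<in> T" "\<And>t. t \<in> T \<Longrightarrow> \<Phi> t q \<in> cdom ?e" using eventually_variation_in[OF e(1) qM e(2)] by blast
  note de = vfield_curve[OF c e(1) q(1) e(2)] and dd = vfield_curve[OF c d q]
  have ve: "vfield q = fderiv (vrep c ?e \<Phi>) (0, cmap c q) (1, 0)"
    unfolding vfield_def fderiv_eqI[OF de] by simp
  have "(transition ?e d has_derivative to_chart N d (\<phi> q)) (at (cmap ?e (\<Phi> 0 q)))"
    using smooth_on_has_derivative[OF smooth_transition[OF N e(1) d], of "cmap ?e (\<phi> q)"] e(2) q(2) variation_0[OF qM]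
    by (simp add: to_chart_def[abs_def])
  from has_derivative_compose[OF de this]
  have "((\<lambda>t. transition ?e d (cmap ?e (\<Phi> t q))) has_derivative (\<lambda>s. to_chart N d (\<phi> q) (s *\<^sub>R vfield q))) (at 0)"
    by (simp only: ve)
  then have "((\<lambda>t. cmap d (\<Phi> t q)) has_derivative (\<lambda>s. to_chart N d (\<phi> q) (s *\<^sub>R vfield q))) (at 0)"
    by (rule has_derivative_transform_within_open[OF _ T(1,2)]) (use T(3) in \<open>simp add: transition_cmap[OF atlas_is_chart[OF N e(1)]]\<close>)
  from fun_cong[OF has_derivative_unique[OF this dd], of 1] show ?thesis by simp
qed

end

end

locale hermitian_submersion = compact_oriented_riemannian M g
  for M :: "('a, real^'m) manifold" and g +
  fixes N :: "('b, real^'n) manifold" and h :: "('b, real^'n) bilin_field" and J :: "'b \<Rightarrow> real^'n \<Rightarrow> real^'n" and \<phi> :: "'a \<Rightarrow> 'b"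
  assumes N: "smooth_manifold N" and h: "riemannian_metric N h"
    and J: "almost_complex_structure N J" and hJ: "\<And>p u v. p \<in> points N \<Longrightarrow> h p (J p u) (J p v) = h p u v"
    and \<phi>: "riemannian_submersion M g N h \<phi>"
begin

lemmas chN = atlas_is_chart[OF N]

lemma smooth_\<phi>: "smooth_map M N \<phi>"
  using \<phi> by (simp add: riemannian_submersion_def)

lemma \<phi>_points: "p \<in> points M \<Longrightarrow> \<phi> p \<in> points N"
  by (rule smooth_map_points[OF M N smooth_\<phi>])

lemma smooth_endo_in_chart: "d \<in> atlas N \<Longrightarrow> smooth_on (cimage d) (\<lambda>z. endo_in_chart N J d z u)"
  using J by (simp add: almost_complex_structure_def)

lemma endo_in_chart:
  assumes d: "d \<in> atlas N" and z: "z \<in> cimage d"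
  shows "linear (endo_in_chart N J d z)" "endo_in_chart N J d z (endo_in_chart N J d z u) = - u"
    "in_chart N h d z (endo_in_chart N J d z u) (endo_in_chart N J d z v) = in_chart N h d z u v"
proof -
  let ?q = "cinv d z"
  have q: "?q \<in> points N" "?q \<in> cdom d" using cinv_points[OF N d z] cinv_in[OF z] by auto
  have Jq: "linear (J ?q)" "J ?q (J ?q u) = - u" for u using J q(1) by (auto simp: almost_complex_structure_def)
  show "linear (endo_in_chart N J d z)"
    unfolding endo_in_chart_def[abs_def]
    using linear_compose[OF linear_compose[OF linear_of_chart[OF N d q(2)] Jq(1)] linear_to_chart[OF N d q(2)]] by (simp add: comp_def)
  show "endo_in_chart N J d z (endo_in_chart N J d z u) = - u"
    by (simp add: endo_in_chart_def of_chart_inverse[OF N d q(2)] Jq(2) linear_neg[OF linear_to_chart[OF N d q(2)]] to_chart_inverse[OF N d q(2)])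
  show "in_chart N h d z (endo_in_chart N J d z u) (endo_in_chart N J d z v) = in_chart N h d z u v"
    by (simp add: in_chart_def endo_in_chart_def of_chart_inverse[OF N d q(2)] hJ[OF q(1)])
qed

lemma smooth_riesz_coord:
  assumes "c \<in> atlas M"
  shows "smooth_on (cimage c) (\<lambda>y. riesz (in_chart M g c y) (\<lambda>w. w \<bullet> i))"
proof -
  note m = metric_on_in_chart[OF M g assms]
  have "linear (\<lambda>w :: real^'m. w \<bullet> i)" by (simp add: linear_iff inner_add_left)
  then show ?thesis by (intro smooth_on_riesz[OF metric_onD(1)[OF m] metric_onD(2,4)[OF m]] smooth_on_const) auto
qed

section \<open>Joint smoothness of the two energy densities along a variation\<close>

abbreviation dirichlet_density :: "('a \<Rightarrow> 'b) \<Rightarrow> 'a \<Rightarrow> real" where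
  "dirichlet_density \<psi> \<equiv> diff_norm_sq M g N h \<psi>"

abbreviation symplectic_density :: "('a \<Rightarrow> 'b) \<Rightarrow> 'a \<Rightarrow> real" where
  "symplectic_density \<psi> \<equiv> \<lambda>p. form2_norm_sq (g p) (pullback_form2 M N \<psi> (kaehler_form h J) p)"

context
  fixes \<epsilon> \<Phi>
  assumes \<Phi>: "smooth_variation M N \<phi> \<epsilon> \<Phi>"
begin

lemma smooth_vrep_terms:
  assumes c: "c \<in> atlas M" and d: "d \<in> atlas N" and a: "smooth_on (vdom \<epsilon> c d \<Phi>) a" and b: "smooth_on (vdom \<epsilon> c d \<Phi>) b"
  defines "A \<equiv> \<lambda>z u. fderiv (vrep c d \<Phi>) z (0, u)"
  shows "smooth_on (vdom \<epsilon> c d \<Phi>) (\<lambda>z. in_chart N h d (vrep c d \<Phi> z) (A z (a z)) (A z (b z)))"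
    "smooth_on (vdom \<epsilon> c d \<Phi>) (\<lambda>z. in_chart N h d (vrep c d \<Phi> z) (endo_in_chart N J d (vrep c d \<Phi> z) (A z (a z))) (A z (b z)))"
proof -
  note o = open_vdom[OF M N \<Phi> c d] and s = smooth_vrep[OF M N \<Phi> c d] and m = metric_on_in_chart[OF N h d]
  have im: "vrep c d \<Phi> z \<in> cimage d" if "z \<in> vdom \<epsilon> c d \<Phi>" for z by (rule subsetD[OF vrep_image[OF M N \<Phi>] imageI[OF that]])
  have A: "smooth_on (vdom \<epsilon> c d \<Phi>) (\<lambda>z. A z (a' z))" if "smooth_on (vdom \<epsilon> c d \<Phi>) a'" for a'
    unfolding A_def by (intro smooth_on_fderiv_smooth[OF o s] smooth_on_Pair[OF o] smooth_on_const that)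
  have H: "bilinear (in_chart N h d (vrep c d \<Phi> z))" if "z \<in> vdom \<epsilon> c d \<Phi>" for z
    by (rule metric_onD(3)[OF m im[OF that]])
  have Hs: "smooth_on (vdom \<epsilon> c d \<Phi>) (\<lambda>z. in_chart N h d (vrep c d \<Phi> z) u v)" for u v
    by (rule smooth_on_compose[OF metric_onD(4)[OF m] s o metric_onD(1)[OF m] im])
  have Js: "smooth_on (vdom \<epsilon> c d \<Phi>) (\<lambda>z. endo_in_chart N J d (vrep c d \<Phi> z) (A z (a z)))"
  proof (rule smooth_on_linear_family[OF o _ _ A[OF a]])
    show "linear (endo_in_chart N J d (vrep c d \<Phi> z))" if "z \<in> vdom \<epsilon> c d \<Phi>" for z by (rule endo_in_chart(1)[OF d im[OF that]])
    show "smooth_on (vdom \<epsilon> c d \<Phi>) (\<lambda>z. endo_in_chart N J d (vrep c d \<Phi> z) u)" for u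
      by (rule smooth_on_compose[OF smooth_endo_in_chart[OF d] s o metric_onD(1)[OF m] im])
  qed
  show "smooth_on (vdom \<epsilon> c d \<Phi>) (\<lambda>z. in_chart N h d (vrep c d \<Phi> z) (A z (a z)) (A z (b z)))"
    by (rule smooth_on_bilinear_family[OF o H Hs A[OF a] A[OF b]])
  show "smooth_on (vdom \<epsilon> c d \<Phi>) (\<lambda>z. in_chart N h d (vrep c d \<Phi> z) (endo_in_chart N J d (vrep c d \<Phi> z) (A z (a z))) (A z (b z)))"
    by (rule smooth_on_bilinear_family[OF o H Hs Js A[OF b]])
qed

text \<open>Each point of the strip is mapped into some chart of N, so the open sets
  \<open>vdom\<close> for the charts d cover the strip and smoothness can be tested on each of
  them.\<close>

lemma smooth_on_strip_local:
  assumes c: "c \<in> atlas M" and F: "\<And>d. d \<in> atlas N \<Longrightarrow> smooth_on (vdom \<epsilon> c d \<Phi>) F"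
  shows "smooth_on ({-\<epsilon><..<\<epsilon>} \<times> cimage c) F"
proof (rule smooth_on_local)
  fix z assume "z \<in> {-\<epsilon><..<\<epsilon>} \<times> cimage c"
  then obtain t y where z: "z = (t, y)" "t \<in> {-\<epsilon><..<\<epsilon>}" "y \<in> cimage c" by blast
  have "smooth_map M N (\<Phi> t)" by (rule smooth_map_slice[OF M N \<Phi>]) (use z in auto)
  then have "\<Phi> t (cinv c y) \<in> points N" by (rule smooth_map_points[OF M N]) (rule cinv_points[OF M c z(3)])
  note d = chart_at[OF N this]
  have "z \<in> vdom \<epsilon> c (chart_at N (\<Phi> t (cinv c y))) \<Phi>" using z d by (simp add: vdom_def)
  then show "\<exists>U. open U \<and> z \<in> U \<and> smooth_on U F" using F[OF d(1)] open_vdom[OF M N \<Phi> c d(1)] by blast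
qed

lemma density_vrep:
  assumes c: "c \<in> atlas M" and d: "d \<in> atlas N" and z: "(t, y) \<in> vdom \<epsilon> c d \<Phi>"
  defines "A \<equiv> \<lambda>u. fderiv (vrep c d \<Phi>) (t, y) (0, u)" and "H \<equiv> in_chart N h d (vrep c d \<Phi> (t, y))"
    and "j \<equiv> endo_in_chart N J d (vrep c d \<Phi> (t, y))"
  shows "dirichlet_density (\<Phi> t) (cinv c y) = trace_on (in_chart M g c y) UNIV (\<lambda>u v. H (A u) (A v))"
    "symplectic_density (\<Phi> t) (cinv c y) = form2_norm_sq (in_chart M g c y) (\<lambda>u v. H (j (A u)) (A v))"
proof -
  note v = vdomD[OF M N \<Phi> z]
  note s = smooth_map_slice[OF M N \<Phi> v(1)]
  have y: "cmap c (cinv c y) = y" by (rule cmap_cinv[OF v(2)])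
  have l: "lrep c d (\<Phi> t) y = vrep c d \<Phi> (t, y)" by (simp add: lrep_def vrep_def)
  have Jl: "\<And>q. q \<in> points N \<Longrightarrow> linear (J q)" using J by (simp add: almost_complex_structure_def)
  have f: "fderiv (lrep c d (\<Phi> t)) y u = A u" for u unfolding A_def by (rule fderiv_vrep_lrep[OF M N \<Phi> c d z])
  show "dirichlet_density (\<Phi> t) (cinv c y) = trace_on (in_chart M g c y) UNIV (\<lambda>u v. H (A u) (A v))"
    using diff_norm_sq_in_chart[OF M N s g h c d v(3,4)] unfolding y l f H_def .
  show "symplectic_density (\<Phi> t) (cinv c y) = form2_norm_sq (in_chart M g c y) (\<lambda>u v. H (j (A u)) (A v))"
    using symplectic_density_in_chart[OF M N s g h Jl c d v(3,4)] unfolding y l f H_def j_def .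
qed

lemma bilinear_vrep_terms:
  assumes c: "c \<in> atlas M" and d: "d \<in> atlas N" and z: "z \<in> vdom \<epsilon> c d \<Phi>"
  defines "A \<equiv> \<lambda>u. fderiv (vrep c d \<Phi>) z (0, u)" and "H \<equiv> in_chart N h d (vrep c d \<Phi> z)" and "j \<equiv> endo_in_chart N J d (vrep c d \<Phi> z)"
  shows "bilinear (\<lambda>u v. H (A u) (A v))" "bilinear (\<lambda>u v. H (j (A u)) (A v))"
proof -
  have im: "vrep c d \<Phi> z \<in> cimage d" by (rule subsetD[OF vrep_image[OF M N \<Phi>] imageI[OF z]])
  have A: "linear A"
    using linear_compose[of "\<lambda>u. (0, u)", OF _ smooth_on_linear_fderiv[OF smooth_vrep[OF M N \<Phi> c d] z]]
    by (simp add: A_def comp_def linear_iff)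
  have H: "linear (H u)" "linear (\<lambda>u. H u v)" for u v
    unfolding H_def using bilinear_linear[OF metric_onD(3)[OF metric_on_in_chart[OF N h d] im]] by auto
  have j: "linear j" unfolding j_def by (rule endo_in_chart(1)[OF d im])
  show "bilinear (\<lambda>u v. H (A u) (A v))" "bilinear (\<lambda>u v. H (j (A u)) (A v))"
    using linear_compose[OF A H(1)] linear_compose[OF A H(2)] linear_compose[OF linear_compose[OF A j] H(2)]
    unfolding bilinear_def comp_def by blast+
qed

text \<open>In the definition the density is a sum over a frame that may jump with the point.
  \<open>trace_on_riesz\<close> rewrites it with the inverse metric and fixed basis vectors, after
  which every ingredient is smooth in time and space.\<close>

lemma smooth_family_dirichlet: "smooth_family \<epsilon> (\<lambda>t. dirichlet_density (\<Phi> t))"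
  unfolding smooth_family_def
proof (intro ballI smooth_on_strip_local)
  fix c d assume c: "c \<in> atlas M" and d: "d \<in> atlas N"
  let ?V = "vdom \<epsilon> c d \<Phi>" and ?r = "\<lambda>i z. riesz (in_chart M g c (snd z)) (\<lambda>w. w \<bullet> i)"
  let ?A = "\<lambda>z u. fderiv (vrep c d \<Phi>) z (0, u)" and ?H = "\<lambda>z. in_chart N h d (vrep c d \<Phi> z)"
  note o = open_vdom[OF M N \<Phi> c d]
  have r: "smooth_on ?V (?r i)" for i
    by (rule smooth_on_compose[OF smooth_riesz_coord[OF c] smooth_on_snd[OF o smooth_on_ident[OF o]] o open_cimage[OF ch[OF c]]])
      (simp add: vdom_def split_beta)
  show "smooth_on ?V (\<lambda>(t, y). dirichlet_density (\<Phi> t) (cinv c y))"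
  proof (rule smooth_on_cong[OF _ o])
    show "smooth_on ?V (\<lambda>z. \<Sum>i\<in>Basis. ?H z (?A z (?r i z)) (?A z i))"
      by (intro smooth_on_sum[OF o] smooth_vrep_terms(1)[OF c d] r smooth_on_const)
    fix z assume z: "z \<in> ?V"
    then obtain t y where ty: "z = (t, y)" by (cases z)
    have y: "y \<in> cimage c" by (rule vdomD(2)[OF M N \<Phi> z[unfolded ty]])
    show "(\<Sum>i\<in>Basis. ?H z (?A z (?r i z)) (?A z i)) = (case z of (t, y) \<Rightarrow> dirichlet_density (\<Phi> t) (cinv c y))"
      using density_vrep(1)[OF c d z[unfolded ty]]
        trace_on_riesz[OF metric_onD(2)[OF metric_on_in_chart[OF M g c] y] bilinear_vrep_terms(1)[OF c d z]]
      by (simp add: ty)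
  qed
qed

lemma smooth_family_symplectic: "smooth_family \<epsilon> (\<lambda>t. symplectic_density (\<Phi> t))"
  unfolding smooth_family_def
proof (intro ballI smooth_on_strip_local)
  fix c d assume c: "c \<in> atlas M" and d: "d \<in> atlas N"
  let ?V = "vdom \<epsilon> c d \<Phi>" and ?r = "\<lambda>i z. riesz (in_chart M g c (snd z)) (\<lambda>w. w \<bullet> i)"
  let ?A = "\<lambda>z u. fderiv (vrep c d \<Phi>) z (0, u)" and ?H = "\<lambda>z. in_chart N h d (vrep c d \<Phi> z)" and ?j = "\<lambda>z. endo_in_chart N J d (vrep c d \<Phi> z)"
  note o = open_vdom[OF M N \<Phi> c d]
  have r: "smooth_on ?V (?r i)" for i
    by (rule smooth_on_compose[OF smooth_riesz_coord[OF c] smooth_on_snd[OF o smooth_on_ident[OF o]] o open_cimage[OF ch[OF c]]])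
      (simp add: vdom_def split_beta)
  show "smooth_on ?V (\<lambda>(t, y). symplectic_density (\<Phi> t) (cinv c y))"
  proof (rule smooth_on_cong[OF _ o])
    show "smooth_on ?V (\<lambda>z. 1/2 * (\<Sum>i\<in>Basis. \<Sum>k\<in>Basis. ?H z (?j z (?A z (?r i z))) (?A z (?r k z)) * ?H z (?j z (?A z i)) (?A z k)))"
      by (intro smooth_on_sum[OF o] smooth_on_mult[OF o] smooth_vrep_terms(2)[OF c d] r smooth_on_const)
    fix z assume z: "z \<in> ?V"
    then obtain t y where ty: "z = (t, y)" by (cases z)
    have y: "y \<in> cimage c" by (rule vdomD(2)[OF M N \<Phi> z[unfolded ty]])
    note ip = metric_onD(2)[OF metric_on_in_chart[OF M g c] y]
    note b = bilinear_vrep_terms(2)[OF c d z]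
    show "1/2 * (\<Sum>i\<in>Basis. \<Sum>k\<in>Basis. ?H z (?j z (?A z (?r i z))) (?A z (?r k z)) * ?H z (?j z (?A z i)) (?A z k))
        = (case z of (t, y) \<Rightarrow> symplectic_density (\<Phi> t) (cinv c y))"
      using density_vrep(2)[OF c d z[unfolded ty]] form2_norm_sq_trace[OF b, of "in_chart M g c y"]
        trace_on_riesz[OF ip bilinear_trace_inner(1)[OF b, of "in_chart M g c y"]] trace_on_riesz[OF ip bilinear_trace_inner(2)[OF b]]
      by (simp add: ty)
  qed
qed

end

end

section \<open>The first variation of the two energies\<close>

context hermitian_submersion
begin

lemma rsub_lrep:
  "c \<in> atlas M \<Longrightarrow> d \<in> atlas N \<Longrightarrow> y \<in> ldom c d \<phi> \<Longrightarrow>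
    rsub_at (in_chart M g c y) (in_chart N h d (lrep c d \<phi> y)) (fderiv (lrep c d \<phi>) y)"
  by (rule rsub_at_lrep[OF M N g h \<phi>])

lemma rsub_mdiff: "p \<in> points M \<Longrightarrow> rsub_at (g p) (h (\<phi> p)) (mdiff M N \<phi> p)"
  by (rule rsub_at_mdiff[OF M N g h \<phi>])

context
  fixes \<epsilon> \<Phi>
  assumes \<Phi>: "smooth_variation M N \<phi> \<epsilon> \<Phi>"
begin

abbreviation vfield_in :: "('a, real^'m) chart \<Rightarrow> ('b, real^'n) chart \<Rightarrow> real^'m \<Rightarrow> real^'n" where
  "vfield_in c d y \<equiv> fderiv (vrep c d \<Phi>) (0, y) (1, 0)"

text \<open>The field adjoint to the variation field, which for a Riemannian submersion is its
  horizontal lift. Its divergence is the part of the first variation that integrates to 0.\<close>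

definition vlift :: "'a \<Rightarrow> real^'m" where
  "vlift p = lift (g p) (h (\<phi> p)) (mdiff M N \<phi> p) (vfield N \<phi> \<Phi> p)"

definition vtension :: "'a \<Rightarrow> real" where
  "vtension p = h (\<phi> p) (vfield N \<phi> \<Phi> p) (tension_field M g N h \<phi> p)"

lemma vdom_0_ldom:
  assumes c: "c \<in> atlas M" and d: "d \<in> atlas N" and y: "y \<in> ldom c d \<phi>"
  shows "(0, y) \<in> vdom \<epsilon> c d \<Phi>"
proof -
  note yD = ldomD[OF M N c y]
  show ?thesis using vdom_0[OF M N \<Phi> c yD(2,3)] unfolding yD(4) .
qed

lemma smooth_vfield_in:
  assumes c: "c \<in> atlas M" and d: "d \<in> atlas N"
  shows "smooth_on (ldom c d \<phi>) (vfield_in c d)"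
proof -
  note o = open_ldom[OF M N smooth_\<phi> c d]
  show ?thesis
    by (rule smooth_on_compose[OF smooth_on_fderiv[OF smooth_vrep[OF M N \<Phi> c d]] _ o open_vdom[OF M N \<Phi> c d] vdom_0_ldom[OF c d]])
      (intro smooth_on_Pair smooth_on_const smooth_on_ident o)
qed

text \<open>Adjointness is an identity of scalars and so survives the change of charts; a vector is
  determined by its inner products, hence the coordinate lift is the coordinate expression of the
  lift.\<close>

lemma vlift_in_chart:
  assumes c: "c \<in> atlas M" and d: "d \<in> atlas N" and y: "y \<in> ldom c d \<phi>"
  shows "field_in_chart M vlift c y = lift (in_chart M g c y) (in_chart N h d (lrep c d \<phi> y)) (fderiv (lrep c d \<phi>) y) (vfield_in c d y)"
proof -
  define q where "q = cinv c y"
  have yD: "y \<in> cimage c" "q \<in> cdom c" "\<phi> q \<in> cdom d" "cmap c q = y" unfolding q_def by (fact ldomD[OF M N c y])+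
  have q: "q \<in> points M" "\<phi> q \<in> points N" using cinv_points[OF M c yD(1)] \<phi>_points unfolding q_def by blast+
  note ip = metric_onD(2)[OF metric_on_in_chart[OF M g c] yD(1)]
  have "in_chart M g c y (field_in_chart M vlift c y) w = in_chart N h d (lrep c d \<phi> y) (vfield_in c d y) (fderiv (lrep c d \<phi>) y w)" for w
  proof -
    have "in_chart M g c y (field_in_chart M vlift c y) w = in_chart M g c (cmap c q) (to_chart M c q (vlift q)) (to_chart M c q (of_chart M c q w))"
      unfolding field_in_chart_def q_def[symmetric] yD(4) to_chart_inverse[OF M c yD(2)] ..
    also have "\<dots> = g q (vlift q) (of_chart M c q w)" by (rule to_chart_in_chart[OF M c yD(2)])
    also have "\<dots> = h (\<phi> q) (vfield N \<phi> \<Phi> q) (mdiff M N \<phi> q (of_chart M c q w))"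
      unfolding vlift_def by (rule lift_works[OF rsub_mdiff[OF q(1)]])
    also have "\<dots> = in_chart N h d (cmap d (\<phi> q)) (to_chart N d (\<phi> q) (vfield N \<phi> \<Phi> q)) (to_chart N d (\<phi> q) (mdiff M N \<phi> q (of_chart M c q w)))"
      by (rule to_chart_in_chart[OF N d yD(3), symmetric])
    also have "\<dots> = in_chart N h d (lrep c d \<phi> y) (vfield_in c d y) (fderiv (lrep c d \<phi>) y w)"
      unfolding to_chart_vfield[OF M N \<Phi> c d yD(2,3) q(2)] to_chart_mdiff_of_chart[OF M N smooth_\<phi> c d yD(2,3)]
        lrep_cmap[OF M N c yD(2), symmetric] yD(4) ..
    finally show ?thesis .
  qed
  from riesz_unique[OF ip this] show ?thesis unfolding lift_def .
qed

lemma smooth_vlift: "smooth_field_on M (points M) vlift"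
  unfolding smooth_field_on_def field_in_chart_def[symmetric]
proof (intro ballI smooth_on_local)
  fix c y assume c: "c \<in> atlas M" and "y \<in> cmap c ` (cdom c \<inter> points M)"
  then obtain q where q: "q \<in> cdom c" "q \<in> points M" "y = cmap c q" by blast
  define d where "d = chart_at N (\<phi> q)"
  have d: "d \<in> atlas N" "\<phi> q \<in> cdom d" unfolding d_def by (rule chart_at[OF N \<phi>_points[OF q(2)]])+
  note o = open_ldom[OF M N smooth_\<phi> c d(1)]
  have m: "metric_on (ldom c d \<phi>) (in_chart M g c)"
    by (rule metric_on_subset[OF metric_on_in_chart[OF M g c] o ldom_cimage[OF M N]])
  have "smooth_on (ldom c d \<phi>) (\<lambda>y. lift (in_chart M g c y) (in_chart N h d (lrep c d \<phi> y)) (fderiv (lrep c d \<phi>) y) (vfield_in c d y))"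
    by (rule smooth_on_lift[OF m metric_on_in_chart[OF N h d(1)] smooth_lrep[OF M N smooth_\<phi> c d(1)] lrep_image[OF M N c] smooth_vfield_in[OF c d(1)]])
  then have "smooth_on (ldom c d \<phi>) (field_in_chart M vlift c)"
    by (rule smooth_on_cong[OF _ o]) (rule vlift_in_chart[OF c d(1), symmetric])
  moreover have "y \<in> ldom c d \<phi>" unfolding q(3) by (rule ldomI[where \<phi>=\<phi>, OF M N q(1) d(2)])
  ultimately show "\<exists>U. open U \<and> y \<in> U \<and> smooth_on U (field_in_chart M vlift c)" using o by (intro exI[of _ "ldom c d \<phi>"] conjI)
qed

text \<open>Both pointwise variation formulas produce the same trace of h(\<nabla>V, d\<phi>).
  \<open>divergence_adjoint\<close>, applied to the variation field and its lift, rewrites that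
  trace as the divergence minus the tension term.\<close>

lemma density_derivative:
  assumes p: "p \<in> points M"
  shows "((\<lambda>t. dirichlet_density (\<Phi> t) p) has_real_derivative 2 * (divergence M g vlift p - vtension p)) (at 0)" (is ?D)
    and "((\<lambda>t. symplectic_density (\<Phi> t) p) has_real_derivative 2 * (divergence M g vlift p - vtension p)) (at 0)" (is ?S)
proof -
  \<comment> \<open>In the charts attached to p and \<phi> p the component maps at these points are
    identities, so the coordinate expressions coincide with the metrics, the variation field and the
    second fundamental form themselves.\<close>
  define c where "c = chart_at M p"
  define d where "d = chart_at N (\<phi> p)"
  define y where "y = cmap c p"
  have c: "c \<in> atlas M" "p \<in> cdom c" unfolding c_def by (rule chart_at[OF M p])+
  note \<phi>p = \<phi>_points[OF p]
  have d: "d \<in> atlas N" "\<phi> p \<in> cdom d" unfolding d_def by (rule chart_at[OF N \<phi>p])+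
  let ?G = "in_chart M g c" and ?H = "in_chart N h d" and ?L = "lrep c d \<phi>" and ?V = "vfield_in c d" and ?U = "ldom c d \<phi>"
  have y: "y \<in> ?U" unfolding y_def by (rule ldomI[where \<phi>=\<phi>, OF M N c(2) d(2)])
  have yc: "y \<in> cimage c" and cy: "cinv c y = p" unfolding y_def using c(2) by (rule imageI, intro cinv_cmap[OF ch[OF c(1)]] c(2))
  note v0 = vdom_0_ldom[OF c(1) d(1) y]
  note o = open_ldom[OF M N smooth_\<phi> c(1) d(1)] and sL = smooth_lrep[OF M N smooth_\<phi> c(1) d(1)]
  note sv = smooth_vrep[OF M N \<Phi> c(1) d(1)] and ov = open_vdom[OF M N \<Phi> c(1) d(1)]
  have mG: "metric_on ?U ?G"
    by (rule metric_on_subset[OF metric_on_in_chart[OF M g c(1)] o ldom_cimage[OF M N]])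
  note mH = metric_on_in_chart[OF N h d(1)]
  have Gy: "?G y = g p" unfolding y_def c_def by (rule in_chart_chart_at[OF M p])
  have Ly: "?L y = cmap d (\<phi> p)" unfolding y_def by (rule lrep_cmap[OF M N c])
  have Hy: "?H (?L y) = h (\<phi> p)" unfolding Ly unfolding d_def by (rule in_chart_chart_at[OF N \<phi>p])
  have Vy: "?V y = vfield N \<phi> \<Phi> p"
    using to_chart_vfield[OF M N \<Phi> c(1) d(1) c(2) d(2) \<phi>p] unfolding y_def d_def to_chart_chart_at[OF N \<phi>p] by simp
  have nab: "sff ?G ?H ?L y = nabla_d M g N h \<phi> p"
    unfolding c_def d_def y_def by (rule nabla_d_eq_sff[OF M N smooth_\<phi> g h p, symmetric])
  have dif: "f differentiable at y" if "smooth_on ?U f" for f :: "real^'m \<Rightarrow> 'x::euclidean_space"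
    by (rule smooth_on_differentiable[OF that y])
  have Zs: "smooth_on ?U (field_in_chart M vlift c)"
    by (rule smooth_on_subset[OF field_in_chart_smooth[OF smooth_vlift c(1)] ldom_cimage[OF M N]])
  have lc: "levi_civita M g vlift p u = covd ?G (\<lambda>y. y) (field_in_chart M vlift c) y u" for u
    using levi_civita_in_chart[OF M g openin_topspace smooth_vlift p c, of u] to_chart_chart_at[OF M p]
    unfolding y_def c_def by simp
  have "divergence M g vlift p = trace_on (?G y) UNIV (\<lambda>u v. ?H (?L y) (covd ?H ?L ?V y u) (fderiv ?L y v))
      + ?H (?L y) (?V y) (trace_on (?G y) UNIV (sff ?G ?H ?L y))"
    unfolding divergence_def lc
  proof (rule divergence_adjoint[OF mG mH sL lrep_image[OF M N c(1)] y dif[OF Zs] dif[OF smooth_vfield_in[OF c(1) d(1)]]])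
    show "?G y (field_in_chart M vlift c y) u = ?H (?L y) (?V y) (fderiv ?L y u)" if "y \<in> ?U" for y u
      unfolding vlift_in_chart[OF c(1) d(1) that] by (rule lift_works[OF rsub_lrep[OF c(1) d(1) that]])
  qed
  then have tr: "trace_on (?G y) UNIV (\<lambda>u v. ?H (?L y) (covd ?H ?L ?V y u) (fderiv ?L y v)) = divergence M g vlift p - vtension p"
    unfolding nab Vy Hy Gy vtension_def tension_field_def by simp
  let ?v0 = "\<lambda>z. vrep c d \<Phi> (0, z)"
  have L0: "?v0 y = ?L y" by (rule lrep_0[OF M N \<Phi> c(1) yc])
  have F0: "fderiv ?v0 y = fderiv ?L y"
    by (rule fderiv_cong_open[OF open_cimage[OF ch[OF c(1)]] yc]) (rule lrep_0[OF M N \<Phi> c(1)])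
  have C0: "covd ?H ?v0 ?V y u = covd ?H ?L ?V y u" for u
    unfolding covd_def L0 F0 ..
  have D0: "2 * trace_on (?G y) UNIV (\<lambda>u v. ?H (?v0 y) (covd ?H ?v0 ?V y u) (fderiv ?v0 y v)) = 2 * (divergence M g vlift p - vtension p)"
    unfolding C0 L0 F0 tr ..
  have ev: "\<forall>\<^sub>F t in nhds 0. (t, y) \<in> vdom \<epsilon> c d \<Phi>"
  proof -
    have "open ((\<lambda>t. (t, y)) -` vdom \<epsilon> c d \<Phi>)" by (intro open_vimage ov) (auto intro!: continuous_intros)
    moreover have "0 \<in> (\<lambda>t. (t, y)) -` vdom \<epsilon> c d \<Phi>" using v0 by simp
    ultimately have "\<forall>\<^sub>F t in nhds 0. t \<in> (\<lambda>t. (t, y)) -` vdom \<epsilon> c d \<Phi>" by (rule eventually_nhds_in_open)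
    then show ?thesis by simp
  qed
  have fr: "fderiv (\<lambda>z. vrep c d \<Phi> (t, z)) y u = fderiv (vrep c d \<Phi>) (t, y) (0, u)" if "(t, y) \<in> vdom \<epsilon> c d \<Phi>" for t u
    by (rule fderiv_Pair_right[OF smooth_on_differentiable[OF sv that]])
  note imv = vrep_image[OF M N \<Phi>, of c d]
  note dd = dirichlet_density_derivative[where g="g p", OF sv ov v0 imv mH, unfolded Gy[symmetric] D0]
  show ?D
  proof (rule DERIV_eventually_cong[OF dd eventually_mono[OF ev]])
    show "dirichlet_density (\<Phi> t) p = trace_on (?G y) UNIV (\<lambda>u v. ?H (vrep c d \<Phi> (t, y)) (fderiv (\<lambda>z. vrep c d \<Phi> (t, z)) y u) (fderiv (\<lambda>z. vrep c d \<Phi> (t, z)) y v))"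
      if t: "(t, y) \<in> vdom \<epsilon> c d \<Phi>" for t
      using density_vrep(1)[OF \<Phi> c(1) d(1) t] unfolding cy fr[OF t] .
  qed
  have rs: "rsub_at (g p) (?H (?v0 y)) (fderiv ?v0 y)" unfolding L0 F0 Gy[symmetric] by (rule rsub_lrep[OF c(1) d(1) y])
  note ds = symplectic_density_derivative[where J="endo_in_chart N J d" and H="?H" and W="cimage d" and \<Phi>="vrep c d \<Phi>", OF sv ov v0 imv mH rs endo_in_chart(1)[OF d(1)] endo_in_chart(2)[OF d(1)] smooth_endo_in_chart[OF d(1)] endo_in_chart(3)[OF d(1)],
      unfolded Gy[symmetric] D0]
  show ?S
  proof (rule DERIV_eventually_cong[OF ds eventually_mono[OF ev]])
    show "symplectic_density (\<Phi> t) p = form2_norm_sq (?G y) (\<lambda>u v. ?H (vrep c d \<Phi> (t, y)) (endo_in_chart N J d (vrep c d \<Phi> (t, y)) (fderiv (\<lambda>z. vrep c d \<Phi> (t, z)) y u)) (fderiv (\<lambda>z. vrep c d \<Phi> (t, z)) y v))"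
      if t: "(t, y) \<in> vdom \<epsilon> c d \<Phi>" for t
      using density_vrep(2)[OF \<Phi> c(1) d(1) t] unfolding cy fr[OF t] .
  qed
qed

text \<open>Continuity is obtained indirectly: the derivative of a smooth family is continuous, and
  so is the divergence of the lift, while the tension term is the divergence minus half of that
  derivative.\<close>

lemma vtension_continuous: "chart_continuous M vtension"
  and integral_density_derivative: "integral_vol M g (\<lambda>p. k * (2 * (divergence M g vlift p - vtension p))) = - 2 * k * integral_vol M g vtension"
proof -
  let ?D = "\<lambda>p. 2 * (divergence M g vlift p - vtension p)"
  note \<epsilon> = variation_eps[OF M N \<Phi>]
  have D: "chart_continuous M ?D"
    by (rule smooth_family_derivative_continuous[OF smooth_family_dirichlet[OF \<Phi>] \<epsilon> density_derivative(1)])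
  have dv: "chart_continuous M (divergence M g vlift)"
    by (rule smooth_fun_chart_continuous[OF M smooth_fun_divergence[OF smooth_vlift]])
  have "chart_continuous M (\<lambda>p. divergence M g vlift p - (1/2) * ?D p)"
    by (intro chart_continuous_ops(2,3) chart_continuous_const D dv)
  moreover have "(\<lambda>p. divergence M g vlift p - (1/2) * ?D p) = vtension" by (rule ext) (simp add: field_simps)
  ultimately show vt: "chart_continuous M vtension" by simp
  have "integral_vol M g (\<lambda>p. k * ?D p) = integral_vol M g (\<lambda>p. (2 * k) * divergence M g vlift p + (- 2 * k) * vtension p)"
    by (simp add: algebra_simps)
  also have "\<dots> = (2 * k) * integral_vol M g (divergence M g vlift) + (- 2 * k) * integral_vol M g vtension"
    using integral_vol_add[OF chart_continuous_ops(2)[OF chart_continuous_const dv] chart_continuous_ops(2)[OF chart_continuous_const vt], of "2 * k" "- 2 * k"]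
    unfolding integral_vol_cmult[OF dv] integral_vol_cmult[OF vt] .
  finally show "integral_vol M g (\<lambda>p. k * ?D p) = - 2 * k * integral_vol M g vtension"
    unfolding divergence_theorem[OF smooth_vlift] by simp
qed

lemma symplectic_energy_derivative:
  "((\<lambda>t. symplectic_energy M g N (kaehler_form h J) (\<Phi> t)) has_real_derivative - integral_vol M g vtension) (at 0)"
proof -
  note \<epsilon> = variation_eps[OF M N \<Phi>]
  note D = has_derivative_integral_vol[OF smooth_family_symplectic[OF \<Phi>] \<epsilon> density_derivative(2)]
  show ?thesis
    using DERIV_cmult[OF D, of "1/2"] integral_density_derivative[of 1] unfolding symplectic_energy_def by simp
qed

text \<open>The two densities have equal derivatives at a Riemannian submersion, so their weights 1
  and \<alpha> simply add up.\<close>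

lemma full_energy_derivative:
  "((\<lambda>t. full_energy \<alpha> M g N h (kaehler_form h J) (\<Phi> t)) has_real_derivative - (1 + \<alpha>) * integral_vol M g vtension) (at 0)"
proof -
  note \<epsilon> = variation_eps[OF M N \<Phi>]
  let ?f = "\<lambda>t p. dirichlet_density (\<Phi> t) p + \<alpha> * symplectic_density (\<Phi> t) p"
  have "smooth_family \<epsilon> ?f"
    unfolding smooth_family_def
  proof
    fix c assume c: "c \<in> atlas M"
    have o: "open ({-\<epsilon><..<\<epsilon>} \<times> cimage c)" by (intro open_Times open_greaterThanLessThan open_cimage[OF ch[OF c]])
    have "smooth_on ({-\<epsilon><..<\<epsilon>} \<times> cimage c) (\<lambda>z. (\<lambda>(t, y). dirichlet_density (\<Phi> t) (cinv c y)) z + \<alpha> * (\<lambda>(t, y). symplectic_density (\<Phi> t) (cinv c y)) z)"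
      using smooth_family_dirichlet[OF \<Phi>] smooth_family_symplectic[OF \<Phi>] c unfolding smooth_family_def
      by (intro smooth_on_add smooth_on_mult smooth_on_const o) blast+
    then show "smooth_on ({-\<epsilon><..<\<epsilon>} \<times> cimage c) (\<lambda>(t, y). ?f t (cinv c y))" by (simp add: case_prod_beta')
  qed
  moreover have "((\<lambda>t. ?f t p) has_real_derivative (1 + \<alpha>) * (2 * (divergence M g vlift p - vtension p))) (at 0)" if p: "p \<in> points M" for p
    using DERIV_add[OF density_derivative(1)[OF p] DERIV_cmult[OF density_derivative(2)[OF p], of \<alpha>]] by (simp add: algebra_simps)
  ultimately have D: "((\<lambda>t. integral_vol M g (?f t)) has_real_derivative
      integral_vol M g (\<lambda>p. (1 + \<alpha>) * (2 * (divergence M g vlift p - vtension p)))) (at 0)"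
    by (rule has_derivative_integral_vol[OF _ \<epsilon>])
  show ?thesis using DERIV_cmult[OF D, of "1/2"] unfolding full_energy_def integral_density_derivative[of "1 + \<alpha>"] by (simp add: algebra_simps)
qed

end

lemma harmonic_imp_critical:
  assumes "harmonic_map M g N h \<phi>"
  shows "critical_point M N (symplectic_energy M g N (kaehler_form h J)) \<phi>"
    "critical_point M N (full_energy \<alpha> M g N h (kaehler_form h J)) \<phi>"
proof -
  have t0: "integral_vol M g (vtension \<Phi>) = 0" if \<Phi>: "smooth_variation M N \<phi> \<epsilon> \<Phi>" for \<epsilon> \<Phi>
  proof -
    have "0 = vtension \<Phi> p" if p: "p \<in> points M" for p
      using assms p bilinear_rzero[OF inner_productD(1)[OF inner_product_metric[OF N h \<phi>_points[OF p]]]]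
      unfolding vtension_def[OF \<Phi>] harmonic_map_def by simp
    from integral_vol_cong[OF chart_continuous_const this]
    have "integral_vol M g (vtension \<Phi>) = integral_vol M g (\<lambda>p. 0)" by simp
    also have "\<dots> = 0" using integral_vol_cmult[OF chart_continuous_const, of 0 0] by simp
    finally show ?thesis .
  qed
  show "critical_point M N (symplectic_energy M g N (kaehler_form h J)) \<phi>"
    unfolding critical_point_def using smooth_\<phi> symplectic_energy_derivative t0 by fastforce
  show "critical_point M N (full_energy \<alpha> M g N h (kaehler_form h J)) \<phi>"
    unfolding critical_point_def using smooth_\<phi> full_energy_derivative[of _ _ \<alpha>] t0 by fastforce
qed

lemma critical_imp_integral_eq_0:
  assumes "critical_point M N (symplectic_energy M g N (kaehler_form h J)) \<phi>" and \<Phi>: "smooth_variation M N \<phi> \<epsilon> \<Phi>"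
  shows "integral_vol M g (vtension \<Phi>) = 0"
  using DERIV_unique[OF symplectic_energy_derivative[OF \<Phi>]] assms unfolding critical_point_def by force

end

section \<open>Variations supported in a chart\<close>

text \<open>Points are pushed along straight lines in the chart \<open>d\<close>, which takes the
  place of the exponential map; the cut-off \<open>\<psi>\<close> leaves the map unchanged outside
  its support. The velocity at q is \<open>\<psi> q\<close> times the vector with components
  \<open>w\<close> in \<open>d\<close>.\<close>

definition bump_variation :: "('a, 'e) chart \<Rightarrow> ('b, 'f::euclidean_space) chart \<Rightarrow> ('a \<Rightarrow> 'b) \<Rightarrow> ('a \<Rightarrow> real) \<Rightarrow> 'f \<Rightarrow> real \<Rightarrow> 'a \<Rightarrow> 'b" where
  "bump_variation c d \<phi> \<psi> w t q =
    (if q \<in> cdom c \<and> \<phi> q \<in> cdom d then cinv d (cmap d (\<phi> q) + (t * \<psi> q) *\<^sub>R w) else \<phi> q)"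

context
  fixes M :: "('a, 'e::euclidean_space) manifold" and N :: "('b, 'f::euclidean_space) manifold" and \<phi> c d \<psi> K and w :: 'f
  assumes M: "smooth_manifold M" and N: "smooth_manifold N" and \<phi>: "smooth_map M N \<phi>" and cM: "compact_space (mtop M)"
    and c: "c \<in> atlas M" and d: "d \<in> atlas N" and \<psi>: "smooth_fun M (points M) \<psi>"
    and K': "closedin (mtop M) K" "\<forall>q\<in>K. q \<in> cdom c \<and> \<phi> q \<in> cdom d" "\<forall>q. q \<notin> K \<longrightarrow> \<psi> q = 0"
begin

private lemma K: "closedin (mtop M) K" "q \<in> K \<Longrightarrow> q \<in> cdom c" "q \<in> K \<Longrightarrow> \<phi> q \<in> cdom d" "q \<notin> K \<Longrightarrow> \<psi> q = 0"
  using K' by blast+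

abbreviation (input) bv where "bv \<equiv> bump_variation c d \<phi> \<psi> w"

private definition "D = {q \<in> cdom c. \<phi> q \<in> cdom d}"

private lemma openin_D: "openin (mtop M) D"
proof -
  have "D = cdom c \<inter> {q \<in> points M. \<phi> q \<in> cdom d}" using cdom_subset_points[OF M c] unfolding D_def by blast
  moreover have "openin (mtop M) (cdom c \<inter> {q \<in> points M. \<phi> q \<in> cdom d})"
    by (rule openin_Int[OF openin_cdom[OF atlas_is_chart[OF M c]] openin_preimage[OF M N \<phi> openin_cdom[OF atlas_is_chart[OF N d]]]])
  ultimately show ?thesis by simp
qed

lemma bump_variation_off: "q \<notin> K \<Longrightarrow> bump_variation c d \<phi> \<psi> w t q = \<phi> q"
  using K(4) by (simp add: bump_variation_def cinv_cmap[OF atlas_is_chart[OF N d]])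

lemma bump_variation_0: "bump_variation c d \<phi> \<psi> w 0 q = \<phi> q"
  by (simp add: bump_variation_def cinv_cmap[OF atlas_is_chart[OF N d]])

private lemma bv_D: "q \<in> D \<Longrightarrow> bv t q = cinv d (cmap d (\<phi> q) + (t * \<psi> q) *\<^sub>R w)"
  by (simp add: D_def bump_variation_def)

lemma bump_variation_interval:
  "\<exists>\<epsilon>>0. \<forall>t q. \<bar>t\<bar> < \<epsilon> \<longrightarrow> q \<in> cdom c \<longrightarrow> \<phi> q \<in> cdom d \<longrightarrow> cmap d (\<phi> q) + (t * \<psi> q) *\<^sub>R w \<in> cimage d"
proof -
  have Kc: "compactin (mtop M) K" by (rule closedin_compact_space[OF cM K(1)])
  have "continuous_map (mtop M) (mtop N) \<phi>" using \<phi> by (simp add: smooth_map_def)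
  then have "compactin (mtop N) (\<phi> ` K)" by (rule image_compactin[OF Kc])
  moreover have "\<phi> ` K \<subseteq> cdom d" using K(3) by blast
  ultimately have A: "compact (cmap d ` \<phi> ` K)" by (rule compact_chart_image[OF atlas_is_chart[OF N d]])
  have "cmap d ` \<phi> ` K \<subseteq> cimage d" using K(3) by blast
  from compact_subset_open_imp_ball_epsilon_subset[OF A open_cimage[OF atlas_is_chart[OF N d]] this]
  obtain r where r: "0 < r" "(\<Union>x\<in>cmap d ` \<phi> ` K. ball x r) \<subseteq> cimage d" by blast
  have Kcd: "K \<subseteq> cdom c" using K(2) by blast
  have "compact (cmap c ` K)" by (rule compact_chart_image[OF atlas_is_chart[OF M c] Kc Kcd])
  moreover have "continuous_on (cmap c ` K) (\<lambda>y. \<psi> (cinv c y))"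
    by (rule continuous_on_subset[OF smooth_fun_continuous[OF M \<psi> c]]) (use Kcd in blast)
  ultimately have "bounded ((\<lambda>y. \<psi> (cinv c y)) ` cmap c ` K)" by (intro compact_imp_bounded compact_continuous_image)
  then obtain B where B: "0 < B" "\<And>x. x \<in> (\<lambda>y. \<psi> (cinv c y)) ` cmap c ` K \<Longrightarrow> norm x \<le> B" unfolding bounded_pos by blast
  have B': "\<bar>\<psi> q\<bar> \<le> B" if q: "q \<in> K" for q
    using B(2)[OF imageI[OF imageI[OF q]]] unfolding cinv_cmap[OF atlas_is_chart[OF M c] K(2)[OF q]] by simp
  \<comment> \<open>The coordinates of \<phi>(K) keep distance r from the complement of the chart
    image, and |\<psi>| \<le> B on K, so the displacement stays below r; the summand 1 covers w = 0.
    Off K nothing moves.\<close>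
  define \<epsilon> where "\<epsilon> = r / (B * (norm w + 1))"
  have "0 < \<epsilon>" unfolding \<epsilon>_def using r B by (intro divide_pos_pos mult_pos_pos) (auto intro: add_nonneg_pos)
  moreover have "cmap d (\<phi> q) + (t * \<psi> q) *\<^sub>R w \<in> cimage d" if t: "\<bar>t\<bar> < \<epsilon>" and q: "q \<in> cdom c" "\<phi> q \<in> cdom d" for t q
  proof (cases "q \<in> K")
    case True
    have "norm ((t * \<psi> q) *\<^sub>R w) = \<bar>t\<bar> * (\<bar>\<psi> q\<bar> * norm w)" by (simp add: abs_mult)
    also have "\<dots> \<le> \<bar>t\<bar> * (B * (norm w + 1))" using B'[OF True] B(1) by (intro mult_left_mono mult_mono) auto
    also have "\<dots> < \<epsilon> * (B * (norm w + 1))" using t B(1) by (intro mult_strict_right_mono mult_pos_pos) (auto intro: add_nonneg_pos)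
    also have "\<dots> = r"
    proof -
      have "norm w + 1 > 0" by (rule add_nonneg_pos) auto
      then show ?thesis unfolding \<epsilon>_def using B(1) by simp
    qed
    finally have "cmap d (\<phi> q) + (t * \<psi> q) *\<^sub>R w \<in> ball (cmap d (\<phi> q)) r" by (simp add: dist_norm)
    then show ?thesis using r(2) True by blast
  next
    case False
    then show ?thesis using K(4) q(2) by simp
  qed
  ultimately show ?thesis by blast
qed

context
  fixes \<epsilon> :: real
  assumes \<epsilon>: "0 < \<epsilon>" and inside: "\<forall>t q. \<bar>t\<bar> < \<epsilon> \<longrightarrow> q \<in> cdom c \<longrightarrow> \<phi> q \<in> cdom d \<longrightarrow> cmap d (\<phi> q) + (t * \<psi> q) *\<^sub>R w \<in> cimage d"
begin

private abbreviation "I \<equiv> {-\<epsilon><..<\<epsilon>}"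

text \<open>Pasted from two open pieces: on I x D the chart formula is continuous, off the closed
  set K the map is \<phi>. The pieces agree on the overlap because \<psi> vanishes off K.\<close>

private lemma bump_variation_continuous: "continuous_map (prod_topology (top_of_set I) (mtop M)) (mtop N) (\<lambda>(t, q). bv t q)"
proof (rule pasting_lemma)
  let ?X = "prod_topology (top_of_set I) (mtop M)"
  define T where "T b = (if b then I \<times> D else I \<times> (points M - K))" for b
  define f where "f b = (if b then (\<lambda>z. cinv d (cmap d (\<phi> (snd z)) + (fst z * \<psi> (snd z)) *\<^sub>R w)) else (\<lambda>z. \<phi> (snd z)))" for b
  show "openin ?X (T b)" if "b \<in> UNIV" for b
  proof -
    have "openin (top_of_set I) I" by simp
    then show ?thesis unfolding T_def using openin_D openin_diff[OF openin_topspace K(1)] by (cases b) (simp_all add: openin_prod_Times_iff)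
  qed
  show "continuous_map (subtopology ?X (T b)) (mtop N) (f b)" if "b \<in> UNIV" for b
  proof (cases b)
    case False
    have "continuous_map ?X (mtop N) (\<phi> \<circ> snd)"
      using \<phi> by (intro continuous_map_compose[OF continuous_map_snd]) (simp add: smooth_map_def)
    then show ?thesis using False by (simp add: f_def comp_def continuous_map_from_subtopology)
  next
    case True
    let ?Y = "subtopology ?X (I \<times> D)"
    have s: "continuous_map ?Y (mtop M) snd" and t: "continuous_map ?Y (top_of_set I) fst"
      by (intro continuous_map_from_subtopology continuous_map_snd continuous_map_fst)+
    have "continuous_map ?Y (mtop N) (\<phi> \<circ> snd)"
      using \<phi> by (intro continuous_map_compose[OF s]) (simp add: smooth_map_def)
    then have "continuous_map ?Y (subtopology (mtop N) (cdom d)) (\<phi> \<circ> snd)"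
      unfolding continuous_map_in_subtopology by (auto simp: D_def)
    from continuous_map_compose[OF this continuous_map_cmap[OF atlas_is_chart[OF N d]]]
    have 1: "continuous_map ?Y euclidean (\<lambda>z. cmap d (\<phi> (snd z)))" by (simp add: comp_def)
    have "continuous_map (mtop M) euclidean \<psi>" by (rule continuous_map_chartsI[OF M smooth_fun_continuous[OF M \<psi>]])
    from continuous_map_compose[OF s this] have 2: "continuous_map ?Y euclidean (\<lambda>z. \<psi> (snd z))" by (simp add: comp_def)
    have 3: "continuous_map ?Y euclidean fst" using t by (simp add: continuous_map_in_subtopology)
    have "continuous_map ?Y (prod_topology euclidean (prod_topology euclidean euclidean)) (\<lambda>z. (cmap d (\<phi> (snd z)), fst z, \<psi> (snd z)))"
      unfolding continuous_map_paired using 1 2 3 by blast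
    then have 4: "continuous_map ?Y euclidean (\<lambda>z. (cmap d (\<phi> (snd z)), fst z, \<psi> (snd z)))" by simp
    have "continuous_map euclidean euclidean (\<lambda>(x :: 'f, t, s). x + (t * s) *\<^sub>R w)"
      by (simp add: case_prod_beta') (intro continuous_intros)
    from continuous_map_compose[OF 4 this]
    have "continuous_map ?Y euclidean (\<lambda>z. cmap d (\<phi> (snd z)) + (fst z * \<psi> (snd z)) *\<^sub>R w)" by (simp add: comp_def)
    moreover have "cmap d (\<phi> (snd z)) + (fst z * \<psi> (snd z)) *\<^sub>R w \<in> cimage d" if "z \<in> I \<times> D" for z
      using inside that by (auto simp: D_def)
    ultimately have "continuous_map ?Y (top_of_set (cimage d)) (\<lambda>z. cmap d (\<phi> (snd z)) + (fst z * \<psi> (snd z)) *\<^sub>R w)"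
      unfolding continuous_map_in_subtopology by simp
    from continuous_map_compose[OF this continuous_map_cinv[OF atlas_is_chart[OF N d]]] True
    show ?thesis by (simp add: T_def f_def comp_def)
  qed
  have eqT: "f True z = bv (fst z) (snd z)" if "z \<in> I \<times> D" for z
    using that by (simp add: f_def bv_D mem_Times_iff)
  have eqF: "f False z = bv (fst z) (snd z)" if "z \<in> I \<times> (points M - K)" for z
    using that by (simp add: f_def bump_variation_off mem_Times_iff)
  have eq: "f b z = bv (fst z) (snd z)" if "z \<in> T b" for b z
    using that eqT eqF by (cases b) (simp_all add: T_def)
  show "f i x = f j x" if "i \<in> UNIV" "j \<in> UNIV" "x \<in> topspace ?X \<inter> T i \<inter> T j" for i j x
    using that eq by simp
  show "\<exists>j. j \<in> UNIV \<and> x \<in> T j \<and> (\<lambda>(t, q). bv t q) x = f j x" if "x \<in> topspace ?X" for x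
  proof -
    have x: "x \<in> I \<times> points M" using that by simp
    show ?thesis
    proof (cases "snd x \<in> K")
      case True
      then have "x \<in> T True" using x K(2,3) by (simp add: T_def D_def mem_Times_iff)
      then show ?thesis using eq by (intro exI[of _ True]) (simp add: split_beta)
    next
      case False
      then have "x \<in> T False" using x by (simp add: T_def mem_Times_iff)
      then show ?thesis using eq by (intro exI[of _ False]) (simp add: split_beta)
    qed
  qed
qed

text \<open>Near a point of K the representative is a transition map applied to the displaced
  coordinates of \<phi>. Around any other point, closedness of K gives a neighbourhood on which
  nothing moves.\<close>

private lemma bump_variation_smooth:
  assumes c': "c' \<in> atlas M" and d': "d' \<in> atlas N"
  shows "smooth_on (vdom \<epsilon> c' d' bv) (vrep c' d' bv)"
proof (rule smooth_on_local)
  fix z assume z: "z \<in> vdom \<epsilon> c' d' bv"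
  let ?V = "vdom \<epsilon> c' d' bv"
  have oV: "open ?V" by (rule open_vdom_continuous[OF M N bump_variation_continuous c' d'])
  have VD: "fst z \<in> I" "snd z \<in> cimage c'" "bv (fst z) (cinv c' (snd z)) \<in> cdom d'" if "z \<in> ?V" for z
    using that by (simp_all add: vdom_def split_beta)
  have oW: "open (?V \<inter> snd -` (cmap c' ` (cdom c' \<inter> W)))" if "openin (mtop M) W" for W
    by (intro open_Int oV open_vimage_snd open_chart_image[OF atlas_is_chart[OF M c'] that])
  have inW: "z \<in> ?V \<inter> snd -` (cmap c' ` (cdom c' \<inter> W))" if "cinv c' (snd z) \<in> W" for W
    using z that VD(2)[OF z] unfolding chart_image_eq[OF atlas_is_chart[OF M c']] by blast
  have cW: "cinv c' (snd z) \<in> W \<and> cinv c' (snd z) \<in> cdom c' \<and> cmap c' (cinv c' (snd z)) = snd z"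
    if "z \<in> ?V \<inter> snd -` (cmap c' ` (cdom c' \<inter> W))" for z W
    using that cinv_in[of "snd z" c'] cmap_cinv[of "snd z" c'] unfolding chart_image_eq[OF atlas_is_chart[OF M c']] by blast
  have cp: "cinv c' (snd z) \<in> points M" by (rule cinv_points[OF M c' VD(2)[OF z]])
  show "\<exists>U. open U \<and> z \<in> U \<and> smooth_on U (vrep c' d' bv)"
  proof (cases "cinv c' (snd z) \<in> K")
    case False
    let ?W = "points M - K" and ?U = "?V \<inter> snd -` (cmap c' ` (cdom c' \<inter> (points M - K)))"
    have W: "openin (mtop M) ?W" by (rule openin_diff[OF openin_topspace K(1)])
    note o = oW[OF W]
    have b: "bv (fst z) (cinv c' (snd z)) = \<phi> (cinv c' (snd z))" if "z \<in> ?U" for z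
      using cW[OF that] by (intro bump_variation_off) blast
    have "smooth_on ?U (\<lambda>z. lrep c' d' \<phi> (snd z))"
    proof (rule smooth_on_compose[OF smooth_lrep[OF M N \<phi> c' d'] smooth_on_snd[OF o smooth_on_ident[OF o]] o open_ldom[OF M N \<phi> c' d']])
      fix z assume u: "z \<in> ?U"
      have "\<phi> (cinv c' (snd z)) \<in> cdom d'" using VD(3)[of z] b[OF u] u by simp
      then have "cmap c' (cinv c' (snd z)) \<in> ldom c' d' \<phi>" using cW[OF u] ldomI[where \<phi>=\<phi>, OF M N] by blast
      then show "snd z \<in> ldom c' d' \<phi>" using cW[OF u] by simp
    qed
    then have "smooth_on ?U (vrep c' d' bv)"
      by (rule smooth_on_cong[OF _ o]) (simp add: lrep_def vrep_def split_beta b)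
    then show ?thesis using o inW[of ?W] False cp by blast
  next
    case True
    let ?U = "?V \<inter> snd -` (cmap c' ` (cdom c' \<inter> D))"
    let ?e = "\<lambda>z. lrep c' d \<phi> (snd z) + (fst z * \<psi> (cinv c' (snd z))) *\<^sub>R w"
    note o = oW[OF openin_D]
    have sD: "snd z \<in> ldom c' d \<phi>" if u: "z \<in> ?U" for z
    proof -
      have "cmap c' (cinv c' (snd z)) \<in> ldom c' d \<phi>" using cW[OF u] ldomI[where \<phi>=\<phi>, OF M N] unfolding D_def by blast
      then show ?thesis using cW[OF u] by simp
    qed
    have "smooth_on ?U (\<lambda>z. lrep c' d \<phi> (snd z))"
      by (rule smooth_on_compose[OF smooth_lrep[OF M N \<phi> c' d] smooth_on_snd[OF o smooth_on_ident[OF o]] o open_ldom[OF M N \<phi> c' d] sD])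
    moreover have "smooth_on ?U (\<lambda>z. \<psi> (cinv c' (snd z)))"
    proof (rule smooth_on_compose[OF smooth_funD[OF M \<psi> c'] smooth_on_snd[OF o smooth_on_ident[OF o]] o open_chart_points[OF M c']])
      show "snd z \<in> cmap c' ` (cdom c' \<inter> points M)" if "z \<in> ?U" for z
        using VD(2)[of z] that cdom_subset_points[OF M c'] by (simp add: Int_absorb2)
    qed
    ultimately have e: "smooth_on ?U ?e"
      by (intro smooth_on_add smooth_on_scaleR smooth_on_mult smooth_on_fst smooth_on_ident smooth_on_const o)
    have in': "?e z \<in> cimage d" and bz: "bv (fst z) (cinv c' (snd z)) = cinv d (?e z)" if u: "z \<in> ?U" for z
    proof -
      have q: "cinv c' (snd z) \<in> D" using cW[OF u] by blast
      have "\<bar>fst z\<bar> < \<epsilon>" using VD(1)[of z] u by auto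
      then show "?e z \<in> cimage d" using inside q by (simp add: lrep_def D_def)
      show "bv (fst z) (cinv c' (snd z)) = cinv d (?e z)" unfolding bv_D[OF q] lrep_def ..
    qed
    have "smooth_on ?U (\<lambda>z. transition d d' (?e z))"
    proof (rule smooth_on_compose[OF smooth_transition[OF N d d'] e o open_overlap[OF atlas_is_chart[OF N d] atlas_is_chart[OF N d']]])
      show "?e z \<in> overlap d d'" if u: "z \<in> ?U" for z
      proof -
        have "cinv d (?e z) \<in> cdom d'" using VD(3)[of z] bz[OF u] u by simp
        then show ?thesis unfolding chart_image_eq[OF atlas_is_chart[OF N d]] using in'[OF u] by blast
      qed
    qed
    then have "smooth_on ?U (vrep c' d' bv)"
      by (rule smooth_on_cong[OF _ o]) (simp add: vrep_def split_beta bz transition_def)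
    moreover have "cinv c' (snd z) \<in> D" using K(2,3) True by (simp add: D_def)
    ultimately show ?thesis using o inW[of D] by blast
  qed
qed

lemma smooth_bump_variation: "smooth_variation M N \<phi> \<epsilon> (bump_variation c d \<phi> \<psi> w)"
  unfolding smooth_variation_iff[OF M N] using \<epsilon> bump_variation_0 bump_variation_continuous bump_variation_smooth by blast

lemma vfield_bump_variation_in:
  assumes q: "q \<in> cdom c" "\<phi> q \<in> cdom d"
  shows "vfield N \<phi> (bump_variation c d \<phi> \<psi> w) q = \<psi> q *\<^sub>R of_chart N d (\<phi> q) w"
proof -
  have \<phi>q: "\<phi> q \<in> points N" using cdom_subset_points[OF N d] q by blast
  have T: "open I" "0 \<in> I" using \<epsilon> by auto
  have "((\<lambda>t. cmap d (\<phi> q) + (t * \<psi> q) *\<^sub>R w) has_derivative (\<lambda>s. (s * \<psi> q) *\<^sub>R w)) (at 0)"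
    by (auto intro!: derivative_eq_intros)
  then have 1: "((\<lambda>t. cmap d (bv t q)) has_derivative (\<lambda>s. (s * \<psi> q) *\<^sub>R w)) (at 0)"
  proof (rule has_derivative_transform_within_open[OF _ T])
    show "cmap d (\<phi> q) + (t * \<psi> q) *\<^sub>R w = cmap d (bv t q)" if "t \<in> I" for t
    proof -
      have "cmap d (\<phi> q) + (t * \<psi> q) *\<^sub>R w \<in> cimage d" using inside q that by auto
      from cmap_cinv[OF this] show ?thesis using q by (simp add: bump_variation_def)
    qed
  qed
  note 2 = vfield_curve[OF M N smooth_bump_variation c d q]
  have "\<psi> q *\<^sub>R w = to_chart N d (\<phi> q) (vfield N \<phi> bv q)"
    using fun_cong[OF has_derivative_unique[OF 1 2], of 1] to_chart_vfield[OF M N smooth_bump_variation c d q \<phi>q] by simp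
  then show ?thesis
    using of_chart_inverse[OF N d q(2), of "vfield N \<phi> bv q"] linear_scale[OF linear_of_chart[OF N d q(2)], of "\<psi> q" w] by simp
qed

lemma vfield_bump_variation_off:
  assumes "q \<notin> K"
  shows "vfield N \<phi> (bump_variation c d \<phi> \<psi> w) q = 0"
  unfolding vfield_def[OF M N smooth_bump_variation] bump_variation_off[OF assms] by (simp add: frechet_derivative_const)

end

end

context hermitian_submersion
begin

lemma bump_variation_vtension:
  assumes c: "c \<in> atlas M" and d: "d \<in> atlas N" and \<psi>: "smooth_fun M (points M) \<psi>"
    and K': "closedin (mtop M) K'" "\<forall>q\<in>K'. q \<in> cdom c \<and> \<phi> q \<in> cdom d" "\<forall>q. q \<notin> K' \<longrightarrow> \<psi> q = 0"
  shows "\<exists>\<epsilon> \<Phi>. smooth_variation M N \<phi> \<epsilon> \<Phi> \<and>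
    (\<forall>q\<in>points M. vtension \<Phi> q = \<psi> q * h (\<phi> q) (of_chart N d (\<phi> q) w) (tension_field M g N h \<phi> q))"
proof -
  obtain \<epsilon> where \<epsilon>: "0 < \<epsilon>" and ins: "\<forall>t q. \<bar>t\<bar> < \<epsilon> \<longrightarrow> q \<in> cdom c \<longrightarrow> \<phi> q \<in> cdom d \<longrightarrow> cmap d (\<phi> q) + (t * \<psi> q) *\<^sub>R w \<in> cimage d"
    using bump_variation_interval[OF M N smooth_\<phi> K c d \<psi> K', of w] by blast
  let ?\<Phi> = "bump_variation c d \<phi> \<psi> w"
  note v = smooth_bump_variation[where w=w, OF M N smooth_\<phi> K c d \<psi> K' \<epsilon> ins]
  have "vtension ?\<Phi> q = \<psi> q * h (\<phi> q) (of_chart N d (\<phi> q) w) (tension_field M g N h \<phi> q)" if q: "q \<in> points M" for q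
  proof -
    note b = inner_productD(1)[OF inner_product_metric[OF N h \<phi>_points[OF q]]]
    show ?thesis
    proof (cases "q \<in> K'")
      case True
      then show ?thesis
        unfolding vtension_def[OF v] vfield_bump_variation_in[OF M N smooth_\<phi> K c d \<psi> K' \<epsilon> ins K'(2)[rule_format, OF True, THEN conjunct1] K'(2)[rule_format, OF True, THEN conjunct2]]
        by (simp add: bilinear_lmul[OF b])
    next
      case False
      then show ?thesis
        unfolding vtension_def[OF v] vfield_bump_variation_off[OF M N smooth_\<phi> K c d \<psi> K' \<epsilon> ins False]
        by (simp add: bilinear_lzero[OF b] K'(3))
    qed
  qed
  then show ?thesis by (intro exI[of _ \<epsilon>] exI[of _ ?\<Phi>] conjI v ballI)
qed

text \<open>The first bump makes \<open>\<psi>1 F\<close> a continuous function, so that the second bump can be supported where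
  \<open>\<psi>1 F > 0\<close>; this avoids proving that the tension field is continuous.\<close>

theorem critical_imp_harmonic:
  assumes crit: "critical_point M N (symplectic_energy M g N (kaehler_form h J)) \<phi>"
  shows "harmonic_map M g N h \<phi>"
  unfolding harmonic_map_def
proof (intro conjI ballI, rule smooth_\<phi>, rule ccontr)
  fix p assume p: "p \<in> points M" and \<tau>: "tension_field M g N h \<phi> p \<noteq> 0"
  define c where "c = chart_at M p"
  define d where "d = chart_at N (\<phi> p)"
  have c: "c \<in> atlas M" "p \<in> cdom c" unfolding c_def by (rule chart_at[OF M p])+
  note \<phi>p = \<phi>_points[OF p]
  have d: "d \<in> atlas N" "\<phi> p \<in> cdom d" unfolding d_def by (rule chart_at[OF N \<phi>p])+
  \<comment> \<open>The tension vector at p, continued with constant components in \<open>d\<close>,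
    serves as the direction of all variations: F(p) is then the squared length of \<tau>(p).\<close>
  define w where "w = tension_field M g N h \<phi> p"
  define F where "F q = h (\<phi> q) (of_chart N d (\<phi> q) w) (tension_field M g N h \<phi> q)" for q
  have Fp: "0 < F p"
    using inner_productD(3)[OF inner_product_metric[OF N h \<phi>p] \<tau>] unfolding F_def d_def of_chart_chart_at[OF N \<phi>p] w_def .
  let ?W = "{q \<in> points M. \<phi> q \<in> cdom d}"
  have W: "openin (mtop M) ?W" by (rule openin_preimage[OF M N smooth_\<phi> openin_cdom[OF chN[OF d(1)]]])
  \<comment> \<open>Each such \<psi> comes from a variation of \<phi>, so \<psi> F is the tension
    term of that variation: it is continuous, and by criticality it integrates to 0.\<close>
  have bump: "\<exists>\<psi> K'. smooth_fun M (points M) \<psi> \<and> (\<forall>q. 0 \<le> \<psi> q) \<and> 0 < \<psi> p \<and> K' \<subseteq> W' \<and> (\<forall>q. q \<notin> K' \<longrightarrow> \<psi> q = 0)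
      \<and> chart_continuous M (\<lambda>q. \<psi> q * F q) \<and> integral_vol M g (\<lambda>q. \<psi> q * F q) = 0"
    if W': "openin (mtop M) W'" "p \<in> W'" "W' \<subseteq> ?W" for W'
  proof -
    obtain \<psi> K' where \<psi>: "smooth_fun M (points M) \<psi>" "\<forall>q. 0 \<le> \<psi> q" "0 < \<psi> p"
      and K': "closedin (mtop M) K'" "K' \<subseteq> W' \<inter> cdom c" "\<forall>q. q \<notin> K' \<longrightarrow> \<psi> q = 0"
      using manifold_bump[OF M c(1) W'(1,2) c(2)] by blast
    have K'': "\<forall>q\<in>K'. q \<in> cdom c \<and> \<phi> q \<in> cdom d" using K'(2) W'(3) by blast
    obtain \<epsilon> \<Phi> where \<Phi>: "smooth_variation M N \<phi> \<epsilon> \<Phi>" and v: "\<And>q. q \<in> points M \<Longrightarrow> vtension \<Phi> q = \<psi> q * F q"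
      using bump_variation_vtension[OF c(1) d(1) \<psi>(1) K'(1) K'' K'(3), of w] unfolding F_def by blast
    note cv = vtension_continuous[OF \<Phi>]
    have "chart_continuous M (\<lambda>q. \<psi> q * F q)"
      unfolding chart_continuous_def
    proof
      fix a assume a: "a \<in> atlas M"
      have "continuous_on (cimage a) (\<lambda>y. vtension \<Phi> (cinv a y))" using cv a by (simp add: chart_continuous_def)
      then show "continuous_on (cimage a) (\<lambda>y. \<psi> (cinv a y) * F (cinv a y))"
        by (rule continuous_on_eq) (rule v[OF cinv_points[OF M a]])
    qed
    moreover have "integral_vol M g (\<lambda>q. \<psi> q * F q) = 0"
      using integral_vol_cong[OF cv v] critical_imp_integral_eq_0[OF crit \<Phi>] by simp
    moreover have "K' \<subseteq> W'" using K'(2) by blast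
    ultimately show ?thesis using \<psi> K'(3) by blast
  qed
  have "p \<in> ?W" using p d(2) by simp
  then obtain \<psi>1 where \<psi>1: "\<forall>q. 0 \<le> \<psi>1 q" "0 < \<psi>1 p" "\<And>q. q \<in> points M \<Longrightarrow> q \<notin> ?W \<Longrightarrow> \<psi>1 q = 0" and C1: "chart_continuous M (\<lambda>q. \<psi>1 q * F q)"
    using bump[OF W] by blast
  have "continuous_map (mtop M) euclidean (\<lambda>q. \<psi>1 q * F q)"
    by (rule continuous_map_chartsI[OF M]) (use C1 in \<open>simp add: chart_continuous_def\<close>)
  from openin_continuous_map_preimage[OF this, of "{0<..}"]
  have oW: "openin (mtop M) {q \<in> points M. 0 < \<psi>1 q * F q}" by simp
  have "{q \<in> points M. 0 < \<psi>1 q * F q} \<subseteq> ?W" using \<psi>1(3) by fastforce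
  moreover have "p \<in> {q \<in> points M. 0 < \<psi>1 q * F q}" using p \<psi>1(2) Fp by simp
  ultimately obtain \<psi>2 where \<psi>2: "\<forall>q. 0 \<le> \<psi>2 q" "0 < \<psi>2 p" "\<And>q. q \<in> points M \<Longrightarrow> \<not> 0 < \<psi>1 q * F q \<Longrightarrow> \<psi>2 q = 0"
    and C2: "chart_continuous M (\<lambda>q. \<psi>2 q * F q)" and I2: "integral_vol M g (\<lambda>q. \<psi>2 q * F q) = 0"
    using bump[OF oW] by blast
  have "0 \<le> \<psi>2 q * F q" if q: "q \<in> points M" for q
  proof (cases "0 < \<psi>1 q * F q")
    case True
    then have "0 < F q" using \<psi>1(1) by (simp add: zero_less_mult_iff) (meson linorder_not_less)
    then show ?thesis using \<psi>2(1) by simp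
  next
    case False
    then show ?thesis using \<psi>2(3)[OF q] by simp
  qed
  from integral_vol_pos[OF C2 this p] show False using \<psi>2(2) Fp I2 by simp
qed

end

section \<open>Composition formula for the Hessian\<close>

definition hess :: "('e::euclidean_space \<Rightarrow> 'e \<Rightarrow> 'e \<Rightarrow> real) \<Rightarrow> ('e \<Rightarrow> real) \<Rightarrow> 'e \<Rightarrow> 'e \<Rightarrow> 'e \<Rightarrow> real" where
  "hess G F x u v = fderiv2 F x u v - fderiv F x (chr G x u v)"

lemma bilinear_hess:
  assumes G: "metric_on U G" "x \<in> U" and F: "smooth_on S F" "open S" "x \<in> S"
  shows "bilinear (hess G F x)"
proof -
  have 1: "linear (fderiv2 F x u)" "linear (\<lambda>u. fderiv2 F x u v)" for u v
    using bilinear_linear[OF bilinear_fderiv2[OF F]] by auto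
  have 2: "linear (\<lambda>v. fderiv F x (chr G x u v))" "linear (\<lambda>u. fderiv F x (chr G x u v))" for u v
    using linear_compose[OF bilinear_linear(1)[OF bilinear_chr[OF G]] smooth_on_linear_fderiv[OF F(1,3)]]
      linear_compose[OF bilinear_linear(2)[OF bilinear_chr[OF G]] smooth_on_linear_fderiv[OF F(1,3)]]
    by (simp_all add: comp_def)
  show ?thesis unfolding bilinear_def hess_def[abs_def] using linear_compose_sub[OF 1(1) 2(1)] linear_compose_sub[OF 1(2) 2(2)] by blast
qed

lemma hess_cong:
  assumes S: "open S" "x \<in> S" and eq: "\<And>y. y \<in> S \<Longrightarrow> F y = F' y"
  shows "hess G F x u v = hess G F' x u v"
proof -
  have 1: "fderiv F y = fderiv F' y" if "y \<in> S" for y by (rule fderiv_cong_open[OF S(1) that eq])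
  have "fderiv (\<lambda>y. fderiv F y v) x = fderiv (\<lambda>y. fderiv F' y v) x" by (rule fderiv_cong_open[OF S]) (simp add: 1)
  then show ?thesis by (simp add: hess_def 1[OF S(2)])
qed

text \<open>The chain rule gives the second derivatives; adding and subtracting the Christoffel term
  of H, evaluated on the images under \<open>fderiv L x\<close>, regroups the remaining terms into
  the Hessian of F and the second fundamental form of L.\<close>

lemma hess_compose:
  fixes F :: "'f::euclidean_space \<Rightarrow> real" and L :: "'e::euclidean_space \<Rightarrow> 'f"
  assumes L: "smooth_on U L" "open U" "x \<in> U" and F: "smooth_on S F" "open S" "L x \<in> S"
  shows "hess G (\<lambda>y. F (L y)) x u v = hess H F (L x) (fderiv L x u) (fderiv L x v) + fderiv F (L x) (sff G H L x u v)"
proof -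
  have o: "open (U \<inter> L -` S)" by (rule continuous_open_preimage[OF smooth_on_continuous_on[OF L(1)] L(2) F(2)])
  have x: "x \<in> U \<inter> L -` S" using L F by simp
  have d: "fderiv (\<lambda>y. F (L y)) y v = fderiv F (L y) (fderiv L y v)" if "y \<in> U \<inter> L -` S" for y v
  proof -
    have y: "y \<in> U" "L y \<in> S" using that by auto
    show ?thesis
      by (rule fun_cong[OF fderiv_eqI[OF has_derivative_compose[OF smooth_on_has_derivative[OF L(1) y(1)] smooth_on_has_derivative[OF F(1) y(2)]]]])
  qed
  have "bilinear (\<lambda>(r::real) v. r *\<^sub>R fderiv F (L y) v)" if "y \<in> U \<inter> L -` S" for y
    using smooth_on_linear_fderiv[OF F(1), of "L y"] that by (auto simp: bilinear_def linear_iff algebra_simps)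
  moreover have "((\<lambda>y. r *\<^sub>R fderiv F (L y) w) has_derivative (\<lambda>u. r *\<^sub>R fderiv2 F (L x) (fderiv L x u) w)) (at x)" for r :: real and w
    by (intro has_derivative_scaleR_right has_derivative_compose[OF smooth_on_has_derivative[OF L(1,3)] smooth_on_has_derivative[OF smooth_on_fderiv[OF F(1)] F(3)]])
  ultimately have "((\<lambda>y. 1 *\<^sub>R fderiv F (L y) (fderiv L y v)) has_derivative (\<lambda>u. 1 *\<^sub>R fderiv2 F (L x) (fderiv L x u) (fderiv L x v)
      + 0 *\<^sub>R fderiv F (L x) (fderiv L x v) + 1 *\<^sub>R fderiv F (L x) (fderiv2 L x u v))) (at x)"
    by (rule has_derivative_bilinear_family[OF o x, where f="\<lambda>_. 1" and f'="\<lambda>_. 0", OF _ _ has_derivative_const smooth_on_has_derivative[OF smooth_on_fderiv[OF L(1)] L(3)]])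
  then have "fderiv (\<lambda>y. fderiv F (L y) (fderiv L y v)) x u = fderiv2 F (L x) (fderiv L x u) (fderiv L x v) + fderiv F (L x) (fderiv2 L x u v)"
    using fun_cong[OF fderiv_eqI, of _ _ _ u] by simp
  moreover have "fderiv2 (\<lambda>y. F (L y)) x u v = fderiv (\<lambda>y. fderiv F (L y) (fderiv L y v)) x u"
    by (rule fun_cong[OF fderiv_cong_open[OF o x]]) (rule d)
  ultimately show ?thesis
    using smooth_on_linear_fderiv[OF F(1,3)] d[OF x] by (simp add: hess_def sff_def linear_add linear_diff)
qed

lemma trace_on_pullback:
  assumes r: "rsub_at g h A" and B: "bilinear (B :: _ \<Rightarrow> _ \<Rightarrow> real)"
  shows "trace_on g UNIV (\<lambda>u v. B (A u) (A v)) = trace_on h UNIV B"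
proof -
  have A: "linear A" and ip: "inner_product g" using r by (simp_all add: rsub_at_def)
  have "bilinear (\<lambda>u v. B (A u) (A v))"
    using linear_compose[OF A bilinear_linear(1)[OF B]] linear_compose[OF A bilinear_linear(2)[OF B]] by (simp add: bilinear_def comp_def)
  from trace_on_split[OF r this]
  have "trace_on g UNIV (\<lambda>u v. B (A u) (A v)) = trace_on g {u. A u = 0} (\<lambda>u v. B (A u) (A v)) + trace_on h UNIV B"
    by (simp add: lift_section[OF r] trace_on_def)
  moreover have "trace_on g {u. A u = 0} (\<lambda>u v. B (A u) (A v)) = 0"
  proof -
    have "A e = 0" if "e \<in> frame g {u. A u = 0}" for e
      using orthonormal_basis_frame[OF ip subspace_kernel[OF r]] span_superset[of "frame g {u. A u = 0}"] that
      unfolding orthonormal_basis_def by blast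
    then show ?thesis unfolding trace_on_def using bilinear_lzero[OF B] by (intro sum.neutral ballI) simp
  qed
  ultimately show ?thesis by simp
qed

section \<open>Differentials and Hessians of functions on a manifold, and smooth composites\<close>

context
  fixes M :: "('a, 'e::euclidean_space) manifold"
  assumes M: "smooth_manifold M"
begin

lemma dfun_of_chart:
  assumes W: "openin (mtop M) W" and f: "smooth_fun M W f" and c: "c \<in> atlas M" and q: "q \<in> cdom c" "q \<in> W"
  shows "dfun M f q (of_chart M c q v) = fderiv (\<lambda>y. f (cinv c y)) (cmap c q) v"
proof -
  define e where "e = chart_at M q"
  have e: "e \<in> atlas M" "q \<in> cdom e" unfolding e_def using chart_at_cdom[OF M c q(1)] by blast+
  have o: "open (overlap c e)" by (rule open_overlap[OF atlas_is_chart[OF M c] atlas_is_chart[OF M e(1)]])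
  have qo: "cmap c q \<in> overlap c e" using q e by blast
  have t: "transition c e (cmap c q) = cmap e q" by (rule transition_cmap[OF atlas_is_chart[OF M c] q(1)])
  have "((\<lambda>z. f (cinv e z)) has_derivative fderiv (\<lambda>z. f (cinv e z)) (cmap e q)) (at (cmap e q))"
    by (rule smooth_on_has_derivative[OF smooth_funD[OF M f e(1)]]) (use e q in blast)
  then have "((\<lambda>y. f (cinv e (transition c e y))) has_derivative (\<lambda>v. fderiv (\<lambda>z. f (cinv e z)) (cmap e q) (fderiv (transition c e) (cmap c q) v))) (at (cmap c q))"
    using has_derivative_compose[OF smooth_on_has_derivative[OF smooth_transition[OF M c e(1)] qo]] unfolding t by blast
  from fderiv_eqI[OF this]
  have "fderiv (\<lambda>y. f (cinv e (transition c e y))) (cmap c q) v = dfun M f q (of_chart M c q v)"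
    unfolding dfun_def of_chart_def e_def[symmetric] by simp
  moreover have "fderiv (\<lambda>y. f (cinv e (transition c e y))) (cmap c q) = fderiv (\<lambda>y. f (cinv c y)) (cmap c q)"
  proof (rule fderiv_cong_open[OF o qo])
    fix y assume "y \<in> overlap c e"
    then obtain r where r: "r \<in> cdom c" "r \<in> cdom e" "y = cmap c r" by blast
    show "f (cinv e (transition c e y)) = f (cinv c y)"
      unfolding r(3) transition_cmap[OF atlas_is_chart[OF M c] r(1)] cinv_cmap[OF atlas_is_chart[OF M e(1)] r(2)] cinv_cmap[OF atlas_is_chart[OF M c] r(1)] ..
  qed
  ultimately show ?thesis by simp
qed

lemma hessian_in_chart:
  assumes g: "riemannian_metric M g" and W: "openin (mtop M) W" and f: "smooth_fun M W f" and p: "p \<in> W"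
  shows "hessian M g f p u v = hess (in_chart M g (chart_at M p)) (\<lambda>y. f (cinv (chart_at M p) y)) (cmap (chart_at M p) p) u v"
proof -
  let ?c = "chart_at M p"
  have pM: "p \<in> points M" using openin_subset[OF W] p by blast
  note c = chart_at[OF M pM]
  have d: "dfun M f p w = fderiv (\<lambda>y. f (cinv ?c y)) (cmap ?c p) w" for w by (simp add: dfun_def)
  have "fderiv (\<lambda>y. dfun M f (cinv ?c y) (coord_field M p v (cinv ?c y))) (cmap ?c p) = fderiv (\<lambda>y. fderiv (\<lambda>y. f (cinv ?c y)) y v) (cmap ?c p)"
  proof (rule fderiv_cong_open[OF open_chart_image[OF atlas_is_chart[OF M c(1)] W]])
    show "cmap ?c p \<in> cmap ?c ` (cdom ?c \<inter> W)" using c(2) p by blast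
    fix y assume "y \<in> cmap ?c ` (cdom ?c \<inter> W)"
    then obtain q where q: "q \<in> cdom ?c" "q \<in> W" "y = cmap ?c q" by blast
    show "dfun M f (cinv ?c y) (coord_field M p v (cinv ?c y)) = fderiv (\<lambda>y. f (cinv ?c y)) y v"
      unfolding coord_field_def q(3) cinv_cmap[OF atlas_is_chart[OF M c(1)] q(1)] by (rule dfun_of_chart[OF W f c(1) q(1,2)])
  qed
  then have 1: "dfun M (\<lambda>q. dfun M f q (coord_field M p v q)) p u = fderiv2 (\<lambda>y. f (cinv ?c y)) (cmap ?c p) u v"
    unfolding dfun_def[of M "\<lambda>q. dfun M f q (coord_field M p v q)"] by simp
  show ?thesis unfolding hessian_def Let_def 1 levi_civita_coord_field[OF M g pM] d hess_def ..
qed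

end

lemma smooth_fun_compose:
  fixes M :: "('a, 'e::euclidean_space) manifold" and N :: "('b, 'f::euclidean_space) manifold"
  assumes M: "smooth_manifold M" and N: "smooth_manifold N" and \<phi>: "smooth_map M N \<phi>"
    and W: "openin (mtop N) W" and f: "smooth_fun N W f"
  shows "smooth_fun M {p \<in> points M. \<phi> p \<in> W} (f \<circ> \<phi>)"
  unfolding smooth_fun_def
proof (intro ballI smooth_on_local)
  fix c y assume c: "c \<in> atlas M" and "y \<in> cmap c ` (cdom c \<inter> {p \<in> points M. \<phi> p \<in> W})"
  then obtain q where q: "q \<in> cdom c" "q \<in> points M" "\<phi> q \<in> W" "y = cmap c q" by blast
  define d where "d = chart_at N (\<phi> q)"
  have d: "d \<in> atlas N" "\<phi> q \<in> cdom d" unfolding d_def by (rule chart_at[OF N smooth_map_points[OF M N \<phi> q(2)]])+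
  note sL = smooth_lrep[OF M N \<phi> c d(1)] and oL = open_ldom[OF M N \<phi> c d(1)] and oF = open_chart_image[OF atlas_is_chart[OF N d(1)] W]
  let ?U = "ldom c d \<phi> \<inter> lrep c d \<phi> -` (cmap d ` (cdom d \<inter> W))"
  have o: "open ?U" by (rule continuous_open_preimage[OF smooth_on_continuous_on[OF sL] oL oF])
  have y: "y \<in> ?U"
    unfolding q(4) using ldomI[where \<phi>=\<phi>, OF M N q(1) d(2)] lrep_cmap[OF M N c q(1), of d \<phi>] q(3) d(2) by simp
  have "smooth_on ?U (\<lambda>y. f (cinv d (lrep c d \<phi> y)))"
    by (rule smooth_on_compose[OF smooth_funD[OF N f d(1)] smooth_on_subset[OF sL] o oF]) auto
  then have "smooth_on ?U (\<lambda>y. (f \<circ> \<phi>) (cinv c y))"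
  proof (rule smooth_on_cong[OF _ o])
    fix y assume "y \<in> ?U"
    then have "y \<in> ldom c d \<phi>" by simp
    note yD = ldomD[OF M N c this]
    show "f (cinv d (lrep c d \<phi> y)) = (f \<circ> \<phi>) (cinv c y)"
      unfolding lrep_def cinv_cmap[OF atlas_is_chart[OF N d(1)] yD(3)] comp_def ..
  qed
  with o y show "\<exists>U. open U \<and> y \<in> U \<and> smooth_on U (\<lambda>y. (f \<circ> \<phi>) (cinv c y))" by (intro exI[of _ ?U] conjI)
qed

context hermitian_submersion
begin

text \<open>Tracing the composition formula leaves the Hessian of f contracted through d\<phi> over
  a frame of M. For a Riemannian submersion this contraction is the trace over a frame of N, that
  is, the Laplacian of f.\<close>

lemma laplacian_compose:
  assumes W: "openin (mtop N) W" and f: "smooth_fun N W f" and p: "p \<in> points M" "\<phi> p \<in> W"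
  shows "laplacian M g (f \<circ> \<phi>) p = laplacian N h f (\<phi> p) + dfun N f (\<phi> p) (tension_field M g N h \<phi> p)"
proof -
  define c where "c = chart_at M p"
  define d where "d = chart_at N (\<phi> p)"
  define x where "x = cmap c p"
  have c: "c \<in> atlas M" "p \<in> cdom c" unfolding c_def by (rule chart_at[OF M p(1)])+
  note \<phi>p = \<phi>_points[OF p(1)]
  have d: "d \<in> atlas N" "\<phi> p \<in> cdom d" unfolding d_def by (rule chart_at[OF N \<phi>p])+
  let ?G = "in_chart M g c" and ?H = "in_chart N h d" and ?L = "lrep c d \<phi>" and ?F = "\<lambda>z. f (cinv d z)"
  note sL = smooth_lrep[OF M N smooth_\<phi> c(1) d(1)] and oL = open_ldom[OF M N smooth_\<phi> c(1) d(1)]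
  have x: "x \<in> ldom c d \<phi>" unfolding x_def by (rule ldomI[where \<phi>=\<phi>, OF M N c(2) d(2)])
  have Lx: "?L x = cmap d (\<phi> p)" unfolding x_def by (rule lrep_cmap[OF M N c])
  let ?S = "cmap d ` (cdom d \<inter> W)"
  note sF = smooth_funD[OF N f d(1)] and oF = open_chart_image[OF chN[OF d(1)] W]
  have LS: "?L x \<in> ?S" unfolding Lx using d(2) p(2) by blast
  have V: "openin (mtop M) {p \<in> points M. \<phi> p \<in> W}" by (rule openin_preimage[OF M N smooth_\<phi> W])
  have pV: "p \<in> {p \<in> points M. \<phi> p \<in> W}" using p by simp
  have A: "mdiff M N \<phi> p = fderiv ?L x" unfolding x_def c_def d_def by (rule mdiff_eq[OF M N smooth_\<phi>])
  have nab: "nabla_d M g N h \<phi> p = sff ?G ?H ?L x" unfolding x_def c_def d_def by (rule nabla_d_eq_sff[OF M N smooth_\<phi> g h p(1)])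
  have HN: "hessian N h f (\<phi> p) u v = hess ?H ?F (?L x) u v" for u v
    unfolding Lx unfolding d_def by (rule hessian_in_chart[OF N h W f p(2)])
  have dF: "dfun N f (\<phi> p) = fderiv ?F (?L x)" unfolding dfun_def[abs_def] Lx unfolding d_def ..
  have HM: "hessian M g (f \<circ> \<phi>) p u v = hessian N h f (\<phi> p) (mdiff M N \<phi> p u) (mdiff M N \<phi> p v) + dfun N f (\<phi> p) (nabla_d M g N h \<phi> p u v)" for u v
  proof -
    have "hessian M g (f \<circ> \<phi>) p u v = hess ?G (\<lambda>y. (f \<circ> \<phi>) (cinv c y)) x u v"
      unfolding x_def c_def by (rule hessian_in_chart[OF M g V smooth_fun_compose[OF M N smooth_\<phi> W f] pV])
    also have "\<dots> = hess ?G (\<lambda>y. ?F (?L y)) x u v"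
    proof (rule hess_cong[OF oL x])
      fix y assume "y \<in> ldom c d \<phi>"
      note yD = ldomD[OF M N c(1) this]
      show "(f \<circ> \<phi>) (cinv c y) = ?F (?L y)" unfolding lrep_def cinv_cmap[OF chN[OF d(1)] yD(3)] comp_def ..
    qed
    also have "\<dots> = hess ?H ?F (?L x) (fderiv ?L x u) (fderiv ?L x v) + fderiv ?F (?L x) (sff ?G ?H ?L x u v)"
      by (rule hess_compose[OF sL oL x sF oF LS])
    finally show ?thesis unfolding HN dF A nab .
  qed
  have Ld: "?L x \<in> cimage d" using LS by blast
  have B: "bilinear (hessian N h f (\<phi> p))"
    using bilinear_hess[OF metric_on_in_chart[OF N h d(1)] Ld sF oF LS] unfolding HN[abs_def, symmetric] .
  have lin: "linear (dfun N f (\<phi> p))" unfolding dF by (rule smooth_on_linear_fderiv[OF sF LS])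
  have "laplacian M g (f \<circ> \<phi>) p = trace_on (g p) UNIV (\<lambda>u v. hessian N h f (\<phi> p) (mdiff M N \<phi> p u) (mdiff M N \<phi> p v))
      + trace_on (g p) UNIV (\<lambda>u v. dfun N f (\<phi> p) (nabla_d M g N h \<phi> p u v))"
    unfolding laplacian_def trace_on_def HM sum.distrib ..
  also have "trace_on (g p) UNIV (\<lambda>u v. dfun N f (\<phi> p) (nabla_d M g N h \<phi> p u v)) = dfun N f (\<phi> p) (tension_field M g N h \<phi> p)"
    unfolding trace_on_def tension_field_def by (rule linear_sum[OF lin, symmetric])
  finally show ?thesis unfolding trace_on_pullback[OF rsub_mdiff[OF p(1)] B] laplacian_def .
qed

theorem harmonic_imp_harmonic_morphism:
  assumes "harmonic_map M g N h \<phi>"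
  shows "harmonic_morphism M g N h \<phi>"
  unfolding harmonic_morphism_def
proof (intro conjI allI impI smooth_\<phi>)
  fix W f assume W: "openin (mtop N) W" and "harmonic_fun N h W f"
  then have f: "smooth_fun N W f" and lap: "\<And>q. q \<in> W \<Longrightarrow> laplacian N h f q = 0" by (simp_all add: harmonic_fun_def)
  have "laplacian M g (f \<circ> \<phi>) p = 0" if p: "p \<in> points M" "\<phi> p \<in> W" for p
  proof -
    note d = chart_at[OF N \<phi>_points[OF p(1)]]
    have "linear (dfun N f (\<phi> p))"
      unfolding dfun_def by (rule smooth_on_linear_fderiv[OF smooth_funD[OF N f d(1)]]) (use d(2) p(2) in blast)
    from linear_0[OF this] show ?thesis
      using assms p(1) unfolding laplacian_compose[OF W f p] lap[OF p(2)] harmonic_map_def by simp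
  qed
  then show "harmonic_fun M g {p \<in> points M. \<phi> p \<in> W} (f \<circ> \<phi>)"
    unfolding harmonic_fun_def using smooth_fun_compose[OF M N smooth_\<phi> W f] by blast
qed

end

section \<open>Straightening a submersion\<close>

text \<open>The inverse function theorem yields a differentiable inverse g whose derivative is the
  inverse of \<open>fderiv f\<close>. Writing that derivative as \<open>R v (g y)\<close> with
  \<open>R v\<close> smooth lets each order of differentiability of g produce the next.\<close>

lemma smooth_local_inverse:
  fixes f :: "real^'m \<Rightarrow> real^'m"
  assumes f: "smooth_on U f" and U: "open U" "a \<in> U" and id: "\<And>v. fderiv f a v = v"
  obtains U' V g where "open U'" "U' \<subseteq> U" "a \<in> U'" "open V" "homeomorphism U' V f g" "smooth_on V g" "\<And>v. fderiv g (f a) v = v"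
proof -
  define D where "D x = Blinfun (fderiv f x)" for x
  have lin: "linear (fderiv f x)" if "x \<in> U" for x by (rule smooth_on_linear_fderiv[OF f that])
  have D: "blinfun_apply (D x) = fderiv f x" if "x \<in> U" for x
    unfolding D_def by (rule bounded_linear_Blinfun_apply) (rule linear_conv_bounded_linear[THEN iffD1, OF lin[OF that]])
  have 1: "(f has_derivative blinfun_apply (D x)) (at x)" if "x \<in> U" for x
    unfolding D[OF that] by (rule smooth_on_has_derivative[OF f that])
  have 2: "continuous_on U D"
  proof (rule continuous_on_blinfun_componentwise)
    fix i :: "real^'m" assume "i \<in> Basis"
    show "continuous_on U (\<lambda>x. blinfun_apply (D x) i)"
      by (rule continuous_on_eq[OF smooth_on_continuous_on[OF smooth_on_fderiv[OF f]]]) (simp add: D)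
  qed
  have 3: "id_blinfun o\<^sub>L D a = id_blinfun"
    by (rule blinfun_eqI) (simp add: D[OF U(2)] id)
  obtain U' V g g' where *: "open U'" "U' \<subseteq> U" "a \<in> U'" "open V" "f a \<in> V" and hom: "homeomorphism U' V f g"
    and g: "\<And>y. y \<in> V \<Longrightarrow> (g has_derivative (g' y)) (at y)"
    and g': "\<And>y. y \<in> V \<Longrightarrow> g' y = inv (blinfun_apply (D (g y)))"
    and bij: "\<And>y. y \<in> V \<Longrightarrow> bij (blinfun_apply (D (g y)))"
    using inverse_function_theorem[OF U(1) 1 2 U(2) 3] by metis
  have gV: "g y \<in> U'" "f (g y) = y" if "y \<in> V" for y using hom that unfolding homeomorphism_def by blast+
  have fU: "f x \<in> V" "g (f x) = x" if "x \<in> U'" for x using hom that unfolding homeomorphism_def by blast+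
  have bijU: "bij (fderiv f x)" if "x \<in> U'" for x
    using bij[OF fU(1)[OF that]] D[of x] fU(2)[OF that] that *(2) by auto
  \<comment> \<open>\<open>R v x\<close> is the preimage of \<open>v\<close> under \<open>fderiv f x\<close>, written in a form that is visibly smooth in \<open>x\<close>.\<close>
  define R where "R v x = riesz (\<lambda>u w. fderiv f x u \<bullet> fderiv f x w) (\<lambda>w. v \<bullet> fderiv f x w)" for v x
  have ip: "inner_product (\<lambda>u w. fderiv f x u \<bullet> fderiv f x w)" if x: "x \<in> U'" for x
  proof -
    have l: "linear (fderiv f x)" using lin x *(2) by blast
    have "fderiv f x u \<noteq> 0" if "u \<noteq> 0" for u
      using linear_injective_0[OF l] bij_is_inj[OF bijU[OF x]] that by blast
    then show ?thesis
      unfolding inner_product_def bilinear_def using l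
      by (auto simp: linear_iff inner_left_distrib inner_right_distrib inner_commute)
  qed
  have l: "linear (\<lambda>w. v \<bullet> fderiv f x w)" if x: "x \<in> U'" for x v
    using lin[of x] x *(2) by (auto simp: linear_iff inner_right_distrib)
  have R: "fderiv f x (R v x) = v" if x: "x \<in> U'" for v x
  proof -
    obtain w where w: "fderiv f x w = fderiv f x (R v x) - v" using bij_is_surj[OF bijU[OF x]] by (metis surjD)
    have "fderiv f x (R v x) \<bullet> fderiv f x w = v \<bullet> fderiv f x w"
      unfolding R_def by (rule riesz_works[OF ip[OF x] l[OF x]])
    then have "(fderiv f x (R v x) - v) \<bullet> (fderiv f x (R v x) - v) = 0" unfolding w by (simp add: inner_diff_left)
    then show ?thesis by simp
  qed
  have Rs: "smooth_on U' (R v)" for v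
    unfolding R_def[abs_def]
    by (intro smooth_on_riesz[OF *(1)] ip l smooth_on_inner smooth_on_const smooth_on_subset[OF smooth_on_fderiv[OF f] *(2)] *(1))
  have gR: "g' y v = R v (g y)" if y: "y \<in> V" for y v
  proof -
    have "g y \<in> U" using gV(1)[OF y] *(2) by blast
    then have "g' y = inv (fderiv f (g y))" using g'[OF y] D by simp
    then show ?thesis using R[OF gV(1)[OF y], of v] inv_f_f[OF bij_is_inj[OF bijU[OF gV(1)[OF y]]], of "R v (g y)"] by simp
  qed
  have "Ck_on k V g" for k
  proof (induction k)
    case 0
    then show ?case using hom by (simp add: homeomorphism_def)
  next
    case (Suc k)
    show ?case
    proof (rule Ck_on_SucI[OF *(4) g])
      fix v
      have "Ck_on k U' (R v)" using Rs by (simp add: smooth_on_def)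
      then have "Ck_on k V (\<lambda>y. R v (g y))" by (rule Ck_on_compose[OF *(4) *(1) Suc]) (use gV in blast)
      then show "Ck_on k V (\<lambda>y. g' y v)" by (rule Ck_on_cong[OF *(4), rotated]) (rule gR[symmetric])
    qed
  qed
  then have sg: "smooth_on V g" by (simp add: smooth_on_def)
  have "fderiv g (f a) v = v" for v
  proof -
    have "fderiv g (f a) v = R v a" using fderiv_eqI[OF g[OF *(5)]] gR[OF *(5)] fU(2)[OF *(3)] by simp
    also have "\<dots> = v" using R[OF *(3), of v] id by simp
    finally show ?thesis .
  qed
  with that * hom sg show thesis by blast
qed

text \<open>With A the derivative at a and T a right inverse of A, the map x \<mapsto> (x - a) - T A
  (x - a) + T (f x - f a) has the identity as derivative at a, and A sends it to f x - f a. It is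
  thus a local diffeomorphism that takes the level set of f to the kernel of A.\<close>

lemma submersion_straightening:
  fixes f :: "real^'m \<Rightarrow> real^'n"
  assumes f: "smooth_on U f" and U: "open U" "a \<in> U" and surj: "surj (fderiv f a)"
  obtains U' V \<Psi> \<Theta> where "open U'" "U' \<subseteq> U" "a \<in> U'" "open V" "homeomorphism U' V \<Psi> \<Theta>" "smooth_on U' \<Psi>" "smooth_on V \<Theta>" "\<Psi> a = 0"
    "\<And>v. fderiv \<Theta> 0 v = v" "\<And>x. x \<in> U' \<Longrightarrow> f x = f a \<longleftrightarrow> fderiv f a (\<Psi> x) = 0"
proof -
  define A where "A = fderiv f a"
  have A: "linear A" unfolding A_def by (rule smooth_on_linear_fderiv[OF f U(2)])
  obtain T where T: "linear T" "A \<circ> T = id" using linear_surjective_right_inverse[OF A] surj unfolding A_def by blast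
  have AT: "A (T w) = w" for w using T(2) by (metis comp_apply id_apply)
  define \<Psi> where "\<Psi> x = (x - a) - T (A (x - a)) + T (f x - f a)" for x
  have TA: "linear (\<lambda>x. T (A x))" using linear_compose[OF A T(1)] by (simp add: comp_def)
  have sm: "smooth_on U \<Psi>"
    unfolding \<Psi>_def[abs_def]
    by (intro smooth_on_add smooth_on_diff smooth_on_ident smooth_on_const smooth_on_linear_compose[OF TA] smooth_on_linear_compose[OF T(1)] f U(1))
  have "(\<Psi> has_derivative (\<lambda>v. (v - 0) - T (A (v - 0)) + T (A v - 0))) (at a)"
    unfolding \<Psi>_def[abs_def] A_def[symmetric]
  proof (intro has_derivative_add has_derivative_diff has_derivative_ident has_derivative_const)
    have "((\<lambda>x. x - a) has_derivative (\<lambda>v. v - 0)) (at a)" by (intro has_derivative_diff has_derivative_ident has_derivative_const)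
    from bounded_linear.has_derivative[OF linear_conv_bounded_linear[THEN iffD1, OF TA] this]
    show "((\<lambda>x. T (A (x - a))) has_derivative (\<lambda>v. T (A (v - 0)))) (at a)" .
    have "((\<lambda>x. f x - f a) has_derivative (\<lambda>v. A v - 0)) (at a)"
      unfolding A_def by (intro has_derivative_diff has_derivative_const smooth_on_has_derivative[OF f U(2)])
    from bounded_linear.has_derivative[OF linear_conv_bounded_linear[THEN iffD1, OF T(1)] this]
    show "((\<lambda>x. T (f x - f a)) has_derivative (\<lambda>v. T (A v - 0))) (at a)" .
  qed
  then have id: "fderiv \<Psi> a v = v" for v using fderiv_eqI by fastforce
  have \<Psi>a: "\<Psi> a = 0" by (simp add: \<Psi>_def linear_0[OF T(1)] linear_0[OF A])
  have A\<Psi>: "A (\<Psi> x) = f x - f a" for x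
    by (simp add: \<Psi>_def linear_add[OF A] linear_diff[OF A] AT)
  obtain U' V g where *: "open U'" "U' \<subseteq> U" "a \<in> U'" "open V" "homeomorphism U' V \<Psi> g" "smooth_on V g" "\<And>v. fderiv g (\<Psi> a) v = v"
    by (rule smooth_local_inverse[OF sm U id]) blast
  have "f x = f a \<longleftrightarrow> fderiv f a (\<Psi> x) = 0" for x using A\<Psi>[of x] unfolding A_def by simp
  then show thesis
    by (intro that[OF *(1-5) smooth_on_subset[OF sm *(2)] *(6) \<Psi>a *(7)[unfolded \<Psi>a]])
qed

lemma dim_kernel_surj:
  fixes A :: "real^'m \<Rightarrow> real^'n"
  assumes A: "linear A" and surj: "surj A"
  shows "dim {u. A u = 0} = CARD('m) - CARD('n)"
proof -
  obtain T where T: "linear T" "A \<circ> T = id" using linear_surjective_right_inverse[OF A surj] by blast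
  have AT: "A (T w) = w" for w using T(2) by (metis comp_apply id_apply)
  have K: "subspace {u. A u = 0}" using linear_subspace_kernel[OF A] .
  have "inj T" using AT by (metis injI)
  then have d: "dim (range T) = CARD('n)" using dim_image_eq[OF T(1), of UNIV] by (simp add: span_UNIV)
  have "{x + y |x y. x \<in> {u. A u = 0} \<and> y \<in> range T} = UNIV"
  proof (intro equalityI subsetI)
    fix u
    have "u = (u - T (A u)) + T (A u)" "A (u - T (A u)) = 0" by (simp_all add: linear_diff[OF A] AT)
    then show "u \<in> {x + y |x y. x \<in> {u. A u = 0} \<and> y \<in> range T}" by blast
  qed simp
  moreover have "{u. A u = 0} \<inter> range T = {0}"
  proof (intro equalityI subsetI)
    fix u assume "u \<in> {u. A u = 0} \<inter> range T"
    then obtain w where "u = T w" "A u = 0" by blast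
    then show "u \<in> {0}" using AT[of w] linear_0[OF T(1)] by simp
  qed (use linear_0[OF A] linear_0[OF T(1)] in \<open>auto intro: image_eqI[of _ _ 0]\<close>)
  ultimately show ?thesis
    using dim_sums_Int[OF K linear_subspace_image[OF T(1) subspace_UNIV]] d by simp
qed

section \<open>Reparametrised charts\<close>

text \<open>A slice chart is an atlas chart followed by a straightening diffeomorphism. It need not
  belong to the atlas; compatibility with all charts places it in
  \<open>maximal_atlas\<close>.\<close>

definition rechart :: "('a, 'e) chart \<Rightarrow> 'e set \<Rightarrow> ('e \<Rightarrow> 'e) \<Rightarrow> ('a, 'e) chart" where
  "rechart c U \<Psi> = ({q \<in> cdom c. cmap c q \<in> U}, \<lambda>q. \<Psi> (cmap c q))"

context
  fixes X :: "'a topology" and c :: "('a, 'e::euclidean_space) chart" and U V and \<Psi> \<Theta> :: "'e \<Rightarrow> 'e"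
  assumes c: "is_chart X c" and U: "open U" "U \<subseteq> cimage c" and V: "open V" and hom: "homeomorphism U V \<Psi> \<Theta>"
begin

private lemma h: "x \<in> U \<Longrightarrow> \<Psi> x \<in> V" "x \<in> U \<Longrightarrow> \<Theta> (\<Psi> x) = x" "z \<in> V \<Longrightarrow> \<Theta> z \<in> U" "z \<in> V \<Longrightarrow> \<Psi> (\<Theta> z) = z"
  using hom unfolding homeomorphism_def by blast+

lemma rechart_cdom: "cdom (rechart c U \<Psi>) = {q \<in> cdom c. cmap c q \<in> U}"
  and rechart_cmap: "cmap (rechart c U \<Psi>) q = \<Psi> (cmap c q)"
  by (simp_all add: rechart_def)

lemma rechart_image: "cmap (rechart c U \<Psi>) ` (cdom (rechart c U \<Psi>) \<inter> S) = {z \<in> V. cinv c (\<Theta> z) \<in> S}"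
proof (intro equalityI subsetI)
  fix z assume "z \<in> cmap (rechart c U \<Psi>) ` (cdom (rechart c U \<Psi>) \<inter> S)"
  then obtain q where q: "q \<in> cdom c" "cmap c q \<in> U" "q \<in> S" "z = \<Psi> (cmap c q)" unfolding rechart_cdom rechart_cmap by blast
  then show "z \<in> {z \<in> V. cinv c (\<Theta> z) \<in> S}" using h cinv_cmap[OF c q(1)] by simp
next
  fix z assume "z \<in> {z \<in> V. cinv c (\<Theta> z) \<in> S}"
  then have z: "z \<in> V" "cinv c (\<Theta> z) \<in> S" by auto
  have t: "\<Theta> z \<in> cimage c" using h(3)[OF z(1)] U(2) by blast
  have "cinv c (\<Theta> z) \<in> cdom (rechart c U \<Psi>) \<inter> S" unfolding rechart_cdom using cinv_in[OF t] cmap_cinv[OF t] h(3)[OF z(1)] z(2) by simp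
  moreover have "z = cmap (rechart c U \<Psi>) (cinv c (\<Theta> z))" unfolding rechart_cmap cmap_cinv[OF t] h(4)[OF z(1)] ..
  ultimately show "z \<in> cmap (rechart c U \<Psi>) ` (cdom (rechart c U \<Psi>) \<inter> S)" by blast
qed

lemma rechart_cimage: "cimage (rechart c U \<Psi>) = V"
  using rechart_image[of UNIV] by simp

lemma is_chart_rechart: "is_chart X (rechart c U \<Psi>)"
proof -
  have op: "openin X (cdom (rechart c U \<Psi>))" unfolding rechart_cdom by (rule openin_chart_vimage[OF c U(1)])
  have hm: "homeomorphic_map (subtopology X (cdom c)) (top_of_set (cimage c)) (cmap c)" using c by (simp add: is_chart_def)
  have sub: "cdom c \<subseteq> topspace X" using openin_subset[OF openin_cdom[OF c]] .
  have im: "cmap c ` {q \<in> cdom c. cmap c q \<in> U} = U" using U(2) by auto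
  have "homeomorphic_map (subtopology (subtopology X (cdom c)) {q \<in> cdom c. cmap c q \<in> U}) (subtopology (top_of_set (cimage c)) U) (cmap c)"
    by (rule homeomorphic_map_subtopologies[OF hm]) (use sub im U(2) in \<open>auto simp: Int_absorb1 Int_absorb2\<close>)
  moreover have "cdom c \<inter> {q \<in> cdom c. cmap c q \<in> U} = {q \<in> cdom c. cmap c q \<in> U}" "cimage c \<inter> U = U" using U(2) by auto
  ultimately have 1: "homeomorphic_map (subtopology X {q \<in> cdom c. cmap c q \<in> U}) (top_of_set U) (cmap c)"
    by (simp add: subtopology_subtopology)
  have "homeomorphic_maps (top_of_set U) (top_of_set V) \<Psi> \<Theta>"
    unfolding homeomorphic_maps_def using hom h by (auto simp: homeomorphism_def continuous_map_in_subtopology)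
  then have "homeomorphic_map (top_of_set U) (top_of_set V) \<Psi>" by (rule homeomorphic_maps_imp_map)
  from homeomorphic_map_compose[OF 1 this]
  have "homeomorphic_map (subtopology X (cdom (rechart c U \<Psi>))) (top_of_set V) (cmap (rechart c U \<Psi>))"
    by (simp add: rechart_def comp_def)
  with op V show ?thesis unfolding is_chart_def rechart_cimage by blast
qed

lemma cinv_rechart: "z \<in> V \<Longrightarrow> cinv (rechart c U \<Psi>) z = cinv c (\<Theta> z)"
proof -
  assume z: "z \<in> V"
  have t: "\<Theta> z \<in> cimage c" using h(3)[OF z] U(2) by blast
  have q: "cinv c (\<Theta> z) \<in> cdom (rechart c U \<Psi>)" unfolding rechart_cdom using cinv_in[OF t] cmap_cinv[OF t] h(3)[OF z] by simp
  from cinv_cmap[OF is_chart_rechart q] show ?thesis unfolding rechart_cmap cmap_cinv[OF t] h(4)[OF z] .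
qed

lemma compatible_rechart:
  assumes e: "is_chart X e" and ce: "compatible c e" and s: "smooth_on U \<Psi>" "smooth_on V \<Theta>"
  shows "compatible (rechart c U \<Psi>) e"
proof -
  let ?r = "rechart c U \<Psi>"
  note ch = is_chart_rechart
  have sm: "smooth_on (overlap c e) (transition c e)" "smooth_on (overlap e c) (transition e c)"
    using ce by (simp_all add: compatible_def Int_commute)
  note o1 = open_overlap[OF c e] and o2 = open_overlap[OF e c] and o3 = open_overlap[OF ch e] and o4 = open_overlap[OF e ch]
  have "smooth_on (overlap ?r e) (\<lambda>z. transition c e (\<Theta> z))"
  proof (rule smooth_on_compose[OF sm(1) smooth_on_subset[OF s(2)] o3 o1])
    show "overlap ?r e \<subseteq> V" unfolding rechart_image by blast
    show "\<Theta> z \<in> overlap c e" if "z \<in> overlap ?r e" for z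
      using that h(3)[of z] U(2) unfolding rechart_image chart_image_eq[OF c] by blast
  qed
  then have 1: "smooth_on (overlap ?r e) (transition ?r e)"
    by (rule smooth_on_cong[OF _ o3]) (simp add: transition_def rechart_image cinv_rechart)
  have sub: "overlap e ?r \<subseteq> overlap e c" unfolding rechart_cdom by blast
  have "smooth_on (overlap e ?r) (\<lambda>y. \<Psi> (transition e c y))"
  proof (rule smooth_on_compose[OF s(1) smooth_on_subset[OF sm(2) sub] o4 U(1)])
    fix y assume "y \<in> overlap e ?r"
    then obtain q where q: "q \<in> cdom e" "q \<in> cdom ?r" "y = cmap e q" by blast
    show "transition e c y \<in> U" unfolding q(3) transition_cmap[OF e q(1)] using q(2) unfolding rechart_cdom by simp
  qed
  then have 2: "smooth_on (overlap e ?r) (transition e ?r)"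
    by (rule smooth_on_cong[OF _ o4]) (simp add: transition_def rechart_cmap)
  show ?thesis unfolding compatible_def using 1 2 by (simp add: Int_commute)
qed

end

section \<open>The fibres of a Riemannian submersion\<close>

lemma smooth_field_one_chart:
  assumes M: "smooth_manifold M" and W: "openin (mtop M) W" and c: "c \<in> atlas M" "W \<subseteq> cdom c"
    and V: "smooth_on (cmap c ` W) (\<lambda>y. to_chart M c (cinv c y) (V (cinv c y)))"
  shows "smooth_field_on M W V"
  unfolding smooth_field_on_def
proof
  note ch = atlas_is_chart[OF M]
  fix e assume e: "e \<in> atlas M"
  have oe: "open (cmap e ` (cdom e \<inter> W))" and oc: "open (cmap c ` (cdom c \<inter> (cdom e \<inter> W)))"
    by (intro open_chart_image[OF ch] e c(1) W openin_Int openin_cdom[OF ch[OF e]])+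
  have ov: "open (overlap c e)" by (rule open_overlap[OF ch[OF c(1)] ch[OF e]])
  have "smooth_on (cmap c ` (cdom c \<inter> (cdom e \<inter> W))) (\<lambda>x. fderiv (transition c e) x (to_chart M c (cinv c x) (V (cinv c x))))"
    by (intro smooth_on_fderiv_smooth[OF oc] smooth_on_subset[OF smooth_transition[OF M c(1) e]] smooth_on_subset[OF V]) auto
  then have "smooth_on (cmap e ` (cdom e \<inter> W)) (\<lambda>y. fderiv (transition c e) (transition e c y) (to_chart M c (cinv c (transition e c y)) (V (cinv c (transition e c y)))))"
  proof (rule smooth_on_compose[OF _ smooth_on_subset[OF smooth_transition[OF M e c(1)]] oe oc])
    show "cmap e ` (cdom e \<inter> W) \<subseteq> overlap e c" using c(2) by blast
    fix y assume "y \<in> cmap e ` (cdom e \<inter> W)"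
    then obtain q where q: "q \<in> cdom e" "q \<in> W" "y = cmap e q" by blast
    show "transition e c y \<in> cmap c ` (cdom c \<inter> (cdom e \<inter> W))"
      unfolding q(3) transition_cmap[OF ch[OF e] q(1)] using q c(2) by blast
  qed
  then show "smooth_on (cmap e ` (cdom e \<inter> W)) (\<lambda>y. to_chart M e (cinv e y) (V (cinv e y)))"
  proof (rule smooth_on_cong[OF _ oe])
    fix y assume "y \<in> cmap e ` (cdom e \<inter> W)"
    then obtain q where q: "q \<in> cdom e" "q \<in> W" "y = cmap e q" by blast
    have qc: "q \<in> cdom c" using q c(2) by blast
    show "fderiv (transition c e) (transition e c y) (to_chart M c (cinv c (transition e c y)) (V (cinv c (transition e c y)))) = to_chart M e (cinv e y) (V (cinv e y))"
      unfolding q(3) transition_cmap[OF ch[OF e] q(1)] cinv_cmap[OF ch[OF c(1)] qc] cinv_cmap[OF ch[OF e] q(1)]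
      by (rule to_chart_trans[OF M c(1) e qc q(1)])
  qed
qed

text \<open>The lift of the image of w is orthogonal to the kernel and differs from w by a kernel
  vector. A second candidate would differ from it by a kernel vector orthogonal to itself.\<close>

lemma normal_part_kernel:
  assumes r: "rsub_at g h A"
  shows "normal_part g {u. A u = 0} w = lift g h A (A w)"
  unfolding normal_part_def
proof (rule the_equality)
  have A: "linear A" and ip: "inner_product g" "inner_product h" using r by (simp_all add: rsub_at_def)
  note bg = inner_productD(1)[OF ip(1)] and bh = inner_productD(1)[OF ip(2)]
  show 1: "w - lift g h A (A w) \<in> {u. A u = 0} \<and> (\<forall>t\<in>{u. A u = 0}. g (lift g h A (A w)) t = 0)"
    by (simp add: linear_diff[OF A] lift_section[OF r] lift_works[OF r] bilinear_rzero[OF bh])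
  fix z assume z: "w - z \<in> {u. A u = 0} \<and> (\<forall>t\<in>{u. A u = 0}. g z t = 0)"
  let ?t = "z - lift g h A (A w)"
  have t: "A ?t = 0" using 1 z by (simp add: linear_diff[OF A])
  then have "g ?t ?t = 0" using 1 z by (simp add: bilinear_lsub[OF bg])
  then have "?t = 0" using inner_productD(3)[OF ip(1), of ?t] by (metis less_irrefl)
  then show "z = lift g h A (A w)" by simp
qed

lemma lift_0: "rsub_at g h A \<Longrightarrow> lift g h A 0 = 0"
proof -
  assume r: "rsub_at g h A"
  have ip: "inner_product g" "inner_product h" using r by (simp_all add: rsub_at_def)
  have "g (lift g h A 0) (lift g h A 0) = 0"
    unfolding lift_works[OF r] by (rule bilinear_lzero[OF inner_productD(1)[OF ip(2)]])
  then show ?thesis using inner_productD(3)[OF ip(1), of "lift g h A 0"] by (metis less_irrefl)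
qed

context hermitian_submersion
begin

lemma surj_lrep:
  assumes "c \<in> atlas M" "d \<in> atlas N" "y \<in> ldom c d \<phi>"
  shows "surj (fderiv (lrep c d \<phi>) y)"
  using rsub_lrep[OF assms] unfolding rsub_at_def by blast

lemma lrep_eq_iff:
  assumes "c \<in> atlas M" "d \<in> atlas N" "x \<in> ldom c d \<phi>" "q \<in> cdom d"
  shows "lrep c d \<phi> x = cmap d q \<longleftrightarrow> \<phi> (cinv c x) = q"
  using cinv_cmap[OF chN[OF assms(2)] ldomD(3)[OF M N assms(1,3)]] cinv_cmap[OF chN[OF assms(2)] assms(4)]
  unfolding lrep_def by metis

text \<open>Collects what is used both for slice charts and for tangent spaces:
  \<open>\<Psi>\<close> takes the fibre through p to the kernel of d\<phi>, and the derivative of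
  \<open>\<Theta>\<close> at 0 is the identity, so lines in the kernel keep their velocity on
  returning to the chart.\<close>

definition straightens :: "'a \<Rightarrow> (real^'m) set \<Rightarrow> (real^'m) set \<Rightarrow> (real^'m \<Rightarrow> real^'m) \<Rightarrow> (real^'m \<Rightarrow> real^'m) \<Rightarrow> bool" where
  "straightens p U V \<Psi> \<Theta> \<longleftrightarrow> (let c = chart_at M p in
     open U \<and> U \<subseteq> ldom c (chart_at N (\<phi> p)) \<phi> \<and> cmap c p \<in> U \<and> open V \<and> homeomorphism U V \<Psi> \<Theta> \<and> smooth_on U \<Psi> \<and> smooth_on V \<Theta> \<and>
     \<Psi> (cmap c p) = 0 \<and> (\<forall>v. fderiv \<Theta> 0 v = v) \<and> (\<forall>z\<in>V. cinv c (\<Theta> z) \<in> fibre M \<phi> (\<phi> p) \<longleftrightarrow> mdiff M N \<phi> p z = 0))"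

lemma straightensD:
  assumes "straightens p U V \<Psi> \<Theta>"
  defines "c \<equiv> chart_at M p" and "d \<equiv> chart_at N (\<phi> p)"
  shows "open U" "U \<subseteq> ldom c d \<phi>" "cmap c p \<in> U" "open V" "homeomorphism U V \<Psi> \<Theta>" "smooth_on U \<Psi>" "smooth_on V \<Theta>"
    "\<Psi> (cmap c p) = 0" "fderiv \<Theta> 0 v = v" "z \<in> V \<Longrightarrow> cinv c (\<Theta> z) \<in> fibre M \<phi> (\<phi> p) \<longleftrightarrow> mdiff M N \<phi> p z = 0"
  using assms(1) unfolding straightens_def Let_def c_def d_def by simp_all

lemma fibre_straightening:
  assumes p: "p \<in> points M"
  shows "\<exists>U V \<Psi> \<Theta>. straightens p U V \<Psi> \<Theta>"
proof -
  define c where "c = chart_at M p"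
  define d where "d = chart_at N (\<phi> p)"
  have c: "c \<in> atlas M" "p \<in> cdom c" unfolding c_def by (rule chart_at[OF M p])+
  have d: "d \<in> atlas N" "\<phi> p \<in> cdom d" unfolding d_def by (rule chart_at[OF N \<phi>_points[OF p]])+
  have a: "cmap c p \<in> ldom c d \<phi>" by (rule ldomI[where \<phi>=\<phi>, OF M N c(2) d(2)])
  have A: "mdiff M N \<phi> p = fderiv (lrep c d \<phi>) (cmap c p)" unfolding c_def d_def by (rule mdiff_eq[OF M N smooth_\<phi>])
  have La: "lrep c d \<phi> (cmap c p) = cmap d (\<phi> p)" by (rule lrep_cmap[OF M N c])
  obtain U V \<Psi> \<Theta> where *: "open U" "U \<subseteq> ldom c d \<phi>" "cmap c p \<in> U" "open V" "homeomorphism U V \<Psi> \<Theta>" "smooth_on U \<Psi>" "smooth_on V \<Theta>"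
    "\<Psi> (cmap c p) = 0" "\<And>v. fderiv \<Theta> 0 v = v"
    and st: "\<And>x. x \<in> U \<Longrightarrow> lrep c d \<phi> x = lrep c d \<phi> (cmap c p) \<longleftrightarrow> fderiv (lrep c d \<phi>) (cmap c p) (\<Psi> x) = 0"
    by (rule submersion_straightening[OF smooth_lrep[OF M N smooth_\<phi> c(1) d(1)] open_ldom[OF M N smooth_\<phi> c(1) d(1)] a surj_lrep[OF c(1) d(1) a]]) blast
  have "cinv c (\<Theta> z) \<in> fibre M \<phi> (\<phi> p) \<longleftrightarrow> mdiff M N \<phi> p z = 0" if z: "z \<in> V" for z
  proof -
    have t: "\<Theta> z \<in> U" "\<Psi> (\<Theta> z) = z" using *(5) z unfolding homeomorphism_def by blast+
    have tl: "\<Theta> z \<in> ldom c d \<phi>" using t(1) *(2) by blast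
    have "cinv c (\<Theta> z) \<in> points M" by (rule cinv_points[OF M c(1) ldomD(1)[OF M N c(1) tl]])
    then show ?thesis
      unfolding A fibre_def using st[OF t(1)] lrep_eq_iff[OF c(1) d(1) tl d(2)] unfolding La t(2) by simp
  qed
  then have "straightens p U V \<Psi> \<Theta>"
    unfolding straightens_def Let_def c_def[symmetric] d_def[symmetric] by (intro conjI * allI ballI)
  then show ?thesis by (intro exI)
qed

lemma submanifold_fibre: "submanifold M (fibre M \<phi> y)"
  unfolding submanifold_def
\<comment> \<open>At a point of the fibre d\<phi> is onto, so the truncated subtraction is an honest
  one; for an empty fibre any value would do.\<close>
proof (intro conjI exI[of _ "CARD('m) - CARD('n)"] ballI)
  show "fibre M \<phi> y \<subseteq> points M" unfolding fibre_def by blast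
  fix p assume "p \<in> fibre M \<phi> y"
  then have p: "p \<in> points M" "y = \<phi> p" by (simp_all add: fibre_def)
  define c where "c = chart_at M p"
  define d where "d = chart_at N (\<phi> p)"
  have c: "c \<in> atlas M" "p \<in> cdom c" unfolding c_def by (rule chart_at[OF M p(1)])+
  obtain U V \<Psi> \<Theta> where "straightens p U V \<Psi> \<Theta>" using fibre_straightening[OF p(1)] by (elim exE) (rule that)
  note * = straightensD(1-9)[OF this, folded c_def d_def] and st = straightensD(10)[OF this, folded c_def d_def]
  have Uc: "U \<subseteq> cimage c" by (rule subset_trans[OF *(2) ldom_cimage[OF M N]])
  note rc = ch[OF c(1)] *(1) Uc *(4,5)
  let ?r = "rechart c U \<Psi>" and ?L = "{u. mdiff M N \<phi> p u = 0}"
  have lin: "linear (mdiff M N \<phi> p)" by (rule linear_mdiff[OF M N smooth_\<phi> p(1)])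
  have sur: "surj (mdiff M N \<phi> p)" using rsub_mdiff[OF p(1)] unfolding rsub_at_def by blast
  have "?r \<in> maximal_atlas M"
    unfolding maximal_atlas_def mem_Collect_eq
    by (intro conjI ballI is_chart_rechart[OF rc] compatible_rechart[OF rc ch atlas_compatible[OF M c(1)] *(6,7)])
  moreover have "p \<in> cdom ?r" unfolding rechart_cdom[OF rc] using c(2) *(3) by simp
  moreover have "subspace ?L" by (rule linear_subspace_kernel[OF lin])
  moreover have "dim ?L = CARD('m) - CARD('n)" by (rule dim_kernel_surj[OF lin sur])
  moreover have "cmap ?r ` (fibre M \<phi> y \<inter> cdom ?r) = cimage ?r \<inter> ?L"
    by (subst Int_commute, unfold rechart_image[OF rc] rechart_cimage[OF rc] p(2), rule set_eqI) (use st in \<open>simp cong: conj_cong\<close>)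
  ultimately show "\<exists>c\<in>maximal_atlas M. p \<in> cdom c \<and>
        (\<exists>L. subspace L \<and> dim L = CARD('m) - CARD('n) \<and> cmap c ` (fibre M \<phi> y \<inter> cdom c) = cimage c \<inter> L)"
    by (intro bexI[of _ ?r] conjI exI[of _ ?L])
qed

section \<open>Tangent spaces of the fibres\<close>

lemma has_derivative_curve:
  fixes \<eta> :: "real \<Rightarrow> 'e::euclidean_space"
  assumes "smooth_on {-\<epsilon><..<\<epsilon>} \<eta>" "0 < \<epsilon>"
  shows "(\<eta> has_derivative (\<lambda>s. s *\<^sub>R vector_derivative \<eta> (at 0))) (at 0)"
proof -
  have "\<eta> differentiable (at 0)" by (rule smooth_on_differentiable[OF assms(1)]) (use assms(2) in auto)
  then show ?thesis unfolding vector_derivative_works has_vector_derivative_def .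
qed

text \<open>A curve in the fibre has constant image, so its velocity lies in the kernel. Conversely
  a kernel vector is the velocity of a curve obtained by straightening the fibre.\<close>

lemma tangent_space_fibre:
  assumes "p \<in> fibre M \<phi> y"
  shows "tangent_space M (fibre M \<phi> y) p = {u. mdiff M N \<phi> p u = 0}"
proof (intro equalityI subsetI)
  have p: "p \<in> points M" "y = \<phi> p" using assms by (simp_all add: fibre_def)
  define c where "c = chart_at M p"
  define d where "d = chart_at N (\<phi> p)"
  have c: "c \<in> atlas M" "p \<in> cdom c" unfolding c_def by (rule chart_at[OF M p(1)])+
  have d: "d \<in> atlas N" "\<phi> p \<in> cdom d" unfolding d_def by (rule chart_at[OF N \<phi>_points[OF p(1)]])+
  have A: "mdiff M N \<phi> p = fderiv (lrep c d \<phi>) (cmap c p)" unfolding c_def d_def by (rule mdiff_eq[OF M N smooth_\<phi>])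
  have a: "cmap c p \<in> ldom c d \<phi>" by (rule ldomI[where \<phi>=\<phi>, OF M N c(2) d(2)])
  {
    fix u assume "u \<in> tangent_space M (fibre M \<phi> y) p"
    then obtain \<gamma> \<epsilon> where u: "u = vector_derivative (\<lambda>t. cmap c (\<gamma> t)) (at 0)" and \<gamma>: "\<gamma> 0 = p" "0 < \<epsilon>"
        "\<gamma> ` {-\<epsilon><..<\<epsilon>} \<subseteq> fibre M \<phi> y \<inter> cdom c" "smooth_on {-\<epsilon><..<\<epsilon>} (\<lambda>t. cmap c (\<gamma> t))"
      unfolding tangent_space_def c_def[symmetric] Let_def by blast
    have I: "open {-\<epsilon><..<\<epsilon>}" "0 \<in> {-\<epsilon><..<\<epsilon>}" using \<gamma>(2) by auto
    have "((\<lambda>t. lrep c d \<phi> (cmap c (\<gamma> t))) has_derivative (\<lambda>s. fderiv (lrep c d \<phi>) (cmap c p) (s *\<^sub>R u))) (at 0)"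
      using has_derivative_compose[OF has_derivative_curve[OF \<gamma>(4,2)]] smooth_on_has_derivative[OF smooth_lrep[OF M N smooth_\<phi> c(1) d(1)] a]
      unfolding u[symmetric] \<gamma>(1)[symmetric] by blast
    moreover have "((\<lambda>t. lrep c d \<phi> (cmap c (\<gamma> t))) has_derivative (\<lambda>s. 0)) (at 0)"
    proof (rule has_derivative_transform_within_open[OF has_derivative_const I])
      fix t assume "t \<in> {-\<epsilon><..<\<epsilon>}"
      then have "\<gamma> t \<in> fibre M \<phi> y" "\<gamma> t \<in> cdom c" using \<gamma>(3) by blast+
      then show "cmap d y = lrep c d \<phi> (cmap c (\<gamma> t))"
        using lrep_cmap[OF M N c(1), of "\<gamma> t" d \<phi>] by (simp add: fibre_def)
    qed
    ultimately have "(\<lambda>s. fderiv (lrep c d \<phi>) (cmap c p) (s *\<^sub>R u)) = (\<lambda>s. 0)" by (rule has_derivative_unique)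
    from fun_cong[OF this, of 1] show "u \<in> {u. mdiff M N \<phi> p u = 0}" unfolding A by simp
  next
    fix u assume "u \<in> {u. mdiff M N \<phi> p u = 0}"
    then have u: "mdiff M N \<phi> p u = 0" by simp
    have lin: "linear (mdiff M N \<phi> p)" by (rule linear_mdiff[OF M N smooth_\<phi> p(1)])
    obtain U V \<Psi> \<Theta> where "straightens p U V \<Psi> \<Theta>" using fibre_straightening[OF p(1)] by (elim exE) (rule that)
    note * = straightensD(1-9)[OF this, folded c_def d_def] and st = straightensD(10)[OF this, folded c_def d_def]
    have V0: "0 \<in> V" "\<Theta> 0 = cmap c p" using *(5,3,8) unfolding homeomorphism_def by force+
    have tV: "\<Theta> z \<in> cimage c" if "z \<in> V" for z
    proof -
      have "\<Theta> z \<in> U" using *(5) that unfolding homeomorphism_def by blast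
      then show ?thesis by (rule subsetD[OF subset_trans[OF *(2) ldom_cimage[OF M N]]])
    qed
    define T where "T = (\<lambda>t::real. t *\<^sub>R u) -` V"
    have T: "open T" "0 \<in> T" unfolding T_def using V0 by (auto intro!: open_vimage *(4) continuous_intros)
    then obtain \<epsilon> where \<epsilon>: "0 < \<epsilon>" "ball 0 \<epsilon> \<subseteq> T" unfolding open_contains_ball by blast
    have I: "t *\<^sub>R u \<in> V" if "t \<in> {-\<epsilon><..<\<epsilon>}" for t
    proof -
      have "t \<in> ball 0 \<epsilon>" using that by auto
      then show ?thesis using \<epsilon>(2) unfolding T_def by blast
    qed
    let ?I = "{-\<epsilon><..<\<epsilon>}"
    \<comment> \<open>The line through 0 in direction u lies in the kernel, hence corresponds to
      points of the fibre, and its velocity survives because \<open>fderiv \<Theta> 0\<close> is the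
      identity.\<close>
    define \<gamma> where "\<gamma> t = cinv c (\<Theta> (t *\<^sub>R u))" for t
    have cg: "cmap c (\<gamma> t) = \<Theta> (t *\<^sub>R u)" if "t \<in> ?I" for t unfolding \<gamma>_def by (rule cmap_cinv[OF tV[OF I[OF that]]])
    have oI: "open ?I" "0 \<in> ?I" using \<epsilon>(1) by auto
    have g0: "\<gamma> 0 = p" using V0(2) cinv_cmap[OF ch[OF c(1)] c(2)] by (simp add: \<gamma>_def)
    have gI: "\<gamma> ` ?I \<subseteq> fibre M \<phi> y \<inter> cdom c"
    proof
      fix q assume "q \<in> \<gamma> ` ?I"
      then obtain t where t: "t \<in> ?I" "q = \<gamma> t" by blast
      have "mdiff M N \<phi> p (t *\<^sub>R u) = 0" using u by (simp add: linear_scale[OF lin])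
      then show "q \<in> fibre M \<phi> y \<inter> cdom c"
        using st[OF I[OF t(1)]] cinv_in[OF tV[OF I[OF t(1)]]] p(2) unfolding t(2) \<gamma>_def by simp
    qed
    have "smooth_on ?I (\<lambda>t. \<Theta> (t *\<^sub>R u))"
      by (rule smooth_on_compose[OF *(7) _ oI(1) *(4) I]) (intro smooth_on_scaleR smooth_on_ident smooth_on_const oI(1))
    then have sm: "smooth_on ?I (\<lambda>t. cmap c (\<gamma> t))" by (rule smooth_on_cong[OF _ oI(1)]) (simp add: cg)
    have "((\<lambda>t::real. t *\<^sub>R u) has_derivative (\<lambda>s. s *\<^sub>R u)) (at 0)" by (auto intro!: derivative_eq_intros)
    from has_derivative_compose[OF this, of \<Theta> "fderiv \<Theta> 0"]
    have "((\<lambda>t. \<Theta> (t *\<^sub>R u)) has_derivative (\<lambda>s. s *\<^sub>R u)) (at 0)"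
      using smooth_on_has_derivative[OF *(7) V0(1)] *(9) by simp
    then have "((\<lambda>t. cmap c (\<gamma> t)) has_derivative (\<lambda>s. s *\<^sub>R u)) (at 0)"
      by (rule has_derivative_transform_within_open[OF _ oI]) (simp add: cg)
    then have "vector_derivative (\<lambda>t. cmap c (\<gamma> t)) (at 0) = u"
      by (intro vector_derivative_at) (simp add: has_vector_derivative_def)
    then show "u \<in> tangent_space M (fibre M \<phi> y) p"
      unfolding tangent_space_def c_def[symmetric] Let_def using g0 gI sm \<epsilon>(1) by blast
  }
qed

end

section \<open>Second fundamental form and mean curvature of the fibres\<close>

context hermitian_submersion
begin

text \<open>V is tangent to the fibre only along the fibre, so d\<phi>(V) = 0 is differentiated
  along a curve in the fibre with velocity u, which exists because u is vertical. The Christoffel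
  term on N drops out as d\<phi>(u) = 0.\<close>

lemma levi_civita_tangent_to_fibre:
  assumes p: "p \<in> fibre M \<phi> y" and W: "openin (mtop M) W" "p \<in> W" and V: "smooth_field_on M W V"
    and tan: "\<And>q. q \<in> fibre M \<phi> y \<Longrightarrow> q \<in> W \<Longrightarrow> mdiff M N \<phi> q (V q) = 0" and u: "mdiff M N \<phi> p u = 0"
  shows "mdiff M N \<phi> p (levi_civita M g V p u) = - nabla_d M g N h \<phi> p u (V p)"
proof -
  have pM: "p \<in> points M" "y = \<phi> p" using p by (simp_all add: fibre_def)
  define c where "c = chart_at M p"
  define d where "d = chart_at N (\<phi> p)"
  define a where "a = cmap c p"
  have c: "c \<in> atlas M" "p \<in> cdom c" unfolding c_def by (rule chart_at[OF M pM(1)])+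
  have d: "d \<in> atlas N" "\<phi> p \<in> cdom d" unfolding d_def by (rule chart_at[OF N \<phi>_points[OF pM(1)]])+
  let ?L = "lrep c d \<phi>" and ?G = "in_chart M g c" and ?H = "in_chart N h d" and ?V = "field_in_chart M V c"
  have A: "mdiff M N \<phi> p = fderiv ?L a" unfolding a_def c_def d_def by (rule mdiff_eq[OF M N smooth_\<phi>])
  have a: "a \<in> ldom c d \<phi>" unfolding a_def by (rule ldomI[where \<phi>=\<phi>, OF M N c(2) d(2)])
  note sL = smooth_lrep[OF M N smooth_\<phi> c(1) d(1)] and oL = open_ldom[OF M N smooth_\<phi> c(1) d(1)]
  have nab: "nabla_d M g N h \<phi> p = sff ?G ?H ?L a" unfolding a_def c_def d_def by (rule nabla_d_eq_sff[OF M N smooth_\<phi> g h pM(1)])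
  have oW: "open (cmap c ` (cdom c \<inter> W))" by (rule open_chart_image[OF ch[OF c(1)] W(1)])
  have aW: "a \<in> cmap c ` (cdom c \<inter> W)" unfolding a_def using c(2) W(2) by blast
  have sV: "smooth_on (cmap c ` (cdom c \<inter> W)) ?V"
    using V c(1) unfolding smooth_field_on_def field_in_chart_def[abs_def] by blast
  have Va: "?V a = V p"
    unfolding field_in_chart_def a_def cinv_cmap[OF ch[OF c(1)] c(2)] unfolding c_def by (rule to_chart_chart_at[OF M pM(1)])
  obtain \<gamma> \<epsilon> where ug: "u = vector_derivative (\<lambda>t. cmap c (\<gamma> t)) (at 0)" and \<gamma>: "\<gamma> 0 = p" "0 < \<epsilon>"
      "\<gamma> ` {-\<epsilon><..<\<epsilon>} \<subseteq> fibre M \<phi> y \<inter> cdom c" "smooth_on {-\<epsilon><..<\<epsilon>} (\<lambda>t. cmap c (\<gamma> t))"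
  proof -
    have "u \<in> tangent_space M (fibre M \<phi> y) p" unfolding tangent_space_fibre[OF p] using u by simp
    then show thesis unfolding tangent_space_def c_def[symmetric] Let_def using that by blast
  qed
  let ?\<eta> = "\<lambda>t. cmap c (\<gamma> t)"
  have \<eta>0: "?\<eta> 0 = a" unfolding \<gamma>(1) a_def ..
  have d\<eta>: "(?\<eta> has_derivative (\<lambda>s. s *\<^sub>R u)) (at 0)" using has_derivative_curve[OF \<gamma>(4,2)] unfolding ug .
  let ?T = "{-\<epsilon><..<\<epsilon>} \<inter> ?\<eta> -` (cmap c ` (cdom c \<inter> W))"
  have oT: "open ?T" by (rule continuous_open_preimage[OF smooth_on_continuous_on[OF \<gamma>(4)] _ oW]) simp
  have T0: "0 \<in> ?T" using \<gamma>(2) aW \<eta>0 by simp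
  have dL: "((\<lambda>x. fderiv ?L x (?V x)) has_derivative (\<lambda>w. fderiv2 ?L a w (?V a) + fderiv ?L a (fderiv ?V a w))) (at (?\<eta> 0))"
    unfolding \<eta>0 by (rule has_derivative_fderiv_apply[OF sL oL a smooth_on_differentiable[OF sV aW]])
  have "((\<lambda>t. fderiv ?L (?\<eta> t) (?V (?\<eta> t))) has_derivative (\<lambda>s. fderiv2 ?L a (s *\<^sub>R u) (?V a) + fderiv ?L a (fderiv ?V a (s *\<^sub>R u)))) (at 0)"
    by (rule has_derivative_compose[OF d\<eta> dL])
  moreover have "((\<lambda>t. fderiv ?L (?\<eta> t) (?V (?\<eta> t))) has_derivative (\<lambda>s. 0)) (at 0)"
  proof (rule has_derivative_transform_within_open[OF has_derivative_const oT T0])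
    fix t assume t: "t \<in> ?T"
    have q: "\<gamma> t \<in> fibre M \<phi> y" "\<gamma> t \<in> cdom c" using \<gamma>(3) t by blast+
    have qW: "\<gamma> t \<in> W"
    proof -
      from t obtain r where r: "r \<in> cdom c" "r \<in> W" "cmap c (\<gamma> t) = cmap c r" by blast
      then show ?thesis using inj_onD[OF is_chart_inj_on[OF ch[OF c(1)]] r(3) q(2) r(1)] by simp
    qed
    have \<phi>q: "\<phi> (\<gamma> t) \<in> cdom d" using q(1) d(2) pM(2) by (simp add: fibre_def)
    have "fderiv ?L (?\<eta> t) (?V (?\<eta> t)) = to_chart N d (\<phi> (\<gamma> t)) (mdiff M N \<phi> (\<gamma> t) (V (\<gamma> t)))"
      unfolding field_in_chart_def cinv_cmap[OF ch[OF c(1)] q(2)] by (rule to_chart_mdiff[OF M N smooth_\<phi> c(1) d(1) q(2) \<phi>q, symmetric])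
    then show "0 = fderiv ?L (?\<eta> t) (?V (?\<eta> t))"
      unfolding tan[OF q(1) qW] linear_0[OF linear_to_chart[OF N d(1) \<phi>q]] by simp
  qed
  ultimately have "(\<lambda>s::real. fderiv2 ?L a (s *\<^sub>R u) (?V a) + fderiv ?L a (fderiv ?V a (s *\<^sub>R u))) = (\<lambda>s. 0)" by (rule has_derivative_unique)
  from fun_cong[OF this, of 1] have 1: "fderiv2 ?L a u (V p) + fderiv ?L a (fderiv ?V a u) = 0" by (simp add: Va)
  have "levi_civita M g V p u = covd ?G (\<lambda>y. y) ?V a u"
    using levi_civita_in_chart[OF M g W(1) V W(2) c, of u] to_chart_chart_at[OF M pM(1)] unfolding a_def c_def by simp
  also have "\<dots> = fderiv ?V a u + chr ?G a u (V p)" by (simp add: covd_def Va)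
  finally have lc: "levi_civita M g V p u = fderiv ?V a u + chr ?G a u (V p)" .
  have Ha: "?L a \<in> cimage d" by (rule subsetD[OF lrep_image[OF M N c(1)] imageI[OF a]])
  have "chr ?H (?L a) 0 w = 0" for w by (rule bilinear_lzero[OF bilinear_chr[OF metric_on_in_chart[OF N h d(1)] Ha]])
  then show ?thesis
    using 1 u unfolding A nab lc sff_def linear_add[OF smooth_on_linear_fderiv[OF sL a]]
    by (simp add: eq_neg_iff_add_eq_0 add.commute)
qed

text \<open>Take the field with constant components and subtract the horizontal lift of its image.
  The lift is smooth, and at p nothing is subtracted because v is vertical.\<close>

lemma vertical_extension:
  assumes p: "p \<in> points M" and v: "mdiff M N \<phi> p v = 0"
  shows "\<exists>W V. openin (mtop M) W \<and> p \<in> W \<and> smooth_field_on M W V \<and> (\<forall>q\<in>W. mdiff M N \<phi> q (V q) = 0) \<and> V p = v"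
proof -
  define c where "c = chart_at M p"
  define d where "d = chart_at N (\<phi> p)"
  have c: "c \<in> atlas M" "p \<in> cdom c" unfolding c_def by (rule chart_at[OF M p])+
  have d: "d \<in> atlas N" "\<phi> p \<in> cdom d" unfolding d_def by (rule chart_at[OF N \<phi>_points[OF p]])+
  let ?L = "lrep c d \<phi>" and ?G = "in_chart M g c" and ?H = "in_chart N h d" and ?U = "ldom c d \<phi>"
  note sL = smooth_lrep[OF M N smooth_\<phi> c(1) d(1)] and oL = open_ldom[OF M N smooth_\<phi> c(1) d(1)]
  define X where "X y = v - lift (?G y) (?H (?L y)) (fderiv ?L y) (fderiv ?L y v)" for y
  define W where "W = cdom c \<inter> {q \<in> points M. \<phi> q \<in> cdom d}"
  define V where "V q = of_chart M c q (X (cmap c q))" for q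
  have W: "openin (mtop M) W"
    unfolding W_def by (rule openin_Int[OF openin_cdom[OF ch[OF c(1)]] openin_preimage[OF M N smooth_\<phi> openin_cdom[OF chN[OF d(1)]]]])
  have WU: "cmap c ` W = ?U" unfolding W_def by (rule ldom_eq[OF M N smooth_\<phi> c(1), symmetric])
  have pW: "p \<in> W" using p c(2) d(2) by (simp add: W_def)
  have m: "metric_on ?U ?G" by (rule metric_on_subset[OF metric_on_in_chart[OF M g c(1)] oL ldom_cimage[OF M N]])
  have sX: "smooth_on ?U X"
    unfolding X_def[abs_def]
    by (intro smooth_on_diff oL smooth_on_const smooth_on_lift[OF m metric_on_in_chart[OF N h d(1)] sL lrep_image[OF M N c(1)] smooth_on_fderiv[OF sL]])
  have "smooth_on ?U (\<lambda>y. to_chart M c (cinv c y) (V (cinv c y)))"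
  proof (rule smooth_on_cong[OF sX oL])
    fix y assume y: "y \<in> ?U"
    note yD = ldomD[OF M N c(1) y]
    show "X y = to_chart M c (cinv c y) (V (cinv c y))" unfolding V_def to_chart_inverse[OF M c(1) yD(2)] yD(4) ..
  qed
  then have "smooth_field_on M W V" unfolding WU[symmetric] by (intro smooth_field_one_chart[OF M W c(1)]) (simp_all add: W_def)
  moreover have "mdiff M N \<phi> q (V q) = 0" if q: "q \<in> W" for q
  proof -
    have qc: "q \<in> cdom c" and \<phi>q: "\<phi> q \<in> cdom d" using q by (simp_all add: W_def)
    have qU: "cmap c q \<in> ?U" by (rule ldomI[where \<phi>=\<phi>, OF M N qc \<phi>q])
    have "to_chart N d (\<phi> q) (mdiff M N \<phi> q (V q)) = fderiv ?L (cmap c q) (X (cmap c q))"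
      unfolding V_def by (rule to_chart_mdiff_of_chart[OF M N smooth_\<phi> c(1) d(1) qc \<phi>q])
    also have "\<dots> = 0"
      unfolding X_def linear_diff[OF smooth_on_linear_fderiv[OF sL qU]] lift_section[OF rsub_lrep[OF c(1) d(1) qU]] by simp
    finally show ?thesis
      using of_chart_inverse[OF N d(1) \<phi>q, of "mdiff M N \<phi> q (V q)"] linear_0[OF linear_of_chart[OF N d(1) \<phi>q]] by simp
  qed
  moreover have "V p = v"
  proof -
    have a: "cmap c p \<in> ?U" by (rule ldomI[where \<phi>=\<phi>, OF M N c(2) d(2)])
    have "fderiv ?L (cmap c p) v = 0" using v unfolding c_def d_def mdiff_eq[OF M N smooth_\<phi>] .
    then have "X (cmap c p) = v" unfolding X_def using lift_0[OF rsub_lrep[OF c(1) d(1) a]] by simp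
    then show ?thesis unfolding V_def unfolding c_def by (simp add: of_chart_chart_at[OF M p])
  qed
  ultimately show ?thesis using W pW by (intro exI[of _ W] exI[of _ V] conjI ballI)
qed

abbreviation hlift :: "'a \<Rightarrow> real^'n \<Rightarrow> real^'m" where
  "hlift p \<equiv> lift (g p) (h (\<phi> p)) (mdiff M N \<phi> p)"

text \<open>The definite description ranges over all tangential extensions of v.
  \<open>levi_civita_tangent_to_fibre\<close> assigns the same value to each of them, and
  \<open>vertical_extension\<close> supplies one.\<close>

lemma second_fundamental_form_fibre:
  assumes p: "p \<in> fibre M \<phi> y" and u: "mdiff M N \<phi> p u = 0" and v: "mdiff M N \<phi> p v = 0"
  shows "second_fundamental_form M g (fibre M \<phi> y) p u v = hlift p (- nabla_d M g N h \<phi> p u v)"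
  unfolding second_fundamental_form_def
proof (rule the_equality)
  have pM: "p \<in> points M" using p by (simp add: fibre_def)
  note r = rsub_mdiff[OF pM]
  have tan: "V q \<in> tangent_space M (fibre M \<phi> y) q \<longleftrightarrow> mdiff M N \<phi> q (V q) = 0" if "q \<in> fibre M \<phi> y" for V q
    unfolding tangent_space_fibre[OF that] by simp
  have key: "normal_part (g p) (tangent_space M (fibre M \<phi> y) p) (levi_civita M g V p u) = hlift p (- nabla_d M g N h \<phi> p u v)"
    if "openin (mtop M) W" "p \<in> W" "smooth_field_on M W V" "\<forall>q\<in>fibre M \<phi> y \<inter> W. V q \<in> tangent_space M (fibre M \<phi> y) q" "V p = v" for W V
  proof -
    have "mdiff M N \<phi> q (V q) = 0" if "q \<in> fibre M \<phi> y" "q \<in> W" for q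
      using \<open>\<forall>q\<in>fibre M \<phi> y \<inter> W. _ q\<close> that tan[OF that(1)] by blast
    from levi_civita_tangent_to_fibre[OF p that(1-3) this u]
    show ?thesis unfolding tangent_space_fibre[OF p] normal_part_kernel[OF r] that(5) by simp
  qed
  show "\<exists>W V. openin (mtop M) W \<and> p \<in> W \<and> smooth_field_on M W V \<and> (\<forall>q\<in>fibre M \<phi> y \<inter> W. V q \<in> tangent_space M (fibre M \<phi> y) q) \<and> V p = v \<and>
      hlift p (- nabla_d M g N h \<phi> p u v) = normal_part (g p) (tangent_space M (fibre M \<phi> y) p) (levi_civita M g V p u)"
  proof -
    obtain W V where WV: "openin (mtop M) W" "p \<in> W" "smooth_field_on M W V" "\<forall>q\<in>W. mdiff M N \<phi> q (V q) = 0" "V p = v"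
      using vertical_extension[OF pM v] by (elim exE conjE) (rule that)
    have t: "\<forall>q\<in>fibre M \<phi> y \<inter> W. V q \<in> tangent_space M (fibre M \<phi> y) q" using WV(4) tan by blast
    show ?thesis
      by (intro exI[of _ W] exI[of _ V] conjI WV(1-3,5) t key[OF WV(1-3) t WV(5), symmetric])
  qed
  show "z = hlift p (- nabla_d M g N h \<phi> p u v)"
    if "\<exists>W V. openin (mtop M) W \<and> p \<in> W \<and> smooth_field_on M W V \<and> (\<forall>q\<in>fibre M \<phi> y \<inter> W. V q \<in> tangent_space M (fibre M \<phi> y) q) \<and> V p = v \<and>
      z = normal_part (g p) (tangent_space M (fibre M \<phi> y) p) (levi_civita M g V p u)" for z
    using that
  proof (elim exE conjE)
    fix W V assume WV: "openin (mtop M) W" "p \<in> W" "smooth_field_on M W V" "\<forall>q\<in>fibre M \<phi> y \<inter> W. V q \<in> tangent_space M (fibre M \<phi> y) q" "V p = v"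
      and z: "z = normal_part (g p) (tangent_space M (fibre M \<phi> y) p) (levi_civita M g V p u)"
    show ?thesis unfolding z by (rule key[OF WV])
  qed
qed

lemma tension_field_vertical:
  assumes p: "p \<in> points M"
  shows "tension_field M g N h \<phi> p = trace_on (g p) {u. mdiff M N \<phi> p u = 0} (nabla_d M g N h \<phi> p)"
proof -
  define c where "c = chart_at M p"
  define d where "d = chart_at N (\<phi> p)"
  define a where "a = cmap c p"
  have c: "c \<in> atlas M" "p \<in> cdom c" unfolding c_def by (rule chart_at[OF M p])+
  have d: "d \<in> atlas N" "\<phi> p \<in> cdom d" unfolding d_def by (rule chart_at[OF N \<phi>_points[OF p]])+
  have A: "mdiff M N \<phi> p = fderiv (lrep c d \<phi>) a" unfolding a_def c_def d_def by (rule mdiff_eq[OF M N smooth_\<phi>])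
  have a: "a \<in> ldom c d \<phi>" unfolding a_def by (rule ldomI[where \<phi>=\<phi>, OF M N c(2) d(2)])
  have nab: "nabla_d M g N h \<phi> p = sff (in_chart M g c) (in_chart N h d) (lrep c d \<phi>) a"
    unfolding a_def c_def d_def by (rule nabla_d_eq_sff[OF M N smooth_\<phi> g h p])
  have Ga: "in_chart M g c a = g p" unfolding a_def c_def by (rule in_chart_chart_at[OF M p])
  have m: "metric_on (ldom c d \<phi>) (in_chart M g c)"
    by (rule metric_on_subset[OF metric_on_in_chart[OF M g c(1)] open_ldom[OF M N smooth_\<phi> c(1) d(1)] ldom_cimage[OF M N]])
  show ?thesis
    unfolding tension_field_def nab A Ga[symmetric]
    by (rule trace_sff_submersion[OF m metric_on_in_chart[OF N h d(1)] smooth_lrep[OF M N smooth_\<phi> c(1) d(1)] lrep_image[OF M N c(1)] a rsub_lrep[OF c(1) d(1)]])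
qed

text \<open>d\<phi> sends the mean curvature vector to -\<tau>, and this vector is a sum of
  horizontal lifts, on which d\<phi> is injective.\<close>

lemma mean_curvature_fibre:
  assumes p: "p \<in> fibre M \<phi> y"
  shows "mean_curvature M g (fibre M \<phi> y) p = 0 \<longleftrightarrow> tension_field M g N h \<phi> p = 0"
proof -
  have pM: "p \<in> points M" using p by (simp add: fibre_def)
  note r = rsub_mdiff[OF pM]
  have lin: "linear (mdiff M N \<phi> p)" and ip: "inner_product (g p)" "inner_product (h (\<phi> p))" using r by (simp_all add: rsub_at_def)
  note bg = inner_productD(1)[OF ip(1)] and bh = inner_productD(1)[OF ip(2)]
  let ?K = "{u. mdiff M N \<phi> p u = 0}" and ?S = "\<lambda>e. nabla_d M g N h \<phi> p e e"
  let ?B = "frame (g p) ?K" and ?H = "mean_curvature M g (fibre M \<phi> y) p"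
  have B: "mdiff M N \<phi> p e = 0" if "e \<in> ?B" for e
    using orthonormal_basis_frame[OF ip(1) subspace_kernel[OF r]] span_superset[of ?B] that unfolding orthonormal_basis_def by blast
  have H: "?H = (\<Sum>e\<in>?B. hlift p (- ?S e))"
    unfolding mean_curvature_def trace_on_def tangent_space_fibre[OF p]
    by (intro sum.cong refl second_fundamental_form_fibre[OF p] B)
  have "mdiff M N \<phi> p ?H = (\<Sum>e\<in>?B. - ?S e)" unfolding H linear_sum[OF lin] lift_section[OF r] ..
  then have AH: "mdiff M N \<phi> p ?H = - tension_field M g N h \<phi> p"
    unfolding tension_field_vertical[OF pM] trace_on_def by (simp add: sum_negf)
  show ?thesis
  proof
    assume "?H = 0"
    then show "tension_field M g N h \<phi> p = 0" using AH linear_0[OF lin] by simp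
  next
    assume "tension_field M g N h \<phi> p = 0"
    then have AH0: "mdiff M N \<phi> p ?H = 0" using AH by simp
    \<comment> \<open>One factor is expanded as a sum of lifts; the product of a lift with
      \<open>?H\<close> depends only on the image of \<open>?H\<close> under d\<phi>, which is
      0.\<close>
    have "g p ?H ?H = (\<Sum>e\<in>?B. g p (hlift p (- ?S e)) ?H)"
      using linear_sum[OF bilinear_linear(2)[OF bg], of "\<lambda>e. hlift p (- ?S e)" ?B ?H] unfolding H[symmetric] .
    also have "\<dots> = 0" unfolding lift_works[OF r] AH0 bilinear_rzero[OF bh] by simp
    finally show "?H = 0" using inner_productD(3)[OF ip(1), of ?H] by (metis less_irrefl)
  qed
qed

theorem harmonic_iff_fibres_minimal:
  "harmonic_map M g N h \<phi> \<longleftrightarrow> (\<forall>y\<in>points N. minimal_submanifold M g (fibre M \<phi> y))"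
proof
  assume harm: "harmonic_map M g N h \<phi>"
  show "\<forall>y\<in>points N. minimal_submanifold M g (fibre M \<phi> y)"
    unfolding minimal_submanifold_def
  proof (intro ballI conjI submanifold_fibre)
    fix y p assume p: "p \<in> fibre M \<phi> y"
    then have "tension_field M g N h \<phi> p = 0" using harm by (simp add: harmonic_map_def fibre_def)
    then show "mean_curvature M g (fibre M \<phi> y) p = 0" using mean_curvature_fibre[OF p] by simp
  qed
next
  assume min: "\<forall>y\<in>points N. minimal_submanifold M g (fibre M \<phi> y)"
  show "harmonic_map M g N h \<phi>"
    unfolding harmonic_map_def
  proof (intro conjI ballI smooth_\<phi>)
    fix p assume p: "p \<in> points M"
    have pf: "p \<in> fibre M \<phi> (\<phi> p)" using p by (simp add: fibre_def)
    have "mean_curvature M g (fibre M \<phi> (\<phi> p)) p = 0"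
      using bspec[OF min \<phi>_points[OF p]] pf by (simp add: minimal_submanifold_def)
    then show "tension_field M g N h \<phi> p = 0" using mean_curvature_fibre[OF pf] by simp
  qed
qed

end

theorem mainTheorem5:
  fixes M :: "('a, real^'m) manifold" and g :: "('a, real^'m) bilin_field"
    and N :: "('b, real^'n) manifold" and h :: "('b, real^'n) bilin_field"
    and J :: "'b \<Rightarrow> real^'n \<Rightarrow> real^'n" and \<phi> :: "'a \<Rightarrow> 'b"
  assumes "riemannian_manifold M g" and "compact_space (mtop M)" and "oriented M"
    and "kaehler_manifold N h J" and "compact_space (mtop N)"
    and "riemannian_submersion M g N h \<phi>"
  shows "(critical_point M N (symplectic_energy M g N (kaehler_form h J)) \<phi>
            \<longleftrightarrow> harmonic_map M g N h \<phi>) \<and>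
         (harmonic_map M g N h \<phi>
            \<longleftrightarrow> (\<forall>y\<in>points N. minimal_submanifold M g (fibre M \<phi> y))) \<and>
         (critical_point M N (symplectic_energy M g N (kaehler_form h J)) \<phi>
            \<longrightarrow> harmonic_morphism M g N h \<phi> \<and>
               (\<forall>\<alpha>\<ge>0. critical_point M N (full_energy \<alpha> M g N h (kaehler_form h J)) \<phi>))"
proof -
  interpret hermitian_submersion M g N h J \<phi>
  proof
    show "smooth_manifold M" "riemannian_metric M g" using assms(1) by (simp_all add: riemannian_manifold_def)
    show "compact_space (mtop M)" "oriented M" "riemannian_submersion M g N h \<phi>" by (fact assms)+
    show "smooth_manifold N" "riemannian_metric N h" "almost_complex_structure N J"
      "\<And>p u v. p \<in> points N \<Longrightarrow> h p (J p u) (J p v) = h p u v"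
      using assms(4) by (simp_all add: kaehler_manifold_def riemannian_manifold_def complex_structure_def)
  qed
  show ?thesis
    using critical_imp_harmonic harmonic_imp_critical harmonic_iff_fibres_minimal harmonic_imp_harmonic_morphism by blast
qed

end
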